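(* Let $\mathcal{Z}=\{\boldsymbol\zeta_1,\dots,\boldsymbol\zeta_p\}\subseteq\boldsymbol\theta(\Omega)$ be a set of $p$ distinct points and let $w_1,\dots,w_p\in\mathbb{D}$. Let $\mathcal{Q}_{\mathcal{Z}}=\mathrm{span}\{\mathbb{S}_{\boldsymbol\theta(\Omega)}(\cdot,\boldsymbol\zeta_i):i=1,\dots,p\}$ and let $X_{\mathcal{Z},\mathcal{W}}\in\mathcal{B}(\mathcal{Q}_{\mathcal{Z}})$ be the operator determined by $X_{\mathcal{Z},\mathcal{W}}^*\mathbb{S}_{\boldsymbol\theta(\Omega)}(\cdot,\boldsymbol\zeta_i)=\overline{w_i}\,\mathbb{S}_{\boldsymbol\theta(\Omega)}(\cdot,\boldsymbol\zeta_i)$, $i=1,\dots,p$. Set $\psi=X_{\mathcal{Z},\mathcal{W}}P_{\mathcal{Q}_{\mathcal{Z}}}1$ and define $$\widetilde{\mathcal{M}}_{\mathcal{Q}_{\mathcal{Z}}}=\left(\mathcal{Q}_{\mathcal{Z}}^{conj}\ominus\mathrm{span}\{\overline\psi\}\right)\dotplus\mathcal{M}_{\boldsymbol\theta(\Omega)}\dotplus H^2_0(\partial\boldsymbol\theta(\Omega)).$$ Then there exists $\varphi\in\mathcal{S}(\boldsymbol\theta(\Omega))$ such that $\varphi(\boldsymbol\zeta_i)=w_i$ for all $i=1,\dots,p$ if and only if $$\operatorname{dist}_{L^1(\partial\boldsymbol\theta(\Omega))}\left(\frac{\overline\psi}{\|\psi\|^2_{L^2(\partial\boldsymbol\theta(\Omega))}},\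 \widetilde{\mathcal{M}}_{\mathcal{Q}_{\mathcal{Z}}}\right)\ge1.$$
   Context: **Domains.** $\Omega\subseteq\mathbb{C}^d$ is a bounded symmetric domain in its standard realization (circled, convex, containing $0$). $G$ is a finite complex reflection group, i.e. a finite group of linear maps of $\mathbb{C}^d$ generated by complex reflections (finite order linear maps $\sigma$ with $\operatorname{rank}(I_d-\sigma)=1$), and $\Omega$ is $G$-invariant. The ring of $G$-invariant polynomials is generated by $d$ algebraically independent homogeneous polynomials; fix such $\theta_1,\dots,\theta_d$ with $k_j=\deg\theta_j$ and put $\boldsymbol\theta=(\theta_1,\dots,\theta_d):\Omega\to\boldsymbol\theta(\Omega)$, a proper holomorphic map onto the bounded domain $\boldsymbol\theta(\Omega)$. $J_{\boldsymbol\theta}$ is its complex Jacobian determinant. Shilov boundaries are denoted $\partial\Omega$ and $\partial\boldsymbol\theta(\Omega)$; one has $\partial\boldsymbol\theta(\Omega)=\boldsymbol\theta(\partial\Omega)$. $\mathbb{D}$ is the open unit disc. **Hardy spaces.** $\mu$ is the normalized measure on $\partial\Omega$ invariant under $\mathbb{K}=\{\phi\in\mathrm{Aut}(\Omega):\phi(0)=0\}$. $H^2(\Omega)$ is the space of holomorphic $f$ on $\Omega$ with $\|f\|^2_{H^2(\Omega)}=\sup_{0<r<1}\int_{\partial\Omega}|f(rz)|^2d\mu(z)<\infty$. Each $f\in H^2(\Omega)$ has a radial boundary value $f^*(z)=\lim_{r\to1^-}f(rz)$ ($\mu$-a.e.), $f^*\in L^2(\partial\Omega)$; $H^2(\partial\Omega)=\{f^*:f\in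 H^2(\Omega)\}$. Let $c_{\boldsymbol\theta}=\|J_{\boldsymbol\theta}\|_{H^2(\Omega)}$. $H^2(\boldsymbol\theta(\Omega))$ is the Hilbert space of holomorphic $f$ on $\boldsymbol\theta(\Omega)$ with $J_{\boldsymbol\theta}(f\circ\boldsymbol\theta)\in H^2(\Omega)$, with norm $\|f\|=c_{\boldsymbol\theta}^{-1}\|J_{\boldsymbol\theta}(f\circ\boldsymbol\theta)\|_{H^2(\Omega)}$. It is a reproducing kernel Hilbert space; $\mathbb{S}_{\boldsymbol\theta(\Omega)}$ denotes its reproducing kernel: $\langle f,\mathbb{S}_{\boldsymbol\theta(\Omega)}(\cdot,\boldsymbol\zeta)\rangle=f(\boldsymbol\zeta)$. $\mu_{\boldsymbol\theta}$ is the probability measure on $\partial\boldsymbol\theta(\Omega)$ given by $\int f\,d\mu_{\boldsymbol\theta}=c_{\boldsymbol\theta}^{-2}\int_{\partial\Omega}(f\circ\boldsymbol\theta)|J_{\boldsymbol\theta}|^2d\mu$, and $L^p(\partial\boldsymbol\theta(\Omega))=L^p(\mu_{\boldsymbol\theta})$. $H^2(\partial\boldsymbol\theta(\Omega))=\{f\in L^2(\partial\boldsymbol\theta(\Omega)):J_{\boldsymbol\theta}(f\circ\boldsymbol\theta)\in H^2(\partial\Omega)\}$, a closed subspace. The boundary map $f\mapsto\tilde f^*$, $\tilde f^*(\boldsymbol\zeta)=\lim_{r\to1^-}f(r^{k_1}\zeta_1,\dots,r^{k_d}\zeta_d)$ ($\mu_{\boldsymbol\theta}$-a.e.), is an isometry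 of $H^2(\boldsymbol\theta(\Omega))$ onto $H^2(\partial\boldsymbol\theta(\Omega))$, and functions are identified with their boundary values. $\mathcal{S}(\boldsymbol\theta(\Omega))$ is the set of holomorphic functions on $\boldsymbol\theta(\Omega)$ bounded by $1$ in modulus (closed unit ball of $H^\infty(\boldsymbol\theta(\Omega))$). $\mathcal{B}(\mathcal{Q}_{\mathcal{Z}})$ is the algebra of bounded linear operators on $\mathcal{Q}_{\mathcal{Z}}$, and $P_{\mathcal{Q}_{\mathcal{Z}}}$ is the orthogonal projection of the Hardy space onto $\mathcal{Q}_{\mathcal{Z}}$. **Subspaces.** For $\mathcal{E}\subseteq L^2(\partial\boldsymbol\theta(\Omega))$ put $\mathcal{E}^{conj}=\{\bar f:f\in\mathcal{E}\}$. $H^2_0(\partial\boldsymbol\theta(\Omega))=\{f\in H^2(\partial\boldsymbol\theta(\Omega)):\langle f,1\rangle=0\}$; $\mathcal{M}_{\boldsymbol\theta(\Omega)}=L^2(\partial\boldsymbol\theta(\Omega))\ominus\big(H^2(\partial\boldsymbol\theta(\Omega))+H^2(\partial\boldsymbol\theta(\Omega))^{conj}\big)$. $\ominus$ is orthogonal complement with respect to the $L^2(\partial\boldsymbol\theta(\Omega))$ inner product, $\dotplus$ is the algebraic direct sum, taken inside $L^1(\partial\boldsymbol\theta(\Omega))$; $\operatorname{dist}_{L^1(\partial\boldsymbol\theta(\Omega))}(g,\mathcal{N})=\inf_{h\in\mathcal{N}}\|g-h\|_{L^1(\partial\boldsymbol\theta(\Omega))}$. *)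

theory Defs
  imports
    "HOL-Probability.Probability"
    "HOL-Algebra.Generated_Groups"
    "HOL-Library.Poly_Mapping"
begin

section \<open>Holomorphic functions and bounded symmetric domains in complex d-space\<close>

text \<open>Here d is the cardinality of the index type. As for the one-variable notion of the
  library, values outside the set are irrelevant when the set is open.\<close>

definition holo_on :: "(complex^'n \<Rightarrow> complex) \<Rightarrow> (complex^'n) set \<Rightarrow> bool" where
  "holo_on f U \<longleftrightarrow>
     (\<forall>z\<in>U. \<exists>f'. (f has_derivative f') (at z within U) \<and> (\<forall>c v. f' (c *s v) = c * f' v))"

definition holo_map_on :: "(complex^'n \<Rightarrow> complex^'n) \<Rightarrow> (complex^'n) set \<Rightarrow> bool" where
  "holo_map_on F U \<longleftrightarrow> (\<forall>i. holo_on (\<lambda>z. F z $ i) U)"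

definition holo_aut :: "(complex^'n) set \<Rightarrow> (complex^'n \<Rightarrow> complex^'n) set" where
  "holo_aut U =
     {\<phi>. bij_betw \<phi> U U \<and> holo_map_on \<phi> U \<and> holo_map_on (inv_into U \<phi>) U}"

definition bounded_domain :: "(complex^'n) set \<Rightarrow> bool" where
  "bounded_domain U \<longleftrightarrow> open U \<and> connected U \<and> bounded U \<and> U \<noteq> {}"

definition symmetric_domain :: "(complex^'n) set \<Rightarrow> bool" where
  "symmetric_domain U \<longleftrightarrow>
     (\<forall>a\<in>U. \<exists>s\<in>holo_aut U. (\<forall>z\<in>U. s (s z) = z) \<and> s a = a \<and>
        (\<exists>e>0. \<forall>z\<in>U \<inter> ball a e. s z = z \<longrightarrow> z = a))"

definition standard_bsd :: "(complex^'n) set \<Rightarrow> bool" where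
  "standard_bsd U \<longleftrightarrow> bounded_domain U \<and> symmetric_domain U \<and> convex U \<and> 0 \<in> U \<and>
     (\<forall>z\<in>U. \<forall>c. cmod c = 1 \<longrightarrow> c *s z \<in> U)"

text \<open>The Shilov boundary is taken with respect to the algebra of functions continuous on the
  closure and holomorphic inside; it is the smallest closed set on which all of them attain
  their maximum modulus.\<close>

definition disc_algebra :: "(complex^'n) set \<Rightarrow> (complex^'n \<Rightarrow> complex) set" where
  "disc_algebra U = {f. continuous_on (closure U) f \<and> holo_on f U}"

definition shilov :: "(complex^'n) set \<Rightarrow> (complex^'n) set" where
  "shilov U = \<Inter>{B. closed B \<and> B \<subseteq> closure U \<and>
     (\<forall>f\<in>disc_algebra U. \<forall>z\<in>closure U. \<exists>b\<in>B. cmod (f z) \<le> cmod (f b))}"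

text \<open>The members of the isotropy group of 0 are restrictions of linear maps (Cartan), so each
  has a representative that is continuous on the closure. That extension is unique, and it is
  the one through which the group acts on the boundary.\<close>

definition isotropy_measure :: "(complex^'n) set \<Rightarrow> (complex^'n) measure \<Rightarrow> bool" where
  "isotropy_measure U mu \<longleftrightarrow>
     prob_space mu \<and> sets mu = sets (restrict_space borel (shilov U)) \<and>
     (\<forall>\<phi>\<in>holo_aut U. \<phi> 0 = 0 \<and> continuous_on (closure U) \<phi> \<longrightarrow> distr mu mu \<phi> = mu)"


section \<open>Reflection groups and basic invariants\<close>

type_synonym 'n cpoly = "('n \<Rightarrow>\<^sub>0 nat) \<Rightarrow>\<^sub>0 complex"

definition cpoly_eval :: "('n::finite) cpoly \<Rightarrow> complex^'n \<Rightarrow> complex" where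
  "cpoly_eval p z = (\<Sum>a\<in>Poly_Mapping.keys p.
     Poly_Mapping.lookup p a * (\<Prod>i\<in>UNIV. z $ i ^ Poly_Mapping.lookup a i))"

definition monom_degree :: "(('n::finite) \<Rightarrow>\<^sub>0 nat) \<Rightarrow> nat" where
  "monom_degree a = (\<Sum>i\<in>UNIV. Poly_Mapping.lookup a i)"

definition cpoly_degree :: "('n::finite) cpoly \<Rightarrow> nat" where
  "cpoly_degree p = Max (insert 0 (monom_degree ` Poly_Mapping.keys p))"

definition cpoly_homogeneous :: "('n::finite) cpoly \<Rightarrow> bool" where
  "cpoly_homogeneous p \<longleftrightarrow> (\<forall>a\<in>Poly_Mapping.keys p. monom_degree a = cpoly_degree p)"

definition GL :: "(complex^'n^'n) monoid" where
  "GL = \<lparr>carrier = {A. invertible A}, mult = (**), one = mat 1\<rparr>"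

definition complex_reflection :: "complex^'n^'n \<Rightarrow> bool" where
  "complex_reflection A \<longleftrightarrow>
     A \<in> carrier GL \<and> (\<exists>m::nat. m > 0 \<and> A [^]\<^bsub>GL\<^esub> m = \<one>\<^bsub>GL\<^esub>) \<and> rank (mat 1 - A) = 1"

definition finite_reflection_group :: "(complex^'n^'n) set \<Rightarrow> bool" where
  "finite_reflection_group G \<longleftrightarrow>
     finite G \<and> (\<exists>R. (\<forall>A\<in>R. complex_reflection A) \<and> G = generate GL R)"

definition cpoly_invariant :: "(complex^'n^'n) set \<Rightarrow> 'n cpoly \<Rightarrow> bool" where
  "cpoly_invariant G p \<longleftrightarrow> (\<forall>A\<in>G. \<forall>z. cpoly_eval p (A *v z) = cpoly_eval p z)"

definition poly_map :: "('n \<Rightarrow> 'n cpoly) \<Rightarrow> complex^'n \<Rightarrow> complex^('n::finite)" where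
  "poly_map P z = (\<chi> j. cpoly_eval (P j) z)"

definition basic_invariants :: "(complex^'n^'n) set \<Rightarrow> ('n \<Rightarrow> 'n cpoly) \<Rightarrow> bool" where
  "basic_invariants G P \<longleftrightarrow>
     (\<forall>j. cpoly_homogeneous (P j) \<and> cpoly_invariant G (P j)) \<and>
     (\<forall>Q. (\<forall>z. cpoly_eval Q (poly_map P z) = 0) \<longrightarrow> Q = 0) \<and>
     (\<forall>f. cpoly_invariant G f \<longrightarrow> (\<exists>Q. \<forall>z. cpoly_eval f z = cpoly_eval Q (poly_map P z)))"

text \<open>The Frechet derivative of a holomorphic map is complex linear, so its matrix with respect to
  the standard basis consists of the complex partial derivatives.\<close>

definition jac :: "('n \<Rightarrow> 'n cpoly) \<Rightarrow> complex^('n::finite) \<Rightarrow> complex" where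
  "jac P z = det (matrix (frechet_derivative (poly_map P) (at z)))"


section \<open>Lebesgue spaces\<close>

text \<open>Elements are represented by functions; all subspaces below are closed under almost
  everywhere equality.\<close>

definition L2 :: "'a measure \<Rightarrow> ('a \<Rightarrow> complex) set" where
  "L2 M = {f \<in> borel_measurable M. integrable M (\<lambda>x. (cmod (f x))\<^sup>2)}"

definition L2_inner :: "'a measure \<Rightarrow> ('a \<Rightarrow> complex) \<Rightarrow> ('a \<Rightarrow> complex) \<Rightarrow> complex" where
  "L2_inner M f g = (LINT x|M. f x * cnj (g x))"

definition L2_nrm :: "'a measure \<Rightarrow> ('a \<Rightarrow> complex) \<Rightarrow> real" where
  "L2_nrm M f = sqrt (LINT x|M. (cmod (f x))\<^sup>2)"

definition L1_dist :: "'a measure \<Rightarrow> ('a \<Rightarrow> complex) \<Rightarrow> ('a \<Rightarrow> complex) set \<Rightarrow> real" where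
  "L1_dist M g N = (INF h\<in>N. LINT x|M. cmod (g x - h x))"

definition conj_set :: "('a \<Rightarrow> complex) set \<Rightarrow> ('a \<Rightarrow> complex) set" where
  "conj_set E = (\<lambda>f x. cnj (f x)) ` E"

definition sum_set :: "('a \<Rightarrow> complex) set \<Rightarrow> ('a \<Rightarrow> complex) set \<Rightarrow> ('a \<Rightarrow> complex) set" where
  "sum_set E F = {\<lambda>x. f x + g x | f g. f \<in> E \<and> g \<in> F}"

definition ominus :: "'a measure \<Rightarrow> ('a \<Rightarrow> complex) set \<Rightarrow> ('a \<Rightarrow> complex) set
    \<Rightarrow> ('a \<Rightarrow> complex) set" where
  "ominus M E F = {f \<in> E. \<forall>g\<in>F. L2_inner M f g = 0}"


section \<open>Hardy spaces\<close>

definition hardy_sq :: "(complex^'n) measure \<Rightarrow> (complex^'n \<Rightarrow> complex) \<Rightarrow> ennreal" where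
  "hardy_sq mu f = (SUP r\<in>{0<..<1::real}. \<integral>\<^sup>+ z. ennreal ((cmod (f (r *\<^sub>R z)))\<^sup>2) \<partial>mu)"

definition hardy_space :: "(complex^'n) set \<Rightarrow> (complex^'n) measure
    \<Rightarrow> (complex^'n \<Rightarrow> complex) set" where
  "hardy_space U mu = {f. holo_on f U \<and> hardy_sq mu f < \<infinity>}"

definition hardy_nrm :: "(complex^'n) measure \<Rightarrow> (complex^'n \<Rightarrow> complex) \<Rightarrow> real" where
  "hardy_nrm mu f = sqrt (enn2real (hardy_sq mu f))"

definition radial_limit :: "(complex^'n \<Rightarrow> complex) \<Rightarrow> complex^'n \<Rightarrow> complex" where
  "radial_limit f z = Lim (at_left (1::real)) (\<lambda>r. f (r *\<^sub>R z))"

definition hardy_boundary :: "(complex^'n) set \<Rightarrow> (complex^'n) measure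
    \<Rightarrow> (complex^'n \<Rightarrow> complex) set" where
  "hardy_boundary U mu =
     {g \<in> L2 mu. \<exists>f\<in>hardy_space U mu. AE z in mu. g z = radial_limit f z}"

text \<open>In what follows P is the tuple of basic invariants.\<close>

definition pull :: "('n \<Rightarrow> 'n cpoly) \<Rightarrow> (complex^'n \<Rightarrow> complex)
    \<Rightarrow> complex^('n::finite) \<Rightarrow> complex" where
  "pull P f = (\<lambda>z. jac P z * f (poly_map P z))"

definition qhardy_space :: "(complex^'n) set \<Rightarrow> ('n \<Rightarrow> 'n cpoly) \<Rightarrow> (complex^'n) measure
    \<Rightarrow> (complex^'n \<Rightarrow> complex) set" where
  "qhardy_space U P mu = {f. holo_on f (poly_map P ` U) \<and> pull P f \<in> hardy_space U mu}"

definition qhardy_nrm :: "('n \<Rightarrow> 'n cpoly) \<Rightarrow> (complex^'n) measure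
    \<Rightarrow> (complex^('n::finite) \<Rightarrow> complex) \<Rightarrow> real" where
  "qhardy_nrm P mu f = hardy_nrm mu (pull P f) / hardy_nrm mu (jac P)"

text \<open>The inner product is recovered from the Hilbert space norm by polarization; it is linear
  in the first argument.\<close>

definition qhardy_inner :: "('n \<Rightarrow> 'n cpoly) \<Rightarrow> (complex^'n) measure
    \<Rightarrow> (complex^('n::finite) \<Rightarrow> complex) \<Rightarrow> (complex^'n \<Rightarrow> complex) \<Rightarrow> complex" where
  "qhardy_inner P mu f g =
     (\<Sum>k<4. \<i> ^ k * of_real ((qhardy_nrm P mu (\<lambda>x. f x + \<i> ^ k * g x))\<^sup>2)) / 4"

definition qmeasure :: "(complex^'n) set \<Rightarrow> ('n \<Rightarrow> 'n cpoly) \<Rightarrow> (complex^'n) measure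
    \<Rightarrow> (complex^'n) measure" where
  "qmeasure U P mu =
     distr (density mu (\<lambda>z. ennreal ((cmod (jac P z))\<^sup>2 / (hardy_nrm mu (jac P))\<^sup>2)))
       (restrict_space borel (shilov (poly_map P ` U))) (poly_map P)"

definition qhardy_boundary :: "(complex^'n) set \<Rightarrow> ('n \<Rightarrow> 'n cpoly) \<Rightarrow> (complex^'n) measure
    \<Rightarrow> (complex^'n \<Rightarrow> complex) set" where
  "qhardy_boundary U P mu = {f \<in> L2 (qmeasure U P mu). pull P f \<in> hardy_boundary U mu}"

definition qradial_limit :: "('n \<Rightarrow> 'n cpoly) \<Rightarrow> (complex^'n \<Rightarrow> complex)
    \<Rightarrow> complex^('n::finite) \<Rightarrow> complex" where
  "qradial_limit P f x =
     Lim (at_left (1::real)) (\<lambda>r. f (\<chi> j. of_real (r ^ cpoly_degree (P j)) * x $ j))"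

text \<open>The image in \<open>L\<^sup>2\<close> of a set of holomorphic functions under the passage to boundary values.\<close>

definition boundary_values :: "(complex^'n) set \<Rightarrow> ('n \<Rightarrow> 'n cpoly) \<Rightarrow> (complex^'n) measure
    \<Rightarrow> (complex^'n \<Rightarrow> complex) set \<Rightarrow> (complex^'n \<Rightarrow> complex) set" where
  "boundary_values U P mu E = {g \<in> L2 (qmeasure U P mu).
     \<exists>f\<in>E. AE x in qmeasure U P mu. g x = qradial_limit P f x}"

definition qhardy_boundary0 :: "(complex^'n) set \<Rightarrow> ('n \<Rightarrow> 'n cpoly) \<Rightarrow> (complex^'n) measure
    \<Rightarrow> (complex^'n \<Rightarrow> complex) set" where
  "qhardy_boundary0 U P mu =
     {f \<in> qhardy_boundary U P mu. L2_inner (qmeasure U P mu) f (\<lambda>_. 1) = 0}"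

definition mixed_space :: "(complex^'n) set \<Rightarrow> ('n \<Rightarrow> 'n cpoly) \<Rightarrow> (complex^'n) measure
    \<Rightarrow> (complex^'n \<Rightarrow> complex) set" where
  "mixed_space U P mu = ominus (qmeasure U P mu) (L2 (qmeasure U P mu))
     (sum_set (qhardy_boundary U P mu) (conj_set (qhardy_boundary U P mu)))"

definition schur_class :: "(complex^'n) set \<Rightarrow> (complex^'n \<Rightarrow> complex) set" where
  "schur_class D = {\<phi>. holo_on \<phi> D \<and> (\<forall>x\<in>D. cmod (\<phi> x) \<le> 1)}"


section \<open>Reproducing kernels and operators on subspaces of function spaces\<close>

definition reproducing_kernel :: "'a set \<Rightarrow> ('a \<Rightarrow> complex) set
    \<Rightarrow> (('a \<Rightarrow> complex) \<Rightarrow> ('a \<Rightarrow> complex) \<Rightarrow> complex) \<Rightarrow> ('a \<Rightarrow> 'a \<Rightarrow> complex) \<Rightarrow> bool" where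
  "reproducing_kernel D H ip S \<longleftrightarrow>
     (\<forall>y\<in>D. (\<lambda>x. S x y) \<in> H \<and> (\<forall>f\<in>H. ip f (\<lambda>x. S x y) = f y))"

definition kernel_span :: "('a \<Rightarrow> 'a \<Rightarrow> complex) \<Rightarrow> nat \<Rightarrow> (nat \<Rightarrow> 'a) \<Rightarrow> ('a \<Rightarrow> complex) set" where
  "kernel_span S p \<zeta> = {\<lambda>x. \<Sum>i<p. a i * S x (\<zeta> i) | a. True}"

definition bounded_ops :: "('a \<Rightarrow> complex) set \<Rightarrow> (('a \<Rightarrow> complex) \<Rightarrow> real)
    \<Rightarrow> (('a \<Rightarrow> complex) \<Rightarrow> ('a \<Rightarrow> complex)) set" where
  "bounded_ops V nrm = {T.
     (\<forall>f\<in>V. T f \<in> V) \<and>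
     (\<forall>f\<in>V. \<forall>g\<in>V. \<forall>a b. T (\<lambda>x. a * f x + b * g x) = (\<lambda>x. a * T f x + b * T g x)) \<and>
     (\<exists>C. \<forall>f\<in>V. nrm (T f) \<le> C * nrm f)}"

definition adjoint_on :: "('a \<Rightarrow> complex) set
    \<Rightarrow> (('a \<Rightarrow> complex) \<Rightarrow> ('a \<Rightarrow> complex) \<Rightarrow> complex)
    \<Rightarrow> (('a \<Rightarrow> complex) \<Rightarrow> ('a \<Rightarrow> complex)) \<Rightarrow> (('a \<Rightarrow> complex) \<Rightarrow> ('a \<Rightarrow> complex)) \<Rightarrow> bool" where
  "adjoint_on V ip T T' \<longleftrightarrow> (\<forall>f\<in>V. \<forall>g\<in>V. ip (T f) g = ip f (T' g))"

definition orth_proj :: "('a \<Rightarrow> complex) set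
    \<Rightarrow> (('a \<Rightarrow> complex) \<Rightarrow> ('a \<Rightarrow> complex) \<Rightarrow> complex) \<Rightarrow> ('a \<Rightarrow> complex) \<Rightarrow> ('a \<Rightarrow> complex)" where
  "orth_proj V ip f = (THE q. q \<in> V \<and> (\<forall>g\<in>V. ip (\<lambda>x. f x - q x) g = 0))"

text \<open>The three summands are linearly independent in \<open>L\<^sup>1\<close>, so their internal direct sum is the
  set of all sums.\<close>

definition M_tilde :: "(complex^'n) set \<Rightarrow> ('n \<Rightarrow> 'n cpoly) \<Rightarrow> (complex^'n) measure
    \<Rightarrow> (complex^'n \<Rightarrow> complex) set \<Rightarrow> (complex^'n \<Rightarrow> complex) \<Rightarrow> (complex^'n \<Rightarrow> complex) set" where
  "M_tilde U P mu Q \<psi> =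
     sum_set
       (sum_set
         (ominus (qmeasure U P mu) (conj_set (boundary_values U P mu Q))
           {\<lambda>x. a * cnj (qradial_limit P \<psi> x) | a. True})
         (mixed_space U P mu))
       (qhardy_boundary0 U P mu)"

end

theory Submission
  imports Defs "HOL-Complex_Analysis.Cauchy_Integral_Formula"
    "HOL-Computational_Algebra.Fundamental_Theorem_Algebra"
begin

text \<open>If \<open>\<phi>\<close> interpolates, then integration against its boundary function annihilates \<open>M_tilde\<close> and maps
  \<open>cnj \<psi> / \<parallel>\<psi>\<parallel>\<^sup>2\<close> to 1, so the distance is at least 1. Conversely, a Hahn-Banach argument inside \<open>L2\<close> turns the
  distance estimate into a function bounded by 1 with these two properties. Since it annihilates the mixed
  space, it is a limit of polynomials on the Shilov boundary. Hence its pairing with the kernel functions is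
  multiplicative, so the powers of the pairing stay bounded, and it defines an interpolating Schur function.

  The radial limits come from a maximal inequality for the Poisson kernel on the circles \<open>{cis t *s z}\<close>. Functions
  on the quotient correspond to skew-invariant functions on the domain because a skew-invariant polynomial is
  divisible by the Jacobian.\<close>

section \<open>Square-integrable functions and the dual extremal problem\<close>

text \<open>Everything in \<open>M_tilde\<close> is square integrable, while the distance is
  measured in L1. Duality for L1 is therefore replaced by an intersection problem in L2: the
  functions with the prescribed pairings form an affine set, those bounded by 1 a convex set, and
  the norm-minimising sequences of \<open>nested_convex_L2\<close> take the place of weak
  compactness. The nodes enter through \<open>\<psi>\<close>: projection onto the kernel span is
  interpolation at the nodes, so \<open>\<psi>\<close> is the element of the span with values
  \<open>w i\<close>, and a function whose pairings with the span equal those of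
  \<open>\<psi>\<close> has the right values. The bridge between the two domains is a degree shift
  by \<open>jdeg\<close>: invariance of \<open>mu\<close> under the circle makes homogeneous
  components of different degree orthogonal, invariance under the group makes the components of a
  pulled back function skew, and a skew homogeneous polynomial is \<open>jac P\<close> times a
  weighted homogeneous one from the quotient. Divisibility by \<open>jac P\<close> is proved on
  generic lines, where the stabiliser of each point acts through a single eigendirection, so that
  orders of vanishing can be compared.\<close>

lemma L2_measurable [measurable_dest]: "f \<in> L2 M \<Longrightarrow> f \<in> borel_measurable M"
  by (simp add: L2_def)

lemma L2_integrable_sq: "f \<in> L2 M \<Longrightarrow> integrable M (\<lambda>x. (cmod (f x))\<^sup>2)"
  by (simp add: L2_def)

lemma L2_dominated:
  assumes "f \<in> borel_measurable M" "integrable M h" "\<And>x. x \<in> space M \<Longrightarrow> (cmod (f x))\<^sup>2 \<le> h x"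
  shows "f \<in> L2 M"
  unfolding L2_def using assms
  by (auto intro!: Bochner_Integration.integrable_bound[OF assms(2)] AE_I2 order_trans[OF assms(3)])

lemma L2_mult_integrable:
  assumes f: "f \<in> L2 M" and g: "g \<in> L2 M"
  shows "integrable M (\<lambda>x. f x * g x)"
proof (rule Bochner_Integration.integrable_bound)
  show "integrable M (\<lambda>x. (cmod (f x))\<^sup>2 + (cmod (g x))\<^sup>2)"
    using f g by (intro Bochner_Integration.integrable_add L2_integrable_sq)
  show "(\<lambda>x. f x * g x) \<in> borel_measurable M"
    using f g by (auto simp: L2_def)
  show "AE x in M. norm (f x * g x) \<le> norm ((cmod (f x))\<^sup>2 + (cmod (g x))\<^sup>2)"
  proof (rule AE_I2)
    fix x
    have "0 \<le> (cmod (f x) - cmod (g x))\<^sup>2" by simp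
    then have "2 * (cmod (f x) * cmod (g x)) \<le> (cmod (f x))\<^sup>2 + (cmod (g x))\<^sup>2"
      by (simp add: power2_diff)
    moreover have "0 \<le> cmod (f x) * cmod (g x)" by simp
    ultimately have "cmod (f x) * cmod (g x) \<le> (cmod (f x))\<^sup>2 + (cmod (g x))\<^sup>2"
      by linarith
    then show "norm (f x * g x) \<le> norm ((cmod (f x))\<^sup>2 + (cmod (g x))\<^sup>2)"
      by (simp add: norm_mult)
  qed
qed

lemma L2_cnj: "f \<in> L2 M \<Longrightarrow> (\<lambda>x. cnj (f x)) \<in> L2 M"
  by (auto simp: L2_def intro: borel_measurable_continuous_on[OF continuous_on_cnj[OF continuous_on_id]])

lemma L2_mult_bounded:
  assumes "f \<in> L2 M" "h \<in> borel_measurable M" "\<And>x. x \<in> space M \<Longrightarrow> cmod (h x) \<le> B"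
  shows "(\<lambda>x. h x * f x) \<in> L2 M"
proof (rule L2_dominated)
  show "(\<lambda>x. h x * f x) \<in> borel_measurable M" using assms by (auto simp: L2_def)
  show "integrable M (\<lambda>x. B\<^sup>2 * (cmod (f x))\<^sup>2)" using assms(1) by (simp add: L2_def)
  show "(cmod (h x * f x))\<^sup>2 \<le> B\<^sup>2 * (cmod (f x))\<^sup>2" if "x \<in> space M" for x
    using assms(3)[OF that] by (simp add: norm_mult power_mult_distrib mult_right_mono power_mono)
qed

lemma L2_scale: "f \<in> L2 M \<Longrightarrow> (\<lambda>x. c * f x) \<in> L2 M"
  by (rule L2_mult_bounded[where B = "cmod c"]) auto

lemma borel_measurable_cnj: "f \<in> borel_measurable M \<Longrightarrow> (\<lambda>x. cnj (f x)) \<in> borel_measurable M"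
  by (rule borel_measurable_continuous_on[where f = cnj]) (auto intro: continuous_intros)

lemma cmod_add_sq: "(cmod (a + b))\<^sup>2 = (cmod a)\<^sup>2 + 2 * Re (cnj a * b) + (cmod b)\<^sup>2"
  unfolding cmod_power2 by (simp add: power2_eq_square algebra_simps)

lemma cmod_parallelogram: "(cmod (a + b))\<^sup>2 + (cmod (a - b))\<^sup>2 = 2 * (cmod a)\<^sup>2 + 2 * (cmod b)\<^sup>2"
  unfolding cmod_power2 by (simp add: power2_eq_square algebra_simps)

lemma cmod_add_sq_le: "(cmod (a + b))\<^sup>2 \<le> 2 * (cmod a)\<^sup>2 + 2 * (cmod b)\<^sup>2"
  using cmod_parallelogram[of a b] zero_le_power2[of "cmod (a - b)"] by linarith

lemma L2_add: "f \<in> L2 M \<Longrightarrow> g \<in> L2 M \<Longrightarrow> (\<lambda>x. f x + g x) \<in> L2 M"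
  by (rule L2_dominated[where h = "\<lambda>x. 2 * (cmod (f x))\<^sup>2 + 2 * (cmod (g x))\<^sup>2"])
    (simp_all add: L2_integrable_sq cmod_add_sq_le L2_measurable)

lemma L2_uminus: "f \<in> L2 M \<Longrightarrow> (\<lambda>x. - f x) \<in> L2 M"
  by (auto simp: L2_def)

lemma L2_diff: "f \<in> L2 M \<Longrightarrow> g \<in> L2 M \<Longrightarrow> (\<lambda>x. f x - g x) \<in> L2 M"
  using L2_add[of f M "\<lambda>x. - g x"] L2_uminus[of g M] by simp

lemma L2_zero: "(\<lambda>x. 0) \<in> L2 M"
  by (simp add: L2_def)

lemma L2_sum: "(\<And>i. i \<in> I \<Longrightarrow> f i \<in> L2 M) \<Longrightarrow> (\<lambda>x. \<Sum>i\<in>I. f i x) \<in> L2 M"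
  by (induction I rule: infinite_finite_induct) (auto simp: L2_zero intro: L2_add)

lemma (in finite_measure) L2_bounded:
  assumes "f \<in> borel_measurable M" "\<And>x. x \<in> space M \<Longrightarrow> cmod (f x) \<le> B"
  shows "f \<in> L2 M"
  using L2_mult_bounded[of "\<lambda>_. 1" M f B] assms by (simp add: L2_def)

lemma (in finite_measure) L2_integrable: "f \<in> L2 M \<Longrightarrow> integrable M f"
proof -
  assume f: "f \<in> L2 M"
  have "(\<lambda>_. 1) \<in> L2 M" by (simp add: L2_def)
  from L2_mult_integrable[OF f this] show ?thesis by simp
qed

text \<open>Squared norms keep the estimates free of roots. The triangle inequality appears as
  \<open>sqn_add_le\<close> with its factor 2, which is harmless because only finiteness and
  convergence to 0 are at stake.\<close>

definition sqn :: "'a measure \<Rightarrow> ('a \<Rightarrow> complex) \<Rightarrow> real" where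
  "sqn M f = (LINT x|M. (cmod (f x))\<^sup>2)"

lemma sqn_nonneg: "0 \<le> sqn M f"
  by (simp add: sqn_def)

lemma sqn_scale: "sqn M (\<lambda>x. c * f x) = (cmod c)\<^sup>2 * sqn M f"
  by (simp add: sqn_def norm_mult power_mult_distrib)

lemma sqn_diff_commute: "sqn M (\<lambda>x. f x - g x) = sqn M (\<lambda>x. g x - f x)"
  by (simp add: sqn_def norm_minus_commute)

lemma integral_mult_sq_le:
  assumes f: "f \<in> L2 M" and g: "g \<in> L2 M"
  shows "(LINT x|M. cmod (f x) * cmod (g x))\<^sup>2 \<le> sqn M f * sqn M g"
proof -
  have int: "integrable M (\<lambda>x. cmod (f x) * cmod (g x))"
    using L2_mult_integrable[OF f g] by (simp add: norm_mult[symmetric] integrable_norm del: norm_mult)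
  have *: "(\<integral>\<^sup>+x. ennreal (cmod (f x) * cmod (g x)) \<partial>M)\<^sup>2 \<le>
     (\<integral>\<^sup>+x. (ennreal (cmod (f x)))\<^sup>2 \<partial>M) * (\<integral>\<^sup>+x. (ennreal (cmod (g x)))\<^sup>2 \<partial>M)"
    using Cauchy_Schwarz_nn_integral[of "\<lambda>x. ennreal (cmod (f x))" M "\<lambda>x. ennreal (cmod (g x))"]
      L2_measurable[OF f] L2_measurable[OF g] by (simp add: ennreal_mult)
  have e: "(\<integral>\<^sup>+x. (ennreal (cmod (h x)))\<^sup>2 \<partial>M) = ennreal (sqn M h)" if "h \<in> L2 M" for h
    unfolding sqn_def using that
    by (subst nn_integral_eq_integral[symmetric]) (auto simp: L2_integrable_sq ennreal_power)
  have "(\<integral>\<^sup>+x. ennreal (cmod (f x) * cmod (g x)) \<partial>M) = ennreal (LINT x|M. cmod (f x) * cmod (g x))"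
    by (rule nn_integral_eq_integral[OF int]) simp
  with * e[OF f] e[OF g] show ?thesis
    by (simp add: ennreal_power ennreal_mult[symmetric] sqn_nonneg)
qed

lemma cmod_integral_sq_le:
  assumes f: "f \<in> L2 M" and g: "g \<in> L2 M"
  shows "(cmod (LINT x|M. f x * g x))\<^sup>2 \<le> sqn M f * sqn M g"
proof -
  have "cmod (LINT x|M. f x * g x) \<le> (LINT x|M. cmod (f x * g x))"
    by (rule integral_norm_bound)
  then have "(cmod (LINT x|M. f x * g x))\<^sup>2 \<le> (LINT x|M. cmod (f x) * cmod (g x))\<^sup>2"
    by (intro power_mono) (auto simp: norm_mult)
  then show ?thesis using integral_mult_sq_le[OF f g] by linarith
qed

lemma sqn_complex: "f \<in> L2 M \<Longrightarrow> of_real (sqn M f) = (LINT x|M. f x * cnj (f x))"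
  unfolding sqn_def complex_norm_square[symmetric] by (simp only: integral_complex_of_real)

lemma L2_inner_scale_left: "L2_inner M (\<lambda>x. a * f x) g = a * L2_inner M f g"
  unfolding L2_inner_def mult.assoc by simp

lemma L2_inner_commute: "L2_inner M g f = cnj (L2_inner M f g)"
  unfolding L2_inner_def Bochner_Integration.integral_cnj[symmetric] by (simp add: mult.commute)

lemma L2_inner_scale_right: "L2_inner M f (\<lambda>x. a * g x) = cnj a * L2_inner M f g"
  using L2_inner_scale_left[of M a g f] by (simp add: L2_inner_commute[of M f])

lemma L2_inner_add_left:
  assumes "f \<in> L2 M" "g \<in> L2 M" "h \<in> L2 M"
  shows "L2_inner M (\<lambda>x. f x + g x) h = L2_inner M f h + L2_inner M g h"
  unfolding L2_inner_def distrib_right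
  by (rule Bochner_Integration.integral_add) (intro L2_mult_integrable L2_cnj assms)+

lemma L2_inner_add_right:
  assumes "f \<in> L2 M" "g \<in> L2 M" "h \<in> L2 M"
  shows "L2_inner M h (\<lambda>x. f x + g x) = L2_inner M h f + L2_inner M h g"
  using L2_inner_add_left[OF assms] by (simp add: L2_inner_commute[of M h])

lemma L2_inner_sum_left:
  assumes "\<And>i. i \<in> I \<Longrightarrow> f i \<in> L2 M" "h \<in> L2 M"
  shows "L2_inner M (\<lambda>x. \<Sum>i\<in>I. f i x) h = (\<Sum>i\<in>I. L2_inner M (f i) h)"
  unfolding L2_inner_def sum_distrib_right
  by (rule Bochner_Integration.integral_sum) (intro L2_mult_integrable L2_cnj assms)

lemma L2_inner_sum_right:
  assumes "\<And>i. i \<in> I \<Longrightarrow> f i \<in> L2 M" "h \<in> L2 M"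
  shows "L2_inner M h (\<lambda>x. \<Sum>i\<in>I. f i x) = (\<Sum>i\<in>I. L2_inner M h (f i))"
  by (simp only: L2_inner_commute[of M h] L2_inner_sum_left[of I f, OF assms] cnj_sum)

lemma L2_inner_cong_AE:
  assumes "f \<in> borel_measurable M" "f' \<in> borel_measurable M" "g \<in> borel_measurable M" "g' \<in> borel_measurable M"
    and "AE x in M. f x = f' x" "AE x in M. g x = g' x"
  shows "L2_inner M f g = L2_inner M f' g'"
  unfolding L2_inner_def
proof (rule integral_cong_AE)
  show "AE x in M. f x * cnj (g x) = f' x * cnj (g' x)" using assms(5,6) by eventually_elim simp
qed (intro borel_measurable_times borel_measurable_cnj assms)+

lemma L2_inner_self: "f \<in> L2 M \<Longrightarrow> L2_inner M f f = of_real (sqn M f)"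
  by (simp add: L2_inner_def sqn_complex)

lemma sqn_eq_0_AE:
  assumes "f \<in> L2 M" "sqn M f = 0"
  shows "AE x in M. f x = 0"
proof -
  have "AE x in M. (cmod (f x))\<^sup>2 = 0"
    using assms L2_integrable_sq[OF assms(1)] unfolding sqn_def by (subst (asm) integral_nonneg_eq_0_iff_AE) auto
  then show ?thesis by eventually_elim simp
qed

lemma L2_inner_zero_AE:
  assumes "AE x in M. f x = 0" "f \<in> borel_measurable M" "g \<in> borel_measurable M"
  shows "L2_inner M f g = 0"
proof -
  have "L2_inner M f g = L2_inner M (\<lambda>x. 0) g"
    by (rule L2_inner_cong_AE) (use assms in auto)
  then show ?thesis by (simp add: L2_inner_def)
qed

lemma cmod_L2_inner_sq_le: "f \<in> L2 M \<Longrightarrow> g \<in> L2 M \<Longrightarrow> (cmod (L2_inner M f g))\<^sup>2 \<le> sqn M f * sqn M g"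
  using cmod_integral_sq_le[of f M "\<lambda>x. cnj (g x)"] by (simp add: L2_inner_def L2_cnj sqn_def)

lemma sqn_add_scale:
  assumes f: "f \<in> L2 M" and g: "g \<in> L2 M"
  shows "sqn M (\<lambda>x. f x + c * g x) = sqn M f + 2 * Re (cnj c * L2_inner M f g) + (cmod c)\<^sup>2 * sqn M g"
proof -
  have i: "integrable M (\<lambda>x. f x * cnj (g x))" by (intro L2_mult_integrable L2_cnj f g)
  have "sqn M (\<lambda>x. f x + c * g x) =
    (LINT x|M. (cmod (f x))\<^sup>2 + 2 * Re (cnj c * (f x * cnj (g x))) + (cmod c)\<^sup>2 * (cmod (g x))\<^sup>2)"
    unfolding sqn_def cmod_add_sq
    by (rule Bochner_Integration.integral_cong) (auto simp: norm_mult power_mult_distrib algebra_simps)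
  also have "\<dots> = sqn M f + 2 * Re (LINT x|M. cnj c * (f x * cnj (g x))) + (cmod c)\<^sup>2 * sqn M g"
    using L2_integrable_sq[OF f] L2_integrable_sq[OF g] i
    by (simp add: sqn_def del: times_complex.sel Bochner_Integration.integral_mult_right_zero)
  finally show ?thesis by (simp add: L2_inner_def)
qed

lemma sqn_parallelogram:
  assumes "f \<in> L2 M" "g \<in> L2 M"
  shows "sqn M (\<lambda>x. f x + g x) + sqn M (\<lambda>x. f x - g x) = 2 * sqn M f + 2 * sqn M g"
  using sqn_add_scale[OF assms, of 1] sqn_add_scale[OF assms, of "-1"] by simp

lemma sqn_add_le:
  assumes "f \<in> L2 M" "g \<in> L2 M"
  shows "sqn M (\<lambda>x. f x + g x) \<le> 2 * sqn M f + 2 * sqn M g"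
  using sqn_parallelogram[OF assms] sqn_nonneg[of M "\<lambda>x. f x - g x"] by linarith

lemma sqn_sum_orthogonal:
  assumes "\<And>n. q n \<in> L2 M" "\<And>m n. m \<noteq> n \<Longrightarrow> L2_inner M (q m) (q n) = 0"
  shows "sqn M (\<lambda>x. \<Sum>n<N::nat. q n x) = (\<Sum>n<N. sqn M (q n))"
proof (induction N)
  case (Suc N)
  have "L2_inner M (\<lambda>x. \<Sum>n<N. q n x) (q N) = 0"
    using assms by (subst L2_inner_sum_left) auto
  then show ?case
    using Suc sqn_add_scale[of "\<lambda>x. \<Sum>n<N. q n x" M "q N" 1] assms(1) by (simp add: L2_sum)
qed (simp add: sqn_def)

lemma sqn_diff_triangle:
  assumes "f \<in> L2 M" "g \<in> L2 M" "h \<in> L2 M"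
  shows "sqn M (\<lambda>x. f x - h x) \<le> 2 * sqn M (\<lambda>x. f x - g x) + 2 * sqn M (\<lambda>x. g x - h x)"
  using sqn_add_le[OF L2_diff[OF assms(1,2)] L2_diff[OF assms(2,3)]] by simp

lemma tendsto_integral_mult:
  assumes u: "\<And>n. u n \<in> L2 M" and v: "v \<in> L2 M" and g: "g \<in> L2 M"
    and lim: "((\<lambda>n. sqn M (\<lambda>x. u n x - v x)) \<longlongrightarrow> 0) F"
  shows "((\<lambda>n. LINT x|M. u n x * g x) \<longlongrightarrow> (LINT x|M. v x * g x)) F"
proof -
  have eq: "(LINT x|M. u n x * g x) - (LINT x|M. v x * g x) = (LINT x|M. (u n x - v x) * g x)" for n
    by (simp add: left_diff_distrib L2_mult_integrable u v g)
  have le: "(cmod ((LINT x|M. u n x * g x) - (LINT x|M. v x * g x)))\<^sup>2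
      \<le> sqn M (\<lambda>x. u n x - v x) * sqn M g" for n
    unfolding eq by (intro cmod_integral_sq_le L2_diff u v g)
  have lim': "((\<lambda>n. sqn M (\<lambda>x. u n x - v x) * sqn M g) \<longlongrightarrow> 0) F"
    using tendsto_mult_right[OF lim, of "sqn M g"] by simp
  have "((\<lambda>n. (cmod ((LINT x|M. u n x * g x) - (LINT x|M. v x * g x)))\<^sup>2) \<longlongrightarrow> 0) F"
    by (rule Lim_null_comparison[OF always_eventually lim']) (use le in simp)
  then have "((\<lambda>n. cmod ((LINT x|M. u n x * g x) - (LINT x|M. v x * g x))) \<longlongrightarrow> 0) F"
    by (simp add: power_tendsto_0_iff)
  then show ?thesis
    by (simp add: tendsto_norm_zero_iff LIM_zero_iff)
qed

lemma sqn_tendsto: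
  assumes u: "\<And>n. u n \<in> L2 M" and v: "v \<in> L2 M" and lim: "((\<lambda>n. sqn M (\<lambda>x. u n x - v x)) \<longlongrightarrow> 0) F"
  shows "((\<lambda>n. sqn M (u n)) \<longlongrightarrow> sqn M v) F"
proof -
  have d: "(\<lambda>x. u n x - v x) \<in> L2 M" for n by (rule L2_diff[OF u v])
  have eq: "sqn M (u n) = sqn M (\<lambda>x. u n x - v x) + 2 * Re (LINT x|M. (u n x - v x) * cnj (v x)) + sqn M v" for n
    using sqn_add_scale[OF d v, of n 1] by (simp add: L2_inner_def)
  have "((\<lambda>n. LINT x|M. (u n x - v x) * cnj (v x)) \<longlongrightarrow> (LINT x|M. 0 * cnj (v x))) F"
    by (rule tendsto_integral_mult[OF d L2_zero L2_cnj[OF v]]) (use lim in simp)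
  then have "((\<lambda>n. sqn M (\<lambda>x. u n x - v x) + 2 * Re (LINT x|M. (u n x - v x) * cnj (v x)) + sqn M v)
      \<longlongrightarrow> 0 + 2 * Re 0 + sqn M v) F"
    by (intro tendsto_intros lim) simp
  then show ?thesis unfolding eq[symmetric] by simp
qed

text \<open>Fatou's lemma for the squared moduli. A bound on the norms replaces a dominating
  function, which is not at hand for radial limits.\<close>

lemma L2_limit:
  assumes f: "\<And>n. f n \<in> L2 M" and g: "g \<in> borel_measurable M" and lim: "AE x in M. (\<lambda>n. f n x) \<longlonglongrightarrow> g x"
    and bound: "\<forall>\<^sub>F n in sequentially. sqn M (f n) \<le> C"
  shows "g \<in> L2 M" and "sqn M g \<le> C"
proof -
  have "(\<integral>\<^sup>+x. ennreal ((cmod (g x))\<^sup>2) \<partial>M) = (\<integral>\<^sup>+x. liminf (\<lambda>n. ennreal ((cmod (f n x))\<^sup>2)) \<partial>M)"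
  proof (rule nn_integral_cong_AE)
    show "AE x in M. ennreal ((cmod (g x))\<^sup>2) = liminf (\<lambda>n. ennreal ((cmod (f n x))\<^sup>2))"
      using lim by eventually_elim (intro lim_imp_Liminf[symmetric] tendsto_ennrealI tendsto_intros, simp_all)
  qed
  also have "\<dots> \<le> liminf (\<lambda>n. \<integral>\<^sup>+x. ennreal ((cmod (f n x))\<^sup>2) \<partial>M)"
    using L2_measurable[OF f] by (intro nn_integral_liminf) measurable
  also have "\<dots> \<le> ennreal C"
  proof (rule Liminf_le)
    have "(\<integral>\<^sup>+x. ennreal ((cmod (f n x))\<^sup>2) \<partial>M) = ennreal (sqn M (f n))" for n
      unfolding sqn_def using L2_integrable_sq[OF f] by (intro nn_integral_eq_integral) auto
    then show "\<forall>\<^sub>F n in sequentially. (\<integral>\<^sup>+x. ennreal ((cmod (f n x))\<^sup>2) \<partial>M) \<le> ennreal C"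
      using bound by (auto elim!: eventually_mono intro: ennreal_leI)
  qed simp
  finally have le: "(\<integral>\<^sup>+x. ennreal ((cmod (g x))\<^sup>2) \<partial>M) \<le> ennreal C" .
  then have int: "integrable M (\<lambda>x. (cmod (g x))\<^sup>2)"
    using g by (intro integrableI_bounded) (auto intro: order.strict_trans1)
  then show "g \<in> L2 M" using g by (simp add: L2_def)
  have "0 \<le> C" using eventually_happens'[OF sequentially_bot bound] sqn_nonneg order_trans by blast
  moreover have "(\<integral>\<^sup>+x. ennreal ((cmod (g x))\<^sup>2) \<partial>M) = ennreal (sqn M g)"
    unfolding sqn_def using int by (intro nn_integral_eq_integral) auto
  ultimately show "sqn M g \<le> C" using le by (simp add: ennreal_le_iff)
qed

text \<open>The Riesz-Fischer argument: increments of size \<open>(1/2)^k\<close> in L2 are summable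
  in L1 because the measure is finite, so a subsequence converges almost everywhere, and Fatou turns
  its limit into a limit in L2.\<close>

theorem L2_complete:
  assumes u: "\<And>n. u n \<in> L2 M"
    and cauchy: "\<And>e. e > 0 \<Longrightarrow> \<exists>N. \<forall>m\<ge>N. \<forall>n\<ge>N. sqn M (\<lambda>x. u m x - u n x) < e"
    and fin: "finite_measure M"
  obtains v where "v \<in> L2 M" "(\<lambda>n. sqn M (\<lambda>x. u n x - v x)) \<longlonglongrightarrow> 0"
proof -
  interpret finite_measure M by (rule fin)
  have "\<exists>N. \<forall>m\<ge>N. \<forall>n\<ge>N. sqn M (\<lambda>x. u m x - u n x) < ((1/2)^k)\<^sup>2" for k :: nat
    by (rule cauchy) simp
  then obtain N where N: "\<And>k m n. m \<ge> N k \<Longrightarrow> n \<ge> N k \<Longrightarrow> sqn M (\<lambda>x. u m x - u n x) < ((1/2)^k)\<^sup>2"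
    by metis
  \<comment> \<open>The sum makes \<open>r j\<close> at least \<open>N k\<close> for every
    \<open>k \<le> j\<close>; the summand \<open>k\<close> makes \<open>r\<close> pass every
    index.\<close>
  define r where "r k = k + (\<Sum>i\<le>k. N i)" for k
  have rN: "N k \<le> r j" if "k \<le> j" for j k
    unfolding r_def using that member_le_sum[of k "{..j}" N] by auto
  define d where "d k x = u (r (Suc k)) x - u (r k) x" for k x
  have d_L2: "d k \<in> L2 M" for k unfolding d_def by (intro L2_diff u)
  have meas: "u n \<in> borel_measurable M" for n by (rule L2_measurable[OF u])
  have [measurable]: "d k \<in> borel_measurable M" for k by (rule L2_measurable[OF d_L2])
  define c where "c = sqrt (sqn M (\<lambda>_. 1))"
  have d_int: "(\<integral>\<^sup>+x. ennreal (cmod (d k x)) \<partial>M) \<le> ennreal ((1/2)^k * c)" for k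
  proof -
    have "sqn M (d k) \<le> ((1/2)^k)\<^sup>2"
      unfolding d_def by (rule less_imp_le[OF N]) (auto intro: rN)
    from mult_right_mono[OF this sqn_nonneg, of M "\<lambda>_. 1"]
    have "(LINT x|M. cmod (d k x))\<^sup>2 \<le> ((1/2)^k * c)\<^sup>2"
      using integral_mult_sq_le[OF d_L2 L2_bounded[of "\<lambda>_. 1" 1], of k]
      by (simp add: c_def power_mult_distrib sqn_nonneg)
    then have "(LINT x|M. cmod (d k x)) \<le> (1/2)^k * c"
      by (rule power2_le_imp_le) (simp add: c_def sqn_nonneg)
    then show ?thesis
      using L2_integrable[OF d_L2[of k]] by (subst nn_integral_eq_integral) (auto intro: ennreal_leI)
  qed
  have "(\<integral>\<^sup>+x. (suminf (\<lambda>k. ennreal (cmod (d k x)))) \<partial>M) = (suminf (\<lambda>k. \<integral>\<^sup>+x. ennreal (cmod (d k x)) \<partial>M))"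
    by (rule nn_integral_suminf) simp
  also have "\<dots> \<le> (suminf (\<lambda>k. ennreal ((1/2)^k * c)))"
    by (intro suminf_le d_int) auto
  also have "\<dots> < \<infinity>"
    by (subst suminf_ennreal2) (auto intro!: summable_mult2 summable_geometric simp: c_def sqn_nonneg)
  finally have "AE x in M. (suminf (\<lambda>k. ennreal (cmod (d k x)))) \<noteq> \<infinity>"
    by (intro nn_integral_noteq_infinite) auto
  then have conv: "AE x in M. convergent (\<lambda>k. u (r k) x)"
  proof eventually_elim
    case (elim x)
    have "summable (\<lambda>k. cmod (d k x))"
      by (rule summable_suminf_not_top) (use elim in auto)
    then have "summable (\<lambda>k. d k x)" by (rule summable_norm_cancel)
    then have "convergent (\<lambda>n. \<Sum>k<n. d k x)" by (simp add: summable_iff_convergent)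
    moreover have "(\<Sum>k<n. d k x) = u (r n) x - u (r 0) x" for n
      unfolding d_def by (rule sum_lessThan_telescope)
    ultimately have "convergent (\<lambda>n. (u (r n) x - u (r 0) x) + u (r 0) x)"
      by (intro convergent_add convergent_const) simp
    then show ?case by simp
  qed
  define v where "v x = lim (\<lambda>k. u (r k) x)" for x
  have v_meas [measurable]: "v \<in> borel_measurable M"
    unfolding v_def using meas by (intro borel_measurable_lim_metric) auto
  have v_lim: "AE x in M. (\<lambda>k. u (r k) x) \<longlonglongrightarrow> v x"
    using conv by eventually_elim (simp add: v_def convergent_LIMSEQ_iff)
  have lim: "(\<lambda>x. u n x - v x) \<in> L2 M \<and> sqn M (\<lambda>x. u n x - v x) \<le> e"
    if "\<forall>m\<ge>K. sqn M (\<lambda>x. u n x - u m x) < e" for n K e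
  proof -
    have "AE x in M. (\<lambda>j. u n x - u (r j) x) \<longlonglongrightarrow> u n x - v x"
      using v_lim by eventually_elim (intro tendsto_intros)
    moreover have "\<forall>\<^sub>F j in sequentially. sqn M (\<lambda>x. u n x - u (r j) x) \<le> e"
      using that by (intro eventually_sequentiallyI[of K]) (auto simp: r_def intro!: less_imp_le)
    moreover have "(\<lambda>x. u n x - v x) \<in> borel_measurable M" using meas by simp
    ultimately show ?thesis by (intro conjI L2_limit[OF L2_diff[OF u u]])
  qed
  obtain K where K: "\<forall>m\<ge>K. \<forall>n\<ge>K. sqn M (\<lambda>x. u m x - u n x) < 1" using cauchy[of 1] by auto
  have "v \<in> L2 M"
    using L2_diff[OF u[of K] lim[of K K 1, THEN conjunct1]] K by simp
  moreover have "(\<lambda>n. sqn M (\<lambda>x. u n x - v x)) \<longlonglongrightarrow> 0"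
  proof (rule LIMSEQ_I)
    fix e :: real assume e: "e > 0"
    then obtain K where K: "\<forall>m\<ge>K. \<forall>n\<ge>K. sqn M (\<lambda>x. u m x - u n x) < e / 2" using cauchy[of "e / 2"] by auto
    have "norm (sqn M (\<lambda>x. u n x - v x) - 0) < e" if "n \<ge> K" for n
      using lim[OF spec[OF K, THEN mp, OF that]] e by (simp add: sqn_nonneg)
    then show "\<exists>no. \<forall>n\<ge>no. norm (sqn M (\<lambda>x. u n x - v x) - 0) < e" by blast
  qed
  ultimately show ?thesis by (rule that)
qed

text \<open>One Gram-Schmidt step per vector: \<open>e'\<close> is the part of the new vector
  orthogonal to the old ones. The \<open>e i\<close> may be dependent, which admits kernel functions
  and monomials restricted to the boundary.\<close>

lemma L2_finite_projection:
  assumes "finite I" "\<And>i. i \<in> I \<Longrightarrow> e i \<in> L2 M" "f \<in> L2 M"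
  shows "\<exists>c. \<forall>i\<in>I. L2_inner M (\<lambda>x. f x - (\<Sum>j\<in>I. c j * e j x)) (e i) = 0"
  using assms
proof (induction I arbitrary: f rule: finite_induct)
  case (insert k I)
  have e: "e i \<in> L2 M" if "i \<in> I" for i using insert that by auto
  have ek: "e k \<in> L2 M" using insert by auto
  obtain d where d: "\<forall>i\<in>I. L2_inner M (\<lambda>x. e k x - (\<Sum>j\<in>I. d j * e j x)) (e i) = 0"
    using insert.IH[OF e ek] by auto
  obtain c where c: "\<forall>i\<in>I. L2_inner M (\<lambda>x. f x - (\<Sum>j\<in>I. c j * e j x)) (e i) = 0"
    using insert.IH[OF e insert.prems(2)] by auto
  define e' where "e' x = e k x - (\<Sum>j\<in>I. d j * e j x)" for x
  define f' where "f' x = f x - (\<Sum>j\<in>I. c j * e j x)" for x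
  have e'_L2: "e' \<in> L2 M" unfolding e'_def by (intro L2_diff ek L2_sum L2_scale e)
  have f'_L2: "f' \<in> L2 M" unfolding f'_def by (intro L2_diff insert.prems L2_sum L2_scale e)
  define s where "s = L2_inner M f' e' / L2_inner M e' e'"
  define g where "g x = f' x + (- s) * e' x" for x
  have g_L2: "g \<in> L2 M" unfolding g_def by (intro L2_add f'_L2 L2_scale e'_L2)
  have lin: "L2_inner M g h = L2_inner M f' h - s * L2_inner M e' h" if "h \<in> L2 M" for h
    using L2_inner_add_left[OF f'_L2 L2_scale[OF e'_L2, of "- s"] that] L2_inner_scale_left[of M "- s" e' h]
    by (simp add: g_def[abs_def])
  have ge: "L2_inner M g (e i) = 0" if "i \<in> I" for i
    using c d that lin[OF e[OF that]] unfolding e'_def f'_def by simp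
  \<comment> \<open>A null vector \<open>e'\<close> is orthogonal to everything by Cauchy-Schwarz,
    so the default value of the quotient \<open>s\<close> does no harm.\<close>
  have ge': "L2_inner M g e' = 0"
  proof (cases "L2_inner M e' e' = 0")
    case True
    then show ?thesis using cmod_L2_inner_sq_le[OF g_L2 e'_L2] by (simp add: L2_inner_self[OF e'_L2])
  qed (simp add: lin[OF e'_L2] s_def)
  have "L2_inner M g (\<lambda>x. \<Sum>j\<in>I. d j * e j x) = (\<Sum>j\<in>I. L2_inner M g (\<lambda>x. d j * e j x))"
    by (intro L2_inner_sum_right L2_scale e g_L2)
  then have sum0: "L2_inner M g (\<lambda>x. \<Sum>j\<in>I. d j * e j x) = 0" using ge by (simp add: L2_inner_scale_right)
  have "e k = (\<lambda>x. e' x + (\<Sum>j\<in>I. d j * e j x))" by (simp add: e'_def)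
  then have gk: "L2_inner M g (e k) = 0"
    using L2_inner_add_right[OF e'_L2 _ g_L2, of "\<lambda>x. \<Sum>j\<in>I. d j * e j x"] ge' sum0
    by (simp add: L2_sum L2_scale e)
  define c' where "c' j = (if j = k then s else c j - s * d j)" for j
  have "(\<Sum>j\<in>insert k I. c' j * e j x) = s * e k x + (\<Sum>j\<in>I. (c j - s * d j) * e j x)" for x
    using insert.hyps by (auto simp: c'_def intro!: sum.cong)
  then have "(\<lambda>x. f x - (\<Sum>j\<in>insert k I. c' j * e j x)) = g"
    unfolding g_def f'_def e'_def
    by (auto simp: fun_eq_iff left_diff_distrib right_diff_distrib sum_subtractf sum_distrib_left sum_negf mult.assoc)
  then show ?case using ge gk by (intro exI[of _ c']) auto
qed simp

text \<open>Near-minimisers \<open>u n\<close> of the norm in \<open>C n\<close> form a Cauchy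
  sequence: the minimal norms increase and are bounded, and midpoints of \<open>u m\<close> and
  \<open>u n\<close> stay in the larger set. This serves in place of weak compactness. The sets need
  not be closed, so \<open>v\<close> is only a limit of their points.\<close>

lemma nested_convex_L2:
  assumes fin: "finite_measure M" and sub: "\<And>n. C n \<subseteq> L2 M" and dec: "\<And>n. C (Suc n) \<subseteq> C n"
    and mid: "\<And>n f g. f \<in> C n \<Longrightarrow> g \<in> C n \<Longrightarrow> (\<lambda>x. (f x + g x) / 2) \<in> C n"
    and bdd: "\<And>n. \<exists>f\<in>C n. sqn M f \<le> B"
  obtains u v where "\<And>n. u n \<in> C n" "v \<in> L2 M" "(\<lambda>n. sqn M (\<lambda>x. u n x - v x)) \<longlonglongrightarrow> 0"
    "\<And>f. (\<And>n. f \<in> C n) \<Longrightarrow> sqn M v \<le> sqn M f"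
proof -
  define i where "i n = Inf (sqn M ` C n)" for n
  have ne: "C n \<noteq> {}" for n using bdd[of n] by blast
  have bb: "bdd_below (sqn M ` C n)" for n by (rule bdd_belowI2[where m = 0]) (rule sqn_nonneg)
  have i_le: "i n \<le> sqn M f" if "f \<in> C n" for n f
    unfolding i_def using that bb by (intro cInf_lower) auto
  have dec': "C m \<subseteq> C n" if "n \<le> m" for m n
    by (rule lift_Suc_antimono_le[of C, OF dec that])
  have i_mono: "i n \<le> i m" if "n \<le> m" for m n
    unfolding i_def using ne bb dec'[OF that] by (intro cInf_superset_mono) auto
  have i_bdd: "i n \<le> B" for n
    using bdd[of n] i_le order_trans by blast
  have "\<exists>f\<in>C n. sqn M f < i n + 1 / real (Suc n)" for n
    using cInf_lessD[of "sqn M ` C n" "i n + 1 / real (Suc n)"] ne unfolding i_def[symmetric] by auto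
  then obtain u where u: "\<And>n. u n \<in> C n" "\<And>n. sqn M (u n) < i n + 1 / real (Suc n)" by metis
  have uL2: "u n \<in> L2 M" for n using u(1) sub by blast
  have "convergent i"
    by (rule incseq_convergent[of i B]) (use i_mono i_bdd in \<open>auto simp: incseq_def convergent_def\<close>)
  then have i_cau: "Cauchy i" by (rule convergent_Cauchy)
  \<comment> \<open>Parallelogram law, with a midpoint of squared norm at least
    \<open>i n\<close>.\<close>
  have est: "sqn M (\<lambda>x. u m x - u n x) \<le> 2 * (i m - i n) + 2 / real (Suc m) + 2 / real (Suc n)"
    if "n \<le> m" for m n
  proof -
    have "(\<lambda>x. (u m x + u n x) / 2) \<in> C n"
      using u(1)[of m] u(1)[of n] dec'[OF that] by (intro mid) auto
    then have "i n \<le> sqn M (\<lambda>x. (u m x + u n x) / 2)" by (rule i_le)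
    also have "\<dots> = sqn M (\<lambda>x. u m x + u n x) / 4"
      using sqn_scale[of M "1/2" "\<lambda>x. u m x + u n x"] by (simp add: power2_eq_square)
    finally have "4 * i n \<le> sqn M (\<lambda>x. u m x + u n x)" by simp
    with sqn_parallelogram[OF uL2[of m] uL2[of n]] u(2)[of m] u(2)[of n]
    show ?thesis by argo
  qed
  obtain v where v: "v \<in> L2 M" "(\<lambda>n. sqn M (\<lambda>x. u n x - v x)) \<longlonglongrightarrow> 0"
  proof (rule L2_complete[OF uL2 _ fin])
    fix r :: real assume r: "0 < r"
    obtain k1 where k1: "\<And>m n. m \<ge> k1 \<Longrightarrow> n \<ge> k1 \<Longrightarrow> norm (i m - i n) < r / 8"
      using i_cau r unfolding Cauchy_def dist_norm by (metis divide_pos_pos zero_less_numeral)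
    obtain k2 where k2: "1 / real (Suc k2) < r / 8"
      using r nat_approx_posE[of "r / 8"] by auto
    have "sqn M (\<lambda>x. u m x - u n x) < r" if "m \<ge> n" "n \<ge> max k1 k2" for m n
    proof -
      have "1 / real (Suc m) \<le> 1 / real (Suc k2)" "1 / real (Suc n) \<le> 1 / real (Suc k2)"
        using that by (auto simp: frac_le)
      moreover have "\<bar>i m - i n\<bar> < r / 8" using k1[of m n] that by simp
      then have "i m - i n < r / 8" by linarith
      ultimately show ?thesis using est[OF that(1)] k2 r by argo
    qed
    then have "sqn M (\<lambda>x. u m x - u n x) < r" if "m \<ge> max k1 k2" "n \<ge> max k1 k2" for m n
      using that sqn_diff_commute[of M "u m" "u n"] by (metis nat_le_linear)
    then show "\<exists>N. \<forall>m\<ge>N. \<forall>n\<ge>N. sqn M (\<lambda>x. u m x - u n x) < r" by blast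
  qed blast
  moreover have "sqn M v \<le> sqn M f" if f: "\<And>n. f \<in> C n" for f
  proof (rule LIMSEQ_le[OF sqn_tendsto[OF uL2 v]])
    show "(\<lambda>n. sqn M f + inverse (real (Suc n))) \<longlonglongrightarrow> sqn M f" by (rule LIMSEQ_inverse_real_of_nat_add)
    show "\<exists>N. \<forall>n\<ge>N. sqn M (u n) \<le> sqn M f + inverse (real (Suc n))"
    proof (intro exI allI impI)
      show "sqn M (u n) \<le> sqn M f + inverse (real (Suc n))" for n
        using u(2)[of n] i_le[OF f, of n] by (simp add: inverse_eq_divide)
    qed
  qed
  ultimately show ?thesis using u(1) that by blast
qed

text \<open>The variational inequality for the point of the closure of \<open>K\<close> nearest to
  0. Since \<open>v\<close> may lie outside \<open>K\<close>, it is given together with the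
  approximating sequence \<open>u\<close>.\<close>

lemma L2_nearest:
  assumes fin: "finite_measure M" and sub: "K \<subseteq> L2 M" and ne: "K \<noteq> {}"
    and conv: "\<And>f g t. f \<in> K \<Longrightarrow> g \<in> K \<Longrightarrow> 0 \<le> t \<Longrightarrow> t \<le> (1::real) \<Longrightarrow> (\<lambda>x. f x + of_real t * (g x - f x)) \<in> K"
  obtains u v where "\<And>n. u n \<in> K" "v \<in> L2 M" "(\<lambda>n. sqn M (\<lambda>x. u n x - v x)) \<longlonglongrightarrow> 0"
    "\<And>k. k \<in> K \<Longrightarrow> sqn M v \<le> Re (L2_inner M k v)"
proof -
  obtain f0 where f0: "f0 \<in> K" using ne by blast
  obtain u v where u: "\<And>n::nat. u n \<in> K" and v: "v \<in> L2 M" "(\<lambda>n. sqn M (\<lambda>x. u n x - v x)) \<longlonglongrightarrow> 0"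
    and min: "\<And>f. f \<in> K \<Longrightarrow> sqn M v \<le> sqn M f"
  proof (rule nested_convex_L2[OF fin, of "\<lambda>_. K" "sqn M f0"])
    show "(\<lambda>x. (f x + g x) / 2) \<in> K" if "f \<in> K" "g \<in> K" for f g
      using conv[OF that, of "1/2"] by (simp add: algebra_simps add_divide_distrib diff_divide_distrib)
  qed (use sub f0 in auto)
  have uL: "u n \<in> L2 M" for n using u sub by blast
  have "sqn M v \<le> Re (L2_inner M k v)" if k: "k \<in> K" for k
  proof -
    define w where "w x = k x + (- 1) * v x" for x
    have kL: "k \<in> L2 M" using k sub by blast
    have wL: "w \<in> L2 M" unfolding w_def by (intro L2_add L2_scale kL v)
    have "0 \<le> 2 * Re (L2_inner M v w) + t * sqn M w" if t: "0 < t" "t < 1" for t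
    proof -
      \<comment> \<open>The segment starts at \<open>u n\<close> instead of \<open>v\<close>, so
        that it stays in \<open>K\<close>; its norms converge to that of
        \<open>v + t w\<close>.\<close>
      define a where "a n x = u n x + of_real t * (k x - u n x)" for n x
      have aK: "a n \<in> K" for n unfolding a_def by (rule conv[OF u k]) (use t in auto)
      have "a n x - (v x + of_real t * w x) = of_real (1 - t) * (u n x - v x)" for n x
        by (simp add: a_def w_def algebra_simps)
      then have "(\<lambda>n. sqn M (\<lambda>x. a n x - (v x + of_real t * w x))) = (\<lambda>n. (cmod (of_real (1 - t)))\<^sup>2 * sqn M (\<lambda>x. u n x - v x))"
        by (simp only: sqn_scale)
      then have "(\<lambda>n. sqn M (\<lambda>x. a n x - (v x + of_real t * w x))) \<longlonglongrightarrow> 0"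
        using tendsto_mult_right_zero[OF v(2)] by simp
      then have "(\<lambda>n. sqn M (a n)) \<longlonglongrightarrow> sqn M (\<lambda>x. v x + of_real t * w x)"
        using aK sub by (intro sqn_tendsto L2_add L2_scale v wL) auto
      then have "sqn M v \<le> sqn M (\<lambda>x. v x + of_real t * w x)"
        by (rule LIMSEQ_le_const) (use min aK in auto)
      then have "0 \<le> t * (2 * Re (L2_inner M v w) + t * sqn M w)"
        unfolding sqn_add_scale[OF v(1) wL] using t by (simp add: algebra_simps power2_eq_square)
      then show ?thesis using t by (simp add: zero_le_mult_iff)
    qed
    then have "\<forall>\<^sub>F t in at_right 0. 0 \<le> 2 * Re (L2_inner M v w) + t * sqn M w"
      by (auto simp: eventually_at_right[of 0 1] intro!: exI[of _ 1])
    moreover have "((\<lambda>t. 2 * Re (L2_inner M v w) + t * sqn M w) \<longlongrightarrow> 2 * Re (L2_inner M v w) + 0 * sqn M w) (at_right 0)"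
      by (intro tendsto_intros)
    ultimately have "0 \<le> Re (L2_inner M v w)"
      using tendsto_lowerbound[of _ "2 * Re (L2_inner M v w) + 0 * sqn M w" "at_right 0" 0] by fastforce
    moreover have "L2_inner M w v = L2_inner M k v - of_real (sqn M v)"
      unfolding w_def using L2_inner_add_left[OF kL L2_scale[OF v(1), of "- 1"] v(1)]
      by (simp add: L2_inner_scale_left[of M "- 1", simplified] L2_inner_self[OF v(1)])
    ultimately show ?thesis using arg_cong[OF L2_inner_commute[of M w v], of Re] by simp
  qed
  then show ?thesis by (rule that[OF u v])
qed

text \<open>A real affine function bounded below on the whole plane has no linear part. It turns a
  one-sided inequality along a subspace into an orthogonality relation.\<close>

lemma zero_if_real_part_bounded_below:
  assumes "\<And>s. C \<le> Re (b + s * w)"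
  shows "w = 0"
proof (rule ccontr)
  assume "w \<noteq> 0"
  then show False using assms[of "of_real (C - Re b - 1) / w"] by simp
qed

text \<open>Orthogonal projection for a subspace that need not be closed: \<open>u n\<close>
  approaches the projection of \<open>f\<close>, and \<open>r\<close> is the remainder. The last
  clause is the density criterion used later for \<open>\<phi>\<close> and the polynomials.\<close>

lemma L2_orthogonal_part:
  assumes fin: "finite_measure M" and f: "f \<in> L2 M" and V: "V \<subseteq> L2 M" "(\<lambda>x. 0) \<in> V"
    and lin: "\<And>h k c. h \<in> V \<Longrightarrow> k \<in> V \<Longrightarrow> (\<lambda>x. h x + c * k x) \<in> V"
  obtains u r where "\<forall>n. u n \<in> V" "r \<in> L2 M" "(\<lambda>n. sqn M (\<lambda>x. (f x - u n x) - r x)) \<longlonglongrightarrow> 0"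
    "\<forall>h\<in>V. L2_inner M h r = 0" "L2_inner M f r = of_real (sqn M r)"
    "sqn M r = 0 \<longrightarrow> (\<lambda>n. sqn M (\<lambda>x. u n x - f x)) \<longlonglongrightarrow> 0"
proof -
  define K where "K = (\<lambda>h x. f x - h x) ` V"
  have KL: "K \<subseteq> L2 M" unfolding K_def using V f by (auto intro: L2_diff)
  obtain k r where k: "\<And>n::nat. k n \<in> K" and r: "r \<in> L2 M" "(\<lambda>n. sqn M (\<lambda>x. k n x - r x)) \<longlonglongrightarrow> 0"
    and near: "\<And>k. k \<in> K \<Longrightarrow> sqn M r \<le> Re (L2_inner M k r)"
  proof (rule L2_nearest[OF fin KL])
    fix a b :: "'a \<Rightarrow> complex" and t :: real assume "a \<in> K" "b \<in> K"
    then obtain h l where h: "h \<in> V" "l \<in> V" "a = (\<lambda>x. f x - h x)" "b = (\<lambda>x. f x - l x)" by (auto simp: K_def)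
    have "(\<lambda>x. h x + of_real t * (l x + (- 1) * h x)) \<in> V" by (intro lin h)
    moreover have "(\<lambda>x. a x + of_real t * (b x - a x)) = (\<lambda>x. f x - (h x + of_real t * (l x + (- 1) * h x)))"
      unfolding h by (simp add: algebra_simps)
    ultimately show "(\<lambda>x. a x + of_real t * (b x - a x)) \<in> K"
      unfolding K_def by (intro image_eqI[where f = "\<lambda>h x. f x - h x"])
  qed (use V in \<open>auto simp: K_def\<close>)
  obtain u where u: "\<And>n. u n \<in> V" "\<And>n. k n = (\<lambda>x. f x - u n x)"
    using k unfolding K_def image_iff Bex_def by metis
  have orth: "L2_inner M h r = 0" if h: "h \<in> V" for h
  proof (rule zero_if_real_part_bounded_below)
    fix s
    have "(\<lambda>x. 0 + (- s) * h x) \<in> V" by (rule lin[OF V(2) h])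
    then have "(\<lambda>x. f x - (0 + (- s) * h x)) \<in> K" unfolding K_def by (rule imageI)
    from near[OF this] have "sqn M r \<le> Re (L2_inner M (\<lambda>x. f x + s * h x) r)" by simp
    also have "L2_inner M (\<lambda>x. f x + s * h x) r = L2_inner M f r + s * L2_inner M h r"
      unfolding L2_inner_scale_left[symmetric] using V h by (intro L2_inner_add_left f L2_scale r) auto
    finally show "sqn M r \<le> Re (L2_inner M f r + s * L2_inner M h r)" .
  qed
  have uL: "u n \<in> L2 M" for n using u V by blast
  have "(\<lambda>n. LINT x|M. k n x * cnj (r x)) \<longlonglongrightarrow> (LINT x|M. r x * cnj (r x))"
    by (rule tendsto_integral_mult[OF _ r(1) L2_cnj[OF r(1)] r(2)]) (use k KL in auto)
  moreover have "(LINT x|M. k n x * cnj (r x)) = L2_inner M f r" for n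
    using L2_inner_add_left[OF f L2_scale[OF uL, of "- 1"] r(1), of n] L2_inner_scale_left[of M "- 1" "u n" r] orth[OF u(1)[of n]]
    by (simp add: u(2) L2_inner_def)
  ultimately have "L2_inner M f r = of_real (sqn M r)"
    by (simp add: LIMSEQ_const_iff sqn_complex[OF r(1)])
  moreover have "sqn M r = 0 \<longrightarrow> (\<lambda>n. sqn M (\<lambda>x. u n x - f x)) \<longlonglongrightarrow> 0"
  proof
    assume r0: "sqn M r = 0"
    have "sqn M (\<lambda>x. (k n x - r x) + r x) \<le> 2 * sqn M (\<lambda>x. k n x - r x) + 2 * sqn M r" for n
      using k KL r by (intro sqn_add_le L2_diff) auto
    then have "norm (sqn M (\<lambda>x. u n x - f x)) \<le> 2 * sqn M (\<lambda>x. k n x - r x)" for n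
      using sqn_diff_commute[of M "u n" f] by (simp add: r0 sqn_nonneg u(2))
    then show "(\<lambda>n. sqn M (\<lambda>x. u n x - f x)) \<longlonglongrightarrow> 0"
      by (intro Lim_null_comparison[OF always_eventually tendsto_mult_right_zero[OF r(2)]]) blast
  qed
  ultimately show ?thesis using u(1) r(1) r(2)[unfolded u(2)] orth by (intro that[of u r] ballI allI)
qed

lemma (in prob_space) integral_sq_le_sqn:
  assumes "f \<in> L2 M"
  shows "(LINT x|M. cmod (f x))\<^sup>2 \<le> sqn M f"
  using integral_mult_sq_le[OF assms L2_bounded[of "\<lambda>_. 1" 1]] by (simp add: sqn_def prob_space)

lemma (in prob_space) sqn_le_1:
  assumes "f \<in> borel_measurable M" "\<And>x. cmod (f x) \<le> 1"
  shows "sqn M f \<le> 1"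
proof -
  have "sqn M f \<le> (LINT x|M. 1)" unfolding sqn_def
    by (intro integral_mono L2_integrable_sq L2_bounded[OF assms]) (auto simp: power_le_one assms(2))
  then show ?thesis by (simp add: prob_space)
qed

text \<open>Needed is a point of \<open>A \<inter> B\<close>, where \<open>A\<close> holds the
  functions with the prescribed integrals and \<open>B\<close> those bounded by 1. The point
  \<open>d\<close> nearest to 0 in the closure of \<open>A - B\<close> would separate the two sets.
  The separating inequality involves the L1 norm of \<open>d\<close>, the support function of
  \<open>B\<close>, and the distance hypothesis contradicts it unless \<open>d\<close> is null. A
  limit of almost common points is then a common point.\<close>

theorem annihilator_of_distance:
  assumes M: "prob_space M" and g: "g \<in> L2 M" and N: "N \<subseteq> L2 M"
    and N0: "(\<lambda>x. 0) \<in> N"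
    and N_lin: "\<And>h k c. h \<in> N \<Longrightarrow> k \<in> N \<Longrightarrow> (\<lambda>x. h x + c * k x) \<in> N"
    and dist: "\<And>h. h \<in> N \<Longrightarrow> 1 \<le> (LINT x|M. cmod (g x - h x))"
  obtains f where "f \<in> borel_measurable M" "\<And>x. cmod (f x) \<le> 1"
    "\<And>h. h \<in> N \<Longrightarrow> (LINT x|M. f x * h x) = 0" "(LINT x|M. f x * g x) = 1"
proof -
  interpret prob_space M by (rule M)
  note fin = finite_measure_axioms
  define A where "A = {a \<in> L2 M. (\<forall>h\<in>N. (LINT x|M. a x * h x) = 0) \<and> (LINT x|M. a x * g x) = 1}"
  define B where "B = {b \<in> borel_measurable M. \<forall>x. cmod (b x) \<le> 1}"
  have AL: "a \<in> L2 M" if "a \<in> A" for a using that by (simp add: A_def)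
  have BL: "b \<in> L2 M" if "b \<in> B" for b using that by (auto simp: B_def intro: L2_bounded)
  have Bsq: "sqn M b \<le> 1" if "b \<in> B" for b using that by (auto simp: B_def intro: sqn_le_1)
  have int: "(LINT x|M. (a x + c * b x) * h x) = (LINT x|M. a x * h x) + c * (LINT x|M. b x * h x)"
    if "a \<in> L2 M" "b \<in> L2 M" "h \<in> L2 M" for a b h c
    using that by (simp add: distrib_right mult.assoc L2_mult_integrable)
  have A_conv: "(\<lambda>x. a x + of_real t * (b x - a x)) \<in> A" if "a \<in> A" "b \<in> A" for a b t
  proof -
    have d: "(\<lambda>x. b x - a x) \<in> L2 M" using that by (intro L2_diff AL)
    have "(LINT x|M. (b x - a x) * h x) = (LINT x|M. b x * h x) - (LINT x|M. a x * h x)" if h: "h \<in> L2 M" for h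
      using \<open>a \<in> A\<close> \<open>b \<in> A\<close> h by (simp add: left_diff_distrib L2_mult_integrable AL)
    moreover have "h \<in> L2 M" if "h \<in> N" for h using that N by auto
    ultimately show ?thesis using that d g unfolding A_def by (simp add: int L2_add L2_scale)
  qed
  have B_conv: "(\<lambda>x. a x + of_real t * (b x - a x)) \<in> B" if "a \<in> B" "b \<in> B" "0 \<le> t" "t \<le> 1" for a b t
  proof -
    have "cmod (a x + of_real t * (b x - a x)) \<le> 1" for x
      using that convexD_alt[OF convex_cball[of 0 1], of "a x" "b x" t]
      by (simp add: B_def scaleR_conv_of_real algebra_simps)
    then show ?thesis using that by (auto simp: B_def)
  qed
  \<comment> \<open>\<open>A\<close> is nonempty: take the part \<open>r\<close> of \<open>g\<close>
    orthogonal to \<open>N\<close>, conjugated and normalised. It is nonzero because L2 norms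
    dominate L1 norms for a probability measure, so the L2 distance is at least 1 as well.\<close>
  obtain a0 where a0: "a0 \<in> A"
  proof -
    obtain u r where u: "\<forall>n. u n \<in> N" and r: "r \<in> L2 M" "(\<lambda>n. sqn M (\<lambda>x. (g x - u n x) - r x)) \<longlonglongrightarrow> 0"
      and orth: "\<forall>h\<in>N. L2_inner M h r = 0" "L2_inner M g r = of_real (sqn M r)"
        "sqn M r = 0 \<longrightarrow> (\<lambda>n. sqn M (\<lambda>x. u n x - g x)) \<longlonglongrightarrow> 0"
    proof (rule L2_orthogonal_part[OF fin g N N0])
      fix f k c assume "f \<in> N" "k \<in> N"
      then show "(\<lambda>x. f x + c * k x) \<in> N" by (rule N_lin)
    qed blast
    have uL: "(\<lambda>x. g x - u n x) \<in> L2 M" for n using u N g by (intro L2_diff) auto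
    have "1 \<le> sqn M (\<lambda>x. g x - u n x)" for n
      using order_trans[OF power_mono[OF dist[OF u[rule_format]], of 2] integral_sq_le_sqn[OF uL]] by simp
    then have "1 \<le> sqn M r"
      by (intro LIMSEQ_le_const[OF sqn_tendsto[OF uL r]]) auto
    then have "(\<lambda>x. of_real (1 / sqn M r) * cnj (r x)) \<in> A"
      using orth L2_scale[OF L2_cnj[OF r(1)], of "of_real (1 / sqn M r)"] unfolding A_def L2_inner_def
      by (auto simp: mult.assoc mult.commute[of _ "cnj _"])
    then show ?thesis by (rule that)
  qed
  define K where "K = {k. \<exists>a\<in>A. \<exists>b\<in>B. k = (\<lambda>x. a x - b x)}"
  have B0: "(\<lambda>x. 0) \<in> B" by (simp add: B_def)
  have KL: "K \<subseteq> L2 M" by (auto simp: K_def intro!: L2_diff dest: AL BL)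
  obtain u d where u: "\<And>n::nat. u n \<in> K" and d: "d \<in> L2 M" "(\<lambda>n. sqn M (\<lambda>x. u n x - d x)) \<longlonglongrightarrow> 0"
    and near: "\<And>k. k \<in> K \<Longrightarrow> sqn M d \<le> Re (L2_inner M k d)"
  proof (rule L2_nearest[OF fin KL])
    show "K \<noteq> {}" using a0 B0 by (auto simp: K_def)
    fix f k t assume fk: "f \<in> K" "k \<in> K" and t: "0 \<le> t" "t \<le> (1::real)"
    obtain a b c e where "a \<in> A" "b \<in> B" "f = (\<lambda>x. a x - b x)" "c \<in> A" "e \<in> B" "k = (\<lambda>x. c x - e x)"
      using fk unfolding K_def by blast
    moreover from this have "(\<lambda>x. f x + of_real t * (k x - f x)) =
      (\<lambda>x. (a x + of_real t * (c x - a x)) - (b x + of_real t * (e x - b x)))"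
      by (simp add: algebra_simps)
    ultimately show "(\<lambda>x. f x + of_real t * (k x - f x)) \<in> K"
      using A_conv[of a c t] B_conv[of b e t] t unfolding K_def mem_Collect_eq
      by (intro bexI[of _ "\<lambda>x. a x + of_real t * (c x - a x)"] bexI[of _ "\<lambda>x. b x + of_real t * (e x - b x)"]) simp_all
  qed blast
  have dm [measurable]: "d \<in> borel_measurable M" by (rule L2_measurable[OF d(1)])
  \<comment> \<open>The choice \<open>b = sgn d\<close> makes the pairing of \<open>b\<close> with
    \<open>d\<close> equal to the L1 norm of \<open>d\<close>.\<close>
  have bound: "(LINT x|M. cmod (d x)) + sqn M d \<le> Re (LINT x|M. a x * cnj (d x))" if a: "a \<in> A" for a
  proof -
    have sB: "(\<lambda>x. sgn (d x)) \<in> B" by (auto simp: B_def norm_sgn)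
    then have "(\<lambda>x. a x - sgn (d x)) \<in> K" using a by (auto simp: K_def)
    from near[OF this] have "sqn M d \<le> Re ((LINT x|M. a x * cnj (d x)) - (LINT x|M. sgn (d x) * cnj (d x)))"
      unfolding L2_inner_def left_diff_distrib
      using L2_mult_integrable[OF AL[OF a] L2_cnj[OF d(1)]] L2_mult_integrable[OF BL[OF sB] L2_cnj[OF d(1)]] by simp
    moreover have "sgn z * cnj z = of_real (cmod z)" for z
      by (simp add: sgn_eq complex_norm_square[symmetric] power2_eq_square)
    ultimately show ?thesis by simp
  qed
  define V where "V = {v. \<exists>h\<in>N. \<exists>t. v = (\<lambda>x. h x + t * g x)}"
  obtain v r where v: "\<forall>n. v n \<in> V" and r: "r \<in> L2 M" "(\<lambda>n. sqn M (\<lambda>x. (cnj (d x) - v n x) - r x)) \<longlonglongrightarrow> 0"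
    and orth: "\<forall>h\<in>V. L2_inner M h r = 0" "L2_inner M (\<lambda>x. cnj (d x)) r = of_real (sqn M r)"
      "sqn M r = 0 \<longrightarrow> (\<lambda>n. sqn M (\<lambda>x. v n x - cnj (d x))) \<longlonglongrightarrow> 0"
  proof (rule L2_orthogonal_part[OF fin L2_cnj[OF d(1)]])
    show "V \<subseteq> L2 M" using N g by (auto simp: V_def intro!: L2_add L2_scale)
    show "(\<lambda>x. 0) \<in> V" using N0 by (auto simp: V_def intro!: bexI[of _ "\<lambda>x. 0"] exI[of _ 0])
    fix f k c assume "f \<in> V" "k \<in> V"
    then obtain h l s t where *: "h \<in> N" "l \<in> N" "f = (\<lambda>x. h x + s * g x)" "k = (\<lambda>x. l x + t * g x)"
      unfolding V_def by blast
    have "(\<lambda>x. f x + c * k x) = (\<lambda>x. (h x + c * l x) + (s + c * t) * g x)" unfolding * by (simp add: algebra_simps)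
    then show "(\<lambda>x. f x + c * k x) \<in> V" using N_lin[OF *(1,2), of c]
      unfolding V_def mem_Collect_eq by (intro bexI[of _ "\<lambda>x. h x + c * l x"] exI[of _ "s + c * t"])
  qed blast
  \<comment> \<open>\<open>A\<close> is stable under adding multiples of \<open>cnj r\<close>, while
    the separating inequality bounds a real part from below on \<open>A\<close>. Hence
    \<open>r\<close> is null and \<open>cnj d\<close> is a limit of elements of
    \<open>V\<close>.\<close>
  have "L2_inner M (\<lambda>x. cnj (d x)) r = 0"
  proof (rule zero_if_real_part_bounded_below)
    fix s
    have "h \<in> V" if "h \<in> N" for h using that by (auto simp: V_def intro!: bexI[of _ h] exI[of _ 0])
    moreover have "g \<in> V" using N0 by (auto simp: V_def intro!: bexI[of _ "\<lambda>x. 0"] exI[of _ 1])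
    ultimately have "(LINT x|M. cnj (r x) * h x) = 0" if "h \<in> N \<or> h = g" for h
      using orth(1) that by (auto simp: L2_inner_def mult.commute)
    then have "(\<lambda>x. a0 x + s * cnj (r x)) \<in> A"
      using a0 r(1) N g unfolding A_def by (auto simp: int L2_cnj L2_add L2_scale subset_iff)
    from bound[OF this] show "(LINT x|M. cmod (d x)) + sqn M d \<le>
        Re ((LINT x|M. a0 x * cnj (d x)) + s * L2_inner M (\<lambda>x. cnj (d x)) r)"
      using AL[OF a0] d(1) r(1) by (simp add: int L2_cnj L2_inner_def mult.commute[of "cnj (r _)"] del: times_complex.sel)
  qed
  then have vd: "(\<lambda>n. sqn M (\<lambda>x. v n x - cnj (d x))) \<longlonglongrightarrow> 0" using orth(2,3) by simp
  have vL: "v n \<in> L2 M" for n using v[rule_format, of n] N g by (auto simp: V_def intro!: L2_add L2_scale)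
  have "Re (LINT x|M. v n x * a0 x) \<le> (LINT x|M. cmod (d x)) + sqrt (sqn M (\<lambda>x. v n x - cnj (d x)))" for n
  proof -
    obtain h t where h: "h \<in> N" "v n = (\<lambda>x. h x + t * g x)" using v[rule_format, of n] unfolding V_def by blast
    have t: "(LINT x|M. v n x * a0 x) = t"
      using a0 h N g unfolding A_def h(2) by (auto simp: int subset_iff mult.commute[of _ "a0 _"] distrib_left mult.left_commute L2_mult_integrable)
    \<comment> \<open>The distance hypothesis, rescaled by \<open>t\<close>, bounds the functional
      \<open>h + t g \<mapsto> t\<close> by the L1 norm.\<close>
    have "cmod t \<le> (LINT x|M. cmod (v n x))"
    proof (cases "t = 0")
      case False
      have "1 \<le> (LINT x|M. cmod (g x - (0 + (- 1 / t) * h x)))" by (intro dist N_lin N0 h)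
      also have "\<dots> = (LINT x|M. cmod (v n x) / cmod t)"
        unfolding h(2) norm_divide[symmetric] using False by (simp add: field_simps)
      finally show ?thesis using False by (simp add: field_simps)
    qed simp
    moreover have "(LINT x|M. cmod (v n x)) \<le> (LINT x|M. cmod (d x) + cmod (v n x - cnj (d x)))"
    proof (intro integral_mono integrable_norm Bochner_Integration.integrable_add L2_integrable L2_diff L2_cnj d vL)
      show "cmod (v n x) \<le> cmod (d x) + cmod (v n x - cnj (d x))" for x
        using norm_triangle_sub[of "v n x" "cnj (d x)"] by simp
    qed
    moreover have "(LINT x|M. cmod (d x) + cmod (v n x - cnj (d x))) =
      (LINT x|M. cmod (d x)) + (LINT x|M. cmod (v n x - cnj (d x)))"
      by (intro Bochner_Integration.integral_add integrable_norm L2_integrable L2_diff L2_cnj d vL)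
    moreover have "(LINT x|M. cmod (v n x - cnj (d x))) \<le> sqrt (sqn M (\<lambda>x. v n x - cnj (d x)))"
      by (intro real_le_rsqrt integral_sq_le_sqn L2_diff L2_cnj d vL)
    ultimately show ?thesis unfolding t using complex_Re_le_cmod[of t] by linarith
  qed
  moreover have "(\<lambda>n. (LINT x|M. cmod (d x)) + sqrt (sqn M (\<lambda>x. v n x - cnj (d x)))) \<longlonglongrightarrow> (LINT x|M. cmod (d x)) + sqrt 0"
    by (intro tendsto_intros vd)
  moreover have "(\<lambda>n. Re (LINT x|M. v n x * a0 x)) \<longlonglongrightarrow> Re (LINT x|M. cnj (d x) * a0 x)"
    by (intro tendsto_Re tendsto_integral_mult[OF vL L2_cnj[OF d(1)] AL[OF a0] vd])
  ultimately have "Re (LINT x|M. cnj (d x) * a0 x) \<le> (LINT x|M. cmod (d x)) + sqrt 0"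
    using LIMSEQ_le by blast
  then have "sqn M d = 0" using bound[OF a0] sqn_nonneg[of M d] by (simp add: mult.commute)
  then have u0: "(\<lambda>n. sqn M (u n)) \<longlonglongrightarrow> 0"
    using sqn_tendsto[OF _ d] u KL by auto
  \<comment> \<open>That \<open>A - B\<close> comes close to 0 gives no convergence of the separate
    parts, so a limit is selected by minimal norm inside the decreasing sets
    \<open>C n\<close>.\<close>
  define C where "C n = {b\<in>B. \<exists>a\<in>A. sqn M (\<lambda>x. a x - b x) \<le> inverse (real (Suc n))}" for n
  obtain b w where b: "\<And>n. b n \<in> C n" and w: "w \<in> L2 M" "(\<lambda>n. sqn M (\<lambda>x. b n x - w x)) \<longlonglongrightarrow> 0"
  proof (rule nested_convex_L2[OF fin, of C 1])
    show "C n \<subseteq> L2 M" for n by (auto simp: C_def BL)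
    show "\<exists>b\<in>C n. sqn M b \<le> 1" for n
    proof -
      have "\<forall>\<^sub>F m in sequentially. sqn M (u m) < inverse (real (Suc n))" by (rule order_tendstoD(2)[OF u0]) simp
      then obtain m where m: "sqn M (u m) < inverse (real (Suc n))" by (auto simp: eventually_sequentially)
      obtain a b where "a \<in> A" "b \<in> B" "u m = (\<lambda>x. a x - b x)" using u[of m] unfolding K_def by blast
      then have "b \<in> C n" "sqn M b \<le> 1" using m Bsq unfolding C_def by (auto intro: less_imp_le)
      then show ?thesis by blast
    qed
    show "C (Suc n) \<subseteq> C n" for n
    proof -
      have "inverse (real (Suc (Suc n))) \<le> inverse (real (Suc n))" by simp
      then show ?thesis unfolding C_def by (blast intro: order_trans)
    qed
    show "(\<lambda>x. (f x + k x) / 2) \<in> C n" if fk: "f \<in> C n" "k \<in> C n" for n f k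
    proof -
      obtain a c where *: "f \<in> B" "a \<in> A" "sqn M (\<lambda>x. a x - f x) \<le> inverse (real (Suc n))"
        "k \<in> B" "c \<in> A" "sqn M (\<lambda>x. c x - k x) \<le> inverse (real (Suc n))"
        using fk unfolding C_def by blast
      define m where "m p q x = p x + of_real (1 / 2) * (q x - p x)" for p q :: "'a \<Rightarrow> complex" and x
      have "m a c \<in> A" "m f k \<in> B" unfolding m_def by (intro A_conv B_conv *; simp)+
      moreover have "sqn M (\<lambda>x. m a c x - m f k x) \<le> inverse (real (Suc n))"
      proof -
        have "m a c x - m f k x = 1/2 * ((a x - f x) + (c x - k x))" for x
          by (simp add: m_def field_simps)
        then have "sqn M (\<lambda>x. m a c x - m f k x) = (cmod (1/2))\<^sup>2 * sqn M (\<lambda>x. (a x - f x) + (c x - k x))"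
          by (simp only: sqn_scale)
        also have "sqn M (\<lambda>x. (a x - f x) + (c x - k x)) \<le> 2 * sqn M (\<lambda>x. a x - f x) + 2 * sqn M (\<lambda>x. c x - k x)"
          by (intro sqn_add_le L2_diff AL BL *)
        finally show ?thesis using *(3,6) by (simp add: power2_eq_square)
      qed
      moreover have "m f k = (\<lambda>x. (f x + k x) / 2)" by (simp add: m_def fun_eq_iff field_simps)
      ultimately show ?thesis unfolding C_def by auto
    qed
  qed blast
  have bB: "b n \<in> B" for n using b by (simp add: C_def)
  obtain a where a: "\<And>n. a n \<in> A" "\<And>n. sqn M (\<lambda>x. a n x - b n x) \<le> inverse (real (Suc n))"
    using b unfolding C_def by simp metis
  have lim: "(\<lambda>n. 2 * inverse (real (Suc n)) + 2 * sqn M (\<lambda>x. b n x - w x)) \<longlonglongrightarrow> 2 * 0 + 2 * 0"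
    by (intro tendsto_intros LIMSEQ_inverse_real_of_nat w)
  have aw: "(\<lambda>n. sqn M (\<lambda>x. a n x - w x)) \<longlonglongrightarrow> 0"
  proof (rule Lim_null_comparison[OF always_eventually])
    show "(\<lambda>n. 2 * inverse (real (Suc n)) + 2 * sqn M (\<lambda>x. b n x - w x)) \<longlonglongrightarrow> 0" using lim by simp
    show "\<forall>n. norm (sqn M (\<lambda>x. a n x - w x)) \<le> 2 * inverse (real (Suc n)) + 2 * sqn M (\<lambda>x. b n x - w x)"
    proof
      fix n
      have "sqn M (\<lambda>x. a n x - w x) \<le> 2 * sqn M (\<lambda>x. a n x - b n x) + 2 * sqn M (\<lambda>x. b n x - w x)"
        by (intro sqn_diff_triangle AL a BL bB w)
      then show "norm (sqn M (\<lambda>x. a n x - w x)) \<le> 2 * inverse (real (Suc n)) + 2 * sqn M (\<lambda>x. b n x - w x)"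
        using a(2)[of n] by (simp add: sqn_nonneg)
    qed
  qed
  have "(LINT x|M. w x * h x) = s" if "h \<in> L2 M" "\<And>a. a \<in> A \<Longrightarrow> (LINT x|M. a x * h x) = s" for h s
    using tendsto_integral_mult[OF AL[OF a(1)] w(1) that(1) aw] that(2)[OF a(1)] by (simp add: LIMSEQ_const_iff)
  then have wA: "w \<in> A" using w(1) N g unfolding A_def by (simp add: subset_iff)
  \<comment> \<open>The excess of \<open>cmod (w x)\<close> over 1 is at most the distance from
    \<open>w x\<close> to any point of the unit disc, so its L2 norm is 0 in the limit.\<close>
  define ex where "ex x = max 0 (cmod (w x) - 1)" for x
  have wm [measurable]: "w \<in> borel_measurable M" by (rule L2_measurable[OF w(1)])
  have ex_meas [measurable]: "ex \<in> borel_measurable M" unfolding ex_def by measurable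
  have ex_bound: "0 \<le> ex x" "cmod z \<le> 1 \<Longrightarrow> ex x \<le> cmod (z - w x)" for x z
    using norm_triangle_ineq2[of "w x" z] by (auto simp: ex_def norm_minus_commute)
  have ex_int: "integrable M (\<lambda>x. (ex x)\<^sup>2)"
  proof (rule Bochner_Integration.integrable_bound[OF L2_integrable_sq[OF w(1)]])
    show "AE x in M. norm ((ex x)\<^sup>2) \<le> norm ((cmod (w x))\<^sup>2)"
      using ex_bound(1) ex_bound(2)[of 0] by (intro AE_I2) (simp add: power_mono)
  qed measurable
  have "(LINT x|M. (ex x)\<^sup>2) \<le> sqn M (\<lambda>x. b n x - w x)" for n
    unfolding sqn_def using bB[of n]
    by (intro integral_mono ex_int L2_integrable_sq L2_diff w BL bB power_mono ex_bound) (auto simp: B_def)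
  then have "(LINT x|M. (ex x)\<^sup>2) \<le> 0"
    by (intro LIMSEQ_le_const[OF w(2)]) auto
  then have "(LINT x|M. (ex x)\<^sup>2) = 0" using ex_bound(1) by (intro antisym integral_nonneg) auto
  then have "AE x in M. (ex x)\<^sup>2 = 0"
    by (subst (asm) integral_nonneg_eq_0_iff_AE[OF ex_int]) auto
  then have w_le: "AE x in M. cmod (w x) \<le> 1" by eventually_elim (auto simp: ex_def max_def split: if_splits)
  \<comment> \<open>A change on a null set makes the bound hold everywhere.\<close>
  define f where "f x = (if cmod (w x) \<le> 1 then w x else 0)" for x
  have f_meas [measurable]: "f \<in> borel_measurable M" unfolding f_def by measurable
  have f_int: "(LINT x|M. f x * h x) = (LINT x|M. w x * h x)" if "h \<in> L2 M" for h
    using L2_measurable[OF that] w_le by (intro integral_cong_AE) (auto simp: f_def elim: eventually_mono)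
  show thesis
  proof (rule that[OF f_meas])
    show "cmod (f x) \<le> 1" for x by (simp add: f_def)
  qed (use f_int wA N g in \<open>auto simp: A_def subset_iff\<close>)
qed

section \<open>A maximal inequality for the Poisson kernel\<close>

text \<open>The Poisson kernel at radius \<open>r\<close>, with the angle \<open>s\<close> counted
  in full turns: the circle is an interval of length 1 and no factor \<open>2 * pi\<close> occurs in
  the integrals.\<close>

definition poisson :: "real \<Rightarrow> real \<Rightarrow> real" where
  "poisson r s = (1 - r\<^sup>2) / (cmod (1 - of_real r * cis (2 * pi * s)))\<^sup>2"

lemma cis_period [simp]: "cis (2 * pi * (s + 1)) = cis (2 * pi * s)"
  by (simp add: distrib_left cis_mult[symmetric])

text \<open>This form of the denominator gives both bounds: its first term alone yields
  \<open>poisson_le_const\<close>, the sine term yields the quadratic decay.\<close>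

lemma poisson_denom: "(cmod (1 - of_real r * cis (2 * pi * s)))\<^sup>2 = (1 - r)\<^sup>2 + 4 * r * (sin (pi * s))\<^sup>2"
proof -
  have c: "cos (2 * pi * s) = 1 - 2 * (sin (pi * s))\<^sup>2"
    using cos_double_sin[of "pi * s"] by (simp add: mult.assoc)
  have alg: "(1 - r * c)\<^sup>2 + (r * d)\<^sup>2 = 1 - 2 * r * c + r\<^sup>2 * (d\<^sup>2 + c\<^sup>2)" for c d :: real
    by (simp add: power2_eq_square algebra_simps)
  have "(cmod (1 - of_real r * cis (2 * pi * s)))\<^sup>2 = (1 - r * cos (2 * pi * s))\<^sup>2 + (r * sin (2 * pi * s))\<^sup>2"
    by (simp add: cmod_power2)
  also have "\<dots> = 1 - 2 * r * cos (2 * pi * s) + r\<^sup>2 * ((sin (2 * pi * s))\<^sup>2 + (cos (2 * pi * s))\<^sup>2)"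
    by (rule alg)
  also have "\<dots> = 1 - 2 * r * cos (2 * pi * s) + r\<^sup>2"
    by (simp only: sin_cos_squared_add mult_1_right)
  also have "\<dots> = (1 - r)\<^sup>2 + 4 * r * (sin (pi * s))\<^sup>2"
    unfolding c by (simp add: power2_eq_square algebra_simps)
  finally show ?thesis .
qed

context
  fixes r :: real assumes r: "0 \<le> r" "r < 1"
begin

lemma poisson_denom_pos: "0 < (cmod (1 - of_real r * cis (2 * pi * s)))\<^sup>2"
  unfolding poisson_denom using r by (simp add: add_pos_nonneg)

lemma poisson_nonneg: "0 \<le> poisson r s"
  using r poisson_denom_pos[of s] by (simp add: poisson_def abs_square_le_1)

lemma continuous_on_poisson: "continuous_on A (poisson r)"
  unfolding poisson_def using poisson_denom_pos
  by (intro continuous_intros continuous_on_cis) (auto simp: less_imp_neq[THEN not_sym])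

lemma poisson_le_const: "poisson r s \<le> 2 / (1 - r)"
proof -
  have "poisson r s \<le> (1 - r\<^sup>2) / (1 - r)\<^sup>2"
    unfolding poisson_def poisson_denom using r
    by (intro divide_left_mono) (auto simp: abs_square_le_1 intro!: mult_pos_pos add_pos_nonneg)
  also have "\<dots> = (1 + r) / (1 - r)" 
  proof -
    have "1 - r\<^sup>2 = (1 + r) * (1 - r)" by (simp add: power2_eq_square algebra_simps)
    then show ?thesis using r by (simp add: power2_eq_square)
  qed
  also have "\<dots> \<le> 2 / (1 - r)" using r by (intro divide_right_mono) auto
  finally show ?thesis .
qed

text \<open>Jordan's inequality, from concavity of the sine on \<open>{0..pi}\<close>: the chord
  from 0 to \<open>pi / 2\<close> lies below the graph.\<close>

lemma abs_sin_pi_ge: "2 * \<bar>s\<bar> \<le> \<bar>sin (pi * s)\<bar>" if "\<bar>s\<bar> \<le> 1 / 2" for s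
proof -
  have *: "2 * t \<le> sin (pi * t)" if t: "0 \<le> t" "t \<le> 1 / 2" for t
  proof -
    have "convex_on {0..pi} (\<lambda>x. - sin x)"
      by (rule f''_ge0_imp_convex[where f' = "\<lambda>x. - cos x" and f'' = sin])
        (auto intro!: derivative_eq_intros sin_ge_zero)
    then have "- sin ((1 - 2 * t) *\<^sub>R 0 + (2 * t) *\<^sub>R (pi / 2)) \<le> (1 - 2 * t) * (- sin 0) + 2 * t * (- sin (pi / 2))"
      using t by (intro convex_onD[of "{0..pi}"]) auto
    then show ?thesis by (simp add: mult.commute)
  qed
  show ?thesis using *[of s] *[of "-s"] that by (cases "0 \<le> s") auto
qed

text \<open>The sine term loses its weight for small \<open>r\<close>, so \<open>r < 1/2\<close> is
  treated by the constant bound 4, which suffices as \<open>\<bar>s\<bar> \<le> 1/2\<close>.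
  Otherwise Jordan's inequality bounds the denominator below by
  \<open>8 * s\<^sup>2\<close>.\<close>

lemma poisson_le_decay: "poisson r s \<le> 2 * (1 - r) / s\<^sup>2" if s: "\<bar>s\<bar> \<le> 1 / 2" "s \<noteq> 0"
proof (cases "r < 1 / 2")
  case True
  have "s\<^sup>2 \<le> (1/2)\<^sup>2" using s(1) by (metis abs_ge_zero power2_abs power_mono)
  then have s2: "s\<^sup>2 \<le> 1/4" by (simp add: power2_eq_square)
  have "poisson r s \<le> 2 / (1 - r)" by (rule poisson_le_const)
  also have "2 / (1 - r) \<le> 4" using True r by (simp add: field_simps)
  also have "4 \<le> 2 * (1 - r) / s\<^sup>2" using True s s2 by (simp add: field_simps)
  finally show ?thesis .
next
  case False
  have "(2 * \<bar>s\<bar>)\<^sup>2 \<le> \<bar>sin (pi * s)\<bar>\<^sup>2" by (rule power_mono[OF abs_sin_pi_ge[OF s(1)]]) simp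
  then have sn: "4 * s\<^sup>2 \<le> (sin (pi * s))\<^sup>2" by (simp add: power_mult_distrib)
  have "2 * (4 * s\<^sup>2) \<le> 4 * r * (sin (pi * s))\<^sup>2" using False sn by (intro mult_mono) auto
  then have "8 * s\<^sup>2 \<le> (1 - r)\<^sup>2 + 4 * r * (sin (pi * s))\<^sup>2" by (simp add: add_increasing)
  then have "poisson r s \<le> (1 - r\<^sup>2) / (8 * s\<^sup>2)"
    unfolding poisson_def poisson_denom using r s
    by (intro divide_left_mono mult_pos_pos) (auto simp: abs_square_le_1 intro: order_less_le_trans[of _ "8 * s\<^sup>2"])
  also have "1 - r\<^sup>2 = (1 - r) * (1 + r)" by (simp add: power2_eq_square algebra_simps)
  \<comment> \<open>The factor \<open>1 + r\<close> is at most 2; the generous 16 merely produces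
    the constant of the statement.\<close>
  also have "(1 - r) * (1 + r) / (8 * s\<^sup>2) \<le> (1 - r) * 16 / (8 * s\<^sup>2)"
    using r by (intro divide_right_mono mult_left_mono) auto
  also have "(1 - r) * 16 / (8 * s\<^sup>2) = 2 * (1 - r) / s\<^sup>2" using s by (simp add: field_simps)
  finally show ?thesis .
qed

text \<open>Cauchy's formula for \<open>h u = f u * (1 - r\<^sup>2) / (1 - r * u)\<close>. This
  function is holomorphic on the closed disc and agrees with \<open>f\<close> at \<open>r\<close>;
  on the unit circle the extra factor turns the Cauchy kernel into the Poisson kernel.\<close>

lemma poisson_formula:
  assumes f: "f holomorphic_on cball 0 1"
  shows "f (of_real r) = (LBINT s:{0..1}. f (cis (2 * pi * s)) * of_real (poisson r s))"
    "set_integrable lborel {0..1} (\<lambda>s. f (cis (2 * pi * s)) * of_real (poisson r s))"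
proof -
  define h where "h u = f u * of_real (1 - r\<^sup>2) / (1 - of_real r * u)" for u
  have nz: "1 - of_real r * u \<noteq> 0" if "cmod u \<le> 1" for u
  proof
    assume "1 - of_real r * u = 0"
    then have "cmod (of_real r * u) = 1" by simp
    moreover have "cmod (of_real r * u) \<le> r * 1" unfolding norm_mult using that r by (intro mult_mono) auto
    ultimately show False using r by simp
  qed
  have "h holomorphic_on cball 0 1"
    unfolding h_def using nz by (intro holomorphic_intros f) auto
  then have ci: "((\<lambda>u. h u / (u - of_real r)) has_contour_integral (2 * of_real pi * \<i> * h (of_real r))) (circlepath 0 1)"
    using r by (intro Cauchy_integral_circlepath_simple) auto
  have hr: "h (of_real r) = f (of_real r)"
  proof -
    have "1 - of_real r * of_real r = (of_real (1 - r\<^sup>2) :: complex)" by (simp add: power2_eq_square)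
    moreover have "(of_real (1 - r\<^sup>2) :: complex) \<noteq> 0" using r by (simp add: power2_eq_1_iff del: of_real_diff)
    ultimately show ?thesis unfolding h_def by simp
  qed
  have cont: "continuous_on {0..1} (\<lambda>s. f (cis (2 * pi * s)) * of_real (poisson r s))"
    by (intro continuous_intros continuous_on_poisson
        continuous_on_compose2[OF holomorphic_on_imp_continuous_on[OF f]] continuous_on_cis) auto
  have eq: "h (circlepath 0 1 s) / (circlepath 0 1 s - of_real r) * vector_derivative (circlepath 0 1) (at s)
      = 2 * of_real pi * \<i> * (f (cis (2 * pi * s)) * of_real (poisson r s))" if "s \<in> {0..1}" for s
  proof -
    define z where "z = cis (2 * pi * s)"
    have z: "circlepath 0 1 s = z" unfolding circlepath_def part_circlepath_def z_def cis_conv_exp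
      by (simp add: linepath_def mult_ac)
    have vd: "vector_derivative (circlepath 0 1) (at s) = 2 * pi * \<i> * z"
      using that z_def by (subst vector_derivative_circlepath) (auto simp: cis_conv_exp mult_ac)
    have zz: "cmod z = 1" "z \<noteq> 0" by (auto simp: z_def)
    have zc: "z * cnj z = 1" using complex_norm_square[of z] zz by simp
    have d: "(z - of_real r) * (1 - of_real r * z) = z * of_real ((cmod (1 - of_real r * z))\<^sup>2)"
    proof -
      have "z * ((1 - of_real r * z) * cnj (1 - of_real r * z)) = (1 - of_real r * z) * (z - of_real r * (z * cnj z))"
        by (simp add: algebra_simps)
      also have "\<dots> = (z - of_real r) * (1 - of_real r * z)" unfolding zc by simp
      finally show ?thesis unfolding complex_norm_square by (rule sym)
    qed
    have p0: "of_real ((cmod (1 - of_real r * z))\<^sup>2) \<noteq> (0::complex)"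
      using poisson_denom_pos[of s] unfolding z_def by simp
    have "h z / (z - of_real r) * (2 * pi * \<i> * z) =
        2 * pi * \<i> * f z * of_real (1 - r\<^sup>2) * z / ((z - of_real r) * (1 - of_real r * z))"
      unfolding h_def by (simp add: mult_ac)
    also have "\<dots> = 2 * pi * \<i> * f z * of_real (1 - r\<^sup>2) / of_real ((cmod (1 - of_real r * z))\<^sup>2)"
      unfolding d using zz p0 by simp
    also have "\<dots> = 2 * of_real pi * \<i> * (f z * of_real (poisson r s))"
      unfolding poisson_def z_def by simp
    finally show ?thesis unfolding z vd z_def by simp
  qed
  have "((\<lambda>s. 2 * of_real pi * \<i> * (f (cis (2 * pi * s)) * of_real (poisson r s))) has_integral (2 * of_real pi * \<i> * f (of_real r))) {0..1}"
    using ci unfolding has_contour_integral hr by (rule has_integral_eq[rotated]) (rule eq)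
  then have hi: "((\<lambda>s. f (cis (2 * pi * s)) * of_real (poisson r s)) has_integral f (of_real r)) {0..1}"
  proof -
    define k where "k = 2 * complex_of_real pi * \<i>"
    have k: "k \<noteq> 0" by (simp add: k_def)
    assume "((\<lambda>s. 2 * of_real pi * \<i> * (f (cis (2 * pi * s)) * of_real (poisson r s))) has_integral (2 * of_real pi * \<i> * f (of_real r))) {0..1}"
    from has_integral_mult_right[OF this[folded k_def], of "inverse k"] show ?thesis
      using k by (simp add: mult.assoc[symmetric])
  qed
  show int: "set_integrable lborel {0..1} (\<lambda>s. f (cis (2 * pi * s)) * of_real (poisson r s))"
    by (rule borel_integrable_atLeastAtMost'[OF cont])
  show "f (of_real r) = (LBINT s:{0..1}. f (cis (2 * pi * s)) * of_real (poisson r s))"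
    using set_borel_integral_eq_integral(2)[OF int] integral_unique[OF hi] by simp
qed

text \<open>Only the window with the least \<open>k\<close> containing \<open>s\<close> is used;
  outside the previous window the quadratic decay gives \<open>2 / (4^(k-1) * (1 - r))\<close>,
  whence the 8. At index \<open>K\<close> the windows exhaust the period.\<close>

lemma poisson_dyadic:
  assumes s: "\<bar>s\<bar> \<le> 1/2" and K: "1/2 \<le> 2^K * (1 - r)"
  shows "poisson r s \<le> (\<Sum>k\<le>K. 8 * (1/4)^k / (1 - r) * indicator {t. \<bar>t\<bar> \<le> min (2^k * (1 - r)) (1/2)} s)"
proof -
  define k where "k = (LEAST k. \<bar>s\<bar> \<le> 2^k * (1 - r))"
  have ex: "\<bar>s\<bar> \<le> 2^K * (1 - r)" using s K by linarith
  have kK: "k \<le> K" unfolding k_def by (rule Least_le[where P = "\<lambda>k. \<bar>s\<bar> \<le> 2^k * (1 - r)", OF ex])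
  have k: "\<bar>s\<bar> \<le> 2^k * (1 - r)" unfolding k_def by (rule LeastI[where P = "\<lambda>k. \<bar>s\<bar> \<le> 2^k * (1 - r)", OF ex])
  have a: "0 < 1 - r" using r by simp
  have "poisson r s \<le> 8 * (1/4)^k / (1 - r)"
  proof (cases k)
    case 0
    have "2 / (1 - r) \<le> 8 / (1 - r)" using a by (intro divide_right_mono) auto
    then show ?thesis using poisson_le_const[of s] 0 by simp
  next
    case (Suc j)
    then have "\<not> \<bar>s\<bar> \<le> 2^j * (1 - r)" using not_less_Least[of j "\<lambda>k. \<bar>s\<bar> \<le> 2^k * (1 - r)"] k_def by auto
    then have j: "2^j * (1 - r) < \<bar>s\<bar>" by simp
    then have "(2^j * (1 - r))\<^sup>2 \<le> \<bar>s\<bar>\<^sup>2" using a by (intro power_mono) auto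
    moreover have "((2::real)^j)\<^sup>2 = 4^j" by (simp add: power2_eq_square flip: power_mult_distrib)
    ultimately have s2: "4^j * (1 - r)\<^sup>2 \<le> s\<^sup>2" by (simp only: power_mult_distrib power2_abs)
    have s0: "s \<noteq> 0" using j a by (metis abs_zero less_eq_real_def mult_pos_pos not_less zero_less_numeral zero_less_power)
    have "poisson r s \<le> 2 * (1 - r) / s\<^sup>2" by (rule poisson_le_decay[OF s s0])
    also have "\<dots> \<le> 2 * (1 - r) / (4^j * (1 - r)\<^sup>2)"
      using s2 a s0 by (intro divide_left_mono) auto
    also have "\<dots> = 8 * (1/4)^k / (1 - r)"
    proof -
      have "2 * b / (4^j * b\<^sup>2) = 8 * (1/4)^Suc j / b" if "0 < b" for b :: real
        using that by (simp add: power2_eq_square power_one_over field_simps)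
      from this[OF a] show ?thesis unfolding Suc .
    qed
    finally show ?thesis .
  qed
  also have "\<dots> = 8 * (1/4)^k / (1 - r) * indicator {t. \<bar>t\<bar> \<le> min (2^k * (1 - r)) (1/2)} s"
    using k s by simp
  also have "\<dots> \<le> (\<Sum>k\<le>K. 8 * (1/4)^k / (1 - r) * indicator {t. \<bar>t\<bar> \<le> min (2^k * (1 - r)) (1/2)} s)"
    using kK a by (intro member_le_sum) auto
  finally show ?thesis .
qed

text \<open>Window \<open>k\<close> contributes \<open>8 * (1/4)^k / (1 - r)\<close> times at most
  \<open>2 * 2^k * (1 - r) * l\<close>, that is \<open>16 * l * (1/2)^k\<close>; the geometric
  series doubles 16 to 32.\<close>

lemma poisson_average_le:
  assumes v: "continuous_on UNIV v" "\<And>s. 0 \<le> v s" and l: "0 \<le> l"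
    and avg: "\<And>d. 0 < d \<Longrightarrow> d \<le> 1/2 \<Longrightarrow> (LBINT s:{-d..d}. v s) \<le> 2 * d * l"
  shows "(LBINT s:{-1/2..1/2}. v s * poisson r s) \<le> 32 * l"
proof -
  have a: "0 < 1 - r" using r by simp
  obtain K :: nat where "1 / 2 / (1 - r) < 2^K" using real_arch_pow[of 2 "1 / 2 / (1 - r)"] by auto
  then have K: "1/2 \<le> 2^K * (1 - r)" using a by (simp add: field_simps)
  define d where "d k = min (2^k * (1 - r)) (1/2)" for k :: nat
  have d: "0 < d k" "d k \<le> 1/2" "d k \<le> 2^k * (1 - r)" for k using a by (auto simp: d_def)
  have vint: "set_integrable lborel {x..y} v" for x y
    by (rule borel_integrable_atLeastAtMost'[OF continuous_on_subset[OF v(1)]]) simp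
  have int1: "set_integrable lborel {-1/2..1/2} (\<lambda>s. v s * poisson r s)"
    by (intro borel_integrable_atLeastAtMost' continuous_intros continuous_on_poisson continuous_on_subset[OF v(1)]) simp
  have ind: "indicator {-1/2..1/2} s * (v s * (c * indicator {t. \<bar>t\<bar> \<le> d k} s)) = c * (indicator {- d k..d k} s * v s)" for s c k
    using d(2)[of k] by (auto simp: indicator_def abs_le_iff)
  have "(LBINT s:{-1/2..1/2}. v s * poisson r s) \<le>
    (LBINT s. (\<Sum>k\<le>K. 8 * (1/4)^k / (1 - r) * (indicator {- d k..d k} s * v s)))"
    unfolding set_lebesgue_integral_def
  proof (rule integral_mono)
    show "integrable lborel (\<lambda>s. indicator {-1/2..1/2} s *\<^sub>R (v s * poisson r s))"
      using int1 by (simp add: set_integrable_def)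
    show "integrable lborel (\<lambda>s. \<Sum>k\<le>K. 8 * (1/4)^k / (1 - r) * (indicator {- d k..d k} s * v s))"
      using vint by (intro Bochner_Integration.integrable_sum integrable_mult_right) (simp add: set_integrable_def)
    fix s :: real
    show "indicator {-1/2..1/2} s *\<^sub>R (v s * poisson r s) \<le> (\<Sum>k\<le>K. 8 * (1/4)^k / (1 - r) * (indicator {- d k..d k} s * v s))"
    proof (cases "s \<in> {-1/2..1/2}")
      case True
      then have "\<bar>s\<bar> \<le> 1/2" by auto
      from poisson_dyadic[OF this K] v(2)[of s]
      have "v s * poisson r s \<le> v s * (\<Sum>k\<le>K. 8 * (1/4)^k / (1 - r) * indicator {t. \<bar>t\<bar> \<le> d k} s)"
        unfolding d_def by (intro mult_left_mono)
      then have "indicator {-1/2..1/2} s *\<^sub>R (v s * poisson r s) \<le> (\<Sum>k\<le>K. indicator {-1/2..1/2} s * (v s * (8 * (1/4)^k / (1 - r) * indicator {t. \<bar>t\<bar> \<le> d k} s)))"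
        using True by (simp add: sum_distrib_left)
      then show ?thesis unfolding ind .
    next
      case False
      then show ?thesis using v(2)[of s] a by (auto intro!: sum_nonneg)
    qed
  qed
  also have "\<dots> = (\<Sum>k\<le>K. 8 * (1/4)^k / (1 - r) * (LBINT s:{- d k..d k}. v s))"
    using vint by (subst Bochner_Integration.integral_sum) (auto simp: set_integrable_def set_lebesgue_integral_def)
  also have "\<dots> \<le> (\<Sum>k\<le>K. 8 * (1/4)^k / (1 - r) * (2 * (2^k * (1 - r)) * l))"
  proof (intro sum_mono mult_left_mono)
    fix k
    have "(LBINT s:{- d k..d k}. v s) \<le> 2 * d k * l" by (rule avg[OF d(1,2)])
    also have "\<dots> \<le> 2 * (2^k * (1 - r)) * l" using d(3)[of k] l by (intro mult_right_mono) auto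
    finally show "(LBINT s:{- d k..d k}. v s) \<le> 2 * (2^k * (1 - r)) * l" .
  qed (use a in auto)
  also have "\<dots> = (\<Sum>k\<le>K. (1/2)^k) * (16 * l)"
  proof -
    have "8 * (1/4)^k / (1 - r) * (2 * (2^k * (1 - r)) * l) = (1/2)^k * (16 * l)" for k
    proof -
      have "(1/4::real)^k * 2^k = (1/2)^k" by (simp flip: power_mult_distrib)
      then show ?thesis using a by (simp add: field_simps)
    qed
    then show ?thesis by (simp add: sum_distrib_right)
  qed
  also have "(\<Sum>k\<le>K. (1/2::real)^k) * (16 * l) \<le> 2 * (16 * l)"
  proof (rule mult_right_mono)
    have "(\<Sum>k\<le>K. (1/2::real)^k) = 2 - (1/2)^K" by (induction K) auto
    then show "(\<Sum>k\<le>K. (1/2::real)^k) \<le> 2" by simp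
  qed (use l in simp)
  finally show ?thesis by simp
qed

end


section \<open>Periodic integrals and the covering argument\<close>

abbreviation nnI :: "real set \<Rightarrow> (real \<Rightarrow> ennreal) \<Rightarrow> ennreal" where
  "nnI A w \<equiv> \<integral>\<^sup>+s\<in>A. w s \<partial>lborel"

lemma nn_integral_split_Icc:
  fixes w :: "real \<Rightarrow> ennreal"
  assumes [measurable]: "w \<in> borel_measurable borel" and "a \<le> b" "b \<le> c"
  shows "nnI {a..c} w = nnI {a..b} w + nnI {b..c} w"
proof -
  have "nnI {a..c} w = (\<integral>\<^sup>+s. w s * indicator {a..b} s + w s * indicator {b..c} s \<partial>lborel)"
  proof (rule nn_integral_cong_AE)
    show "AE s in lborel. w s * indicator {a..c} s = w s * indicator {a..b} s + w s * indicator {b..c} s"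
      using AE_lborel_singleton[of b] by eventually_elim (use assms in \<open>auto simp: indicator_def\<close>)
  qed
  then show ?thesis by (subst (asm) nn_integral_add) auto
qed

lemma nn_integral_shift_Icc:
  fixes w :: "real \<Rightarrow> ennreal"
  assumes [measurable]: "w \<in> borel_measurable borel"
  shows "(\<integral>\<^sup>+s\<in>{a..b}. w (t + s) \<partial>lborel) = nnI {t+a..t+b} w"
  by (subst (2) nn_integral_real_affine[where c = 1 and t = t])
    (auto intro!: nn_integral_cong simp: indicator_def)

lemma nn_integral_periodic:
  fixes w :: "real \<Rightarrow> ennreal"
  assumes w [measurable]: "w \<in> borel_measurable borel" and per: "\<And>s. w (s + 1) = w s"
  shows "nnI {-1/2..1/2} w = nnI {0..1} w"
    "nnI {-1/2..3/2} w = 2 * nnI {0..1} w"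
proof -
  have sh: "nnI {a..b} w = nnI {1+a..1+b} w" for a b
    using nn_integral_shift_Icc[OF w, of 1 a b] per by (simp add: add.commute)
  have 1: "nnI {0..1} w = nnI {0..1/2} w + nnI {1/2..1} w"
    by (rule nn_integral_split_Icc) auto
  have 2: "nnI {-1/2..1/2} w = nnI {-1/2..0} w + nnI {0..1/2} w"
    by (rule nn_integral_split_Icc) auto
  have 3: "nnI {-1/2..3/2} w = nnI {-1/2..1/2} w + nnI {1/2..3/2} w"
    by (rule nn_integral_split_Icc) auto
  show 4: "nnI {-1/2..1/2} w = nnI {0..1} w"
    unfolding 1 2 using sh[of "-1/2" 0] by (simp add: add.commute)
  show "nnI {-1/2..3/2} w = 2 * nnI {0..1} w"
    unfolding 3 4 using sh[of "-1/2" "1/2"] 4 by (simp add: mult_2)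
qed

lemma nn_integral_eq_set_integral:
  fixes w :: "real \<Rightarrow> real"
  assumes "continuous_on UNIV w" "\<And>s. 0 \<le> w s"
  shows "(\<integral>\<^sup>+s\<in>{a..b}. ennreal (w s) \<partial>lborel) = ennreal (LBINT s:{a..b}. w s)"
proof -
  have "set_integrable lborel {a..b} w"
    by (rule borel_integrable_atLeastAtMost'[OF continuous_on_subset[OF assms(1)]]) simp
  then have "(\<integral>\<^sup>+s. ennreal (indicator {a..b} s * w s) \<partial>lborel) = ennreal (LBINT s:{a..b}. w s)"
    unfolding set_lebesgue_integral_def set_integrable_def
    using assms(2) by (subst nn_integral_eq_integral) auto
  moreover have "ennreal (indicator {a..b} s * w s) = ennreal (w s) * indicator {a..b} s" for s
    by (simp add: indicator_def)
  ultimately show ?thesis by simp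
qed

text \<open>Contrapositive of \<open>poisson_average_le\<close>, applied after a rotation that moves
  the angle \<open>t\<close> to 0. The interval is written as \<open>cball t d\<close> for the
  covering lemma.\<close>

lemma poisson_average_gt:
  assumes f: "f holomorphic_on ball 0 R" and R: "1 < R" and l: "0 < l"
    and r: "0 < r" "r < 1" and gt: "32 * l < cmod (f (of_real r * cis (2 * pi * t)))"
  obtains d where "0 < d" "d \<le> 1/2"
    "ennreal (2 * d * l) \<le> (\<integral>\<^sup>+s\<in>cball t d. ennreal (cmod (f (cis (2 * pi * s)))) \<partial>lborel)"
proof -
  define v where "v s = cmod (f (cis (2 * pi * (t + s))))" for s
  have fc: "continuous_on (ball 0 R) f" by (rule holomorphic_on_imp_continuous_on[OF f])
  have v: "continuous_on UNIV v" "\<And>s. 0 \<le> v s"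
    unfolding v_def using R
    by (auto intro!: continuous_intros continuous_on_compose2[OF fc] continuous_on_cis)
  have "\<exists>d. 0 < d \<and> d \<le> 1/2 \<and> 2 * d * l < (LBINT s:{-d..d}. v s)"
  proof (rule ccontr)
    assume "\<not> ?thesis"
    then have avg: "(LBINT s:{-d..d}. v s) \<le> 2 * d * l" if "0 < d" "d \<le> 1/2" for d
      using that by (meson not_le)
    have r': "0 \<le> r" using r by simp
    define g where "g z = f (z * cis (2 * pi * t))" for z
    have g: "g holomorphic_on cball 0 1" unfolding g_def using R
      by (intro holomorphic_on_compose_gen[OF _ f, unfolded comp_def] holomorphic_intros) (auto simp: norm_mult)
    have gc: "g (cis (2 * pi * s)) = f (cis (2 * pi * (t + s)))" for s
      unfolding g_def by (simp add: cis_mult distrib_left add.commute)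
    have "cmod (g (of_real r)) \<le> (LBINT s:{0..1}. cmod (g (cis (2 * pi * s)) * of_real (poisson r s)))"
      unfolding poisson_formula(1)[OF r' r(2) g]
      by (rule set_integral_norm_bound[OF poisson_formula(2)[OF r' r(2) g]])
    also have "\<dots> = (LBINT s:{0..1}. v s * poisson r s)"
      unfolding gc v_def using poisson_nonneg[OF r' r(2)] by (simp add: norm_mult)
    also have "\<dots> = (LBINT s:{-1/2..1/2}. v s * poisson r s)"
    proof -
      define w where "w s = v s * poisson r s" for s
      have w: "continuous_on UNIV w" "\<And>s. 0 \<le> w s"
        unfolding w_def using v poisson_nonneg[OF r' r(2)] by (auto intro!: continuous_intros continuous_on_poisson[OF r' r(2)])
      have wp: "w (s + 1) = w s" for s
        using cis_period[of "t + s"] by (simp add: w_def v_def poisson_def add.assoc)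
      have "ennreal (LBINT s:{-1/2..1/2}. w s) = ennreal (LBINT s:{0..1}. w s)"
        unfolding nn_integral_eq_set_integral[OF w, symmetric]
        by (rule nn_integral_periodic(1)) (use borel_measurable_continuous_onI[OF w(1)] wp in simp_all)
      moreover have "0 \<le> (LBINT s:{a..b}. w s)" for a b
        unfolding set_lebesgue_integral_def using w(2) by (intro integral_nonneg_AE) auto
      ultimately show ?thesis unfolding w_def by simp
    qed
    also have "\<dots> \<le> 32 * l" by (rule poisson_average_le[OF r' r(2) v _ avg]) (use l in auto)
    finally show False using gt unfolding g_def by simp
  qed
  then obtain d where d: "0 < d" "d \<le> 1/2" "2 * d * l < (LBINT s:{-d..d}. v s)" by auto
  have m: "(\<lambda>s. ennreal (cmod (f (cis (2 * pi * s))))) \<in> borel_measurable borel"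
    using R by (intro measurable_compose[OF _ measurable_ennreal] borel_measurable_continuous_onI
       continuous_intros continuous_on_compose2[OF fc] continuous_on_cis) auto
  have "ennreal (2 * d * l) \<le> (\<integral>\<^sup>+s\<in>{-d..d}. ennreal (v s) \<partial>lborel)"
    unfolding nn_integral_eq_set_integral[OF v] using d by (intro ennreal_leI) simp
  also have "\<dots> = (\<integral>\<^sup>+s\<in>cball t d. ennreal (cmod (f (cis (2 * pi * s)))) \<partial>lborel)"
    unfolding v_def using nn_integral_shift_Icc[OF m, of t "-d" d] by (simp add: cball_eq_atLeastAtMost)
  finally show ?thesis using d that by blast
qed

text \<open>Vitali covering: every point of the exceptional set is the centre of an interval of
  length at most 1 on which the modulus of \<open>f\<close> has average at least \<open>l\<close>,
  and a disjoint subfamily covers the set after enlargement by 5. The constant 10 is this 5 times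
  the 2 that comes from \<open>D_sub\<close>.\<close>

theorem radial_weak_type:
  assumes f: "f holomorphic_on ball 0 R" and R: "1 < R" and l: "0 < l"
  shows "emeasure lborel {t\<in>{0..1}. \<exists>r\<in>{0<..<1}. 32 * l < cmod (f (of_real r * cis (2 * pi * t)))}
    \<le> ennreal (10 / l) * (\<integral>\<^sup>+t\<in>{0..1}. ennreal (cmod (f (cis (2 * pi * t)))) \<partial>lborel)"
proof -
  define w where "w s = ennreal (cmod (f (cis (2 * pi * s))))" for s
  define A where "A = {t\<in>{0..1}. \<exists>r\<in>{0<..<1}. 32 * l < cmod (f (of_real r * cis (2 * pi * t)))}"
  have fc: "continuous_on (ball 0 R) f" by (rule holomorphic_on_imp_continuous_on[OF f])
  have w [measurable]: "w \<in> borel_measurable borel"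
    unfolding w_def using R by (intro measurable_compose[OF _ measurable_ennreal] borel_measurable_continuous_onI
       continuous_intros continuous_on_compose2[OF fc] continuous_on_cis) auto
  have wp: "w (s + 1) = w s" for s unfolding w_def by simp
  have "\<exists>d. 0 < d \<and> d \<le> 1/2 \<and> ennreal (2 * d * l) \<le> nnI (cball t d) w" if "t \<in> A" for t
  proof -
    from that obtain r where "0 < r" "r < 1" "32 * l < cmod (f (of_real r * cis (2 * pi * t)))"
      unfolding A_def by auto
    from poisson_average_gt[OF f R l this] show ?thesis unfolding w_def by metis
  qed
  then obtain d where d: "\<And>t. t \<in> A \<Longrightarrow> 0 < d t \<and> d t \<le> 1/2"
    and dw: "\<And>t. t \<in> A \<Longrightarrow> ennreal (2 * d t * l) \<le> (\<integral>\<^sup>+s\<in>cball t (d t). w s \<partial>lborel)"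
    by metis
  have cov: "A \<subseteq> (\<Union>t\<in>A. cball t (d t))" using d by (force intro: less_imp_le)
  obtain C where C: "countable C" "C \<subseteq> A"
    and disj: "pairwise (\<lambda>i j. disjnt (cball i (d i)) (cball j (d j))) C"
    and covC: "A \<subseteq> (\<Union>i\<in>C. cball i (5 * d i))"
    using Vitali_covering_lemma_cballs[of A id d A "1/2"] cov d by auto
  define I where "I = to_nat_on C ` C"
  define c where "c = from_nat_into C"
  have cI: "c n \<in> C" if "n \<in> I" for n using that C(1) unfolding I_def c_def by auto
  have c_inj: "n = m" if "n \<in> I" "m \<in> I" "c n = c m" for n m
    using that C(1) unfolding I_def c_def by auto
  have Cc: "\<exists>n\<in>I. c n = i" if "i \<in> C" for i using that C(1) unfolding I_def c_def by force
  define D where "D n = (if n \<in> I then cball (c n) (d (c n)) else {})" for n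
  define E where "E n = (if n \<in> I then cball (c n) (5 * d (c n)) else {})" for n
  have [measurable]: "D n \<in> sets borel" "E n \<in> sets borel" for n by (auto simp: D_def E_def)
  have disjD: "disjoint_family D"
    unfolding disjoint_family_on_def
  proof (intro ballI impI)
    fix m n :: nat assume "m \<noteq> n"
    show "D m \<inter> D n = {}"
    proof (cases "m \<in> I \<and> n \<in> I")
      case True
      then have "c m \<noteq> c n" "c m \<in> C" "c n \<in> C" using c_inj \<open>m \<noteq> n\<close> cI by auto
      then show ?thesis using disj True unfolding pairwise_def disjnt_def D_def by simp
    qed (auto simp: D_def)
  qed
  have AE: "A \<subseteq> (\<Union>n. E n)"
    using covC Cc unfolding E_def by (force split: if_splits)
  have le: "emeasure lborel (E n) \<le> ennreal (5 / l) * emeasure (density lborel w) (D n)" for n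
  proof (cases "n \<in> I")
    case True
    then have cA: "c n \<in> A" using cI C(2) by auto
    have "emeasure lborel (E n) = ennreal (10 * d (c n))"
      using True d[OF cA] unfolding E_def by (simp add: cball_eq_atLeastAtMost)
    also have "\<dots> = ennreal (5 / l) * ennreal (2 * d (c n) * l)"
      using l d[OF cA] by (simp flip: ennreal_mult'')
    also have "\<dots> \<le> ennreal (5 / l) * nnI (cball (c n) (d (c n))) w"
      by (intro mult_left_mono dw[OF cA]) simp
    also have "\<dots> = ennreal (5 / l) * emeasure (density lborel w) (D n)"
      using True by (simp add: emeasure_density D_def)
    finally show ?thesis .
  qed (simp add: E_def)
  \<comment> \<open>The intervals stick out of \<open>{0..1}\<close> by at most 1/2, so they lie in
    an interval of two periods, and periodicity costs a factor 2.\<close>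
  have D_sub: "(\<Union>n. D n) \<subseteq> {-1/2..3/2}"
  proof
    fix x assume "x \<in> (\<Union>n. D n)"
    then obtain n where n: "n \<in> I" "x \<in> cball (c n) (d (c n))" unfolding D_def by (auto split: if_splits)
    then have "c n \<in> A" using cI C(2) by auto
    then show "x \<in> {-1/2..3/2}" using n(2) d[of "c n"] unfolding A_def cball_eq_atLeastAtMost by auto
  qed
  have "emeasure lborel A \<le> emeasure lborel (\<Union>n. E n)"
    by (rule emeasure_mono[OF AE]) simp
  also have "\<dots> \<le> suminf (\<lambda>n. emeasure lborel (E n))"
    by (rule emeasure_subadditive_countably) auto
  also have "\<dots> \<le> suminf (\<lambda>n. ennreal (5 / l) * emeasure (density lborel w) (D n))"
    by (intro suminf_le le) auto
  also have "\<dots> = ennreal (5 / l) * suminf (\<lambda>n. emeasure (density lborel w) (D n))"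
    by (rule ennreal_suminf_cmult)
  also have "suminf (\<lambda>n. emeasure (density lborel w) (D n)) = emeasure (density lborel w) (\<Union>n. D n)"
    by (rule suminf_emeasure[OF _ disjD]) auto
  also have "\<dots> \<le> emeasure (density lborel w) {-1/2..3/2}"
    by (rule emeasure_mono[OF D_sub]) simp
  also have "\<dots> = 2 * nnI {0..1} w"
    using nn_integral_periodic(2)[OF w wp] by (simp add: emeasure_density)
  also have "ennreal (5 / l) * (2 * nnI {0..1} w) = ennreal (10 / l) * nnI {0..1} w"
  proof -
    have "ennreal (5 / l) * 2 = ennreal (10 / l)"
      using l ennreal_mult''[of 2 "5/l"] by simp
    then show ?thesis by (simp add: mult.assoc[symmetric])
  qed
  finally show ?thesis unfolding A_def w_def by (simp add: mult_left_mono)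
qed

section \<open>Polynomial functions\<close>

text \<open>Functions in place of formal polynomials: composition, restriction to lines and
  differentiation become pointwise, and a formal \<open>cpoly\<close> is chosen only where
  coefficients or the basic invariants are involved.\<close>

definition poly_fun :: "(complex^'n \<Rightarrow> complex) \<Rightarrow> bool" where
  "poly_fun f \<longleftrightarrow> (\<exists>q. f = cpoly_eval q)"

definition monom_fun :: "('n::finite \<Rightarrow>\<^sub>0 nat) \<Rightarrow> complex^'n \<Rightarrow> complex" where
  "monom_fun a z = (\<Prod>i\<in>UNIV. z $ i ^ Poly_Mapping.lookup a i)"

lemma cpoly_eval_superset:
  assumes "finite A" "Poly_Mapping.keys p \<subseteq> A"
  shows "cpoly_eval p z = (\<Sum>a\<in>A. Poly_Mapping.lookup p a * monom_fun a z)"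
  unfolding cpoly_eval_def monom_fun_def
  using assms by (intro sum.mono_neutral_left) (auto simp: in_keys_iff)

lemma cpoly_eval_add: "cpoly_eval (p + q) z = cpoly_eval p z + cpoly_eval q z"
proof -
  let ?A = "Poly_Mapping.keys p \<union> Poly_Mapping.keys q"
  have "cpoly_eval (p + q) z = (\<Sum>a\<in>?A. Poly_Mapping.lookup (p + q) a * monom_fun a z)"
    using Poly_Mapping.keys_add[of p q] by (intro cpoly_eval_superset) auto
  also have "\<dots> = (\<Sum>a\<in>?A. Poly_Mapping.lookup p a * monom_fun a z) + (\<Sum>a\<in>?A. Poly_Mapping.lookup q a * monom_fun a z)"
    by (simp add: lookup_add distrib_right sum.distrib)
  also have "\<dots> = cpoly_eval p z + cpoly_eval q z"
    by (subst (1 2) cpoly_eval_superset[where A = ?A]) auto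
  finally show ?thesis .
qed

lemma cpoly_eval_single: "cpoly_eval (Poly_Mapping.single a c) z = c * monom_fun a z"
  by (subst cpoly_eval_superset[where A = "{a}"]) auto

lemma poly_fun_monom: "poly_fun (\<lambda>z. c * monom_fun a z)"
  unfolding poly_fun_def by (intro exI[of _ "Poly_Mapping.single a c"]) (simp add: cpoly_eval_single fun_eq_iff)

lemma poly_fun_const [simp]: "poly_fun (\<lambda>z. c)"
  using poly_fun_monom[of c 0] by (simp add: monom_fun_def)

lemma poly_fun_coord [simp]: "poly_fun (\<lambda>z::complex^'n. z $ i)"
proof -
  have "monom_fun (Poly_Mapping.single i 1) z = z $ i" for z :: "complex^'n"
    unfolding monom_fun_def by (subst prod.remove[of _ i]) (auto simp: lookup_single when_def intro!: prod.neutral)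
  then show ?thesis using poly_fun_monom[of 1 "Poly_Mapping.single i 1"] by simp
qed

lemma poly_fun_cpoly_eval [simp]: "poly_fun (cpoly_eval q)"
  by (auto simp: poly_fun_def)

lemma poly_fun_add [intro]: "poly_fun f \<Longrightarrow> poly_fun g \<Longrightarrow> poly_fun (\<lambda>z. f z + g z)"
proof -
  assume "poly_fun f" "poly_fun g"
  then obtain p q where "f = cpoly_eval p" "g = cpoly_eval q" by (auto simp: poly_fun_def)
  then show ?thesis
    unfolding poly_fun_def by (intro exI[of _ "p + q"]) (simp add: fun_eq_iff cpoly_eval_add)
qed

lemma poly_fun_sum [intro]: "(\<And>i. i \<in> I \<Longrightarrow> poly_fun (f i)) \<Longrightarrow> poly_fun (\<lambda>z. \<Sum>i\<in>I. f i z)"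
  by (induction I rule: infinite_finite_induct) auto

lemma monom_fun_add: "monom_fun (a + b) z = monom_fun a z * monom_fun b z"
  by (simp add: monom_fun_def lookup_add power_add prod.distrib)

lemma poly_fun_mult [intro]:
  assumes "poly_fun f" "poly_fun g"
  shows "poly_fun (\<lambda>z. f z * g z)"
proof -
  obtain p q where pq: "f = cpoly_eval p" "g = cpoly_eval q" using assms by (auto simp: poly_fun_def)
  let ?c = "Poly_Mapping.lookup p" and ?d = "Poly_Mapping.lookup q"
  have "f z * g z = (\<Sum>a\<in>Poly_Mapping.keys p. \<Sum>b\<in>Poly_Mapping.keys q. (?c a * ?d b) * monom_fun (a + b) z)" for z
    unfolding pq monom_fun_add
    by (simp add: cpoly_eval_def monom_fun_def sum_product mult_ac)
  then have "(\<lambda>z. f z * g z) = (\<lambda>z. \<Sum>a\<in>Poly_Mapping.keys p. \<Sum>b\<in>Poly_Mapping.keys q. (?c a * ?d b) * monom_fun (a + b) z)"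
    by auto
  then show ?thesis by (simp only:) (intro poly_fun_sum poly_fun_monom)
qed

lemma poly_fun_minus [intro]: "poly_fun f \<Longrightarrow> poly_fun (\<lambda>z. - f z)"
  using poly_fun_mult[of "\<lambda>_. -1" f] by simp

lemma poly_fun_diff [intro]: "poly_fun f \<Longrightarrow> poly_fun g \<Longrightarrow> poly_fun (\<lambda>z. f z - g z)"
  using poly_fun_add[of f "\<lambda>z. - g z"] by auto

lemma poly_fun_divide [intro]: "poly_fun f \<Longrightarrow> poly_fun (\<lambda>z. f z / c)"
  using poly_fun_mult[of f "\<lambda>_. inverse c"] by (simp add: divide_inverse)

lemma poly_fun_prod [intro]: "(\<And>i. i \<in> I \<Longrightarrow> poly_fun (f i)) \<Longrightarrow> poly_fun (\<lambda>z. \<Prod>i\<in>I. f i z)"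
  by (induction I rule: infinite_finite_induct) auto

lemma poly_fun_power [intro]: "poly_fun f \<Longrightarrow> poly_fun (\<lambda>z. f z ^ k)"
  by (induction k) auto

lemma poly_fun_induct [consumes 1, case_names const coord add mult]:
  assumes "poly_fun f" and c: "\<And>c. Q (\<lambda>_. c)" and x: "\<And>i. Q (\<lambda>z. z $ i)"
    and a: "\<And>f g. poly_fun f \<Longrightarrow> poly_fun g \<Longrightarrow> Q f \<Longrightarrow> Q g \<Longrightarrow> Q (\<lambda>z. f z + g z)"
    and m: "\<And>f g. poly_fun f \<Longrightarrow> poly_fun g \<Longrightarrow> Q f \<Longrightarrow> Q g \<Longrightarrow> Q (\<lambda>z. f z * g z)"
  shows "Q f"
proof -
  obtain p where p: "f = cpoly_eval p" using assms(1) by (auto simp: poly_fun_def)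
  have pow: "Q (\<lambda>z. z $ i ^ k)" for i k
  proof (induction k)
    case (Suc k)
    then show ?case using m[OF poly_fun_coord[of i] poly_fun_power[OF poly_fun_coord[of i], of k] x] by simp
  qed (use c in simp)
  have prod: "Q (\<lambda>z. \<Prod>i\<in>I. z $ i ^ k i)" if "finite I" for I and k :: "'a \<Rightarrow> nat"
    using that
  proof induction
    case (insert i I)
    have "poly_fun (\<lambda>z. z $ i ^ k i)" "poly_fun (\<lambda>z. \<Prod>i\<in>I. z $ i ^ k i)"
      by (auto intro!: poly_fun_prod poly_fun_power)
    from m[OF this pow insert.IH] show ?case using insert.hyps by simp
  qed (use c in simp)
  have mon: "Q (\<lambda>z. c * monom_fun a z)" for c :: complex and a
  proof -
    have "poly_fun (monom_fun a)" using poly_fun_monom[of 1 a] by simp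
    moreover have "Q (monom_fun a)" unfolding monom_fun_def[abs_def] by (rule prod) simp
    ultimately show ?thesis using m[of "\<lambda>_. c" "monom_fun a"] c by simp
  qed
  have "Q (\<lambda>z. \<Sum>a\<in>A. Poly_Mapping.lookup p a * monom_fun a z)" if "finite A" for A
    using that
  proof induction
    case (insert a A)
    have "poly_fun (\<lambda>z. \<Sum>a\<in>A. Poly_Mapping.lookup p a * monom_fun a z)" by (intro poly_fun_sum poly_fun_monom)
    from a[OF poly_fun_monom this mon insert.IH] show ?case using insert.hyps by simp
  qed (use c in simp)
  moreover have "f = (\<lambda>z. \<Sum>a\<in>Poly_Mapping.keys p. Poly_Mapping.lookup p a * monom_fun a z)"
    unfolding p by (auto simp: cpoly_eval_def monom_fun_def)
  ultimately show ?thesis by simp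
qed

section \<open>Substitution and restriction to complex lines\<close>

lemma poly_fun_compose:
  assumes "poly_fun f" "\<And>i. poly_fun (\<lambda>y. A y $ i)"
  shows "poly_fun (\<lambda>y. f (A y))"
  using assms(1) by (induction rule: poly_fun_induct) (use assms(2) in auto)

lemma poly_fun_matrix: "poly_fun (\<lambda>z. (A *v z) $ i)"
  unfolding matrix_vector_mult_def by (auto intro!: poly_fun_sum poly_fun_mult)

lemma poly_fun_compose_matrix: "poly_fun f \<Longrightarrow> poly_fun (\<lambda>z. f (A *v z))"
  by (rule poly_fun_compose) (auto intro: poly_fun_matrix)

text \<open>What counts is that the coefficients depend polynomially on the parameter
  \<open>y\<close>; this makes the quotient in \<open>skew_divisible\<close> a polynomial. Vanishing
  beyond \<open>N\<close> allows sums of different length to be combined.\<close>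

lemma poly_fun_line:
  assumes f: "poly_fun f" and A: "\<And>i. poly_fun (\<lambda>y. A y $ i)" and B: "\<And>i. poly_fun (\<lambda>y. B y $ i)"
  obtains N c where "\<And>k. poly_fun (c k)" "\<And>k y. k > N \<Longrightarrow> c k y = 0"
    "\<And>y s. f (A y + s *s B y) = (\<Sum>k\<le>N. c k y * s ^ k)"
proof -
  have "\<exists>N c. (\<forall>k. poly_fun (c k)) \<and> (\<forall>k y. k > N \<longrightarrow> c k y = 0) \<and>
     (\<forall>y s. f (A y + s *s B y) = (\<Sum>k\<le>N. c k y * s ^ k))"
    using f
  proof (induction rule: poly_fun_induct)
    case (const c)
    show ?case by (rule exI[of _ 0], rule exI[of _ "\<lambda>k y. if k = 0 then c else 0"]) auto
  next
    case (coord i)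
    have "poly_fun (if k = 0 then \<lambda>y. A y $ i else if k = 1 then \<lambda>y. B y $ i else (\<lambda>_. 0))" for k :: nat
      using A B by auto
    moreover have "(\<lambda>y. if k = 0 then A y $ i else if k = 1 then B y $ i else 0) =
        (if k = 0 then \<lambda>y. A y $ i else if k = 1 then \<lambda>y. B y $ i else (\<lambda>_. 0))" for k :: nat by auto
    ultimately show ?case
      by (intro exI[of _ 1] exI[of _ "\<lambda>k y. if k = 0 then A y $ i else if k = 1 then B y $ i else 0"])
        (auto simp: mult.commute)
  next
    case (add f g)
    obtain N c where
      c: "\<forall>k. poly_fun (c k)" "\<forall>k y. k > N \<longrightarrow> c k y = 0" "\<forall>y s. f (A y + s *s B y) = (\<Sum>k\<le>N. c k y * s ^ k)"
      using add.IH(1) by blast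
    obtain M d where
      d: "\<forall>k. poly_fun (d k)" "\<forall>k y. k > M \<longrightarrow> d k y = 0" "\<forall>y s. g (A y + s *s B y) = (\<Sum>k\<le>M. d k y * s ^ k)"
      using add.IH(2) by blast
    have "(\<Sum>k\<le>N. c k y * s ^ k) = (\<Sum>k\<le>N+M. c k y * s ^ k)" for y s
      using c(2) by (intro sum.mono_neutral_left) auto
    moreover have "(\<Sum>k\<le>M. d k y * s ^ k) = (\<Sum>k\<le>N+M. d k y * s ^ k)" for y s
      using d(2) by (intro sum.mono_neutral_left) auto
    ultimately show ?case
      using c d by (intro exI[of _ "N+M"] exI[of _ "\<lambda>k y. c k y + d k y"]) (auto simp: distrib_right sum.distrib)
  next
    case (mult f g)
    obtain N c where
      c: "\<forall>k. poly_fun (c k)" "\<forall>k y. k > N \<longrightarrow> c k y = 0" "\<forall>y s. f (A y + s *s B y) = (\<Sum>k\<le>N. c k y * s ^ k)"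
      using mult.IH(1) by blast
    obtain M d where
      d: "\<forall>k. poly_fun (d k)" "\<forall>k y. k > M \<longrightarrow> d k y = 0" "\<forall>y s. g (A y + s *s B y) = (\<Sum>k\<le>M. d k y * s ^ k)"
      using mult.IH(2) by blast
    have "(\<Sum>k\<le>r. c k y * d (r - k) y) = 0" if "r > N + M" for r y
    proof (rule sum.neutral, rule ballI)
      fix k assume "k \<in> {..r}"
      then have "k > N \<or> r - k > M" using that by auto
      then show "c k y * d (r - k) y = 0" using c(2) d(2) by auto
    qed
    moreover have "f (A y + s *s B y) * g (A y + s *s B y) = (\<Sum>r\<le>N + M. (\<Sum>k\<le>r. c k y * d (r - k) y) * s ^ r)" for y s
      unfolding c(3)[rule_format] d(3)[rule_format]
      by (rule polynomial_product) (use c(2) d(2) in auto)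
    ultimately show ?case
      using c(1) d(1)
      by (intro exI[of _ "N+M"] exI[of _ "\<lambda>r y. \<Sum>k\<le>r. c k y * d (r - k) y"]) (auto intro!: poly_fun_sum poly_fun_mult)
  qed
  then show ?thesis using that by blast
qed

text \<open>Encoded as a univariate polynomial in the line parameter, so that vanishing to order
  \<open>k\<close> at \<open>x\<close> in direction \<open>v\<close> is divisibility by
  \<open>[:0, 1:] ^ k\<close>. The choice is unique by \<open>line_poly_unique\<close>.\<close>

definition line_poly :: "(complex^'n \<Rightarrow> complex) \<Rightarrow> complex^'n \<Rightarrow> complex^'n \<Rightarrow> complex poly" where
  "line_poly f x v = (SOME p. \<forall>t. f (x + t *s v) = poly p t)"

lemma poly_line_poly:
  fixes f :: "complex^'a \<Rightarrow> complex"
  assumes "poly_fun f"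
  shows "poly (line_poly f x v) t = f (x + t *s v)"
proof -
  obtain N :: nat and c where c: "\<And>(y::complex^'a) s. f (x + s *s v) = (\<Sum>k\<le>N. c k y * s ^ k)"
    by (rule poly_fun_line[OF assms, of "\<lambda>_::complex^'a. x" "\<lambda>_. v"]) auto
  have "\<exists>p. \<forall>t. f (x + t *s v) = poly p t"
  proof (intro exI allI)
    fix t
    show "f (x + t *s v) = poly (\<Sum>k\<le>N. Polynomial.monom (c k 0) k) t"
      unfolding poly_sum poly_monom by (rule c)
  qed
  then have "\<forall>t. f (x + t *s v) = poly (line_poly f x v) t"
    unfolding line_poly_def by (rule someI_ex)
  from spec[OF this, of t] show ?thesis by (rule sym)
qed

lemma line_poly_unique: "poly_fun f \<Longrightarrow> (\<And>t. poly p t = f (x + t *s v)) \<Longrightarrow> line_poly f x v = p"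
proof -
  assume "poly_fun f" "\<And>t. poly p t = f (x + t *s v)"
  then have "poly (line_poly f x v) = poly p" by (simp add: fun_eq_iff poly_line_poly)
  then show ?thesis by (simp only: poly_eq_poly_eq_iff)
qed

text \<open>On the line through a point with \<open>f x \<noteq> 0\<close> and a point with
  \<open>g y \<noteq> 0\<close> both restrictions are nonzero, and univariate polynomials have no
  zero divisors.\<close>

lemma poly_fun_mult_eq_0:
  assumes "poly_fun f" "poly_fun g" "\<And>z. f z * g z = 0"
  shows "(\<forall>z. f z = 0) \<or> (\<forall>z. g z = 0)"
proof (rule ccontr)
  assume "\<not> ?thesis"
  then obtain x y where xy: "f x \<noteq> 0" "g y \<noteq> 0" by auto
  have "poly (line_poly f x (y - x) * line_poly g x (y - x)) t = 0" for t
    using assms by (simp add: poly_line_poly)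
  then have "line_poly f x (y - x) * line_poly g x (y - x) = 0" using poly_all_0_iff_0 by blast
  then have "line_poly f x (y - x) = 0 \<or> line_poly g x (y - x) = 0" by simp
  then show False
    using xy poly_line_poly[OF assms(1), of x "y - x" 0] poly_line_poly[OF assms(2), of x "y - x" 1] by auto
qed

lemma poly_fun_prod_nonzero:
  assumes "finite I" "\<And>i. i \<in> I \<Longrightarrow> poly_fun (f i)" "\<And>i. i \<in> I \<Longrightarrow> \<exists>z. f i z \<noteq> 0"
  shows "\<exists>z. (\<Prod>i\<in>I. f i z) \<noteq> 0"
  using assms
proof (induction I rule: finite_induct)
  case (insert i I)
  have pf: "poly_fun (\<lambda>z. \<Prod>i\<in>I. f i z)" "poly_fun (f i)" using insert.prems(1) by (auto intro!: poly_fun_prod)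
  have "\<exists>z. (\<Prod>i\<in>I. f i z) \<noteq> 0" "\<exists>z. f i z \<noteq> 0" using insert by blast+
  then have "\<exists>z. f i z * (\<Prod>i\<in>I. f i z) \<noteq> 0"
    using poly_fun_mult_eq_0[OF pf(2,1)] by blast
  then show ?case using insert.hyps by simp
qed simp

text \<open>Used to divide by \<open>jac P\<close> and to pass from generic directions to all: the
  zeros of a nonzero polynomial are negligible for polynomial identities.\<close>

lemma poly_fun_cancel:
  assumes "poly_fun f" "poly_fun g" "poly_fun d" "d z0 \<noteq> 0" "\<And>z. d z \<noteq> 0 \<Longrightarrow> f z = g z"
  shows "f z = g z"
proof -
  have "d z * (f z - g z) = 0" for z using assms(5)[of z] by (cases "d z = 0") auto
  then show ?thesis
    using poly_fun_mult_eq_0[OF assms(3) poly_fun_diff[OF assms(1,2)]] assms(4) by (metis right_minus_eq)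
qed

section \<open>Complex partial derivatives and Jacobian matrices\<close>

definition pd :: "(complex^'n \<Rightarrow> complex) \<Rightarrow> 'n \<Rightarrow> complex^'n \<Rightarrow> complex" where
  "pd f i z = frechet_derivative f (at z) (axis i 1)"

lemma has_derivative_sum_axis:
  assumes "(f has_derivative (\<lambda>h. \<Sum>i\<in>UNIV. D i * h $ i)) (at z)"
  shows "pd f i z = D i"
  unfolding pd_def frechet_derivative_at[OF assms, symmetric]
  by (simp add: axis_def mult_delta_right)

lemma poly_fun_has_derivative:
  assumes "poly_fun f"
  shows "(f has_derivative (\<lambda>h. \<Sum>i\<in>UNIV. pd f i z * h $ i)) (at z)" "poly_fun (pd f i)"
proof -
  have "\<exists>D. (\<forall>z. (f has_derivative (\<lambda>h. \<Sum>i\<in>UNIV. D i z * h $ i)) (at z)) \<and> (\<forall>i. poly_fun (D i))"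
    using assms
  proof (induction rule: poly_fun_induct)
    case (const c)
    show ?case by (intro exI[of _ "\<lambda>i z. 0"]) auto
  next
    case (coord j)
    have "((\<lambda>z. z $ j) has_derivative (\<lambda>h. \<Sum>i\<in>UNIV. (if i = j then 1 else 0) * h $ i)) (at z)" for z :: "complex^'a"
      using bounded_linear_imp_has_derivative[OF bounded_linear_vec_nth[of j], of "at z"]
      by (simp add: mult_delta_left)
    then show ?case by (intro exI[of _ "\<lambda>i z. if i = j then 1 else 0"]) auto
  next
    case (add f g)
    obtain D where D': "(\<forall>z. (f has_derivative (\<lambda>h. \<Sum>i\<in>UNIV. D i z * h $ i)) (at z)) \<and> (\<forall>i. poly_fun (D i))"
      using add.IH(1) by (elim exE)
    obtain E where E': "(\<forall>z. (g has_derivative (\<lambda>h. \<Sum>i\<in>UNIV. E i z * h $ i)) (at z)) \<and> (\<forall>i. poly_fun (E i))"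
      using add.IH(2) by (elim exE)
    note D = conjunct1[OF D', rule_format] conjunct2[OF D', rule_format]
      and E = conjunct1[OF E', rule_format] conjunct2[OF E', rule_format]
    have "((\<lambda>z. f z + g z) has_derivative (\<lambda>h. \<Sum>i\<in>UNIV. (D i z + E i z) * h $ i)) (at z)" for z
      using has_derivative_add[OF D(1)[of z] E(1)[of z]] by (simp add: distrib_right sum.distrib)
    then show ?case using D(2) E(2)
      by (intro exI[of _ "\<lambda>i z. D i z + E i z"] conjI allI) (blast intro: poly_fun_add)+
  next
    case (mult f g)
    obtain D where D': "(\<forall>z. (f has_derivative (\<lambda>h. \<Sum>i\<in>UNIV. D i z * h $ i)) (at z)) \<and> (\<forall>i. poly_fun (D i))"
      using mult.IH(1) by (elim exE)
    obtain E where E': "(\<forall>z. (g has_derivative (\<lambda>h. \<Sum>i\<in>UNIV. E i z * h $ i)) (at z)) \<and> (\<forall>i. poly_fun (E i))"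
      using mult.IH(2) by (elim exE)
    note D = conjunct1[OF D', rule_format] conjunct2[OF D', rule_format]
      and E = conjunct1[OF E', rule_format] conjunct2[OF E', rule_format]
    have "((\<lambda>z. f z * g z) has_derivative (\<lambda>h. \<Sum>i\<in>UNIV. (f z * E i z + D i z * g z) * h $ i)) (at z)" for z
      using has_derivative_mult[OF D(1)[of z] E(1)[of z]]
      by (simp add: algebra_simps sum.distrib sum_distrib_left)
    moreover have "poly_fun (\<lambda>z. f z * E i z + D i z * g z)" for i
      using D(2) E(2) mult(1,2) by (intro poly_fun_add poly_fun_mult) auto
    ultimately show ?case by (intro exI[of _ "\<lambda>i z. f z * E i z + D i z * g z"] conjI allI) assumption+
  qed
  then obtain D where D': "(\<forall>z. (f has_derivative (\<lambda>h. \<Sum>i\<in>UNIV. D i z * h $ i)) (at z)) \<and> (\<forall>i. poly_fun (D i))"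
    by (elim exE)
  note D = conjunct1[OF D', rule_format] conjunct2[OF D', rule_format]
  have eq: "pd f i = D i" for i using has_derivative_sum_axis[OF D(1)] by auto
  show "(f has_derivative (\<lambda>h. \<Sum>i\<in>UNIV. pd f i z * h $ i)) (at z)" "poly_fun (pd f i)"
    using D by (auto simp: eq)
qed

lemma poly_fun_continuous_on: "poly_fun f \<Longrightarrow> continuous_on A f"
  using poly_fun_has_derivative(1) by (meson continuous_at_imp_continuous_on has_derivative_continuous)

lemma poly_fun_holo_on:
  assumes "poly_fun f"
  shows "holo_on f U"
  unfolding holo_on_def
proof (intro ballI exI conjI allI)
  fix z
  show "(f has_derivative (\<lambda>h. \<Sum>i\<in>UNIV. pd f i z * h $ i)) (at z within U)"
    by (rule has_derivative_at_withinI[OF poly_fun_has_derivative(1)[OF assms]])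
  show "(\<Sum>i\<in>UNIV. pd f i z * (c *s v) $ i) = c * (\<Sum>i\<in>UNIV. pd f i z * v $ i)" for c v
    by (simp add: sum_distrib_left mult_ac)
qed

lemma pd_add:
  assumes "poly_fun f" "poly_fun g"
  shows "pd (\<lambda>z. f z + g z) i z = pd f i z + pd g i z"
proof (rule has_derivative_sum_axis[where D = "\<lambda>i. pd f i z + pd g i z"])
  show "((\<lambda>z. f z + g z) has_derivative (\<lambda>h. \<Sum>i\<in>UNIV. (pd f i z + pd g i z) * h $ i)) (at z)"
    using has_derivative_add[OF poly_fun_has_derivative(1)[OF assms(1)] poly_fun_has_derivative(1)[OF assms(2)], of z]
    by (simp add: algebra_simps sum.distrib sum_distrib_left)
qed

lemma pd_mult:
  assumes "poly_fun f" "poly_fun g"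
  shows "pd (\<lambda>z. f z * g z) i z = f z * pd g i z + pd f i z * g z"
proof (rule has_derivative_sum_axis[where D = "\<lambda>i. f z * pd g i z + pd f i z * g z"])
  show "((\<lambda>z. f z * g z) has_derivative (\<lambda>h. \<Sum>i\<in>UNIV. (f z * pd g i z + pd f i z * g z) * h $ i)) (at z)"
    using has_derivative_mult[OF poly_fun_has_derivative(1)[OF assms(1)] poly_fun_has_derivative(1)[OF assms(2)], of z]
    by (simp add: algebra_simps sum.distrib sum_distrib_left)
qed

lemma pd_const [simp]: "pd (\<lambda>z. c) i z = 0"
  by (simp add: pd_def)

lemma pd_coord: "pd (\<lambda>z. z $ j) i z = (if i = j then 1 else 0)"
  unfolding pd_def frechet_derivative_at[OF bounded_linear_imp_has_derivative[OF bounded_linear_vec_nth[of j], of "at z"], symmetric]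
  by (simp add: axis_def)

lemma pd_cmult: "poly_fun f \<Longrightarrow> pd (\<lambda>z. c * f z) i z = c * pd f i z"
  using pd_mult[of "\<lambda>_. c" f] by simp

lemma pd_power: "poly_fun f \<Longrightarrow> pd (\<lambda>z. f z ^ Suc k) i z = of_nat (Suc k) * f z ^ k * pd f i z"
proof (induction k)
  case (Suc k)
  have "pd (\<lambda>z. f z * f z ^ Suc k) i z = f z * pd (\<lambda>z. f z ^ Suc k) i z + pd f i z * f z ^ Suc k"
    by (rule pd_mult) (use Suc.prems in \<open>auto intro: poly_fun_power simp del: power_Suc\<close>)
  then show ?case using Suc by (simp add: algebra_simps)
qed simp


lemma has_derivative_vec_componentwise:
  fixes F :: "'a::real_normed_vector \<Rightarrow> complex^'n"
  assumes "\<And>i. ((\<lambda>z. F z $ i) has_derivative (\<lambda>h. D h $ i)) (at x within A)"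
  shows "(F has_derivative D) (at x within A)"
proof -
  have "((\<lambda>z. F z \<bullet> b) has_derivative (\<lambda>h. D h \<bullet> b)) (at x within A)" if bB: "b \<in> Basis" for b
  proof -
    obtain i u where b: "b = axis i u" "u \<in> Basis" using bB by (auto simp: Basis_vec_def)
    show ?thesis
      using has_derivative_inner_left[OF assms[of i], of u] by (simp add: b(1) inner_axis)
  qed
  then show ?thesis
    by (subst has_derivative_componentwise_within) blast
qed

lemma poly_map_has_derivative:
  assumes "\<And>i. poly_fun (\<lambda>z. F z $ i)"
  shows "(F has_derivative (\<lambda>h. \<chi> i. \<Sum>j\<in>UNIV. pd (\<lambda>z. F z $ i) j z * h $ j)) (at z)"
  by (rule has_derivative_vec_componentwise) (simp add: poly_fun_has_derivative(1)[OF assms])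

lemma pd_compose:
  assumes f: "poly_fun f" and F: "\<And>i. poly_fun (\<lambda>z. F z $ i)"
  shows "pd (\<lambda>z. f (F z)) j z = (\<Sum>k\<in>UNIV. pd f k (F z) * pd (\<lambda>z. F z $ k) j z)"
proof (rule has_derivative_sum_axis[where D = "\<lambda>j. \<Sum>k\<in>UNIV. pd f k (F z) * pd (\<lambda>z. F z $ k) j z"])
  have "((\<lambda>z. f (F z)) has_derivative
    (\<lambda>h. \<Sum>k\<in>UNIV. pd f k (F z) * (\<Sum>j\<in>UNIV. pd (\<lambda>z. F z $ k) j z * h $ j))) (at z)"
    using has_derivative_compose[OF poly_map_has_derivative[OF F] poly_fun_has_derivative(1)[OF f], of z] by simp
  also have "(\<lambda>h. \<Sum>k\<in>UNIV. pd f k (F z) * (\<Sum>j\<in>UNIV. pd (\<lambda>z. F z $ k) j z * h $ j)) =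
    (\<lambda>h. \<Sum>j\<in>UNIV. (\<Sum>k\<in>UNIV. pd f k (F z) * pd (\<lambda>z. F z $ k) j z) * h $ j)"
    unfolding sum_distrib_left sum_distrib_right by (subst sum.swap) (simp add: mult.assoc)
  finally show "((\<lambda>z. f (F z)) has_derivative
    (\<lambda>h. \<Sum>j\<in>UNIV. (\<Sum>k\<in>UNIV. pd f k (F z) * pd (\<lambda>z. F z $ k) j z) * h $ j)) (at z)" .
qed

definition jacm :: "(complex^'n \<Rightarrow> complex^'n) \<Rightarrow> complex^'n \<Rightarrow> complex^'n^'n" where
  "jacm F z = (\<chi> i j. pd (\<lambda>z. F z $ i) j z)"

lemma poly_fun_poly_map [simp]: "poly_fun (\<lambda>z. poly_map P z $ i)"
  by (simp add: poly_map_def)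

lemma jac_eq: "jac P z = det (jacm (poly_map P) z)"
proof -
  have "matrix (frechet_derivative (poly_map P) (at z)) = jacm (poly_map P) z"
    unfolding frechet_derivative_at[OF poly_map_has_derivative[OF poly_fun_poly_map], symmetric] jacm_def matrix_def
    by (simp add: vec_eq_iff axis_def mult_delta_right)
  then show ?thesis by (simp add: jac_def)
qed

lemma jacm_compose:
  assumes "\<And>i. poly_fun (\<lambda>z. H z $ i)" "\<And>i. poly_fun (\<lambda>z. F z $ i)"
  shows "jacm (\<lambda>z. H (F z)) z = jacm H (F z) ** jacm F z"
  unfolding jacm_def matrix_matrix_mult_def by (simp add: pd_compose[OF assms(1) assms(2)])

lemma jacm_matrix: "jacm (\<lambda>z. A *v z) z = A"
proof -
  have "pd (\<lambda>z. \<Sum>j\<in>UNIV. A $ i $ j * z $ j) k z = A $ i $ k" for i k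
    by (rule has_derivative_sum_axis, rule bounded_linear_imp_has_derivative)
      (intro bounded_linear_sum bounded_linear_mult_right[THEN bounded_linear_compose] bounded_linear_vec_nth)
  then show ?thesis by (simp add: jacm_def matrix_vector_mult_def vec_eq_iff)
qed

lemma poly_fun_det:
  assumes "\<And>i j. poly_fun (\<lambda>z. M z $ i $ j)"
  shows "poly_fun (\<lambda>z. det (M z))"
  unfolding det_def using assms by (intro poly_fun_sum poly_fun_mult poly_fun_prod) auto

lemma poly_fun_jac [simp]: "poly_fun (jac P)"
proof -
  have "poly_fun (\<lambda>z. det (jacm (poly_map P) z))"
    by (rule poly_fun_det) (simp add: jacm_def poly_fun_has_derivative(2))
  then show ?thesis unfolding jac_eq[abs_def, symmetric] by (simp add: jac_eq[abs_def])
qed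

text \<open>Over the complex numbers a nonzero polynomial is determined up to a unit by the orders
  of its roots; one linear factor is split off per step. Divisibility on a line thus reduces to a
  comparison of orders at each of its points.\<close>

lemma poly_dvd_by_order:
  fixes p q :: "complex poly"
  assumes "p \<noteq> 0" "\<And>a k. [:-a, 1:] ^ k dvd p \<Longrightarrow> [:-a, 1:] ^ k dvd q"
  shows "p dvd q"
  using assms
proof (induction "degree p" arbitrary: p q)
  case 0
  then have "is_unit p" by (simp add: is_unit_iff_degree)
  then show ?case by (rule unit_imp_dvd)
next
  case (Suc n)
  show ?case
  proof (cases "q = 0")
    case False
    obtain a where a: "poly p a = 0"
      using fundamental_theorem_of_algebra[of p] Suc(2) by (auto simp: constant_degree)
    then have d: "[:-a, 1:] dvd p" by (simp add: poly_eq_0_iff_dvd)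
    then obtain p' where p': "p = [:-a, 1:] * p'" by (elim dvdE)
    have "[:-a, 1:] dvd q" using Suc(4)[of a 1] d by simp
    then obtain q' where q': "q = [:-a, 1:] * q'" by (elim dvdE)
    have nz: "p' \<noteq> 0" "q' \<noteq> 0" using p' q' Suc(3) False by auto
    have ord: "Polynomial.order b ([:-a, 1:] * r) = Polynomial.order b [:-a, 1:] + Polynomial.order b r" if "r \<noteq> 0" for b r
      using that by (intro order_mult no_zero_divisors) auto
    have "p' dvd q'"
    proof (rule Suc(1))
      have "degree p = 1 + degree p'" unfolding p' using nz by (subst degree_mult_eq) auto
      then show "n = degree p'" using Suc(2) by simp
      fix b k assume "[:-b, 1:] ^ k dvd p'"
      then have "k \<le> Polynomial.order b p'" using nz by (simp add: order_divides)
      then have "Polynomial.order b [:-a, 1:] + k \<le> Polynomial.order b p" unfolding p' ord[OF nz(1)] by simp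
      then have "[:-b, 1:] ^ (Polynomial.order b [:-a, 1:] + k) dvd p" by (simp add: order_divides)
      then have "[:-b, 1:] ^ (Polynomial.order b [:-a, 1:] + k) dvd q" by (rule Suc(4))
      then have "Polynomial.order b [:-a, 1:] + k \<le> Polynomial.order b q" using False by (simp add: order_divides)
      then have "k \<le> Polynomial.order b q'" unfolding q' ord[OF nz(2)] by simp
      then show "[:-b, 1:] ^ k dvd q'" by (simp add: order_divides)
    qed (use nz in simp)
    then show ?thesis unfolding p' q' by (rule mult_dvd_mono[OF dvd_refl])
  qed simp
qed

lemma dvd_prod_diff:
  fixes a b :: "'i \<Rightarrow> 'r::comm_ring_1"
  assumes "finite I" "\<And>i. i \<in> I \<Longrightarrow> d dvd a i - b i"
  shows "d dvd prod a I - prod b I"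
  using assms
proof (induction I rule: finite_induct)
  case (insert i I)
  have "prod a (insert i I) - prod b (insert i I) = a i * (prod a I - prod b I) + (a i - b i) * prod b I"
    using insert.hyps by (simp add: algebra_simps)
  then show ?case using insert by (simp add: dvd_mult dvd_mult2)
qed simp

lemma dvd_det_diff:
  fixes A B :: "'r::comm_ring_1^'n^'n"
  assumes "\<And>i j. d dvd A $ i $ j - B $ i $ j"
  shows "d dvd det A - det B"
proof -
  have "det A - det B = (\<Sum>p | p permutes UNIV. of_int (sign p) * ((\<Prod>i\<in>UNIV. A $ i $ p i) - (\<Prod>i\<in>UNIV. B $ i $ p i)))"
    by (simp add: det_def sum_subtractf right_diff_distrib)
  then show ?thesis
    by (simp only:) (intro dvd_sum dvd_mult dvd_prod_diff assms finite)
qed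

lemma poly_det: "poly (det M) t = det (\<chi> i j. poly (M $ i $ j) t)"
  unfolding det_def by (simp add: poly_sum poly_prod)

text \<open>In the coordinates given by \<open>B\<close>, namely \<open>L\<close> in slot
  \<open>i0\<close> and the components of \<open>y - L(y) a\<close> elsewhere, the matrix becomes
  diagonal with \<open>c\<close> in slot \<open>i0\<close> and 1 elsewhere.\<close>

lemma det_rank_one_update:
  fixes a L :: "complex^'n"
  assumes aL: "(\<Sum>i\<in>UNIV. L $ i * a $ i) = 1"
  shows "det (\<chi> i j. (if i = j then 1 else 0) + (c - 1) * a $ i * L $ j) = c"
proof -
  define l where "l y = (\<Sum>i\<in>UNIV. L $ i * y $ i)" for y :: "complex^'n"
  obtain i0 where i0: "L $ i0 * a $ i0 \<noteq> 0"
    using aL sum.neutral[of UNIV "\<lambda>i. L $ i * a $ i"] by fastforce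
  define M where "M = (\<chi> i j. (if i = j then 1 else 0) + (c - 1) * a $ i * L $ j)"
  define B where "B = (\<chi> i j. if i = i0 then L $ j else (if i = j then 1 else 0) - a $ i * L $ j)"
  define D where "D = (\<chi> i j. if i = j then (if i = i0 then c else 1) else 0)"
  have By: "(B *v y) $ i = (if i = i0 then l y else y $ i - a $ i * l y)" for y i
    unfolding B_def l_def matrix_vector_mult_def
    by (auto simp: left_diff_distrib sum_subtractf sum_distrib_left mult.assoc mult_delta_left)
  have My: "(M *v y) $ i = y $ i + (c - 1) * a $ i * l y" for y i
    unfolding M_def l_def matrix_vector_mult_def
    by (auto simp: distrib_right sum.distrib sum_distrib_left mult.assoc mult_delta_left)
  have Dy: "(D *v y) $ i = (if i = i0 then c else 1) * y $ i" for y i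
    unfolding D_def matrix_vector_mult_def
    by (simp add: mult_delta_left)
  have lM: "l (M *v y) = c * l y" for y
  proof -
    have "l (M *v y) = (\<Sum>i\<in>UNIV. L $ i * y $ i + (c - 1) * l y * (L $ i * a $ i))"
      unfolding l_def[of "M *v y"] My by (simp add: algebra_simps)
    also have "\<dots> = l y + (c - 1) * l y * 1"
      unfolding sum.distrib sum_distrib_left[symmetric] aL by (simp add: l_def)
    finally show ?thesis by (simp add: algebra_simps)
  qed
  have "(B ** M) *v y = (D ** B) *v y" for y
    unfolding matrix_vector_mul_assoc[symmetric] vec_eq_iff By Dy lM My by (auto simp: algebra_simps)
  then have "B ** M = D ** B" by (simp add: matrix_eq)
  then have "det B * det M = det D * det B" by (metis det_mul)
  moreover have "det B \<noteq> 0"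
  proof -
    have "y = 0" if "B *v y = 0" for y
    proof -
      have *: "(B *v y) $ i = 0" for i using that by simp
      have l0: "l y = 0" using *[of i0] unfolding By by simp
      have y0: "y $ i = 0" if "i \<noteq> i0" for i using *[of i] that l0 unfolding By by simp
      have "l y = L $ i0 * y $ i0" unfolding l_def
        by (subst sum.remove[of _ i0]) (auto simp: y0)
      then have "y $ i0 = 0" using l0 i0 by auto
      then show "y = 0" using y0 by (metis vec_eq_iff zero_index)
    qed
    then have "invertible B" unfolding invertible_left_inverse matrix_left_invertible_ker by blast
    then show ?thesis by (simp add: invertible_det_nz)
  qed
  moreover have "det D = c"
    by (subst det_diagonal) (auto simp: D_def prod.remove[of UNIV i0] intro!: prod.neutral)
  ultimately show ?thesis unfolding M_def by simp
qed

section \<open>Invariants and the order of the Jacobian\<close>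

lemma group_GL: "Group.group (GL :: (complex^'n^'n) monoid)"
proof (rule groupI)
  fix A :: "complex^'n^'n" assume "A \<in> carrier GL"
  then obtain B where "A ** B = mat 1" "B ** A = mat 1" by (auto simp: GL_def invertible_def)
  then show "\<exists>y\<in>carrier GL. y \<otimes>\<^bsub>GL\<^esub> A = \<one>\<^bsub>GL\<^esub>"
    by (intro bexI[of _ B]) (auto simp: GL_def invertible_def)
next
  have "invertible (mat 1 :: complex^'n^'n)" unfolding invertible_def by (rule exI[of _ "mat 1"]) simp
  then show "\<one>\<^bsub>GL\<^esub> \<in> carrier (GL :: (complex^'n^'n) monoid)" by (simp add: GL_def)
qed (simp_all add: GL_def invertible_mult matrix_mul_assoc)

locale reflection_invariants =
  fixes G :: "(complex^'n^'n) set" and P :: "'n \<Rightarrow> 'n cpoly"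
  assumes group: "finite_reflection_group G" and basic: "basic_invariants G P"
begin

abbreviation "th \<equiv> poly_map P"

lemma G_finite: "finite G"
  using group by (simp add: finite_reflection_group_def)

lemma G_subgroup: "subgroup G GL"
proof -
  obtain R where R: "\<forall>A\<in>R. complex_reflection A" "G = generate GL R"
    using group unfolding finite_reflection_group_def by blast
  then have "R \<subseteq> carrier GL" by (auto simp: complex_reflection_def)
  then show ?thesis unfolding R(2) by (rule group.generate_is_subgroup[OF group_GL])
qed

lemma G_one: "mat 1 \<in> G"
  using subgroup.one_closed[OF G_subgroup] by (simp add: GL_def)

lemma G_mult: "A \<in> G \<Longrightarrow> B \<in> G \<Longrightarrow> A ** B \<in> G"
  using subgroup.m_closed[OF G_subgroup] by (simp add: GL_def)

lemma G_inverse: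
  assumes "A \<in> G"
  obtains B where "B \<in> G" "A ** B = mat 1" "B ** A = mat 1"
proof -
  interpret GL: Group.group GL by (rule group_GL)
  have c: "A \<in> carrier GL" using subgroup.subset[OF G_subgroup] assms by auto
  have "inv\<^bsub>GL\<^esub> A \<in> G" by (rule subgroup.m_inv_closed[OF G_subgroup assms])
  moreover have "A ** inv\<^bsub>GL\<^esub> A = mat 1" "inv\<^bsub>GL\<^esub> A ** A = mat 1"
    using GL.r_inv[OF c] GL.l_inv[OF c] by (simp_all add: GL_def)
  ultimately show ?thesis by (rule that)
qed

lemma G_det: "A \<in> G \<Longrightarrow> det A \<noteq> 0"
  by (metis G_inverse det_I det_mul mult_zero_left zero_neq_one)

lemma G_cancel: "A \<in> G \<Longrightarrow> A *v x = A *v y \<Longrightarrow> x = y"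
  by (metis G_inverse matrix_vector_mul_assoc matrix_vector_mul_lid)

lemma bij_G_mult:
  assumes A: "A \<in> G"
  shows "bij_betw (\<lambda>B. B ** A) G G"
proof -
  obtain C where C: "C \<in> G" "A ** C = mat 1" "C ** A = mat 1" by (rule G_inverse[OF A])
  show ?thesis
  proof (rule bij_betwI[of _ _ _ "\<lambda>B. B ** C"])
  show "(\<lambda>B. B ** A) \<in> G \<rightarrow> G" using A G_mult by auto
  show "(\<lambda>B. B ** C) \<in> G \<rightarrow> G" using C G_mult by auto
  show "B ** A ** C = B" "B ** C ** A = B" for B
    using C by (simp_all flip: matrix_mul_assoc)
  qed
qed

lemma sum_G: "A \<in> G \<Longrightarrow> (\<Sum>B\<in>G. f (B ** A)) = (\<Sum>B\<in>G. f B)"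
  using sum.reindex_bij_betw[OF bij_G_mult, of A f] by simp

lemma th_invariant: "A \<in> G \<Longrightarrow> th (A *v z) = th z"
  using basic by (simp add: basic_invariants_def cpoly_invariant_def poly_map_def vec_eq_iff)

lemma invariant_poly_fun:
  assumes "poly_fun f" "\<And>A z. A \<in> G \<Longrightarrow> f (A *v z) = f z"
  obtains q where "\<And>z. f z = cpoly_eval q (th z)"
proof -
  obtain p where p: "f = cpoly_eval p" using assms(1) by (auto simp: poly_fun_def)
  then have "cpoly_invariant G p" using assms(2) by (simp add: cpoly_invariant_def)
  then show ?thesis using basic that unfolding p basic_invariants_def by blast
qed

lemma jac_skew:
  assumes "A \<in> G"
  shows "jac P (A *v z) * det A = jac P z"
proof -
  have "jacm (\<lambda>z. th (A *v z)) z = jacm th (A *v z) ** A"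
    using jacm_compose[of th "\<lambda>z. A *v z" z] by (simp add: jacm_matrix poly_fun_matrix)
  moreover have "(\<lambda>z. th (A *v z)) = th" using th_invariant[OF assms] by auto
  ultimately show ?thesis by (simp add: jac_eq det_mul)
qed

end

text \<open>Divisibility by the \<open>s\<close>-th power of a polynomial that is 0 at
  \<open>c\<close>. This explicit form survives products and linear substitution, and
  differentiation at the cost of one power.\<close>

abbreviation vanishes :: "nat \<Rightarrow> complex^'n \<Rightarrow> (complex^'n \<Rightarrow> complex) \<Rightarrow> bool" where
  "vanishes s c b \<equiv> \<exists>a g. poly_fun a \<and> poly_fun g \<and> a c = 0 \<and> (\<forall>y. b y = a y ^ s * g y)"

lemma poly_fun_bump:
  fixes x :: "complex^'n"
  assumes "finite E" "x \<notin> E"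
  obtains b where "poly_fun b" "b x = 1"
    "\<And>c. c \<in> E \<Longrightarrow> vanishes s c b"
proof -
  have "\<exists>b. poly_fun b \<and> b x = 1 \<and>
    (\<forall>c\<in>E. vanishes s c b)"
    using assms
  proof (induction E rule: finite_induct)
    case empty
    show ?case by (intro exI[of _ "\<lambda>_. 1"]) auto
  next
    case (insert c E)
    then obtain b where b: "poly_fun b" "b x = 1"
      "\<forall>c\<in>E. vanishes s c b" by auto
    obtain i where i: "x $ i \<noteq> c $ i" using insert.prems by (auto simp: vec_eq_iff)
    define \<alpha> where "\<alpha> y = (y $ i - c $ i) / (x $ i - c $ i)" for y :: "complex^'n"
    have \<alpha>: "poly_fun \<alpha>" "\<alpha> c = 0" "\<alpha> x = 1"
      unfolding \<alpha>_def using i by (auto intro!: poly_fun_divide poly_fun_diff)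
    have pw: "poly_fun (\<lambda>y. \<alpha> y ^ s)" by (rule poly_fun_power[OF \<alpha>(1)])
    show ?case
    proof (rule exI[of _ "\<lambda>y. b y * \<alpha> y ^ s"], intro conjI ballI)
      show "poly_fun (\<lambda>y. b y * \<alpha> y ^ s)" by (rule poly_fun_mult[OF b(1) pw])
      show "b x * \<alpha> x ^ s = 1" using b \<alpha> by simp
      fix d assume d: "d \<in> insert c E"
      show "vanishes s d (\<lambda>y. b y * \<alpha> y ^ s)"
      proof (cases "d = c")
        case True
        then show ?thesis using \<alpha> b(1) by (intro exI[of _ \<alpha>] exI[of _ b]) (auto simp: mult.commute)
      next
        case False
        then obtain \<alpha>' g where "poly_fun \<alpha>'" "poly_fun g" "\<alpha>' d = 0" "\<forall>y. b y = \<alpha>' y ^ s * g y"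
          using b(3) d by blast
        then show ?thesis
          by (intro exI[of _ \<alpha>'] exI[of _ "\<lambda>y. g y * \<alpha> y ^ s"]) (auto intro!: poly_fun_mult[OF _ pw])
      qed
    qed
  qed
  then show ?thesis using that by blast
qed

text \<open>From a bump \<open>b\<close> with \<open>b x = 1\<close> the polynomial
  \<open>1 - (1 - b)^s\<close> equals 1 to order \<open>s\<close> at \<open>x\<close>, and being
  divisible by \<open>b\<close> it inherits the zeros on \<open>E\<close>.\<close>

lemma poly_fun_cutoff:
  fixes x :: "complex^'n"
  assumes "finite E" "x \<notin> E"
  obtains h where "poly_fun h"
    "\<exists>a. poly_fun a \<and> a x = 0 \<and> (\<forall>y. h y - 1 = a y ^ s * (- 1))"
    "\<And>c. c \<in> E \<Longrightarrow> vanishes s c h"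
proof -
  obtain b where b: "poly_fun b" "b x = 1"
    "\<And>c. c \<in> E \<Longrightarrow> vanishes s c b"
    by (rule poly_fun_bump[OF assms, where s = s]) blast
  define h where "h y = 1 - (1 - b y) ^ s" for y
  have p1: "poly_fun (\<lambda>y. 1 - b y)" by (intro poly_fun_diff b) simp
  have hb: "h y = b y * (\<Sum>k<s. (1 - b y) ^ k)" for y
    unfolding h_def using one_diff_power_eq[of "1 - b y" s] by simp
  have ps: "poly_fun (\<lambda>y. \<Sum>k<s. (1 - b y) ^ k)" by (intro poly_fun_sum poly_fun_power p1)
  have 3: "vanishes s c h" if c: "c \<in> E" for c
  proof -
    obtain a g where ab: "poly_fun a" "poly_fun g" "a c = 0" "\<forall>y. b y = a y ^ s * g y"
      using b(3)[OF c] by blast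
    show ?thesis
    proof (rule exI[of _ a], rule exI[of _ "\<lambda>y. g y * (\<Sum>k<s. (1 - b y) ^ k)"], intro conjI allI)
      show "poly_fun (\<lambda>y. g y * (\<Sum>k<s. (1 - b y) ^ k))" by (rule poly_fun_mult[OF ab(2) ps])
      show "h y = a y ^ s * (g y * (\<Sum>k<s. (1 - b y) ^ k))" for y
        using ab(4) hb[of y] by (simp add: mult.assoc)
    qed (use ab in auto)
  qed
  have 2: "\<exists>a. poly_fun a \<and> a x = 0 \<and> (\<forall>y. h y - 1 = a y ^ s * (- 1))"
    by (rule exI[of _ "\<lambda>y. 1 - b y"]) (use p1 b(2) in \<open>simp add: h_def\<close>)
  have 1: "poly_fun h" unfolding h_def by (intro poly_fun_diff poly_fun_power p1) simp
  show ?thesis by (rule that[OF 1 2 3])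
qed

text \<open>Only first derivatives are recorded, since the jet matters through the Jacobian matrix
  alone; they have to vanish to order \<open>e\<close> at \<open>x\<close> along every line.\<close>

definition flat_at :: "nat \<Rightarrow> complex^'n \<Rightarrow> (complex^'n \<Rightarrow> complex) \<Rightarrow> bool" where
  "flat_at e x r \<longleftrightarrow> poly_fun r \<and> (\<forall>j v. [:0, 1:] ^ e dvd line_poly (pd r j) x v)"

lemma line_poly_add:
  "poly_fun f \<Longrightarrow> poly_fun g \<Longrightarrow> line_poly (\<lambda>z. f z + g z) x v = line_poly f x v + line_poly g x v"
  by (rule line_poly_unique) (auto simp: poly_line_poly)

lemma line_poly_mult:
  "poly_fun f \<Longrightarrow> poly_fun g \<Longrightarrow> line_poly (\<lambda>z. f z * g z) x v = line_poly f x v * line_poly g x v"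
  by (rule line_poly_unique) (auto simp: poly_line_poly)

lemma flat_at_add:
  assumes "flat_at e x r" "flat_at e x s"
  shows "flat_at e x (\<lambda>y. r y + s y)"
proof -
  have p: "poly_fun r" "poly_fun s" using assms by (auto simp: flat_at_def)
  have "pd (\<lambda>y. r y + s y) j = (\<lambda>z. pd r j z + pd s j z)" for j
    using pd_add[OF p] by auto
  then show ?thesis using assms p
    by (simp add: flat_at_def poly_fun_add line_poly_add poly_fun_has_derivative(2))
qed

lemma flat_at_0: "flat_at e x (\<lambda>_. 0)"
proof -
  have "pd (\<lambda>_. 0) j = (\<lambda>_. 0)" for j :: 'a by auto
  moreover have "line_poly (\<lambda>_. 0) x v = 0" for v by (rule line_poly_unique) auto
  ultimately show ?thesis by (simp add: flat_at_def)
qed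

lemma flat_at_sum: "(\<And>i. i \<in> I \<Longrightarrow> flat_at e x (f i)) \<Longrightarrow> flat_at e x (\<lambda>y. \<Sum>i\<in>I. f i y)"
  by (induction I rule: infinite_finite_induct) (simp_all add: flat_at_0 flat_at_add)

lemma flat_at_power_mult:
  assumes a: "poly_fun f" "f x = 0" and b: "poly_fun h"
  shows "flat_at e x (\<lambda>y. f y ^ Suc e * h y)"
  unfolding flat_at_def
proof (intro conjI allI)
  have pe: "poly_fun (\<lambda>y. f y ^ Suc e)" "poly_fun (\<lambda>y. f y ^ e)" by (rule poly_fun_power[OF a(1)])+
  show "poly_fun (\<lambda>y. f y ^ Suc e * h y)" by (rule poly_fun_mult[OF pe(1) b])
  fix j v
  define \<gamma> where "\<gamma> y = f y * pd h j y + of_nat (Suc e) * pd f j y * h y" for y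
  have g: "poly_fun \<gamma>" unfolding \<gamma>_def
    by (intro poly_fun_add poly_fun_mult a b poly_fun_has_derivative(2)) auto
  have "pd (\<lambda>y. f y ^ Suc e * h y) j = (\<lambda>y. f y ^ e * \<gamma> y)"
    unfolding pd_mult[OF pe(1) b] pd_power[OF a(1)] \<gamma>_def by (auto simp: algebra_simps)
  then have "line_poly (pd (\<lambda>y. f y ^ Suc e * h y) j) x v = line_poly (\<lambda>y. f y ^ e) x v * line_poly \<gamma> x v"
    using line_poly_mult[OF pe(2) g] by simp
  also have "line_poly (\<lambda>y. f y ^ e) x v = line_poly f x v ^ e"
    by (rule line_poly_unique[OF pe(2)]) (simp add: poly_line_poly[OF a(1)])
  finally have eq: "line_poly (pd (\<lambda>y. f y ^ Suc e * h y) j) x v = line_poly f x v ^ e * line_poly \<gamma> x v" .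
  have "poly (line_poly f x v) 0 = 0" using a by (simp add: poly_line_poly)
  then have "[:- 0, 1:] dvd line_poly f x v" using poly_eq_0_iff_dvd by blast
  then have "[:0, 1:] dvd line_poly f x v" by (simp only: minus_zero)
  then show "[:0, 1:] ^ e dvd line_poly (pd (\<lambda>y. f y ^ Suc e * h y) j) x v"
    unfolding eq by (intro dvd_mult2 dvd_power_same)
qed


context reflection_invariants
begin

definition stab :: "complex^'n \<Rightarrow> (complex^'n^'n) set" where
  "stab x = {A \<in> G. A *v x = x}"

lemma stab_sub: "stab x \<subseteq> G"
  by (auto simp: stab_def)

lemma stab_finite: "finite (stab x)"
  using finite_subset[OF stab_sub G_finite] .

lemma stab_one: "mat 1 \<in> stab x"
  by (simp add: stab_def G_one)

text \<open>Averaging a locally invariant map against a cut-off produces a globally invariant one with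
  the same jet.\<close>

lemma invariant_map_with_jet:
  fixes g :: "complex^'n \<Rightarrow> complex^'n"
  assumes k: "\<And>i. poly_fun (\<lambda>y. g y $ i)" and inv: "\<And>A y. A \<in> stab x \<Longrightarrow> g (A *v y) = g y"
  shows "\<exists>f. (\<forall>i. poly_fun (\<lambda>y. f y $ i)) \<and> (\<forall>A\<in>G. \<forall>y. f (A *v y) = f y) \<and>
    (\<forall>i. flat_at e x (\<lambda>y. f y $ i - of_nat (card (stab x)) * g y $ i))"
proof -
  \<comment> \<open>The other points of the orbit of \<open>x\<close>. Each element of
    \<open>stab x\<close> contributes a copy of \<open>g\<close> near \<open>x\<close>, the origin
    of the factor \<open>card (stab x)\<close>.\<close>
  define E where "E = (\<lambda>A. A *v x) ` (G - stab x)"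
  have E: "finite E" "x \<notin> E" unfolding E_def stab_def using G_finite by auto
  \<comment> \<open>The exponent is \<open>Suc e\<close> because differentiation costs one
    power.\<close>
  obtain h where h: "poly_fun h"
    and h1: "\<exists>a. poly_fun a \<and> a x = 0 \<and> (\<forall>y. h y - 1 = a y ^ Suc e * (- 1))"
    and h0: "\<And>c. c \<in> E \<Longrightarrow> vanishes (Suc e) c h"
    by (rule poly_fun_cutoff[OF E, where s = "Suc e"]) blast
  define f where "f y = (\<Sum>A\<in>G. h (A *v y) *s g (A *v y))" for y
  have fi: "f y $ i = (\<Sum>A\<in>G. h (A *v y) * g (A *v y) $ i)" for y i
    unfolding f_def by simp
  have kA: "poly_fun (\<lambda>y. g (A *v y) $ i)" for A i
    by (rule poly_fun_compose_matrix[OF k[of i]])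
  have hA: "poly_fun (\<lambda>y. h (A *v y))" for A by (rule poly_fun_compose_matrix[OF h])
  show ?thesis
  proof (rule exI[of _ f], intro conjI allI ballI)
    show "poly_fun (\<lambda>y. f y $ i)" for i
      unfolding fi by (intro poly_fun_sum poly_fun_mult hA kA)
    show "f (A *v y) = f y" if "A \<in> G" for A y
      unfolding f_def matrix_vector_mul_assoc by (rule sum_G[OF that, of "\<lambda>B. h (B *v y) *s g (B *v y)"])
    fix i
    have st: "flat_at e x (\<lambda>y. (h (A *v y) - 1) * g y $ i)" if A: "A \<in> stab x" for A
    proof -
      obtain a where a: "poly_fun a" "a x = 0" "\<forall>y. h y - 1 = a y ^ Suc e * (- 1)" using h1 by blast
      have "flat_at e x (\<lambda>y. a (A *v y) ^ Suc e * (- g y $ i))"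
        using A a by (intro flat_at_power_mult poly_fun_compose_matrix poly_fun_minus k) (auto simp: stab_def)
      then show ?thesis using a(3) by simp
    qed
    have ns: "flat_at e x (\<lambda>y. h (A *v y) * g (A *v y) $ i)" if A: "A \<in> G - stab x" for A
    proof -
      have "A *v x \<in> E" using A by (auto simp: E_def)
      from h0[OF this] obtain a b where a: "poly_fun a" "poly_fun b" "a (A *v x) = 0" "\<forall>y. h y = a y ^ Suc e * b y"
        by blast
      have "flat_at e x (\<lambda>y. a (A *v y) ^ Suc e * (b (A *v y) * g (A *v y) $ i))"
        using a by (intro flat_at_power_mult poly_fun_compose_matrix[OF a(1)] poly_fun_mult
          poly_fun_compose_matrix[OF a(2)] kA) auto
      then show ?thesis using a(4) by (simp add: mult.assoc)
    qed
    have "f y $ i - of_nat (card (stab x)) * g y $ i =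
      (\<Sum>A\<in>stab x. (h (A *v y) - 1) * g y $ i) + (\<Sum>A\<in>G - stab x. h (A *v y) * g (A *v y) $ i)" for y
    proof -
      have "f y $ i = (\<Sum>A\<in>stab x. h (A *v y) * g y $ i) + (\<Sum>A\<in>G - stab x. h (A *v y) * g (A *v y) $ i)"
        unfolding fi using sum.subset_diff[OF stab_sub G_finite, of "\<lambda>A. h (A *v y) * g (A *v y) $ i" x]
        by (simp add: inv add.commute)
      then show ?thesis by (simp add: left_diff_distrib sum_subtractf)
    qed
    then have eq: "(\<lambda>y. f y $ i - of_nat (card (stab x)) * g y $ i) =
      (\<lambda>y. (\<Sum>A\<in>stab x. (h (A *v y) - 1) * g y $ i) + (\<Sum>A\<in>G - stab x. h (A *v y) * g (A *v y) $ i))" by auto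
    show "flat_at e x (\<lambda>y. f y $ i - of_nat (card (stab x)) * g y $ i)"
      unfolding eq by (intro flat_at_add flat_at_sum st ns)
  qed
qed

text \<open>The map \<open>\<kappa>\<close> raises the coordinate \<open>L (y - x)\<close> to the power \<open>e\<close>, so its Jacobian has order exactly \<open>e - 1\<close>
  at \<open>x\<close>. An invariant map with the same jet factors through the basic invariants, so its Jacobian is a
  multiple of \<open>jac P\<close>.\<close>

lemma jac_order_less:
  assumes La: "(\<Sum>i\<in>UNIV. L $ i * a $ i) = 1"
    and act: "\<And>A y. A \<in> stab x \<Longrightarrow> A *v y = y + ((\<omega> A - 1) * (\<Sum>i\<in>UNIV. L $ i * y $ i)) *s a"
    and om: "\<And>A. A \<in> stab x \<Longrightarrow> \<omega> A ^ e = 1" and e: "0 < e"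
    and v: "(\<Sum>i\<in>UNIV. L $ i * v $ i) \<noteq> 0"
  shows "\<not> [:0, 1:] ^ e dvd line_poly (jac P) x v"
proof
  assume dvdJ: "[:0, 1:] ^ e dvd line_poly (jac P) x v"
  define l where "l y = (\<Sum>i\<in>UNIV. L $ i * y $ i)" for y :: "complex^'n"
  have l_add: "l (y + z) = l y + l z" for y z by (simp add: l_def distrib_left sum.distrib)
  have l_sc: "l (c *s y) = c * l y" for c y by (simp add: l_def sum_distrib_left mult_ac)
  have l_diff: "l (y - z) = l y - l z" for y z by (simp add: l_def right_diff_distrib sum_subtractf)
  have la: "l a = 1" using La by (simp add: l_def)
  have l_pf: "poly_fun l" unfolding l_def by (intro poly_fun_sum poly_fun_mult) auto
  have lx_pf: "poly_fun (\<lambda>y. l (y - x))"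
    unfolding l_diff by (intro poly_fun_diff l_pf) simp
  define \<kappa> where "\<kappa> y = y + (l (y - x) ^ e - l (y - x)) *s a" for y
  have k_pf: "poly_fun (\<lambda>y. \<kappa> y $ i)" for i
    unfolding \<kappa>_def by (auto intro!: poly_fun_add poly_fun_mult poly_fun_diff poly_fun_power lx_pf)
  have k_inv: "\<kappa> (A *v y) = \<kappa> y" if A: "A \<in> stab x" for A y
  proof -
    have "A *v y - x = A *v (y - x)" using A by (simp add: stab_def matrix_vector_mult_diff_distrib)
    also have "\<dots> = (y - x) + ((\<omega> A - 1) * l (y - x)) *s a" using act[OF A, of "y - x"] by (simp add: l_def)
    finally have eq: "A *v y - x = (y - x) + ((\<omega> A - 1) * l (y - x)) *s a" .
    then have lA: "l (A *v y - x) = \<omega> A * l (y - x)"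
      unfolding eq l_add l_sc la by (simp add: algebra_simps)
    have "A *v y = y + ((\<omega> A - 1) * l (y - x)) *s a" using eq by (simp add: algebra_simps)
    then show ?thesis
      unfolding \<kappa>_def lA power_mult_distrib om[OF A]
      by (simp add: vec_eq_iff algebra_simps)
  qed
  obtain f where f': "(\<forall>i. poly_fun (\<lambda>y. f y $ i)) \<and> (\<forall>A\<in>G. \<forall>y. f (A *v y) = f y) \<and>
    (\<forall>i. flat_at e x (\<lambda>y. f y $ i - of_nat (card (stab x)) * \<kappa> y $ i))"
    using invariant_map_with_jet[of \<kappa> x e] k_pf k_inv by blast
  note f = conjunct1[OF f', rule_format] conjunct1[OF conjunct2[OF f'], rule_format]
    conjunct2[OF conjunct2[OF f'], rule_format]
  have "\<exists>q. \<forall>y. f y $ i = cpoly_eval q (th y)" for i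
    using invariant_poly_fun[OF f(1)[of i]] f(2) by metis
  then obtain Q where Q: "\<And>i y. f y $ i = cpoly_eval (Q i) (th y)" by metis
  have fQ: "f = (\<lambda>y. poly_map Q (th y))" by (auto simp: vec_eq_iff Q poly_map_def)
  have jf: "jacm f y = jacm (poly_map Q) (th y) ** jacm th y" for y
    unfolding fQ by (rule jacm_compose) auto
  \<comment> \<open>\<open>M\<close> and \<open>M'\<close> are Jacobian matrices along the line,
    with entries in the polynomial ring in \<open>t\<close>; entries that agree modulo
    \<open>t ^ e\<close> give determinants that agree modulo \<open>t ^ e\<close>.\<close>
  define M where "M = (\<chi> i j. line_poly (pd (\<lambda>y. f y $ i) j) x v)"
  define c where "c = (of_nat (card (stab x)) :: complex)"
  define M' where "M' = (\<chi> i j. line_poly (\<lambda>y. c * pd (\<lambda>y. \<kappa> y $ i) j y) x v)"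
  have dp: "poly (det M) t = det (jacm f (x + t *s v))" for t
    unfolding poly_det M_def jacm_def by (simp add: poly_line_poly poly_fun_has_derivative(2)[OF f(1)])
  have "poly_fun (\<lambda>y. det (jacm (poly_map Q) y))"
    by (rule poly_fun_det) (simp add: jacm_def poly_fun_has_derivative(2))
  then have dQ: "poly_fun (\<lambda>y. det (jacm (poly_map Q) (th y)))" by (rule poly_fun_compose) simp
  have "det M = line_poly (\<lambda>y. det (jacm (poly_map Q) (th y)) * jac P y) x v"
  proof (rule line_poly_unique[symmetric])
    show "poly_fun (\<lambda>y. det (jacm (poly_map Q) (th y)) * jac P y)" by (rule poly_fun_mult[OF dQ]) simp
    show "poly (det M) t = det (jacm (poly_map Q) (th (x + t *s v))) * jac P (x + t *s v)" for t
      unfolding dp jf jac_eq by (rule det_mul)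
  qed
  also have "\<dots> = line_poly (\<lambda>y. det (jacm (poly_map Q) (th y))) x v * line_poly (jac P) x v"
    by (rule line_poly_mult[OF dQ]) simp
  finally have d1: "[:0, 1:] ^ e dvd det M" using dvdJ by simp
  have d2: "[:0, 1:] ^ e dvd det M - det M'"
  proof (rule dvd_det_diff)
    fix i j
    define r where "r y = f y $ i - c * \<kappa> y $ i" for y
    have r: "flat_at e x r" using f(3)[of i] by (simp add: r_def[abs_def] c_def)
    have ck: "poly_fun (\<lambda>y. c * \<kappa> y $ i)" by (intro poly_fun_mult k_pf) simp
    have "f y $ i = r y + c * \<kappa> y $ i" for y by (simp add: r_def)
    then have "(\<lambda>y. f y $ i) = (\<lambda>y. r y + c * \<kappa> y $ i)" by auto
    then have "pd (\<lambda>y. f y $ i) j = (\<lambda>y. pd r j y + c * pd (\<lambda>y. \<kappa> y $ i) j y)"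
      using pd_add[of r "\<lambda>y. c * \<kappa> y $ i" j] pd_cmult[OF k_pf[of i], of c j] r ck
      by (auto simp: flat_at_def)
    then have "M $ i $ j - M' $ i $ j = line_poly (pd r j) x v"
      using r unfolding M_def M'_def flat_at_def
      by (simp add: line_poly_add poly_fun_has_derivative(2) k_pf poly_fun_mult)
    then show "[:0, 1:] ^ e dvd M $ i $ j - M' $ i $ j" using r by (simp add: flat_at_def)
  qed
  \<comment> \<open>Along the line the Jacobian determinant of \<open>c * \<kappa>\<close> is
    exactly \<open>K * t ^ (e - 1)\<close>, with \<open>K \<noteq> 0\<close>, so it is not divisible
    by \<open>t ^ e\<close>.\<close>
  define K where "K = c ^ CARD('n) * of_nat e * l v ^ (e - 1)"
  have K: "K \<noteq> 0"
    unfolding K_def c_def using e v stab_finite[of x] stab_one[of x] by (auto simp: l_def card_eq_0_iff)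
  have "det M' = Polynomial.monom K (e - 1)"
  proof -
    have "poly (det M') t = poly (Polynomial.monom K (e - 1)) t" for t
    proof -
      have lt: "l (x + t *s v - x) = t * l v" by (simp add: l_sc)
      have pdk: "pd (\<lambda>y. \<kappa> y $ i) j y = (if i = j then 1 else 0) + (of_nat e * l (y - x) ^ (e - 1) - 1) * a $ i * L $ j" for i j y
      proof (rule has_derivative_sum_axis)
        have "bounded_linear l"
          unfolding l_def by (intro bounded_linear_sum bounded_linear_mult_right[THEN bounded_linear_compose] bounded_linear_vec_nth)
        have eq: "(\<lambda>y. \<kappa> y $ i) = (\<lambda>y. y $ i + ((l y - l x) ^ e - (l y - l x)) * a $ i)" for i
          by (simp add: \<kappa>_def l_diff algebra_simps)
        note D = bounded_linear_imp_has_derivative[OF \<open>bounded_linear l\<close>] bounded_linear_imp_has_derivative[OF bounded_linear_vec_nth]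
        have "((\<lambda>y. y $ i + ((l y - l x) ^ e - (l y - l x)) * a $ i) has_derivative
            (\<lambda>h. h $ i + (of_nat e * l h * (l y - l x) ^ (e - 1) - l h) * a $ i)) (at y)"
          by (rule derivative_eq_intros D refl)+ simp
        moreover have "h $ i + (of_nat e * l h * (l y - l x) ^ (e - 1) - l h) * a $ i =
            (\<Sum>j\<in>UNIV. ((if i = j then 1 else 0) + (of_nat e * l (y - x) ^ (e - 1) - 1) * a $ i * L $ j) * h $ j)" for h
          by (simp add: distrib_right sum.distrib mult_delta_left l_diff)
            (simp add: l_def sum_distrib_left sum_distrib_right algebra_simps sum_subtractf)
        ultimately show "((\<lambda>y. \<kappa> y $ i) has_derivative
            (\<lambda>h. \<Sum>j\<in>UNIV. ((if i = j then 1 else 0) + (of_nat e * l (y - x) ^ (e - 1) - 1) * a $ i * L $ j) * h $ j)) (at y)"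
          unfolding eq by (simp only:)
      qed
      have "poly (det M') t = det (\<chi> i j. c * pd (\<lambda>y. \<kappa> y $ i) j (x + t *s v))"
        unfolding poly_det M'_def by (simp add: poly_line_poly poly_fun_mult k_pf poly_fun_has_derivative(2))
      also have "\<dots> = det (\<chi> i. c *s (\<chi> j. pd (\<lambda>y. \<kappa> y $ i) j (x + t *s v)))"
        by (rule arg_cong[of _ _ det]) (simp add: vec_eq_iff)
      also have "\<dots> = c ^ CARD('n) * det (\<chi> i j. pd (\<lambda>y. \<kappa> y $ i) j (x + t *s v))"
        by (subst det_rows_mul) simp
      also have "det (\<chi> i j. pd (\<lambda>y. \<kappa> y $ i) j (x + t *s v)) = of_nat e * (t * l v) ^ (e - 1)"
        unfolding pdk lt by (rule det_rank_one_update[OF La])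
      finally show ?thesis by (simp add: K_def poly_monom power_mult_distrib)
    qed
    then show ?thesis by (metis ext poly_eq_poly_eq_iff)
  qed
  moreover have "[:0, 1:] ^ e dvd det M'" using dvd_diff[OF d1 d2] by simp
  ultimately have "Polynomial.monom 1 e dvd Polynomial.monom K (e - 1)"
    by (simp add: monom_altdef)
  then have "e \<le> e - 1" using K by (auto dest!: dvd_imp_degree_le simp: degree_monom_eq)
  then show False using e by simp
qed

end

section \<open>Orders of vanishing on lines and divisibility by the Jacobian\<close>

lemma det_eigendirection:
  assumes La: "(\<Sum>i\<in>UNIV. L $ i * a $ i) = 1"
    and act: "\<And>y. A *v y = y + ((w - 1) * (\<Sum>i\<in>UNIV. L $ i * y $ i)) *s a"
  shows "det A = (w :: complex)"
proof -
  have "A = (\<chi> i j. (if i = j then 1 else 0) + (w - 1) * a $ i * L $ j)" (is "A = ?M")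
  proof -
    have "A *v y = ?M *v y" for y
      unfolding act
      by (simp add: vec_eq_iff matrix_vector_mult_def distrib_right sum.distrib mult_delta_left)
        (simp add: sum_distrib_left mult_ac)
    then show ?thesis by (simp add: matrix_eq)
  qed
  then show ?thesis using det_rank_one_update[OF La, of w] by simp
qed

text \<open>Coefficients of the power series quotient of \<open>F\<close> by \<open>J\<close>, where
  \<open>d\<close> is the constant term of \<open>J\<close>. Since only the constant
  \<open>d\<close> is divided by, they stay polynomial in the direction.\<close>

fun quotient_coeff :: "(nat \<Rightarrow> 'a \<Rightarrow> complex) \<Rightarrow> (nat \<Rightarrow> 'a \<Rightarrow> complex) \<Rightarrow> complex \<Rightarrow> nat \<Rightarrow> 'a \<Rightarrow> complex" where
  "quotient_coeff F J d n v = (F n v - (\<Sum>k<n. quotient_coeff F J d k v * J (n - k) v)) / d"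

declare quotient_coeff.simps [simp del]

lemma poly_fun_quotient_coeff:
  assumes "\<And>k. poly_fun (F k)" "\<And>k. poly_fun (J k)"
  shows "poly_fun (quotient_coeff F J d n)"
proof (induction n rule: less_induct)
  case (less n)
  have "quotient_coeff F J d n = (\<lambda>v. (F n v - (\<Sum>k<n. quotient_coeff F J d k v * J (n - k) v)) / d)"
    by (auto simp: quotient_coeff.simps[of F J d n])
  moreover have "poly_fun (\<lambda>v. \<Sum>k<n. quotient_coeff F J d k v * J (n - k) v)"
    by (intro poly_fun_sum poly_fun_mult assms less) simp
  ultimately show ?case using assms by (simp only:) (intro poly_fun_divide poly_fun_diff)
qed

context reflection_invariants
begin

definition skew :: "(complex^'n \<Rightarrow> complex) \<Rightarrow> bool" where
  "skew f \<longleftrightarrow> (\<forall>A\<in>G. \<forall>z. f (A *v z) * det A = f z)"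

lemma stab_mult: "A \<in> stab x \<Longrightarrow> B \<in> stab x \<Longrightarrow> A ** B \<in> stab x"
  by (simp add: stab_def G_mult flip: matrix_vector_mul_assoc)

lemma bij_stab_mult:
  assumes A: "A \<in> stab x"
  shows "bij_betw (\<lambda>B. B ** A) (stab x) (stab x)"
proof -
  have "A \<in> G" using A stab_sub by auto
  then obtain C where C: "C \<in> G" "A ** C = mat 1" by (rule G_inverse)
  have "inj_on (\<lambda>B. B ** A) (stab x)"
    by (rule inj_onI) (metis C(2) matrix_mul_assoc matrix_mul_rid)
  moreover have "(\<lambda>B. B ** A) ` stab x \<subseteq> stab x" using A by (auto intro: stab_mult)
  ultimately show ?thesis
    using endo_inj_surj[OF stab_finite] unfolding bij_betw_def by blast
qed

text \<open>Write a point as a part in the kernel of \<open>L\<close> plus a multiple of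
  \<open>a\<close>, and expand \<open>f\<close> in that multiple. An element of the stabiliser
  multiplies the \<open>k\<close>-th coefficient by \<open>\<omega> A ^ k\<close> and has
  determinant \<open>\<omega> A\<close>, so skewness kills every coefficient with
  \<open>k + 1 < e\<close>. What remains is divisible by the power \<open>e - 1\<close> of the
  linear form, which vanishes at \<open>x\<close>.\<close>

lemma skew_order_ge:
  assumes f: "poly_fun f" "skew f"
    and La: "(\<Sum>i\<in>UNIV. L $ i * a $ i) = 1"
    and act: "\<And>A y. A \<in> stab x \<Longrightarrow> A *v y = y + ((\<omega> A - 1) * (\<Sum>i\<in>UNIV. L $ i * y $ i)) *s a"
    and e: "\<And>k. 0 < k \<Longrightarrow> k < e \<Longrightarrow> \<exists>A\<in>stab x. \<omega> A ^ k \<noteq> 1"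
    and x: "1 < e \<Longrightarrow> (\<Sum>i\<in>UNIV. L $ i * x $ i) = 0"
  shows "[:0, 1:] ^ (e - 1) dvd line_poly f x v"
proof (cases "1 < e")
  case True
  define l where "l y = (\<Sum>i\<in>UNIV. L $ i * y $ i)" for y :: "complex^'n"
  have l_add: "l (y + z) = l y + l z" for y z by (simp add: l_def distrib_left sum.distrib)
  have l_sc: "l (c *s y) = c * l y" for c y by (simp add: l_def sum_distrib_left mult_ac)
  have l_diff: "l (y - z) = l y - l z" for y z by (simp add: l_def right_diff_distrib sum_subtractf)
  have la: "l a = 1" using La by (simp add: l_def)
  have lx: "l x = 0" using x True by (simp add: l_def)
  have l_pf: "poly_fun l" unfolding l_def by (intro poly_fun_sum poly_fun_mult) auto
  define Y where "Y y = y - l y *s a" for y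
  have Y_pf: "poly_fun (\<lambda>y. Y y $ i)" for i
    unfolding Y_def by (auto intro!: poly_fun_diff poly_fun_mult l_pf)
  have lY: "l (Y y) = 0" for y by (simp add: Y_def l_diff l_sc la)
  obtain N c where c: "\<And>k. poly_fun (c k)" "\<And>k y. k > N \<Longrightarrow> c k y = 0"
    "\<And>y s. f (Y y + s *s a) = (\<Sum>k\<le>N. c k y * s ^ k)"
    by (rule poly_fun_line[OF f(1), of Y "\<lambda>_. a"]) (auto intro: Y_pf)
  have c0: "c k y = 0" if k: "Suc k < e" for k y
  proof -
    obtain A where A: "A \<in> stab x" "\<omega> A ^ Suc k \<noteq> 1" using e[OF _ k] by auto
    have AG: "A \<in> G" using A stab_sub by auto
    have dA: "det A = \<omega> A" by (rule det_eigendirection[OF La act[OF A(1)]])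
    have Ay: "A *v (Y y + s *s a) = Y y + (\<omega> A * s) *s a" for s
      unfolding act[OF A(1)] l_def[symmetric] l_add l_sc lY la by (simp add: vec_eq_iff algebra_simps)
    have "(\<Sum>k\<le>N. (c k y * \<omega> A ^ Suc k) * s ^ k) = (\<Sum>k\<le>N. c k y * s ^ k)" for s
    proof -
      have "(\<Sum>k\<le>N. c k y * s ^ k) = f (Y y + s *s a)" by (rule c(3)[symmetric])
      also have "\<dots> = f (A *v (Y y + s *s a)) * det A" using f(2) AG by (simp add: skew_def)
      also have "\<dots> = (\<Sum>k\<le>N. c k y * (\<omega> A * s) ^ k) * \<omega> A" unfolding Ay dA c(3) ..
      also have "\<dots> = (\<Sum>k\<le>N. (c k y * \<omega> A ^ Suc k) * s ^ k)"
        by (simp add: sum_distrib_left power_mult_distrib mult_ac)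
      finally show ?thesis by simp
    qed
    then have "\<forall>k\<le>N. c k y * \<omega> A ^ Suc k = c k y"
      by (subst polyfun_eq_coeffs[symmetric]) simp
    then show ?thesis using A(2) c(2)[of k y] by (cases "k \<le> N") auto
  qed
  have eq: "line_poly f x v = (\<Sum>k\<le>N. line_poly (c k) x v * [:0, l v:] ^ k)"
  proof (rule line_poly_unique[OF f(1)])
    fix t
    have "l (x + t *s v) = t * l v" by (simp add: l_add l_sc lx)
    then have "Y (x + t *s v) + (t * l v) *s a = x + t *s v" by (simp add: Y_def)
    then show "poly (\<Sum>k\<le>N. line_poly (c k) x v * [:0, l v:] ^ k) t = f (x + t *s v)"
      using c(3)[of "x + t *s v" "t * l v"] by (simp add: poly_sum poly_line_poly[OF c(1)] mult.commute[of t])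
  qed
  show ?thesis unfolding eq
  proof (rule dvd_sum)
    fix k
    show "[:0, 1:] ^ (e - 1) dvd line_poly (c k) x v * [:0, l v:] ^ k"
    proof (cases "Suc k < e")
      case True
      then have "line_poly (c k) x v = 0" using c0 by (intro line_poly_unique c) simp
      then show ?thesis by simp
    next
      case False
      have "[:0, l v:] = [:0, 1:] * [:l v:]" by simp
      then have "[:0, 1:] dvd [:0, l v:]" by (rule dvdI)
      then have "[:0, 1:] ^ (e - 1) dvd [:0, l v:] ^ k" using False by (intro dvd_power_le) auto
      then show ?thesis by (rule dvd_mult)
    qed
  qed
qed simp

text \<open>For \<open>A\<close> and \<open>B\<close> fixing \<open>x = z + t v\<close> the minor in
  \<open>gen\<close> vanishes at \<open>v\<close>, hence identically. So \<open>A y - y\<close> is,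
  for all elements of the stabiliser, the same linear form \<open>l y\<close> times a vector
  \<open>U A\<close>, and averaging \<open>U\<close> over the stabiliser yields one common direction
  \<open>a\<close>. The stabiliser fixes the hyperplane \<open>l = 0\<close> pointwise.\<close>

lemma stab_structure:
  assumes z: "\<And>A. A \<in> G \<Longrightarrow> A *v z = z \<Longrightarrow> A = mat 1" and v: "v $ i1 \<noteq> 0"
    and gen: "\<And>A B i j u. A \<in> G \<Longrightarrow> B \<in> G \<Longrightarrow>
      ((A - mat 1) *v z) $ i * ((B - mat 1) *v v) $ j = ((B - mat 1) *v z) $ j * ((A - mat 1) *v v) $ i \<Longrightarrow>
      ((A - mat 1) *v z) $ i * ((B - mat 1) *v u) $ j = ((B - mat 1) *v z) $ j * ((A - mat 1) *v u) $ i"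
    and x: "x = z + t *s v"
  obtains L a \<omega> where "(\<Sum>i\<in>UNIV. L $ i * a $ i) = 1"
    "\<forall>A\<in>stab x. \<forall>y. A *v y = y + ((\<omega> A - 1) * (\<Sum>i\<in>UNIV. L $ i * y $ i)) *s a"
    "(\<Sum>i\<in>UNIV. L $ i * v $ i) \<noteq> 0"
    "\<forall>A\<in>stab x. \<omega> A ^ card (stab x) = 1"
    "(\<Sum>i\<in>UNIV. L $ i * x $ i) = 0 \<or> (\<forall>A\<in>stab x. \<omega> A = 1)"
proof (cases "stab x = {mat 1}")
  case True
  \<comment> \<open>With trivial stabiliser any linear form that is nonzero on \<open>v\<close> will
    do, with all multipliers equal to 1.\<close>
  show ?thesis
    by (rule that[of "axis i1 1" "axis i1 1" "\<lambda>_. 1"])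
      (use v True in \<open>simp_all add: axis_def mult_delta_left\<close>)
next
  case False
  then obtain A0 where A0: "A0 \<in> stab x" "A0 \<noteq> mat 1" using stab_one by blast
  have rdef: "((A - mat 1) *v y) = A *v y - y" for A :: "complex^'n^'n" and y
    by (simp add: matrix_vector_mult_diff_rdistrib)
  have G0: "A \<in> G" if "A \<in> stab x" for A using that stab_sub by auto
  have fx: "A *v x = x" if "A \<in> stab x" for A using that by (simp add: stab_def)
  have "A0 *v z \<noteq> z" using z[OF G0[OF A0(1)]] A0(2) by auto
  then obtain i0 where i0: "(A0 *v z - z) $ i0 \<noteq> 0" by (auto simp: vec_eq_iff)
  define d where "d = (A0 *v z - z) $ i0"
  have d: "d \<noteq> 0" using i0 by (simp add: d_def)
  \<comment> \<open>Normalised to be 1 at \<open>z\<close>. It vanishes at \<open>x\<close>, since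
    \<open>A0\<close> fixes \<open>x\<close>, and therefore not at \<open>v\<close>.\<close>
  define L where "L = (\<chi> j. (A0 - mat 1) $ i0 $ j / d)"
  define l where "l y = (\<Sum>i\<in>UNIV. L $ i * y $ i)" for y :: "complex^'n"
  have l_eq: "l y = (A0 *v y - y) $ i0 / d" for y
    unfolding rdef[symmetric] by (simp add: l_def L_def matrix_vector_mult_def sum_divide_distrib)
  have l_add: "l (y + u) = l y + l u" for y u by (simp add: l_def distrib_left sum.distrib)
  have l_sc: "l (c *s y) = c * l y" for c y by (simp add: l_def sum_distrib_left mult_ac)
  have l_sum: "l (\<Sum>i\<in>I. g i) = (\<Sum>i\<in>I. l (g i))" for I and g :: "complex^'n^'n \<Rightarrow> complex^'n"
  proof (induction I rule: infinite_finite_induct)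
    case (insert i I) then show ?case by (simp add: l_add)
  qed (simp_all add: l_def)
  have lz: "l z = 1" using d by (simp add: l_eq d_def)
  have lx: "l x = 0" using fx[OF A0(1)] by (simp add: l_eq)
  have lv: "l v \<noteq> 0" using lx unfolding x l_add l_sc lz by auto
  define U where "U B = B *v z - z" for B
  have act: "B *v y = y + l y *s U B" if B: "B \<in> stab x" for B y
  proof -
    have "(B *v y - y) $ j = l y * U B $ j" for j
    proof -
      have A0x: "((A0 - mat 1) *v z) $ i0 = - t * ((A0 - mat 1) *v v) $ i0"
        using arg_cong[OF fx[OF A0(1)], of "\<lambda>y. y $ i0"] unfolding rdef x
        by (simp add: matrix_vector_right_distrib vector_scalar_commute algebra_simps)
      have Bx: "((B - mat 1) *v z) $ j = - t * ((B - mat 1) *v v) $ j"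
        using arg_cong[OF fx[OF B], of "\<lambda>y. y $ j"] unfolding rdef x
        by (simp add: matrix_vector_right_distrib vector_scalar_commute algebra_simps)
      have "((A0 - mat 1) *v z) $ i0 * ((B - mat 1) *v y) $ j = ((B - mat 1) *v z) $ j * ((A0 - mat 1) *v y) $ i0"
        by (rule gen[OF G0[OF A0(1)] G0[OF B]]) (simp add: A0x Bx)
      then show ?thesis unfolding rdef l_eq U_def using d by (simp add: d_def field_simps)
    qed
    then show ?thesis by (simp add: vec_eq_iff algebra_simps)
  qed
  define w where "w B = 1 + l (U B)" for B
  have UU: "U (B ** A) = U A + w A *s U B" if "A \<in> stab x" "B \<in> stab x" for A B
  proof -
    have "A *v z = z + U A" by (simp add: U_def)
    then have "U (B ** A) = B *v (z + U A) - z" by (simp add: U_def flip: matrix_vector_mul_assoc)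
    also have "\<dots> = U A + w A *s U B" unfolding act[OF that(2)] by (simp add: l_add lz w_def)
    finally show ?thesis .
  qed
  \<comment> \<open>\<open>U\<close> satisfies the cocycle identity \<open>UU\<close>; summing it
    over the stabiliser shows that it is a coboundary, with \<open>a\<close> equal to minus the mean
    of \<open>U\<close>.\<close>
  define k where "k = (of_nat (card (stab x)) :: complex)"
  have k: "k \<noteq> 0" using stab_finite[of x] stab_one[of x] by (auto simp: k_def card_eq_0_iff)
  define s where "s = (\<Sum>B\<in>stab x. U B)"
  define a where "a = - (inverse k *s s)"
  have Ua: "U A = (w A - 1) *s a" if A: "A \<in> stab x" for A
  proof -
    have "s = (\<Sum>B\<in>stab x. U (B ** A))"
      unfolding s_def by (rule sum.reindex_bij_betw[OF bij_stab_mult[OF A], symmetric])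
    also have "\<dots> = (\<Sum>B\<in>stab x. U A + w A *s U B)" by (rule sum.cong) (auto simp: UU[OF A])
    also have "\<dots> = k *s U A + w A *s s"
      unfolding vec_eq_iff sum_component vector_add_component vector_smult_component sum.distrib
      by (simp add: s_def k_def sum_distrib_left)
    finally have "k *s U A = s - w A *s s" by (simp add: algebra_simps)
    then have "inverse k *s (k *s U A) = inverse k *s (s - w A *s s)" by simp
    then show ?thesis using k by (simp add: a_def vec_eq_iff algebra_simps)
  qed
  have la: "l a = 1"
  proof -
    have "U A0 \<noteq> 0" using i0 by (auto simp: U_def)
    then have w1: "w A0 - 1 \<noteq> 0" using Ua[OF A0(1)] by auto
    have "w A0 - 1 = (w A0 - 1) * l a"
      using arg_cong[OF Ua[OF A0(1)], of l] by (simp add: l_sc w_def)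
    then show ?thesis using w1 by simp
  qed
  have act': "A *v y = y + ((w A - 1) * (\<Sum>i\<in>UNIV. L $ i * y $ i)) *s a" if "A \<in> stab x" for A y
    using act[OF that, of y] Ua[OF that] by (simp add: l_def[symmetric] vec_eq_iff algebra_simps)
  have La: "(\<Sum>i\<in>UNIV. L $ i * a $ i) = 1" using la by (simp add: l_def)
  have wdet: "det A = w A" if "A \<in> stab x" for A by (rule det_eigendirection[OF La act'[OF that]])
  \<comment> \<open>\<open>w\<close> is multiplicative because it is the determinant; multiplying
    \<open>w (B ** A)\<close> over all \<open>B\<close> produces the exponent.\<close>
  have wk: "w A ^ card (stab x) = 1" if A: "A \<in> stab x" for A
  proof -
    have "(\<Prod>B\<in>stab x. w B) = (\<Prod>B\<in>stab x. w (B ** A))"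
      by (rule prod.reindex_bij_betw[OF bij_stab_mult[OF A], symmetric])
    also have "\<dots> = (\<Prod>B\<in>stab x. w B * w A)"
      by (rule prod.cong) (auto simp: stab_mult A det_mul simp flip: wdet)
    also have "\<dots> = (\<Prod>B\<in>stab x. w B) * w A ^ card (stab x)"
      by (simp add: prod.distrib)
    finally show ?thesis using stab_finite[of x] G_det[OF G0] wdet by (auto simp: prod_zero_iff)
  qed
  show ?thesis
    by (rule that[of L a w]) (use La act' wk lv lx in \<open>auto simp: l_def\<close>)
qed

text \<open>A point outside finitely many proper fixed subspaces: for each \<open>A\<close> other
  than the identity some coordinate of \<open>A y - y\<close> is a nonzero polynomial, and a product
  of such polynomials is nonzero.\<close>

lemma trivial_stab_point:
  obtains z where "\<And>A. A \<in> G \<Longrightarrow> A *v z = z \<Longrightarrow> A = mat 1"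
proof -
  have "\<exists>i j. A $ i $ j \<noteq> mat 1 $ i $ j" if "A \<in> G - {mat 1}" for A
    using that by (auto simp: vec_eq_iff)
  then obtain i j where ij: "\<And>A. A \<in> G - {mat 1} \<Longrightarrow> A $ i A $ j A \<noteq> mat 1 $ i A $ j A" by metis
  define f where "f A y = ((A - mat 1) *v y) $ i A" for A y
  have "\<exists>y. (\<Prod>A\<in>G - {mat 1}. f A y) \<noteq> 0"
  proof (rule poly_fun_prod_nonzero)
    show "finite (G - {mat 1})" using G_finite by simp
    fix A assume A: "A \<in> G - {mat 1}"
    show "poly_fun (f A)" unfolding f_def by (rule poly_fun_matrix)
    have "f A (axis (j A) 1) = A $ i A $ j A - mat 1 $ i A $ j A"
      unfolding f_def matrix_vector_mult_def by (simp add: axis_def mult_delta_right)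
    then show "\<exists>y. f A y \<noteq> 0" using ij[OF A] by (intro exI[of _ "axis (j A) 1"]) simp
  qed
  then obtain z where z: "(\<Prod>A\<in>G - {mat 1}. f A z) \<noteq> 0" by blast
  have "A = mat 1" if "A \<in> G" "A *v z = z" for A
  proof (rule ccontr)
    assume "A \<noteq> mat 1"
    then have "f A z \<noteq> 0" using z that(1) G_finite by (simp add: prod_zero_iff)
    then show False using that(2) by (simp add: f_def matrix_vector_mult_diff_rdistrib)
  qed
  then show ?thesis by (rule that)
qed

text \<open>The case \<open>e = 1\<close> of \<open>jac_order_less\<close>: with trivial stabiliser
  every multiplier is 1 and the Jacobian has order 0.\<close>

lemma jac_nonzero:
  assumes "\<And>A. A \<in> G \<Longrightarrow> A *v z = z \<Longrightarrow> A = mat 1"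
  shows "jac P z \<noteq> 0"
proof -
  have "A = mat 1" if "A \<in> stab z" for A
    by (rule assms) (use that in \<open>auto simp: stab_def\<close>)
  then have st: "stab z = {mat 1}" using stab_one by blast
  obtain i :: 'n where True by simp
  define v :: "complex^'n" where "v = axis i 1"
  have vv: "(\<Sum>k\<in>UNIV. v $ k * v $ k) = 1"
  proof -
    have "(\<Sum>k\<in>UNIV. v $ k * v $ k) = (\<Sum>k\<in>UNIV. (if k = i then 1 else 0) * v $ k)"
      by (rule sum.cong) (auto simp: v_def axis_def)
    also have "\<dots> = 1 * v $ i" by (simp add: mult_delta_left)
    finally show ?thesis by (simp add: v_def axis_def)
  qed
  have "\<not> [:0, 1:] ^ 1 dvd line_poly (jac P) z v"
    by (rule jac_order_less[OF vv, where \<omega> = "\<lambda>_. 1"]) (use st vv in simp_all)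
  then have "\<not> [:- 0, 1:] dvd line_poly (jac P) z v" by (simp only: minus_zero power_one_right not_False_eq_True)
  then have "poly (line_poly (jac P) z v) 0 \<noteq> 0" unfolding poly_eq_0_iff_dvd .
  then show ?thesis by (simp add: poly_line_poly)
qed

lemma line_poly_shift_dvd:
  assumes "poly_fun f" and "x = z + t *s v"
  shows "[:0, 1:] ^ k dvd line_poly f x v \<longleftrightarrow> [:- t, 1:] ^ k dvd line_poly f z v"
proof
  assume "[:0, 1:] ^ k dvd line_poly f x v"
  then obtain q where q: "line_poly f x v = [:0, 1:] ^ k * q" by (elim dvdE)
  have "line_poly f z v = [:- t, 1:] ^ k * pcompose q [:- t, 1:]"
  proof (rule line_poly_unique[OF assms(1)])
    fix s
    have "z + s *s v = x + (s - t) *s v" by (simp add: assms(2) vec_eq_iff algebra_simps)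
    then have "f (z + s *s v) = poly (line_poly f x v) (s - t)" by (simp only: poly_line_poly[OF assms(1)])
    then show "poly ([:- t, 1:] ^ k * pcompose q [:- t, 1:]) s = f (z + s *s v)"
      by (simp add: q poly_pcompose algebra_simps)
  qed
  then show "[:- t, 1:] ^ k dvd line_poly f z v" by simp
next
  assume "[:- t, 1:] ^ k dvd line_poly f z v"
  then obtain q where q: "line_poly f z v = [:- t, 1:] ^ k * q" by (elim dvdE)
  have "line_poly f x v = [:0, 1:] ^ k * pcompose q [:t, 1:]"
  proof (rule line_poly_unique[OF assms(1)])
    fix s
    have "x + s *s v = z + (s + t) *s v" by (simp add: assms(2) vec_eq_iff algebra_simps)
    then have "f (x + s *s v) = poly (line_poly f z v) (s + t)" by (simp only: poly_line_poly[OF assms(1)])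
    then show "poly ([:0, 1:] ^ k * pcompose q [:t, 1:]) s = f (x + s *s v)"
      by (simp add: q poly_pcompose algebra_simps)
  qed
  then show "[:0, 1:] ^ k dvd line_poly f x v" by simp
qed

text \<open>At each point \<open>x\<close> of the line let \<open>e\<close> be the least common
  exponent of the multipliers. The Jacobian vanishes there to order at most \<open>e - 1\<close>, a
  skew polynomial to order at least \<open>e - 1\<close>.\<close>

lemma jac_line_dvd:
  assumes f: "poly_fun f" "skew f"
    and z: "\<And>A. A \<in> G \<Longrightarrow> A *v z = z \<Longrightarrow> A = mat 1" and v: "v $ i1 \<noteq> 0"
    and gen: "\<And>A B i j u. A \<in> G \<Longrightarrow> B \<in> G \<Longrightarrow>
      ((A - mat 1) *v z) $ i * ((B - mat 1) *v v) $ j = ((B - mat 1) *v z) $ j * ((A - mat 1) *v v) $ i \<Longrightarrow>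
      ((A - mat 1) *v z) $ i * ((B - mat 1) *v u) $ j = ((B - mat 1) *v z) $ j * ((A - mat 1) *v u) $ i"
  shows "line_poly (jac P) z v dvd line_poly f z v"
proof (rule poly_dvd_by_order)
  have "poly (line_poly (jac P) z v) 0 \<noteq> 0" using jac_nonzero[OF z] by (simp add: poly_line_poly)
  then show "line_poly (jac P) z v \<noteq> 0" by auto
  fix t k assume k: "[:- t, 1:] ^ k dvd line_poly (jac P) z v"
  define x where "x = z + t *s v"
  obtain L a \<omega> where La: "(\<Sum>i\<in>UNIV. L $ i * a $ i) = 1"
    and act': "\<forall>A\<in>stab x. \<forall>y. A *v y = y + ((\<omega> A - 1) * (\<Sum>i\<in>UNIV. L $ i * y $ i)) *s a"
    and lv: "(\<Sum>i\<in>UNIV. L $ i * v $ i) \<noteq> 0"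
    and om: "\<forall>A\<in>stab x. \<omega> A ^ card (stab x) = 1"
    and lx: "(\<Sum>i\<in>UNIV. L $ i * x $ i) = 0 \<or> (\<forall>A\<in>stab x. \<omega> A = 1)"
    by (rule stab_structure[OF z v gen x_def])
  note act = act'[rule_format]
  define p where "p e \<longleftrightarrow> 0 < e \<and> (\<forall>A\<in>stab x. \<omega> A ^ e = 1)" for e :: nat
  define e where "e = (LEAST e. p e)"
  have "p (card (stab x))" unfolding p_def using om stab_finite[of x] stab_one[of x] by (auto simp: card_gt_0_iff)
  then have pe: "p e" unfolding e_def by (rule LeastI)
  have min: "\<exists>A\<in>stab x. \<omega> A ^ k \<noteq> 1" if "0 < k" "k < e" for k
  proof -
    have "\<not> p k" using not_less_Least[of k p] that(2) unfolding e_def by blast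
    then show ?thesis using that(1) by (auto simp: p_def)
  qed
  have "(\<Sum>i\<in>UNIV. L $ i * x $ i) = 0" if "1 < e"
    using lx min[of 1] that by auto
  then have fe: "[:0, 1:] ^ (e - 1) dvd line_poly f x v"
    by (intro skew_order_ge[OF f La act min])
  have "\<not> [:0, 1:] ^ e dvd line_poly (jac P) x v"
    by (rule jac_order_less[OF La act _ _ lv]) (use pe in \<open>auto simp: p_def\<close>)
  then have "\<not> [:- t, 1:] ^ e dvd line_poly (jac P) z v"
    using line_poly_shift_dvd[OF poly_fun_jac x_def] by simp
  then have "k < e" using k power_le_dvd[of "[:- t, 1:]" k] by (meson not_less)
  then have "k \<le> e - 1" by simp
  have "[:- t, 1:] ^ (e - 1) dvd line_poly f z v"
    using fe line_poly_shift_dvd[OF f(1) x_def] by simp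
  then show "[:- t, 1:] ^ k dvd line_poly f z v" using \<open>k \<le> e - 1\<close> by (rule power_le_dvd)
qed

text \<open>Multiplying only those minors that are not identically zero gives a nonzero
  \<open>D\<close>; where \<open>D\<close> does not vanish, a minor that is zero at \<open>v\<close>
  is zero everywhere. The factor \<open>v $ i1\<close> keeps the direction nonzero.\<close>

lemma generic_direction:
  fixes z :: "complex^'n" and i1 :: 'n
  obtains D where "poly_fun D" "\<exists>v. D v \<noteq> 0" "\<forall>v. D v \<noteq> 0 \<longrightarrow> v $ i1 \<noteq> 0"
    "\<forall>v. D v \<noteq> 0 \<longrightarrow> (\<forall>A\<in>G. \<forall>B\<in>G. \<forall>i j u.
      ((A - mat 1) *v z) $ i * ((B - mat 1) *v v) $ j = ((B - mat 1) *v z) $ j * ((A - mat 1) *v v) $ i \<longrightarrow>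
      ((A - mat 1) *v z) $ i * ((B - mat 1) *v u) $ j = ((B - mat 1) *v z) $ j * ((A - mat 1) *v u) $ i)"
proof -
  define N where "N = (\<lambda>(A::complex^'n^'n, i, B::complex^'n^'n, j) v.
      ((A - mat 1) *v z) $ i * ((B - mat 1) *v v) $ j - ((B - mat 1) *v z) $ j * ((A - mat 1) *v v) $ i)"
  define S where "S = {s \<in> G \<times> UNIV \<times> G \<times> UNIV. \<exists>v. N s v \<noteq> 0}"
  have S: "finite S" unfolding S_def using G_finite by simp
  have N_pf: "poly_fun (N s)" for s
    unfolding N_def by (cases s) (auto intro!: poly_fun_diff poly_fun_mult poly_fun_matrix)
  define D where "D v = v $ i1 * (\<Prod>s\<in>S. N s v)" for v
  have pr: "poly_fun (\<lambda>v. \<Prod>s\<in>S. N s v)" by (intro poly_fun_prod N_pf)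
  show ?thesis
  proof (rule that[of D]; (intro allI impI ballI)?)
    show "poly_fun D" unfolding D_def by (rule poly_fun_mult[OF poly_fun_coord pr])
    have "\<exists>v. (\<Prod>s\<in>S. N s v) \<noteq> 0" by (rule poly_fun_prod_nonzero[OF S N_pf]) (auto simp: S_def)
    moreover have "\<exists>v::complex^'n. v $ i1 \<noteq> 0" by (rule exI[of _ "axis i1 1"]) (simp add: axis_def)
    ultimately show "\<exists>v. D v \<noteq> 0"
      using poly_fun_mult_eq_0[OF poly_fun_coord[of i1] pr] unfolding D_def by blast
  next
    fix v assume "D v \<noteq> 0"
    then show "v $ i1 \<noteq> 0" by (auto simp: D_def)
  next
    fix v u :: "complex^'n" and A B :: "complex^'n^'n" and i j
    assume D: "D v \<noteq> 0" and AB: "A \<in> G" "B \<in> G" and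
      eq: "((A - mat 1) *v z) $ i * ((B - mat 1) *v v) $ j = ((B - mat 1) *v z) $ j * ((A - mat 1) *v v) $ i"
    have "N (A, i, B, j) v = 0" using eq by (simp add: N_def)
    moreover have "\<forall>s\<in>S. N s v \<noteq> 0" using D S by (auto simp: D_def prod_zero_iff)
    ultimately have "(A, i, B, j) \<notin> S" by auto
    then have "N (A, i, B, j) u = 0" using AB by (auto simp: S_def)
    then show "((A - mat 1) *v z) $ i * ((B - mat 1) *v u) $ j = ((B - mat 1) *v z) $ j * ((A - mat 1) *v u) $ i"
      by (simp add: N_def)
  qed
qed

text \<open>On generic lines through a point \<open>z\<close> with \<open>jac P z \<noteq> 0\<close>
  the quotient is a polynomial in the line parameter. Its coefficients satisfy the power series
  recursion, so they are polynomial in the direction, and its value at parameter 1 is a polynomial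
  in \<open>y - z\<close>.\<close>

theorem skew_divisible:
  assumes f: "poly_fun f" "skew f"
  obtains T where "poly_fun T" "\<And>z. f z = jac P z * T z"
proof -
  obtain z where z: "\<And>A. A \<in> G \<Longrightarrow> A *v z = z \<Longrightarrow> A = mat 1"
    by (rule trivial_stab_point) (rule that, blast)
  have Jz: "jac P z \<noteq> 0" by (rule jac_nonzero[OF z])
  obtain i1 :: 'n where True by simp
  obtain D where D: "poly_fun D" "\<exists>v. D v \<noteq> 0" "\<forall>v. D v \<noteq> 0 \<longrightarrow> v $ i1 \<noteq> 0"
    and gen: "\<forall>v. D v \<noteq> 0 \<longrightarrow> (\<forall>A\<in>G. \<forall>B\<in>G. \<forall>i j u.
      ((A - mat 1) *v z) $ i * ((B - mat 1) *v v) $ j = ((B - mat 1) *v z) $ j * ((A - mat 1) *v v) $ i \<longrightarrow>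
      ((A - mat 1) *v z) $ i * ((B - mat 1) *v u) $ j = ((B - mat 1) *v z) $ j * ((A - mat 1) *v u) $ i)"
    by (rule generic_direction[of i1 z])
  obtain N F where F: "\<And>k. poly_fun (F k)" "\<And>k v. k > N \<Longrightarrow> F k v = 0"
    "\<And>v s. f (z + s *s v) = (\<Sum>k\<le>N. F k v * s ^ k)"
    by (rule poly_fun_line[OF f(1), of "\<lambda>_. z" "\<lambda>v. v"]) auto
  obtain M J where J: "\<And>k. poly_fun (J k)" "\<And>k v. k > M \<Longrightarrow> J k v = 0"
    "\<And>v s. jac P (z + s *s v) = (\<Sum>k\<le>M. J k v * s ^ k)"
    by (rule poly_fun_line[OF poly_fun_jac, of "\<lambda>_. z" "\<lambda>v. v"]) auto
  have J0: "J 0 v = jac P z" for v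
  proof -
    have "(\<Sum>k\<le>M. J k v * 0 ^ k) = (\<Sum>k\<le>M. if k = 0 then J k v else 0)"
      by (rule sum.cong) (auto simp: power_0_left)
    then show ?thesis using J(3)[of 0 v] by simp
  qed
  have coeffs: "coeff (line_poly g z v) n = C n v"
    if g: "poly_fun g" and C: "\<And>k v. k > K \<Longrightarrow> C k v = 0" "\<And>v s. g (z + s *s v) = (\<Sum>k\<le>K. C k v * s ^ k)"
    for g C K n v
  proof -
    have "line_poly g z v = (\<Sum>k\<le>K. Polynomial.monom (C k v) k)"
      by (rule line_poly_unique[OF g]) (simp add: C(2) poly_sum poly_monom)
    then show ?thesis using C(1)[of n v] by (simp add: coeff_sum if_distrib cong: if_cong)
  qed
  \<comment> \<open>The sum may stop at \<open>N\<close>, the degree bound for \<open>f\<close>,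
    since the quotient has no larger degree.\<close>
  define T where "T v = (\<Sum>n\<le>N. quotient_coeff F J (jac P z) n v)" for v
  have T: "poly_fun T" unfolding T_def by (intro poly_fun_sum poly_fun_quotient_coeff F J)
  have key: "f (z + v) = jac P (z + v) * T v" if Dv: "D v \<noteq> 0" for v
  proof -
    have "line_poly (jac P) z v dvd line_poly f z v"
      by (rule jac_line_dvd[OF f z D(3)[rule_format, OF Dv] gen[rule_format, OF Dv]])
    then obtain R where R: "line_poly f z v = R * line_poly (jac P) z v" by (metis dvdE mult.commute)
    have Rn: "coeff R n = quotient_coeff F J (jac P z) n v" for n
    proof (induction n rule: less_induct)
      case (less n)
      have "F n v = (\<Sum>i\<le>n. coeff R i * J (n - i) v)"
        using arg_cong[OF R, of "\<lambda>p. coeff p n"] coeffs[OF f(1) F(2,3)] coeffs[OF poly_fun_jac J(2,3)]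
        by (simp add: coeff_mult)
      also have "\<dots> = (\<Sum>k<n. quotient_coeff F J (jac P z) k v * J (n - k) v) + coeff R n * jac P z"
        using less by (simp add: lessThan_Suc_atMost[symmetric] J0)
      finally show ?case using Jz by (simp add: quotient_coeff.simps[of F J _ n])
    qed
    have "coeff R n = 0" if "n > N" for n
    proof (cases "R = 0")
      case False
      have "line_poly (jac P) z v \<noteq> 0"
        using Jz poly_line_poly[OF poly_fun_jac, of P z v 0] by auto
      then have "degree R \<le> degree (line_poly f z v)" unfolding R using False by (simp add: degree_mult_eq)
      also have "\<dots> \<le> N" by (rule degree_le) (auto simp: coeffs[OF f(1) F(2,3)] F(2))
      finally show ?thesis using that by (intro coeff_eq_0) simp
    qed simp
    then have "degree R \<le> N" by (intro degree_le) auto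
    then have "poly R 1 = (\<Sum>n\<le>N. coeff R n)"
      unfolding poly_altdef by (auto intro!: sum.mono_neutral_left intro: le_degree)
    then have "poly R 1 = T v" by (simp add: T_def Rn)
    then have "poly (line_poly f z v) 1 = T v * poly (line_poly (jac P) z v) 1" by (simp add: R)
    then show ?thesis by (simp add: poly_line_poly f(1) mult.commute)
  qed
  have sh: "poly_fun (\<lambda>v. g (z + v))" if "poly_fun g" for g
    by (rule poly_fun_compose[OF that]) auto
  obtain v0 where v0: "D v0 \<noteq> 0" using D(2) by blast
  have all: "f (z + v) = jac P (z + v) * T v" for v
    by (rule poly_fun_cancel[OF sh[OF f(1)] poly_fun_mult[OF sh[OF poly_fun_jac] T] D(1) v0 key])
  show ?thesis
  proof (rule that[of "\<lambda>y. T (y - z)"])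
    show "poly_fun (\<lambda>y. T (y - z))" by (rule poly_fun_compose[OF T]) (auto intro: poly_fun_diff)
    show "f y = jac P y * T (y - z)" for y using all[of "y - z"] by simp
  qed
qed

end

section \<open>Homogeneity, fibres and openness of the quotient map\<close>

lemma monom_fun_scale: "monom_fun a (c *s z) = c ^ monom_degree a * monom_fun a z"
  by (simp add: monom_fun_def monom_degree_def power_mult_distrib prod.distrib power_sum)

lemma cpoly_homogeneous_eval:
  assumes "cpoly_homogeneous p"
  shows "cpoly_eval p (c *s z) = c ^ cpoly_degree p * cpoly_eval p z"
  unfolding cpoly_eval_superset[OF finite_keys subset_refl] sum_distrib_left
  using assms by (intro sum.cong) (auto simp: monom_fun_scale cpoly_homogeneous_def mult_ac)

lemma bounded_linear_matrix: "bounded_linear (\<lambda>h::complex^'n. (A::complex^'n^'n) *v h)"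
proof -
  have "linear (\<lambda>h::complex^'n. A *v h)"
  proof (rule linearI)
    show "A *v (x + y) = A *v x + A *v y" for x y by (rule matrix_vector_right_distrib)
    show "A *v (r *\<^sub>R x) = r *\<^sub>R (A *v x)" for r x
      by (simp add: vec_eq_iff matrix_vector_mult_def scaleR_sum_right)
  qed
  then show ?thesis by (simp add: linear_conv_bounded_linear)
qed

lemma continuous_on_matrix: "continuous_on X (\<lambda>h::complex^'n. (A::complex^'n^'n) *v h)"
  by (rule linear_continuous_on[OF bounded_linear_matrix])

lemma continuous_on_poly_map: "continuous_on X (poly_map Q)"
proof -
  have "continuous_on X (\<lambda>z. \<chi> j. cpoly_eval (Q j) z)"
    by (intro continuous_on_vec_lambda poly_fun_continuous_on) simp
  then show ?thesis by (simp add: poly_map_def[abs_def])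
qed

context reflection_invariants
begin

definition wt :: "'n \<Rightarrow> nat" where "wt j = cpoly_degree (P j)"

text \<open>The weighted scaling that corresponds to \<open>c *s z\<close> under \<open>th\<close>,
  see \<open>th_scale\<close>.\<close>

definition dil :: "complex \<Rightarrow> complex^'n \<Rightarrow> complex^'n" where
  "dil c y = (\<chi> j. c ^ wt j * y $ j)"

lemma th_scale: "th (c *s z) = dil c (th z)"
  using basic by (simp add: poly_map_def dil_def wt_def vec_eq_iff basic_invariants_def cpoly_homogeneous_eval)

lemma jac_nontrivial: "\<exists>z. jac P z \<noteq> 0"
  using trivial_stab_point jac_nonzero by metis

text \<open>A constant basic invariant would give the Jacobian matrix a zero row everywhere.\<close>

lemma wt_pos: "0 < wt j"
proof (rule ccontr)
  assume "\<not> 0 < wt j"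
  then have "cpoly_eval (P j) z = cpoly_eval (P j) 0" for z
    using arg_cong[OF th_scale[of 0 z], of "\<lambda>y. y $ j"] by (simp add: dil_def poly_map_def)
  then have "(\<lambda>z. th z $ j) = (\<lambda>z. cpoly_eval (P j) 0)" by (auto simp: poly_map_def)
  then have "jacm th z $ j = 0" for z by (simp add: jacm_def vec_eq_iff)
  then have "row j (jacm th z) = 0" for z by (simp add: row_def vec_eq_iff)
  then have "jac P z = 0" for z unfolding jac_eq by (rule det_zero_row)
  then show False using jac_nontrivial by simp
qed

text \<open>The degree of \<open>jac P\<close> by \<open>jac_scale\<close>, and the lowest degree in
  which a pulled back function can have a component.\<close>

definition jdeg :: nat where "jdeg = (\<Sum>j\<in>UNIV. wt j - 1)"

lemma jac_scale:
  assumes "c \<noteq> 0"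
  shows "jac P (c *s z) = c ^ jdeg * jac P z"
proof -
  have a: "pd (\<lambda>z. th (c *s z) $ i) j z = c * pd (\<lambda>z. th z $ i) j (c *s z)" for i j
  proof -
    have "pd (\<lambda>z. (c *s z) $ k) j z = (if j = k then c else 0)" for k
      using pd_cmult[OF poly_fun_coord[of k], of c j z] by (simp add: pd_coord)
    then show ?thesis
      using pd_compose[of "\<lambda>z. th z $ i" "\<lambda>z. c *s z" j z] by (simp add: mult_delta_right poly_fun_mult)
  qed
  have b: "pd (\<lambda>z. th (c *s z) $ i) j z = c ^ wt i * pd (\<lambda>z. th z $ i) j z" for i j
    unfolding th_scale dil_def using pd_cmult[of "\<lambda>z. th z $ i" "c ^ wt i" j z] by simp
  have "jacm th (c *s z) = (\<chi> i. c ^ (wt i - 1) *s jacm th z $ i)"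
  proof -
    have "pd (\<lambda>z. th z $ i) j (c *s z) = c ^ (wt i - 1) * pd (\<lambda>z. th z $ i) j z" for i j
    proof -
      have "c * pd (\<lambda>z. th z $ i) j (c *s z) = c * (c ^ (wt i - 1) * pd (\<lambda>z. th z $ i) j z)"
        unfolding a[symmetric] b using power_minus_mult[OF wt_pos[of i], of c] by (simp add: mult_ac)
      then show ?thesis using assms by simp
    qed
    then show ?thesis by (simp add: jacm_def vec_eq_iff)
  qed
  then have "jac P (c *s z) = prod (\<lambda>i. c ^ (wt i - 1)) UNIV * det (\<chi> i. jacm th z $ i)"
    unfolding jac_eq by (simp only: det_rows_mul)
  then show ?thesis by (simp add: jac_eq jdeg_def power_sum)
qed

text \<open>Average over \<open>G\<close> a polynomial that is 1 at \<open>x\<close> and 0 at all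
  other points of the two orbits. If \<open>y\<close> lay in another orbit, this invariant would
  separate \<open>x\<close> from \<open>y\<close>, yet it is a polynomial in
  \<open>th\<close>.\<close>

lemma th_eq_imp_orbit:
  assumes eq: "th x = th y"
  obtains A where "A \<in> G" "A *v y = x"
proof (rule ccontr)
  assume no: "\<not> thesis"
  define E where "E = ((\<lambda>A. A *v x) ` G \<union> (\<lambda>A. A *v y) ` G) - {x}"
  have E: "finite E" "x \<notin> E" using G_finite by (auto simp: E_def)
  obtain b where b: "poly_fun b" "b x = 1"
    "\<And>c. c \<in> E \<Longrightarrow> vanishes 1 c b"
    by (rule poly_fun_bump[OF E, where s = 1]) blast
  have b0: "b c = 0" if "c \<in> E" for c using b(3)[OF that] by auto
  define f where "f u = (\<Sum>A\<in>G. b (A *v u))" for u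
  have "poly_fun f" unfolding f_def by (intro poly_fun_sum poly_fun_compose_matrix b)
  moreover have "f (A *v u) = f u" if "A \<in> G" for A u
    unfolding f_def matrix_vector_mul_assoc by (rule sum_G[OF that, of "\<lambda>B. b (B *v u)"])
  ultimately have "\<exists>q. \<forall>z. f z = cpoly_eval q (th z)" using invariant_poly_fun[of f] by metis
  then obtain q where q: "\<And>z. f z = cpoly_eval q (th z)" by blast
  have "f x = (\<Sum>A\<in>G. if A \<in> stab x then 1 else 0)"
    unfolding f_def by (rule sum.cong) (auto simp: stab_def b(2) E_def intro!: b0)
  also have "\<dots> = of_nat (card (stab x))"
    using G_finite stab_sub[of x] by (simp add: sum.If_cases Int_absorb1)
  finally have "f x \<noteq> 0" using stab_finite[of x] stab_one[of x] by (auto simp: card_eq_0_iff)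
  moreover have "f y = 0"
    unfolding f_def
  proof (rule sum.neutral, rule ballI)
    fix A assume A: "A \<in> G"
    then have "A *v y \<noteq> x" using no that by blast
    then show "b (A *v y) = 0" using A by (intro b0) (auto simp: E_def)
  qed
  ultimately show False using q eq by metis
qed

lemma th_zero: "th 0 = 0"
  using th_scale[of 0 0] by (simp add: dil_def vec_eq_iff zero_power[OF wt_pos])

lemma th_eq_zero: "th x = 0 \<Longrightarrow> x = 0"
proof -
  assume "th x = 0"
  then have "th 0 = th x" by (simp add: th_zero)
  then obtain A where "A \<in> G" "A *v x = 0" by (rule th_eq_imp_orbit)
  then show "x = 0" using G_cancel[of A x 0] by (simp add: matrix_vector_mult_0_right)
qed

lemma continuous_on_th: "continuous_on X th"
  by (rule continuous_on_poly_map)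

text \<open>Properness: \<open>th\<close> has no zero on the compact unit sphere, and all weights
  are at least 1, so scaling by \<open>t \<ge> 1\<close> enlarges \<open>th\<close> at least by
  \<open>t\<close>.\<close>

lemma norm_th_ge:
  obtains d where "0 < d" "\<And>x. 1 \<le> norm x \<Longrightarrow> d * norm x \<le> norm (th x)"
proof -
  have "compact (sphere (0::complex^'n) 1)" by simp
  moreover have "sphere (0::complex^'n) 1 \<noteq> {}" by simp
  ultimately obtain x0 where x0: "x0 \<in> sphere 0 1" "\<And>x. x \<in> sphere 0 1 \<Longrightarrow> norm (th x0) \<le> norm (th x)"
    using continuous_attains_inf[of "sphere 0 1" "\<lambda>x. norm (th x)"]
      continuous_on_norm[OF continuous_on_th] by blast
  have "x0 \<noteq> 0" using x0(1) by auto
  then have "0 < norm (th x0)" using th_eq_zero by auto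
  moreover have "norm (th x0) * norm x \<le> norm (th x)" if x: "1 \<le> norm x" for x
  proof -
    define t where "t = norm x"
    define u where "u = (of_real (1 / t) :: complex) *s x"
    have t: "1 \<le> t" using x by (simp add: t_def)
    have "u = (1 / t) *\<^sub>R x" by (simp add: u_def vec_eq_iff) (simp add: scaleR_conv_of_real)
    then have "u \<in> sphere 0 1" using t by (auto simp: t_def)
    have xu: "x = of_real t *s u" using t by (simp add: u_def vec_eq_iff)
    have "t * norm (th u) \<le> norm (th x)"
    proof -
      have "norm (t *\<^sub>R th u) \<le> norm (dil (of_real t) (th u))"
      proof (rule norm_le_componentwise_cart)
        fix i
        have "t ^ 1 \<le> t ^ wt i" using t wt_pos[of i] by (intro power_increasing) auto
        then show "norm ((t *\<^sub>R th u) $ i) \<le> norm (dil (of_real t) (th u) $ i)"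
          using t by (simp add: dil_def norm_mult norm_power mult_right_mono)
      qed
      then show ?thesis using t by (simp add: xu th_scale)
    qed
    moreover have "norm (th x0) \<le> norm (th u)" by (rule x0(2)[OF \<open>u \<in> sphere 0 1\<close>])
    ultimately show ?thesis using t mult_left_mono[of "norm (th x0)" "norm (th u)" t]
      by (simp add: t_def mult.commute)
  qed
  ultimately show ?thesis by (rule that)
qed

lemma closed_th_image:
  assumes "closed X"
  shows "closed (th ` X)"
  unfolding closed_sequential_limits
proof (intro allI impI, elim conjE)
  fix y l assume y: "\<forall>n. y n \<in> th ` X" "y \<longlonglongrightarrow> l"
  then have "\<forall>n. \<exists>x. x \<in> X \<and> y n = th x" by blast
  then obtain x where x: "\<And>n. x n \<in> X" "\<And>n. y n = th (x n)" by metis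
  obtain d where d: "0 < d" "\<And>x. 1 \<le> norm x \<Longrightarrow> d * norm x \<le> norm (th x)" by (rule norm_th_ge) blast
  have "Bseq y" using y(2) by (intro convergent_imp_Bseq convergentI)
  then obtain R where R: "\<And>n. norm (y n) \<le> R" unfolding Bseq_def by blast
  have "norm (x n) \<le> max 1 (R / d)" for n
  proof (cases "1 \<le> norm (x n)")
    case True
    then have "d * norm (x n) \<le> R" using d(2)[OF True] R[of n] x(2)[of n] by simp
    then have "norm (x n) \<le> R / d" using d(1) by (simp add: field_simps)
    then show ?thesis by simp
  qed simp
  then have "\<forall>n. x n \<in> cball 0 (max 1 (R / d))" by simp
  moreover have "compact (cball (0::complex^'n) (max 1 (R / d)))" by simp
  ultimately obtain l' r where r: "strict_mono r" "(x \<circ> r) \<longlonglongrightarrow> l'"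
    unfolding compact_def by meson
  have "l' \<in> X" using closed_sequentially[OF assms, of "x \<circ> r" l'] x(1) r(2) by auto
  have "(\<lambda>n. th ((x \<circ> r) n)) \<longlonglongrightarrow> th l'"
    using continuous_on_tendsto_compose[OF continuous_on_th[of UNIV] r(2)] by simp
  moreover have "(y \<circ> r) \<longlonglongrightarrow> l" by (rule LIMSEQ_subseq_LIMSEQ[OF y(2) r(1)])
  ultimately have "l = th l'" using LIMSEQ_unique by (fastforce simp: o_def x(2)[symmetric])
  then show "l \<in> th ` X" using \<open>l' \<in> X\<close> by simp
qed

lemma th_interior:
  assumes "jac P x \<noteq> 0" "x \<in> W" "open W"
  shows "th x \<in> interior (th ` W)"
proof -
  define M where "M = jacm th x"
  have "det M \<noteq> 0" using assms by (simp add: M_def jac_eq)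
  then obtain B where B: "M ** B = mat 1" by (metis invertible_det_nz invertible_def)
  have der: "(th has_derivative (\<lambda>h. M *v h)) (at x)"
    using poly_map_has_derivative[OF poly_fun_poly_map, of P x]
    by (simp add: M_def jacm_def matrix_vector_mult_def)
  show ?thesis
  proof (rule sussmann_open_mapping[of UNIV th x _ "\<lambda>h. B *v h" W])
    show "(\<lambda>h. M *v h) \<circ> (\<lambda>h. B *v h) = id" using B by (auto simp: matrix_vector_mul_assoc)
    show "x \<in> interior W" using assms by (simp add: interior_open)
  qed (auto intro: continuous_on_th der bounded_linear_matrix)
qed

text \<open>The product of \<open>jac P\<close> over an orbit is invariant, hence a polynomial in
  \<open>th\<close>; its factors vanish together because \<open>jac P\<close> changes only by
  determinants.\<close>

lemma discriminant:
  obtains q where "\<And>z. cpoly_eval q (th z) = 0 \<longleftrightarrow> jac P z = 0" "\<exists>y. cpoly_eval q y \<noteq> 0"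
proof -
  define f where "f z = (\<Prod>A\<in>G. jac P (A *v z))" for z
  have "poly_fun f" unfolding f_def by (intro poly_fun_prod poly_fun_compose_matrix) simp
  moreover have "f (A *v u) = f u" if "A \<in> G" for A u
    unfolding f_def matrix_vector_mul_assoc
    using prod.reindex_bij_betw[OF bij_G_mult[OF that], of "\<lambda>B. jac P (B *v u)"] .
  ultimately have "\<exists>q. \<forall>z. f z = cpoly_eval q (th z)" using invariant_poly_fun[of f] by metis
  then obtain q where q: "\<And>z. f z = cpoly_eval q (th z)" by blast
  have "jac P (A *v z) = 0 \<longleftrightarrow> jac P z = 0" if "A \<in> G" for A z
    using jac_skew[OF that, of z] G_det[OF that] by auto
  then have "f z = 0 \<longleftrightarrow> jac P z = 0" for z
    unfolding f_def using G_finite G_one by (auto simp: prod_zero_iff)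
  then show ?thesis using that q jac_nontrivial by metis
qed

text \<open>The range is closed by properness and open off the discriminant. A suitable complex line
  meets the discriminant in finitely many points, so the rest of the line is connected and lies in
  the range as soon as one of its points does; points of the discriminant are limits.\<close>

lemma surj_th: "range th = UNIV"
proof -
  obtain q where q: "\<And>z. cpoly_eval q (th z) = 0 \<longleftrightarrow> jac P z = 0" by (rule discriminant) blast
  obtain x2 where x2: "jac P x2 \<noteq> 0" using jac_nontrivial by blast
  define y2 where "y2 = th x2"
  have q2: "cpoly_eval q y2 \<noteq> 0" using q[of x2] x2 by (simp add: y2_def)
  have fin: "finite {t. cpoly_eval q (y1 + t *s (y2 - y1)) = 0}" for y1
  proof -
    have "poly (line_poly (cpoly_eval q) y1 (y2 - y1)) 1 \<noteq> 0" using q2 by (simp add: poly_line_poly)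
    then have "line_poly (cpoly_eval q) y1 (y2 - y1) \<noteq> 0" by auto
    from poly_roots_finite[OF this] show ?thesis unfolding poly_line_poly[OF poly_fun_cpoly_eval] .
  qed
  have clo: "closed (range th)" by (rule closed_th_image) simp
  have main: "y1 \<in> range th" if y1: "cpoly_eval q y1 \<noteq> 0" for y1
  proof -
    define T where "T = - {t. cpoly_eval q (y1 + t *s (y2 - y1)) = 0}"
    define ln where "ln t = y1 + t *s (y2 - y1)" for t
    have ln: "continuous_on UNIV ln"
      unfolding ln_def vector_scalar_mult_def by (intro continuous_intros continuous_on_vec_lambda)
    have oT: "open T" unfolding T_def using fin[of y1] by (simp add: open_Compl finite_imp_closed)
    have "connected T" unfolding T_def
      using fin[of y1] connected_open_delete_finite[of UNIV "{t. cpoly_eval q (y1 + t *s (y2 - y1)) = 0}"]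
      by (simp add: Compl_eq_Diff_UNIV connected_UNIV)
    have op: "open {t \<in> T. ln t \<in> range th}"
    proof -
      have "{t \<in> T. ln t \<in> range th} = T \<inter> ln -` interior (range th)"
      proof (intro equalityI subsetI)
        fix t assume t: "t \<in> {t \<in> T. ln t \<in> range th}"
        then obtain x where x: "ln t = th x" by auto
        then have "jac P x \<noteq> 0" using t q[of x] by (simp add: T_def ln_def)
        then show "t \<in> T \<inter> ln -` interior (range th)" using th_interior[of x UNIV] t x by auto
      qed (use interior_subset in auto)
      then show ?thesis using oT continuous_on_open_vimage[of UNIV ln] ln by (auto intro!: open_Int)
    qed
    have op2: "open {t \<in> T. ln t \<notin> range th}"
    proof -
      have "{t \<in> T. ln t \<notin> range th} = T \<inter> ln -` (- range th)" by auto
      then show ?thesis using oT clo continuous_on_open_vimage[of UNIV ln] ln by (auto intro!: open_Int)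
    qed
    have "1 \<in> {t \<in> T. ln t \<in> range th}" using q2 by (auto simp: T_def ln_def y2_def)
    moreover have "0 \<in> T" using y1 by (simp add: T_def)
    moreover have "T \<subseteq> {t \<in> T. ln t \<in> range th} \<union> {t \<in> T. ln t \<notin> range th}" by auto
    ultimately have "0 \<notin> {t \<in> T. ln t \<notin> range th}"
      using connectedD[OF \<open>connected T\<close> op op2] by blast
    then show ?thesis using \<open>0 \<in> T\<close> by (simp add: ln_def)
  qed
  show ?thesis
  proof (intro equalityI subsetI)
    fix y0 :: "complex^'n"
    define F where "F = {t. cpoly_eval q (y0 + t *s (y2 - y0)) = 0}"
    have "0 islimpt - F"
      using fin[of y0] unfolding F_def[symmetric]
      by (metis Compl_eq_Diff_UNIV islimpt_UNIV islimpt_Un_finite Un_Diff_cancel2 sup_commute Un_UNIV_right)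
    then obtain t where t: "\<And>n::nat. t n \<in> - F" "t \<longlonglongrightarrow> 0" unfolding islimpt_sequential by blast
    have lim: "(\<lambda>n. y0 + t n *s (y2 - y0)) \<longlonglongrightarrow> y0 + 0 *s (y2 - y0)"
      unfolding vector_scalar_mult_def using t(2) by (intro tendsto_intros tendsto_vec_lambda)
    have mem: "\<And>n. y0 + t n *s (y2 - y0) \<in> range th" using main t(1) by (simp add: F_def)
    from closed_sequentially[OF clo mem lim] show "y0 \<in> range th" by simp
  qed simp
qed

text \<open>By surjectivity and \<open>th_eq_imp_orbit\<close> the complement of the image is the
  image of the closed set of points whose orbit misses \<open>W\<close>. Branch points are covered
  as well.\<close>

theorem open_th_image:
  assumes "open W"
  shows "open (th ` W)"
proof -
  define X where "X = {x. \<forall>A\<in>G. A *v x \<notin> W}"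
  have "- X = (\<Union>A\<in>G. (\<lambda>x. A *v x) -` W)" by (auto simp: X_def)
  moreover have "open ((\<lambda>x. A *v x) -` W)" for A :: "complex^'n^'n"
    using continuous_on_open_vimage[of UNIV "\<lambda>x. A *v x"] continuous_on_matrix assms by auto
  then have "open (\<Union>A\<in>G. (\<lambda>x. A *v x) -` W)" by (intro open_UN ballI)
  ultimately have "closed X" unfolding closed_def by (simp only:)
  then have "closed (th ` X)" by (rule closed_th_image)
  moreover have "- (th ` W) = th ` X"
  proof (intro equalityI subsetI)
    fix y assume y: "y \<in> - (th ` W)"
    obtain x where x: "y = th x" using surj_th by (metis UNIV_I imageE)
    have "x \<in> X" unfolding X_def
    proof (intro CollectI ballI notI)
      fix A assume "A \<in> G" "A *v x \<in> W"
      then have "th x \<in> th ` W" using th_invariant by (metis imageI)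
      then show False using y x by simp
    qed
    then show "y \<in> th ` X" using x by simp
  next
    fix y assume "y \<in> th ` X"
    then obtain x where x: "y = th x" "x \<in> X" by auto
    show "y \<in> - (th ` W)"
    proof (intro ComplI notI)
      assume "y \<in> th ` W"
      then obtain w where w: "w \<in> W" "th w = th x" using x by auto
      then obtain A where "A \<in> G" "A *v x = w" by (metis th_eq_imp_orbit)
      then show False using x(2) w(1) by (auto simp: X_def)
    qed
  qed
  ultimately show ?thesis by (simp add: open_closed)
qed

end

section \<open>Homogeneous expansions\<close>

lemma poly_fun_poly: "poly_fun g \<Longrightarrow> poly_fun (\<lambda>y. poly p (g y))"
  unfolding poly_altdef by (intro poly_fun_sum poly_fun_mult poly_fun_power) simp_all

lemma norm_smult_vec: "norm (c *s z) = cmod c * norm (z::complex^'n)"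
  by (simp add: norm_vec_def norm_mult L2_set_right_distrib)

definition lagrange_basis :: "nat \<Rightarrow> nat \<Rightarrow> complex poly" where
  "lagrange_basis n j = (\<Prod>i\<in>{..n} - {j}. smult (1 / (of_nat j - of_nat i)) [:- of_nat i, 1:])"

lemma poly_lagrange_basis:
  assumes "i \<le> n" "j \<le> n"
  shows "poly (lagrange_basis n j) (of_nat i) = (if i = j then 1 else 0)"
proof (cases "i = j")
  case True
  have "(1 / (of_nat j - of_nat k)) * (- of_nat k + of_nat j) = (1::complex)" if "k \<noteq> j" for k
    using that by simp
  then have "poly (lagrange_basis n j) (of_nat j) = 1"
    unfolding lagrange_basis_def poly_prod by (intro prod.neutral ballI) (auto simp del: smult_pCons)
  then show ?thesis using True by simp
next
  case False
  then have "i \<in> {..n} - {j}" using assms by auto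
  then show ?thesis using False by (auto simp: lagrange_basis_def poly_prod prod_zero_iff)
qed

lemma degree_lagrange_basis: "j \<le> n \<Longrightarrow> degree (lagrange_basis n j) \<le> n"
proof -
  assume j: "j \<le> n"
  have "degree (lagrange_basis n j) \<le> sum (degree \<circ> (\<lambda>i. smult (1 / (of_nat j - of_nat i)) [:- of_nat i, 1::complex:])) ({..n} - {j})"
    unfolding lagrange_basis_def by (rule degree_prod_sum_le) simp
  also have "\<dots> \<le> (\<Sum>i\<in>{..n} - {j}. 1)" by (intro sum_mono) (simp add: degree_smult_eq)
  also have "\<dots> = n" using j by simp
  finally show ?thesis .
qed

lemma lagrange_interpolation:
  assumes "degree p \<le> n"
  shows "poly p t = (\<Sum>j\<le>n. poly p (of_nat j) * poly (lagrange_basis n j) t)"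
proof -
  have "p = (\<Sum>j\<le>n. smult (poly p (of_nat j)) (lagrange_basis n j))" (is "p = ?q")
  proof (rule poly_eqI_degree[of "of_nat ` {..n}"])
    fix x :: complex assume "x \<in> of_nat ` {..n}"
    then obtain i where i: "i \<le> n" "x = of_nat i" by auto
    have "poly ?q x = (\<Sum>j\<le>n. if i = j then poly p (of_nat j) else 0)"
      unfolding poly_sum by (rule sum.cong) (auto simp: i poly_lagrange_basis)
    then show "poly p x = poly ?q x" using i by simp
  next
    have c: "card (of_nat ` {..n} :: complex set) = Suc n"
      by (subst card_image) (auto simp: inj_on_def)
    show "degree p < card (of_nat ` {..n} :: complex set)" using assms c by simp
    have "degree ?q \<le> n"
      by (rule degree_sum_le) (auto simp: degree_smult_eq degree_lagrange_basis)
    then show "degree ?q < card (of_nat ` {..n} :: complex set)" using c by simp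
  qed
  then have "poly p t = poly ?q t" by simp
  then show ?thesis by (simp add: poly_sum)
qed

text \<open>Interpolation at the nodes 0 to \<open>n\<close> in one coordinate after another;
  \<open>I\<close> holds the coordinates already freed. The common degree bound makes the nodes the
  same for all lines.\<close>

lemma poly_fun_separately:
  fixes F :: "complex^'n \<Rightarrow> complex"
  assumes "\<And>x i. \<exists>p. degree p \<le> n \<and> (\<forall>t. F (x + t *s axis i 1) = poly p t)"
  shows "poly_fun F"
proof -
  have "\<forall>c::complex^'n. poly_fun (\<lambda>y. F (\<chi> k. if k \<in> I then y $ k else c $ k))" if "finite I" for I :: "'n set"
    using that
  proof induction
    case (insert i I)
    show ?case
    proof
      fix c :: "complex^'n"
      define c' where "c' j = (\<chi> k. if k = i then of_nat j else c $ k)" for j :: nat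
      have "F (\<chi> k. if k \<in> insert i I then y $ k else c $ k) =
        (\<Sum>j\<le>n. F (\<chi> k. if k \<in> I then y $ k else c' j $ k) * poly (lagrange_basis n j) (y $ i))" for y
      proof -
        define x where "x = (\<chi> k. if k \<in> I then y $ k else if k = i then 0 else c $ k)"
        obtain p where p: "degree p \<le> n" "\<forall>t. F (x + t *s axis i 1) = poly p t" using assms by blast
        have 1: "(\<chi> k. if k \<in> insert i I then y $ k else c $ k) = x + (y $ i) *s axis i 1"
          using insert.hyps by (auto simp: x_def vec_eq_iff axis_def)
        have 2: "(\<chi> k. if k \<in> I then y $ k else c' j $ k) = x + of_nat j *s axis i 1" for j
          using insert.hyps by (auto simp: x_def c'_def vec_eq_iff axis_def)
        show ?thesis unfolding 1 2 p(2)[rule_format] by (rule lagrange_interpolation[OF p(1)])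
      qed
      moreover have "poly_fun (\<lambda>y. \<Sum>j\<le>n. F (\<chi> k. if k \<in> I then y $ k else c' j $ k) * poly (lagrange_basis n j) (y $ i))"
        using insert.IH by (intro poly_fun_sum poly_fun_mult poly_fun_poly) auto
      ultimately show "poly_fun (\<lambda>y. F (\<chi> k. if k \<in> insert i I then y $ k else c $ k))" by simp
    qed
  qed simp
  from this[of UNIV] show ?thesis by simp
qed

lemma holo_on_line_derivative:
  fixes F :: "complex^'n \<Rightarrow> complex"
  assumes F: "(F has_derivative D) (at (x + t *s v))" and D: "\<And>c u. D (c *s u) = c * D u"
  shows "((\<lambda>s. F (x + s *s v)) has_field_derivative D v) (at t)"
proof -
  have "((\<lambda>s. x + s *s v) has_derivative (\<lambda>h. h *s v)) (at t)"
    by (rule has_derivative_vec_componentwise) (auto intro!: derivative_eq_intros)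
  from has_derivative_compose[where g = F and f = "\<lambda>s. x + s *s v", OF this F]
  have "((\<lambda>s. F (x + s *s v)) has_derivative (\<lambda>h. D (h *s v))) (at t)" .
  then show ?thesis by (simp add: has_field_derivative_def D mult_commute_abs)
qed

lemma holo_on_derivative:
  assumes "holo_on F U" "open U" "z \<in> U"
  obtains D where "(F has_derivative D) (at z)" "\<And>c u. D (c *s u) = c * D u"
  using assms unfolding holo_on_def by (metis at_within_open)

lemma holo_on_line:
  fixes F :: "complex^'n \<Rightarrow> complex"
  assumes F: "holo_on F U" "open U" and S: "open S" "\<And>t. t \<in> S \<Longrightarrow> x + t *s v \<in> U"
  shows "(\<lambda>t. F (x + t *s v)) holomorphic_on S"
  unfolding holomorphic_on_open[OF S(1)]
proof (intro ballI)
  fix t assume "t \<in> S"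
  then obtain D where "(F has_derivative D) (at (x + t *s v))" "\<And>c u. D (c *s u) = c * D u"
    using holo_on_derivative[OF F S(2)] by metis
  then show "\<exists>f'. ((\<lambda>t. F (x + t *s v)) has_field_derivative f') (at t)"
    using holo_on_line_derivative by metis
qed

lemma holo_on_continuous_on: "holo_on F U \<Longrightarrow> continuous_on U F"
  unfolding holo_on_def continuous_on_eq_continuous_within
  using has_derivative_continuous by blast

lemma holo_on_subset: "holo_on F U \<Longrightarrow> V \<subseteq> U \<Longrightarrow> holo_on F V"
  unfolding holo_on_def by (meson has_derivative_subset subsetD)

lemma holo_on_locally:
  assumes "\<And>y. y \<in> U \<Longrightarrow> \<exists>W. open W \<and> y \<in> W \<and> holo_on F W"
  shows "holo_on F U"
  unfolding holo_on_def
proof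
  fix y assume "y \<in> U"
  then obtain W where W: "open W" "y \<in> W" "holo_on F W" using assms by blast
  then obtain D where "(F has_derivative D) (at y)" "\<And>c u. D (c *s u) = c * D u"
    using holo_on_derivative by metis
  then show "\<exists>D. (F has_derivative D) (at y within U) \<and> (\<forall>c u. D (c *s u) = c * D u)"
    using has_derivative_at_withinI by blast
qed

lemma holo_on_mult:
  assumes "holo_on F U" "holo_on H U"
  shows "holo_on (\<lambda>z. F z * H z) U"
  unfolding holo_on_def
proof
  fix z assume "z \<in> U"
  then obtain D E where D: "(F has_derivative D) (at z within U)" "\<forall>c u. D (c *s u) = c * D u"
    and E: "(H has_derivative E) (at z within U)" "\<forall>c u. E (c *s u) = c * E u"
    using assms unfolding holo_on_def by meson
  show "\<exists>D. ((\<lambda>z. F z * H z) has_derivative D) (at z within U) \<and> (\<forall>c u. D (c *s u) = c * D u)"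
    by (intro exI[of _ "\<lambda>h. F z * E h + D h * H z"] conjI has_derivative_mult D(1) E(1))
      (simp add: D(2) E(2) algebra_simps)
qed

lemma holo_on_add:
  assumes "holo_on F U" "holo_on H U"
  shows "holo_on (\<lambda>z. F z + H z) U"
  unfolding holo_on_def
proof
  fix z assume "z \<in> U"
  then obtain D E where D: "(F has_derivative D) (at z within U)" "\<forall>c u. D (c *s u) = c * D u"
    and E: "(H has_derivative E) (at z within U)" "\<forall>c u. E (c *s u) = c * E u"
    using assms unfolding holo_on_def by meson
  show "\<exists>D. ((\<lambda>z. F z + H z) has_derivative D) (at z within U) \<and> (\<forall>c u. D (c *s u) = c * D u)"
    by (intro exI[of _ "\<lambda>h. D h + E h"] conjI has_derivative_add D(1) E(1))
      (simp add: D(2) E(2) algebra_simps)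
qed

lemma holo_on_const: "holo_on (\<lambda>z. c) U"
  by (rule poly_fun_holo_on) simp

lemma holo_on_cmult: "holo_on F U \<Longrightarrow> holo_on (\<lambda>z. c * F z) U"
  by (rule holo_on_mult[OF holo_on_const])

lemma holo_on_compose_poly:
  assumes F: "holo_on F (H ` U)" and H: "\<And>i. poly_fun (\<lambda>z. H z $ i)"
  shows "holo_on (\<lambda>z. F (H z)) U"
  unfolding holo_on_def
proof
  fix z assume "z \<in> U"
  then obtain D where D: "(F has_derivative D) (at (H z) within H ` U)" "\<forall>c u. D (c *s u) = c * D u"
    using F unfolding holo_on_def by (meson imageI)
  define E where "E h = (\<chi> i. \<Sum>j\<in>UNIV. pd (\<lambda>z. H z $ i) j z * h $ j)" for h
  have E: "(H has_derivative E) (at z within U)"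
    unfolding E_def[abs_def] by (rule has_derivative_at_withinI[OF poly_map_has_derivative[OF H]])
  have "E (c *s h) = c *s E h" for c h
    by (simp add: E_def vec_eq_iff sum_distrib_left mult_ac)
  then show "\<exists>D. ((\<lambda>z. F (H z)) has_derivative D) (at z within U) \<and> (\<forall>c u. D (c *s u) = c * D u)"
    using has_derivative_in_compose[OF E D(1)] D(2) by (intro exI[of _ "\<lambda>h. D (E h)"]) simp
qed

text \<open>Cauchy's estimate along complex lines makes the differentiated series converge uniformly.\<close>

lemma holo_on_geometric_series:
  fixes Q :: "nat \<Rightarrow> complex^'n \<Rightarrow> complex"
  assumes Q: "\<And>n. poly_fun (Q n)" and W: "open W" and s: "0 \<le> s" "s < 1"
    and bound: "\<And>n y. y \<in> W \<Longrightarrow> cmod (Q n y) \<le> C * s ^ n"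
  shows "holo_on (\<lambda>y. suminf (\<lambda>n. Q n y)) W"
proof (rule holo_on_locally)
  fix y0 assume "y0 \<in> W"
  then obtain a where a: "0 < a" "ball y0 (2 * a) \<subseteq> W"
    using W open_contains_ball[of W] by (metis field_sum_of_halves half_gt_zero mult_2)
  have C: "0 \<le> C" using order_trans[OF norm_ge_zero bound[OF \<open>y0 \<in> W\<close>, of 0]] by simp
  define D where "D n y h = (\<Sum>i\<in>UNIV. pd (Q n) i y * h $ i)" for n y h
  have D: "(Q n has_derivative D n y) (at y)" for n y
    unfolding D_def[abs_def] by (rule poly_fun_has_derivative(1)[OF Q])
  have D_sc: "D n y (c *s u) = c * D n y u" for n y c u
    by (simp add: D_def sum_distrib_left mult_ac)
  have D_bound: "cmod (D n y h) \<le> C * s ^ n * norm h / a" if y: "y \<in> ball y0 a" for n y h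
  proof (cases "h = 0")
    case True
    then show ?thesis by (simp add: D_def)
  next
    case False
    define r where "r = a / norm h"
    have r: "0 < r" using False a by (simp add: r_def)
    have hol: "(\<lambda>t. Q n (y + t *s h)) holomorphic_on UNIV"
      by (rule holo_on_line[OF poly_fun_holo_on[OF Q, of n UNIV]]) auto
    have "cmod ((deriv ^^ 1) (\<lambda>t. Q n (y + t *s h)) 0) \<le> fact 1 * (C * s ^ n) / r ^ 1"
    proof (rule Cauchy_inequality)
      show "(\<lambda>t. Q n (y + t *s h)) holomorphic_on ball 0 r" using hol holomorphic_on_subset by blast
      show "continuous_on (cball 0 r) (\<lambda>t. Q n (y + t *s h))"
        by (rule holomorphic_on_imp_continuous_on[OF holomorphic_on_subset[OF hol]]) simp
      fix t :: complex assume "cmod (0 - t) = r"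
      then have "norm (t *s h) = a" using False by (simp add: norm_smult_vec r_def)
      then have "dist y0 (y + t *s h) < 2 * a"
        using y norm_triangle_ineq[of "y - y0" "t *s h"] by (simp add: dist_norm norm_minus_commute algebra_simps)
      then show "cmod (Q n (y + t *s h)) \<le> C * s ^ n" using a(2) by (intro bound) auto
    qed (rule r)
    moreover have "((\<lambda>t. Q n (y + t *s h)) has_field_derivative D n y h) (at 0)"
      by (rule holo_on_line_derivative) (simp_all add: D D_sc)
    then have "deriv (\<lambda>t. Q n (y + t *s h)) 0 = D n y h" by (rule DERIV_imp_deriv)
    ultimately show ?thesis by (simp add: r_def mult_ac)
  qed
  have geo: "summable (\<lambda>n. C * s ^ n)" using s by (intro summable_mult summable_geometric) simp
  have sD: "summable (\<lambda>n. D n y h)" if "y \<in> ball y0 a" for y h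
  proof (rule summable_comparison_test')
    show "summable (\<lambda>n. C * s ^ n * (norm h / a))" by (rule summable_mult2[OF geo])
    show "norm (D n y h) \<le> C * s ^ n * (norm h / a)" if "n \<ge> 0" for n
      using D_bound[OF \<open>y \<in> ball y0 a\<close>, of n h] by simp
  qed
  define D' where "D' y h = suminf (\<lambda>n. D n y h)" for y h
  have tail: "norm ((\<Sum>i<n. D i y h) - D' y h) \<le> C * s ^ n / (1 - s) / a * norm h" if y: "y \<in> ball y0 a" for n y h
  proof -
    have "D' y h - (\<Sum>i<n. D i y h) = suminf (\<lambda>i. D (i + n) y h)"
      unfolding D'_def by (rule suminf_minus_initial_segment[OF sD[OF y], symmetric])
    also have "norm \<dots> \<le> suminf (\<lambda>i. C * s ^ (i + n) * (norm h / a))"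
    proof (rule norm_suminf_le)
      show "norm (D (i + n) y h) \<le> C * s ^ (i + n) * (norm h / a)" for i
        using D_bound[OF y, of "i + n" h] by simp
      show "summable (\<lambda>i. C * s ^ (i + n) * (norm h / a))"
        using summable_ignore_initial_segment[OF summable_mult2[OF geo, of "norm h / a"], of n] by simp
    qed
    also have "\<dots> = C * s ^ n * (norm h / a) * suminf (\<lambda>i. s ^ i)"
      using s by (subst suminf_mult[symmetric]) (auto intro!: summable_geometric simp: power_add mult_ac)
    also have "suminf (\<lambda>i. s ^ i) = 1 / (1 - s)" using s by (intro suminf_geometric) simp
    finally show ?thesis by (simp add: norm_minus_commute mult_ac)
  qed
  have "\<exists>g. \<forall>y\<in>ball y0 a. (\<lambda>n. Q n y) sums g y \<and> (g has_derivative D' y) (at y within ball y0 a)"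
  proof (rule has_derivative_series)
    show "convex (ball y0 a)" by simp
    show "(Q n has_derivative D n y) (at y within ball y0 a)" for n y
      by (rule has_derivative_at_withinI[OF D])
    show "y0 \<in> ball y0 a" using a by simp
    show "(\<lambda>n. Q n y0) sums suminf (\<lambda>n. Q n y0)"
      by (rule summable_sums, rule summable_comparison_test'[OF geo]) (use bound[OF \<open>y0 \<in> W\<close>] in simp)
    fix e :: real assume e: "0 < e"
    have "(\<lambda>n. C * s ^ n / (1 - s) / a) \<longlonglongrightarrow> C * 0 / (1 - s) / a"
      using s by (intro tendsto_intros LIMSEQ_power_zero) (use a in auto)
    then have "\<forall>\<^sub>F n in sequentially. C * s ^ n / (1 - s) / a < e"
      using e by (intro order_tendstoD(2)[of _ "C * 0 / (1 - s) / a"]) auto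
    then show "\<forall>\<^sub>F n in sequentially. \<forall>x\<in>ball y0 a. \<forall>h. norm ((\<Sum>i<n. D i x h) - D' x h) \<le> e * norm h"
    proof eventually_elim
      case (elim n)
      then show ?case
        using tail order_trans mult_right_mono[OF less_imp_le[OF elim] norm_ge_zero] by blast
    qed
  qed
  then obtain g where g: "\<forall>y\<in>ball y0 a. (\<lambda>n. Q n y) sums g y \<and> (g has_derivative D' y) (at y within ball y0 a)" ..
  have "holo_on (\<lambda>y. suminf (\<lambda>n. Q n y)) (ball y0 a)"
    unfolding holo_on_def
  proof
    fix y assume y: "y \<in> ball y0 a"
    have "((\<lambda>y. suminf (\<lambda>n. Q n y)) has_derivative D' y) (at y within ball y0 a)"
      by (rule has_derivative_transform[OF y _ g[rule_format, OF y, THEN conjunct2]])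
        (use g in \<open>auto simp: sums_iff\<close>)
    moreover have "D' y (c *s u) = c * D' y u" for c u
      unfolding D'_def D_sc using sD[OF y] by (rule suminf_mult)
    ultimately show "\<exists>D. ((\<lambda>y. suminf (\<lambda>n. Q n y)) has_derivative D) (at y within ball y0 a) \<and> (\<forall>c u. D (c *s u) = c * D u)"
      by blast
  qed
  then show "\<exists>W. open W \<and> y0 \<in> W \<and> holo_on (\<lambda>y. suminf (\<lambda>n. Q n y)) W"
    using a by (intro exI[of _ "ball y0 a"]) auto
qed

text \<open>The component of degree \<open>n\<close> of the Taylor expansion at 0. Taken from the
  slice in direction \<open>z\<close> it is a one-variable derivative, meaningful for every
  \<open>z\<close> because small multiples of \<open>z\<close> lie in the domain.\<close>

definition hcomp :: "(complex^'n \<Rightarrow> complex) \<Rightarrow> nat \<Rightarrow> complex^'n \<Rightarrow> complex" where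
  "hcomp F n z = (deriv ^^ n) (\<lambda>w. F (w *s z)) 0 / fact n"

section \<open>Taylor components on a circled convex domain\<close>

locale circled_domain =
  fixes \<Omega> :: "(complex^'n) set"
  assumes domain: "standard_bsd \<Omega>"
begin

lemma open_dom: "open \<Omega>" and convex_dom: "convex \<Omega>" and zero_dom: "0 \<in> \<Omega>" and bounded_dom: "bounded \<Omega>"
  and circ_dom: "z \<in> \<Omega> \<Longrightarrow> cmod c = 1 \<Longrightarrow> c *s z \<in> \<Omega>"
  using domain by (auto simp: standard_bsd_def bounded_domain_def)

lemma compact_closure_dom: "compact (closure \<Omega>)"
  using bounded_dom by (simp add: compact_closure)

lemma continuous_scale: "continuous_on X (\<lambda>z::complex^'n. c *s z)"
  unfolding vector_scalar_mult_def by (intro continuous_intros continuous_on_vec_lambda)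

lemma circ_closure:
  assumes "z \<in> closure \<Omega>" "cmod c = 1"
  shows "c *s z \<in> closure \<Omega>"
proof -
  have "(\<lambda>z. c *s z) ` closure \<Omega> \<subseteq> closure \<Omega>"
    by (rule image_closure_subset[OF continuous_scale]) (use circ_dom[OF _ assms(2)] closure_subset in auto)
  then show ?thesis using assms(1) by auto
qed

lemma scale_closure:
  assumes z: "z \<in> closure \<Omega>" and c: "cmod c < 1"
  shows "c *s z \<in> \<Omega>"
proof (cases "c = 0 \<or> z = 0")
  case True
  then show ?thesis using zero_dom by auto
next
  case False
  define r where "r = cmod c"
  have r: "0 < r" "r < 1" using c False by (auto simp: r_def)
  have "open_segment 0 z \<subseteq> interior \<Omega>"
    using convex_dom zero_dom z open_dom by (intro in_interior_closure_convex_segment) (auto simp: interior_open)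
  moreover have "r *\<^sub>R z \<in> open_segment 0 z" using r False by (auto simp: in_segment)
  ultimately have "r *\<^sub>R z \<in> \<Omega>" using open_dom by (auto simp: interior_open)
  then have "(c / of_real r) *s (r *\<^sub>R z) \<in> \<Omega>" using r by (intro circ_dom) (auto simp: norm_divide r_def)
  moreover have "(c / of_real r) *s (r *\<^sub>R z) = c *s z"
    using r by (simp add: vec_eq_iff scaleR_conv_of_real[where 'a = complex])
  ultimately show ?thesis by simp
qed

lemma scaleR_closure: "z \<in> closure \<Omega> \<Longrightarrow> 0 \<le> r \<Longrightarrow> r < 1 \<Longrightarrow> r *\<^sub>R z \<in> \<Omega>"
  using scale_closure[of z "of_real r"] by (simp add: scaleR_vec_def vector_scalar_mult_def scaleR_conv_of_real)

lemma slice_holomorphic: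
  assumes "holo_on F \<Omega>" "z \<in> closure \<Omega>"
  shows "(\<lambda>w. F (w *s z)) holomorphic_on ball 0 1"
  using holo_on_line[OF assms(1) open_dom, of "ball 0 1" 0 z] scale_closure[OF assms(2)] by simp

lemma near_zero:
  obtains e where "0 < e" "\<And>z. norm z \<le> e \<Longrightarrow> z \<in> \<Omega>"
  using open_dom zero_dom open_contains_cball[of \<Omega>] by (force simp: dist_norm)

lemma hcomp_sums:
  assumes "holo_on F \<Omega>" "z \<in> closure \<Omega>" "cmod w < 1"
  shows "(\<lambda>n. hcomp F n z * w ^ n) sums F (w *s z)"
  using holomorphic_power_series[OF slice_holomorphic[OF assms(1,2)], of w] assms(3)
  by (simp add: hcomp_def)

lemma hcomp_scale:
  assumes F: "holo_on F \<Omega>"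
  shows "hcomp F n (c *s z) = c ^ n * hcomp F n z"
proof -
  obtain e where e: "0 < e" "\<And>z. norm z \<le> e \<Longrightarrow> z \<in> \<Omega>" by (rule near_zero) blast
  define \<rho> where "\<rho> = e / (norm z + 1)"
  have \<rho>: "0 < \<rho>" using e by (simp add: \<rho>_def add_nonneg_pos)
  have hol: "(\<lambda>w. F (w *s z)) holomorphic_on ball 0 \<rho>"
  proof -
    have "w *s z \<in> \<Omega>" if "w \<in> ball 0 \<rho>" for w :: complex
    proof (rule e(2))
      have "cmod w * norm z \<le> \<rho> * (norm z + 1)" using that \<rho> by (intro mult_mono) auto
      then show "norm (w *s z) \<le> e" using \<rho> by (simp add: norm_smult_vec \<rho>_def add_nonneg_eq_0_iff)
    qed
    then show ?thesis using holo_on_line[OF F open_dom, of "ball 0 \<rho>" 0 z] by simp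
  qed
  have "(deriv ^^ n) (\<lambda>w. (\<lambda>w. F (w *s z)) (c * w)) 0 = c ^ n * (deriv ^^ n) (\<lambda>w. F (w *s z)) (c * 0)"
  proof (rule higher_deriv_compose_linear[OF hol, of "ball 0 (\<rho> / (cmod c + 1))"])
    show "0 \<in> ball 0 (\<rho> / (cmod c + 1))" using \<rho> by (simp add: add_nonneg_pos)
    fix w :: complex assume w: "w \<in> ball 0 (\<rho> / (cmod c + 1))"
    have "cmod c * cmod w \<le> (cmod c + 1) * cmod w" by (intro mult_right_mono) auto
    also have "\<dots> < \<rho>" using w by (simp add: pos_less_divide_eq add_nonneg_pos mult.commute)
    finally show "c * w \<in> ball 0 \<rho>" by (simp add: norm_mult)
  qed auto
  then show ?thesis by (simp add: hcomp_def vector_smult_assoc mult.commute)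
qed

lemma hcomp_bound:
  assumes F: "holo_on F \<Omega>" and r: "0 < r" and z: "\<And>w. cmod w \<le> r \<Longrightarrow> w *s z \<in> \<Omega>"
    and B: "\<And>w. cmod w = r \<Longrightarrow> cmod (F (w *s z)) \<le> B"
  shows "cmod (hcomp F n z) \<le> B / r ^ n"
proof -
  have c: "continuous_on (cball 0 r) (\<lambda>w. F (w *s z))"
  proof (rule continuous_on_compose2[OF holo_on_continuous_on[OF F]])
    show "continuous_on (cball 0 r) (\<lambda>w. w *s z)"
      unfolding vector_scalar_mult_def by (intro continuous_intros continuous_on_vec_lambda)
  qed (use z in auto)
  have "cmod ((deriv ^^ n) (\<lambda>w. F (w *s z)) 0) \<le> fact n * B / r ^ n"
  proof (rule Cauchy_inequality[OF _ c r])
    show "(\<lambda>w. F (w *s z)) holomorphic_on ball 0 r"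
      using holo_on_line[OF F open_dom, of "ball 0 r" 0 z] z by simp
  qed (use B in simp)
  then show ?thesis by (simp add: hcomp_def norm_divide field_simps)
qed

end

text \<open>Error of the difference quotient that extracts the coefficient \<open>a n\<close>. It
  depends on the coefficients only through \<open>B\<close>, which gives the uniform convergence in
  \<open>poly_fun_hcomp\<close>.\<close>

lemma power_series_remainder:
  fixes w :: complex
  assumes s: "(\<lambda>k. a k * w ^ k) sums f" and a: "\<And>k. cmod (a k) \<le> B" and w: "w \<noteq> 0" "cmod w \<le> 1 / 2"
  shows "cmod ((f - (\<Sum>k<n. a k * w ^ k)) / w ^ n - a n) \<le> 2 * B * cmod w"
proof -
  have B: "0 \<le> B" using order_trans[OF norm_ge_zero a[of 0]] .
  have geo: "(\<lambda>k. (1 / 2) ^ k) sums (2::real)" using geometric_sums[of "1 / 2 :: real"] by simp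
  have "(\<lambda>k. a (k + Suc n) * w ^ (k + Suc n)) sums (f - (\<Sum>k<Suc n. a k * w ^ k))"
    by (rule sums_split_initial_segment[OF s])
  then have eq: "f - (\<Sum>k<Suc n. a k * w ^ k) = suminf (\<lambda>k. a (k + Suc n) * w ^ (k + Suc n))"
    by (simp add: sums_iff)
  have "cmod (suminf (\<lambda>k. a (k + Suc n) * w ^ (k + Suc n))) \<le> suminf (\<lambda>k. B * cmod w ^ Suc n * (1 / 2) ^ k)"
  proof (rule norm_suminf_le)
    show "summable (\<lambda>k. B * cmod w ^ Suc n * (1 / 2) ^ k)"
      using geo by (intro summable_mult) (simp add: sums_iff)
    show "cmod (a (k + Suc n) * w ^ (k + Suc n)) \<le> B * cmod w ^ Suc n * (1 / 2) ^ k" for k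
    proof -
      have "cmod (a (k + Suc n) * w ^ (k + Suc n)) = cmod (a (k + Suc n)) * (cmod w ^ Suc n * cmod w ^ k)"
        by (simp add: norm_mult norm_power power_add mult_ac)
      also have "\<dots> \<le> B * (cmod w ^ Suc n * (1 / 2) ^ k)"
        by (intro mult_mono a power_mono w(2)) (use B in auto)
      finally show ?thesis by (simp add: mult_ac)
    qed
  qed
  also have "\<dots> = B * cmod w ^ Suc n * 2"
    using geo by (subst suminf_mult) (auto simp: sums_iff)
  finally have "cmod (f - (\<Sum>k<Suc n. a k * w ^ k)) \<le> 2 * B * cmod w * cmod w ^ n"
    unfolding eq by (simp add: mult_ac)
  moreover have "(f - (\<Sum>k<n. a k * w ^ k)) / w ^ n - a n = (f - (\<Sum>k<Suc n. a k * w ^ k)) / w ^ n"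
    using w by (simp add: field_simps)
  ultimately show ?thesis using w by (simp add: norm_divide norm_power field_simps)
qed

lemma continuous_on_compact_bound:
  fixes f :: "'a::topological_space \<Rightarrow> 'b::real_normed_vector"
  assumes "compact K" "continuous_on K f"
  shows "\<exists>B. \<forall>x\<in>K. norm (f x) \<le> B"
  using compact_imp_bounded[OF compact_continuous_image[OF assms(2,1)]] by (auto simp: bounded_iff)

lemma smult_line: "c *s (x + t *s v) = c *s x + t *s (c *s (v::complex^'n))"
  by (simp add: vec_eq_iff algebra_simps)

context circled_domain
begin

lemma eventually_scale_dom: "\<forall>\<^sub>F w in nhds 0. w *s z \<in> \<Omega>"
proof -
  have "continuous_on UNIV (\<lambda>w. w *s z)"
    unfolding vector_scalar_mult_def by (intro continuous_intros continuous_on_vec_lambda)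
  then have "open ((\<lambda>w. w *s z) -` \<Omega>)" using continuous_on_open_vimage[of UNIV "\<lambda>w. w *s z"] open_dom by auto
  then show ?thesis using zero_dom by (auto simp: eventually_nhds intro!: exI[of _ "(\<lambda>w. w *s z) -` \<Omega>"])
qed

lemma hcomp_cong:
  assumes "\<And>z. z \<in> \<Omega> \<Longrightarrow> F z = H z"
  shows "hcomp F n z = hcomp H n z"
proof -
  have "\<forall>\<^sub>F w in nhds 0. F (w *s z) = H (w *s z)"
    using eventually_scale_dom[of z] by eventually_elim (rule assms)
  then show ?thesis unfolding hcomp_def by (simp only: higher_deriv_cong_ev[OF _ refl])
qed

lemma hcomp_bounded_near_zero:
  assumes F: "holo_on F \<Omega>" and e: "0 < e" "\<And>z. norm z \<le> e \<Longrightarrow> z \<in> \<Omega>"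
  obtains B where "\<And>n z. norm z \<le> e \<Longrightarrow> cmod (hcomp F n z) \<le> B"
proof -
  have "\<exists>B. \<forall>z\<in>cball 0 e. norm (F z) \<le> B"
    by (rule continuous_on_compact_bound[OF _ continuous_on_subset[OF holo_on_continuous_on[OF F]]]) (use e in auto)
  then obtain B where "\<forall>z\<in>cball 0 e. norm (F z) \<le> B" by blast
  then have B: "cmod (F z) \<le> B" if "norm z \<le> e" for z using that by simp
  have "cmod (hcomp F n z) \<le> B" if z: "norm z \<le> e" for n z
  proof -
    have le: "norm (w *s z) \<le> e" if "cmod w \<le> 1" for w
      using mult_mono[OF that z] e by (simp add: norm_smult_vec)
    then show ?thesis using hcomp_bound[OF F, of 1 z B n] B e(2) by simp
  qed
  then show ?thesis by (rule that)
qed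

text \<open>Near 0 the component is a uniform limit of the difference quotients \<open>g j\<close>,
  holomorphic on lines by the induction hypothesis. Homogeneity spreads this to all lines, the
  growth \<open>norm z ^ n\<close> and Liouville's theorem give a polynomial of degree at most
  \<open>n\<close> on each, and \<open>poly_fun_separately\<close> applies.\<close>

lemma poly_fun_hcomp:
  assumes F: "holo_on F \<Omega>"
  shows "poly_fun (hcomp F n)"
proof (induction n rule: less_induct)
  case (less n)
  obtain e where e: "0 < e" "\<And>z. norm z \<le> e \<Longrightarrow> z \<in> \<Omega>" by (rule near_zero) blast
  obtain B where B: "\<And>n z. norm z \<le> e \<Longrightarrow> cmod (hcomp F n z) \<le> B"
    using hcomp_bounded_near_zero[OF F e] by blast
  have B0: "0 \<le> B" using order_trans[OF norm_ge_zero B[of 0 0]] e(1) by simp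
  \<comment> \<open>Points tending to 0; the shift by 2 keeps them at most 1/2, as
    \<open>power_series_remainder\<close> requires.\<close>
  define a :: "nat \<Rightarrow> complex" where "a j = 1 / of_nat (j + 2)" for j
  have a: "cmod (a j) = 1 / real (j + 2)" for j unfolding a_def norm_divide norm_of_nat by simp
  have a2: "cmod (a j) \<le> 1 / 2" for j unfolding a by (simp add: field_simps)
  have a0: "a j \<noteq> 0" for j unfolding a_def divide_eq_0_iff of_nat_eq_0_iff by simp
  have a1: "cmod (a j) < 1" for j using order.strict_trans1[OF a2[of j]] by simp
  define g where "g j z = (F (a j *s z) - (\<Sum>k<n. hcomp F k z * a j ^ k)) / a j ^ n"
    for j :: nat and z
  have gl: "cmod (g j z - hcomp F n z) \<le> 2 * B * (1 / real (j + 2))" if z: "norm z \<le> e" for j z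
  proof -
    have "cmod (g j z - hcomp F n z) \<le> 2 * B * cmod (a j)"
      unfolding g_def
    proof (rule power_series_remainder)
      show "(\<lambda>k. hcomp F k z * a j ^ k) sums F (a j *s z)"
        by (rule hcomp_sums[OF F]) (use e(2)[OF z] closure_subset[of \<Omega>] a1[of j] in auto)
        qed (use B[OF z] a0 a2 in auto)
    then show ?thesis by (simp add: a)
  qed
  have small: "(\<lambda>t. hcomp F n (x + t *s v)) holomorphic_on S"
    if S: "open S" "\<And>t. t \<in> S \<Longrightarrow> norm (x + t *s v) \<le> e" for S x v
  proof (rule holomorphic_uniform_sequence[OF S(1)])
    show "(\<lambda>t. g j (x + t *s v)) holomorphic_on S" for j
    proof -
      have 1: "(\<lambda>t. F (a j *s (x + t *s v))) holomorphic_on S"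
        unfolding smult_line
      proof (rule holo_on_line[OF F open_dom S(1)])
        fix t assume "t \<in> S"
        then have "x + t *s v \<in> closure \<Omega>" using S(2) e(2) closure_subset by blast
        then show "a j *s x + t *s (a j *s v) \<in> \<Omega>"
          unfolding smult_line[symmetric] by (rule scale_closure) (rule a1)
      qed
      have 2: "(\<lambda>t. hcomp F k (x + t *s v)) holomorphic_on S" if "k < n" for k
        by (rule holo_on_line[OF poly_fun_holo_on[OF less.IH[OF that], of UNIV] open_UNIV S(1)]) simp
      show ?thesis unfolding g_def
        by (intro holomorphic_on_divide holomorphic_on_diff holomorphic_on_sum holomorphic_on_mult 1 2 holomorphic_on_const power_not_zero a0) simp
    qed
    fix t assume "t \<in> S"
    then obtain d where d: "0 < d" "cball t d \<subseteq> S" using S(1) open_contains_cball by blast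
    have "uniform_limit S (\<lambda>j t. g j (x + t *s v)) (\<lambda>t. hcomp F n (x + t *s v)) sequentially"
      unfolding uniform_limit_iff dist_norm
    proof (intro allI impI)
      fix \<epsilon> :: real assume "0 < \<epsilon>"
      have "(\<lambda>j. 2 * B * (1 / real (j + 2))) \<longlonglongrightarrow> 2 * B * 0"
        using LIMSEQ_ignore_initial_segment[OF lim_1_over_n, of 2] by (intro tendsto_mult_left) simp
      then have "\<forall>\<^sub>F j in sequentially. 2 * B * (1 / real (j + 2)) < \<epsilon>"
        using \<open>0 < \<epsilon>\<close> by (intro order_tendstoD(2)[of _ "2 * B * 0"]) auto
      then show "\<forall>\<^sub>F j in sequentially. \<forall>t\<in>S. cmod (g j (x + t *s v) - hcomp F n (x + t *s v)) < \<epsilon>"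
        by eventually_elim (use gl S(2) in \<open>blast intro: order.strict_trans1\<close>)
    qed
    then show "\<exists>d>0. cball t d \<subseteq> S \<and> uniform_limit (cball t d) (\<lambda>j t. g j (x + t *s v)) (\<lambda>t. hcomp F n (x + t *s v)) sequentially"
      using d uniform_limit_on_subset by blast
  qed
  have grow: "cmod (hcomp F n z) \<le> B / e ^ n * norm z ^ n" for z
  proof (cases "z = 0")
    case True
    then show ?thesis using hcomp_scale[OF F, of n 0 0] B[of 0 0] e(1) by (cases n) auto
  next
    case False
    define c where "c = (of_real (e / norm z) :: complex)"
    have c: "cmod c = e / norm z" using e by (simp add: c_def norm_divide)
    have "cmod (hcomp F n (c *s z)) \<le> B" using False by (intro B) (simp add: norm_smult_vec c)
    then have "(e / norm z) ^ n * cmod (hcomp F n z) \<le> B" by (simp add: hcomp_scale[OF F] norm_mult norm_power c)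
    then show ?thesis using e(1) False by (simp add: power_divide field_simps)
  qed
  show ?case
  proof (rule poly_fun_separately)
    fix x and i :: 'n
    define v :: "complex^'n" where "v = axis i 1"
    define h where "h t = hcomp F n (x + t *s v)" for t
    have v: "norm v = 1" by (simp add: v_def)
    have le: "norm (x + t *s v) \<le> norm x + cmod t" for t
      using norm_triangle_ineq[of x "t *s v"] by (simp add: norm_smult_vec v)
    have "h holomorphic_on ball 0 R" if R: "0 < R" for R
    proof -
      \<comment> \<open>Multiplication by \<open>c\<close> moves the disc of radius \<open>R\<close>
        on the line into the ball of radius \<open>e\<close>.\<close>
      define c where "c = (of_real (e / (norm x + R)) :: complex)"
      have pos: "0 < norm x + R" using R by (simp add: add_nonneg_pos)
      have c: "cmod c = e / (norm x + R)" using e pos unfolding c_def norm_of_real by simp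
      have c0: "c \<noteq> 0" using e pos unfolding c_def of_real_eq_0_iff by simp
      have hol: "(\<lambda>t. hcomp F n (c *s x + t *s (c *s v))) holomorphic_on ball 0 R"
      proof (rule small)
        fix t :: complex assume "t \<in> ball 0 R"
        then have "norm (x + t *s v) \<le> norm x + R" using le[of t] by simp
        then have "e / (norm x + R) * norm (x + t *s v) \<le> e / (norm x + R) * (norm x + R)"
          using e pos by (intro mult_left_mono) auto
        then show "norm (c *s x + t *s (c *s v)) \<le> e"
          unfolding smult_line[symmetric] norm_smult_vec c using pos by simp
      qed simp
      have "h t = hcomp F n (c *s x + t *s (c *s v)) / c ^ n" for t
        unfolding h_def smult_line[symmetric] hcomp_scale[OF F] using c0 by simp
      then have "h = (\<lambda>t. hcomp F n (c *s x + t *s (c *s v)) / c ^ n)" by blast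
      then show ?thesis using hol c0 by (auto intro!: holomorphic_intros)
    qed
    then have "h field_differentiable at t" for t
      using holomorphic_on_imp_differentiable_at[of h "ball 0 (cmod t + 1)" t] by (simp add: add_nonneg_pos)
    then have ent: "h holomorphic_on UNIV" by (simp add: holomorphic_on_def)
    have poly: "h t = (\<Sum>k\<le>n. (deriv ^^ k) h 0 / fact k * t ^ k)" for t
    proof (rule Liouville_polynomial[OF ent])
      fix t assume t: "norm x + 1 \<le> cmod t"
      then have "norm (x + t *s v) \<le> 2 * cmod t" using le[of t] by simp
      then have "norm (x + t *s v) ^ n \<le> (2 * cmod t) ^ n" by (rule power_mono) simp
      then show "cmod (h t) \<le> B / e ^ n * 2 ^ n * cmod t ^ n"
        using order_trans[OF grow[of "x + t *s v"] mult_left_mono[of _ _ "B / e ^ n"], of "(2 * cmod t) ^ n"] B0 e(1)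
        by (simp add: h_def power_mult_distrib mult_ac)
    qed
    show "\<exists>p. degree p \<le> n \<and> (\<forall>t. hcomp F n (x + t *s axis i 1) = poly p t)"
    proof (intro exI[of _ "\<Sum>k\<le>n. Polynomial.monom ((deriv ^^ k) h 0 / fact k) k"] conjI allI)
      show "degree (\<Sum>k\<le>n. Polynomial.monom ((deriv ^^ k) h 0 / fact k) k) \<le> n"
        by (rule degree_sum_le) (auto intro: order_trans[OF degree_monom_le])
      show "hcomp F n (x + t *s axis i 1) = poly (\<Sum>k\<le>n. Polynomial.monom ((deriv ^^ k) h 0 / fact k) k) t" for t
        using poly[of t] by (simp add: h_def v_def poly_sum poly_monom)
    qed
  qed
qed

lemma dom_shrink:
  assumes "z \<in> \<Omega>"
  obtains s z' where "0 < s" "s < 1" "z' \<in> \<Omega>" "z = of_real s *s z'"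
proof -
  obtain e where e: "0 < e" "ball z e \<subseteq> \<Omega>" using open_dom assms open_contains_ball by blast
  define t where "t = 1 + e / (2 * (norm z + 1))"
  have p: "0 < norm z + 1" by (simp add: add_nonneg_pos)
  have t: "1 < t" using e p by (simp add: t_def)
  have "norm (of_real (t - 1) *s z) < e"
  proof -
    have "e * norm z < e * (2 * (norm z + 1))" using e by (intro mult_strict_left_mono) (auto simp: add_nonneg_pos)
    then show ?thesis using e p by (simp add: norm_smult_vec t_def pos_divide_less_eq del: of_real_divide of_real_add of_real_mult)
  qed
  then have "dist z (of_real t *s z) < e"
    by (simp add: dist_norm norm_minus_commute vec_eq_iff[symmetric] vector_sub_rdistrib)
  then have "of_real t *s z \<in> \<Omega>" using e by auto
  moreover have "z = of_real (1 / t) *s (of_real t *s z)" using t by (simp add: vector_smult_assoc)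
  ultimately show ?thesis using t by (intro that[of "1 / t" "of_real t *s z"]) auto
qed

lemma hcomp_sums_dom:
  assumes F: "holo_on F \<Omega>" and z: "z \<in> \<Omega>"
  shows "(\<lambda>n. hcomp F n z) sums F z"
proof -
  obtain s z' where s: "0 < s" "s < 1" "z' \<in> \<Omega>" "z = of_real s *s z'" by (rule dom_shrink[OF z])
  have "(\<lambda>n. hcomp F n z' * of_real s ^ n) sums F (of_real s *s z')"
    using s closure_subset by (intro hcomp_sums[OF F]) auto
  then show ?thesis by (simp add: s(4) hcomp_scale[OF F] mult.commute)
qed

lemma hcomp_bound_closure:
  assumes F: "holo_on F \<Omega>" and r: "0 < r" "r < 1"
  shows "\<exists>M. \<forall>n. \<forall>z\<in>closure \<Omega>. cmod (hcomp F n z) \<le> M / r ^ n"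
proof -
  have sub: "(\<lambda>z. of_real r *s z) ` closure \<Omega> \<subseteq> \<Omega>" using r by (auto intro!: scale_closure)
  have "\<exists>B. \<forall>z\<in>(\<lambda>z. of_real r *s z) ` closure \<Omega>. norm (F z) \<le> B"
    by (intro continuous_on_compact_bound compact_continuous_image compact_closure_dom continuous_scale
        continuous_on_subset[OF holo_on_continuous_on[OF F] sub])
  then obtain M where "\<forall>z\<in>(\<lambda>z. of_real r *s z) ` closure \<Omega>. norm (F z) \<le> M" by blast
  then have M: "cmod (F (of_real r *s z)) \<le> M" if "z \<in> closure \<Omega>" for z using that by simp
  have "cmod (hcomp F n z) \<le> M / r ^ n" if z: "z \<in> closure \<Omega>" for n z
  proof (rule hcomp_bound[OF F r(1)])
    show "w *s z \<in> \<Omega>" if "cmod w \<le> r" for w using that r by (intro scale_closure[OF z]) auto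
    fix w assume w: "cmod w = r"
    have "w *s z = of_real r *s ((w / of_real r) *s z)" using r by (simp only: vector_smult_assoc) simp
    moreover have "(w / of_real r) *s z \<in> closure \<Omega>"
      using w r by (intro circ_closure[OF z]) (auto simp: norm_divide)
    ultimately show "cmod (F (w *s z)) \<le> M" using M by metis
  qed
  then show ?thesis by blast
qed

end

section \<open>Invariant functions descend to the quotient\<close>

locale quotient_domain = reflection_invariants G P + circled_domain \<Omega>
  for G :: "(complex^'n^'n) set" and P :: "'n \<Rightarrow> 'n cpoly" and \<Omega> :: "(complex^'n) set" +
  assumes invariant: "\<forall>A\<in>G. (*v) A ` \<Omega> = \<Omega>"
begin

lemma G_dom: "A \<in> G \<Longrightarrow> z \<in> \<Omega> \<Longrightarrow> A *v z \<in> \<Omega>"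
  using invariant by blast

lemma matrix_smult: "(A::complex^'n^'n) *v (c *s z) = c *s (A *v z)"
  by (simp add: vec_eq_iff matrix_vector_mult_def sum_distrib_left mult_ac)

text \<open>Near \<open>y\<close> all points have the form \<open>th (s u)\<close> with a fixed
  \<open>s < 1\<close>, so homogeneity gains \<open>s ^ n\<close>, and a radius strictly between
  \<open>s\<close> and 1 leaves a convergent geometric series. The neighbourhood is open by
  \<open>open_th_image\<close>.\<close>

lemma weighted_series:
  assumes Q: "\<And>n. poly_fun (Q n)" and hom: "\<And>n c z. Q n (th (c *s z)) = c ^ n * Q n (th z)"
    and bound: "\<And>\<rho>. 0 < \<rho> \<Longrightarrow> \<rho> < 1 \<Longrightarrow> \<exists>M. \<forall>n. \<forall>z\<in>\<Omega>. cmod (Q n (th z)) \<le> M / \<rho> ^ n"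
  shows "holo_on (\<lambda>y. suminf (\<lambda>n. Q n y)) (th ` \<Omega>)"
proof (rule holo_on_locally)
  fix y assume "y \<in> th ` \<Omega>"
  then obtain z where z: "z \<in> \<Omega>" "y = th z" by auto
  obtain s z' where s: "0 < s" "s < 1" "z' \<in> \<Omega>" "z = of_real s *s z'" by (rule dom_shrink[OF z(1)])
  define \<rho> where "\<rho> = (1 + s) / 2"
  have \<rho>: "0 < \<rho>" "\<rho> < 1" "s < \<rho>" using s by (auto simp: \<rho>_def)
  obtain M where M: "\<And>n z. z \<in> \<Omega> \<Longrightarrow> cmod (Q n (th z)) \<le> M / \<rho> ^ n" using bound[OF \<rho>(1,2)] by blast
  have img: "(\<lambda>z. of_real s *s z) ` \<Omega> = (\<lambda>z. s *\<^sub>R z) ` \<Omega>"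
    by (intro image_cong refl) (simp add: vec_eq_iff, simp add: scaleR_conv_of_real)
  define W where "W = th ` ((\<lambda>z. of_real s *s z) ` \<Omega>)"
  have "open W" unfolding W_def img using open_scaling[OF _ open_dom, of s] s by (intro open_th_image) auto
  moreover have "y \<in> W" using s z by (auto simp: W_def)
  moreover have "holo_on (\<lambda>y. suminf (\<lambda>n. Q n y)) W"
  proof (rule holo_on_geometric_series[OF Q \<open>open W\<close>])
    show "0 \<le> s / \<rho>" "s / \<rho> < 1" using s \<rho> by auto
    fix n y assume "y \<in> W"
    then obtain u where u: "u \<in> \<Omega>" "y = th (of_real s *s u)" by (auto simp: W_def)
    have "cmod (Q n y) = s ^ n * cmod (Q n (th u))" using s by (simp add: u hom norm_mult norm_power)
    also have "\<dots> \<le> s ^ n * (M / \<rho> ^ n)" using M[OF u(1)] s by (intro mult_left_mono) auto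
    finally show "cmod (Q n y) \<le> M * (s / \<rho>) ^ n" by (simp add: power_divide mult.commute)
  qed
  ultimately show "\<exists>W. open W \<and> y \<in> W \<and> holo_on (\<lambda>y. suminf (\<lambda>n. Q n y)) W" by blast
qed

lemma hcomp_invariant:
  assumes "\<And>z. z \<in> \<Omega> \<Longrightarrow> f (A *v z) = f z"
  shows "hcomp f n (A *v z) = hcomp f n z"
proof -
  have "hcomp f n (A *v z) = hcomp (\<lambda>z. f (A *v z)) n z" by (simp add: hcomp_def matrix_smult)
  also have "\<dots> = hcomp f n z" by (rule hcomp_cong) (rule assms)
  finally show ?thesis .
qed

text \<open>Components of an invariant function are invariant polynomials, hence polynomials in
  \<open>th\<close>; their series on the quotient converges by
  \<open>weighted_series\<close>.\<close>

theorem holo_descends: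
  assumes f: "holo_on f \<Omega>" and inv: "\<And>A z. A \<in> G \<Longrightarrow> z \<in> \<Omega> \<Longrightarrow> f (A *v z) = f z"
  obtains g where "holo_on g (th ` \<Omega>)" "\<And>z. z \<in> \<Omega> \<Longrightarrow> g (th z) = f z"
proof -
  have "\<forall>n. \<exists>q. \<forall>z. hcomp f n z = cpoly_eval q (th z)"
  proof
    fix n
    have *: "hcomp f n (A *v z) = hcomp f n z" if "A \<in> G" for A z
      by (rule hcomp_invariant) (rule inv[OF that])
    show "\<exists>q. \<forall>z. hcomp f n z = cpoly_eval q (th z)"
      by (rule invariant_poly_fun[OF poly_fun_hcomp[OF f, of n]]) (use * in blast)+
  qed
  then obtain q where q: "\<And>n z. hcomp f n z = cpoly_eval (q n) (th z)" by metis
  have "holo_on (\<lambda>y. suminf (\<lambda>n. cpoly_eval (q n) y)) (th ` \<Omega>)"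
  proof (rule weighted_series)
    fix r :: real assume "0 < r" "r < 1"
    from hcomp_bound_closure[OF f this] show "\<exists>M. \<forall>n. \<forall>z\<in>\<Omega>. cmod (cpoly_eval (q n) (th z)) \<le> M / r ^ n"
      unfolding q using closure_subset[of \<Omega>] by blast
  qed (simp_all add: q[symmetric] hcomp_scale[OF f])
  moreover have "suminf (\<lambda>n. cpoly_eval (q n) (th z)) = f z" if "z \<in> \<Omega>" for z
    using hcomp_sums_dom[OF f that] by (simp add: q sums_iff)
  ultimately show ?thesis by (rule that)
qed

end

section \<open>The Shilov boundary of the quotient\<close>

definition boundary_for :: "(complex^'n) set \<Rightarrow> (complex^'n) set \<Rightarrow> bool" where
  "boundary_for U B \<longleftrightarrow> closed B \<and> B \<subseteq> closure U \<and>
     (\<forall>f\<in>disc_algebra U. \<forall>z\<in>closure U. \<exists>b\<in>B. cmod (f z) \<le> cmod (f b))"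

lemma shilov_alt: "z \<in> shilov U \<longleftrightarrow> (\<forall>B. boundary_for U B \<longrightarrow> z \<in> B)"
  unfolding shilov_def boundary_for_def by blast

lemma boundary_forD:
  assumes "boundary_for U B" "f \<in> disc_algebra U" "z \<in> closure U"
  shows "\<exists>b\<in>B. cmod (f z) \<le> cmod (f b)"
  using assms unfolding boundary_for_def by blast

lemma boundary_for_closure: "boundary_for U (closure U)"
  unfolding boundary_for_def by auto

lemma shilov_subset: "shilov U \<subseteq> closure U"
  using boundary_for_closure shilov_alt by blast

lemma holo_on_diff: "holo_on F U \<Longrightarrow> holo_on H U \<Longrightarrow> holo_on (\<lambda>z. F z - H z) U"
  using holo_on_add[OF _ holo_on_cmult[of H U "-1"], of F] by simp

lemma holo_on_power: "holo_on F U \<Longrightarrow> holo_on (\<lambda>z. F z ^ k) U"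
  by (induction k) (simp_all add: holo_on_const holo_on_mult)

lemma holo_on_prod: "(\<And>i. i \<in> I \<Longrightarrow> holo_on (F i) U) \<Longrightarrow> holo_on (\<lambda>z. \<Prod>i\<in>I. F i z) U"
  by (induction I rule: infinite_finite_induct) (simp_all add: holo_on_const holo_on_mult)

lemma holo_on_cong:
  assumes "\<And>z. z \<in> U \<Longrightarrow> F z = H z"
  shows "holo_on F U \<longleftrightarrow> holo_on H U"
proof -
  have *: "holo_on H U" if "holo_on F U" "\<And>z. z \<in> U \<Longrightarrow> F z = H z" for F H
    unfolding holo_on_def
  proof
    fix z assume z: "z \<in> U"
    then obtain D where "(F has_derivative D) (at z within U)" "\<forall>c v. D (c *s v) = c * D v"
      using \<open>holo_on F U\<close> unfolding holo_on_def by blast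
    then show "\<exists>D. (H has_derivative D) (at z within U) \<and> (\<forall>c v. D (c *s v) = c * D v)"
      using has_derivative_transform[OF z, of H F D] that(2) by (intro exI[of _ D]) auto
  qed
  show ?thesis using *[of F H] *[of H F] assms by auto
qed

lemma holo_on_compose_matrix:
  assumes "holo_on F U" "\<And>z. z \<in> U \<Longrightarrow> A *v z \<in> U"
  shows "holo_on (\<lambda>z. F (A *v z)) U"
  by (rule holo_on_compose_poly[OF holo_on_subset[OF assms(1)]]) (use assms(2) in \<open>auto intro: poly_fun_matrix\<close>)

text \<open>The function \<open>1 - \<Prod>(1 - (a_A/T)^m)\<close> is symmetric in the \<open>a_A\<close>, equals 1 when some \<open>a_A\<close> is \<open>T\<close>, and is
  small for large \<open>m\<close> when all \<open>a_A\<close> are smaller than \<open>T\<close> in modulus. It replaces a power sum.\<close>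

lemma norm_prod_le_prod:
  fixes b :: "'a \<Rightarrow> complex"
  shows "cmod ((\<Prod>i\<in>I. 1 + b i) - 1) \<le> (\<Prod>i\<in>I. 1 + cmod (b i)) - 1"
proof (induction I rule: infinite_finite_induct)
  case (insert i I)
  have "(\<Prod>i\<in>insert i I. 1 + b i) - 1 = (1 + b i) * ((\<Prod>i\<in>I. 1 + b i) - 1) + b i"
    using insert.hyps by (simp add: algebra_simps)
  also have "cmod \<dots> \<le> (1 + cmod (b i)) * ((\<Prod>i\<in>I. 1 + cmod (b i)) - 1) + cmod (b i)"
    by (intro norm_triangle_mono order_refl, subst norm_mult, intro mult_mono insert.IH)
      (use norm_triangle_ineq[of 1 "b i"] in auto)
  also have "\<dots> = (\<Prod>i\<in>insert i I. 1 + cmod (b i)) - 1"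
    using insert.hyps by (simp add: algebra_simps)
  finally show ?case .
qed simp_all

lemma norm_one_minus_prod_le:
  fixes a :: "'a \<Rightarrow> complex"
  assumes "\<And>i. i \<in> I \<Longrightarrow> cmod (a i) \<le> q"
  shows "cmod (1 - (\<Prod>i\<in>I. 1 - a i ^ m)) \<le> (1 + q ^ m) ^ card I - 1"
proof -
  have "cmod ((\<Prod>i\<in>I. 1 + - (a i ^ m)) - 1) \<le> (\<Prod>i\<in>I. 1 + cmod (- (a i ^ m))) - 1"
    by (rule norm_prod_le_prod)
  also have "(\<Prod>i\<in>I. 1 + cmod (- (a i ^ m))) \<le> (\<Prod>i\<in>I. 1 + q ^ m)"
    using assms by (intro prod_mono) (auto simp: norm_power intro!: power_mono)
  finally show ?thesis by (simp add: norm_minus_commute)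
qed

section \<open>Linear automorphisms and the Shilov boundary\<close>

context circled_domain
begin

text \<open>The inverse is carried along as \<open>B\<close>, so that the mapping properties of both
  can be used symmetrically.\<close>

definition lin_aut :: "complex^'n^'n \<Rightarrow> complex^'n^'n \<Rightarrow> bool" where
  "lin_aut A B \<longleftrightarrow> A ** B = mat 1 \<and> B ** A = mat 1 \<and> (\<forall>z\<in>\<Omega>. A *v z \<in> \<Omega>) \<and> (\<forall>z\<in>\<Omega>. B *v z \<in> \<Omega>)"

lemma lin_aut_sym: "lin_aut A B \<Longrightarrow> lin_aut B A"
  by (auto simp: lin_aut_def)

lemma lin_aut_inverse: "lin_aut A B \<Longrightarrow> B *v (A *v z) = z"
  by (simp add: lin_aut_def matrix_vector_mul_assoc)

lemma lin_aut_dom: "lin_aut A B \<Longrightarrow> z \<in> \<Omega> \<Longrightarrow> A *v z \<in> \<Omega>"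
  by (simp add: lin_aut_def)

lemma lin_aut_closure:
  assumes "lin_aut A B" "z \<in> closure \<Omega>"
  shows "A *v z \<in> closure \<Omega>"
proof -
  have "(\<lambda>z. A *v z) ` closure \<Omega> \<subseteq> closure \<Omega>"
    by (rule image_closure_subset[OF continuous_on_matrix]) (use lin_aut_dom[OF assms(1)] closure_subset in auto)
  then show ?thesis using assms(2) by auto
qed

lemma disc_algebra_compose:
  assumes "lin_aut A B" "f \<in> disc_algebra \<Omega>"
  shows "(\<lambda>z. f (A *v z)) \<in> disc_algebra \<Omega>"
proof -
  have "continuous_on (closure \<Omega>) (\<lambda>z. f (A *v z))"
    by (rule continuous_on_compose2[of "closure \<Omega>" f, OF _ continuous_on_matrix])
      (use assms lin_aut_closure[OF assms(1)] in \<open>auto simp: disc_algebra_def\<close>)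
  then show ?thesis
    using assms(2) lin_aut_dom[OF assms(1)] by (auto simp: disc_algebra_def intro: holo_on_compose_matrix)
qed

text \<open>The preimage of a boundary under a linear automorphism is again a boundary, so it
  contains \<open>z\<close>.\<close>

lemma shilov_lin_aut:
  assumes A: "lin_aut A B" and z: "z \<in> shilov \<Omega>"
  shows "A *v z \<in> shilov \<Omega>"
  unfolding shilov_alt
proof (intro allI impI)
  fix S assume S: "boundary_for \<Omega> S"
  define T where "T = closure \<Omega> \<inter> (\<lambda>z. A *v z) -` S"
  have "boundary_for \<Omega> T"
    unfolding boundary_for_def
  proof (intro conjI ballI)
    show "closed T" unfolding T_def
      using S by (intro continuous_closed_preimage continuous_on_matrix) (auto simp: boundary_for_def)
    fix f u assume f: "f \<in> disc_algebra \<Omega>" and u: "u \<in> closure \<Omega>"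
    have "\<exists>b\<in>S. cmod (f (B *v (A *v u))) \<le> cmod (f (B *v b))"
      using boundary_forD[OF S disc_algebra_compose[OF lin_aut_sym[OF A] f] lin_aut_closure[OF A u]] .
    then obtain b where b: "b \<in> S" "cmod (f u) \<le> cmod (f (B *v b))" by (auto simp: lin_aut_inverse[OF A])
    have "B *v b \<in> T"
      using b(1) S lin_aut_closure[OF lin_aut_sym[OF A], of b] lin_aut_inverse[OF lin_aut_sym[OF A], of b]
      by (auto simp: T_def boundary_for_def)
    then show "\<exists>b\<in>T. cmod (f u) \<le> cmod (f b)" using b(2) by blast
  qed (auto simp: T_def)
  then have "z \<in> T" using z by (simp add: shilov_alt)
  then show "A *v z \<in> S" by (simp add: T_def)
qed

lemma lin_aut_holo_aut:
  assumes A: "lin_aut A B"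
  shows "(\<lambda>z. A *v z) \<in> holo_aut \<Omega>"
proof -
  have inj: "inj_on (\<lambda>z. A *v z) \<Omega>" using lin_aut_inverse[OF A] by (auto intro: inj_on_inverseI)
  have inv: "inv_into \<Omega> (\<lambda>z. A *v z) z = B *v z" if "z \<in> \<Omega>" for z
    using inv_into_f_f[OF inj lin_aut_dom[OF lin_aut_sym[OF A] that]] lin_aut_inverse[OF lin_aut_sym[OF A], of z] by simp
  have "(\<lambda>z. A *v z) ` \<Omega> = \<Omega>"
  proof (intro equalityI subsetI)
    fix z assume "z \<in> \<Omega>"
    then show "z \<in> (\<lambda>z. A *v z) ` \<Omega>"
      using lin_aut_dom[OF lin_aut_sym[OF A]] lin_aut_inverse[OF lin_aut_sym[OF A], of z] by (metis imageI)
  qed (use lin_aut_dom[OF A] in blast)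
  then have "bij_betw (\<lambda>z. A *v z) \<Omega> \<Omega>" using inj by (simp add: bij_betw_def)
  moreover have "holo_map_on (inv_into \<Omega> (\<lambda>z. A *v z)) \<Omega>"
    unfolding holo_map_on_def
  proof
    fix i
    show "holo_on (\<lambda>z. inv_into \<Omega> (\<lambda>z. A *v z) z $ i) \<Omega>"
      by (subst holo_on_cong[where H = "\<lambda>z. (B *v z) $ i"]) (simp_all add: inv poly_fun_holo_on poly_fun_matrix)
  qed
  ultimately show ?thesis
    by (simp add: holo_aut_def holo_map_on_def poly_fun_holo_on poly_fun_matrix)
qed

lemma mat_smult: "(mat c :: complex^'n^'n) *v z = c *s z"
  by (simp add: vec_eq_iff matrix_vector_mult_def mat_def if_distrib[of "\<lambda>x. x * _"] cong: if_cong)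

lemma lin_aut_mat:
  assumes "cmod c = 1"
  shows "lin_aut (mat c) (mat (cnj c))"
proof -
  have c: "c * cnj c = 1" using assms by (simp add: complex_norm_square[symmetric])
  have "mat a ** mat b = (mat (a * b) :: complex^'n^'n)" for a b
    by (simp add: vec_eq_iff matrix_matrix_mult_def mat_def if_distrib[of "\<lambda>x. x * _"] cong: if_cong)
  then show ?thesis using c assms circ_dom by (simp add: lin_aut_def mat_smult mult.commute)
qed

lemma shilov_circ: "z \<in> shilov \<Omega> \<Longrightarrow> cmod c = 1 \<Longrightarrow> c *s z \<in> shilov \<Omega>"
  using shilov_lin_aut[OF lin_aut_mat] by (simp add: mat_smult)

end

context quotient_domain
begin

lemma lin_aut_G:
  assumes "A \<in> G"
  shows "\<exists>B. lin_aut A B"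
  by (rule G_inverse[OF assms]) (use assms G_dom in \<open>auto simp: lin_aut_def\<close>)

lemma G_closure: "A \<in> G \<Longrightarrow> z \<in> closure \<Omega> \<Longrightarrow> A *v z \<in> closure \<Omega>"
  using lin_aut_G lin_aut_closure by blast

lemma closure_th: "closure (th ` \<Omega>) = th ` closure \<Omega>"
proof
  show "closure (th ` \<Omega>) \<subseteq> th ` closure \<Omega>"
    by (rule closure_minimal) (auto intro: closed_th_image closure_subset[THEN subsetD])
  show "th ` closure \<Omega> \<subseteq> closure (th ` \<Omega>)"
    by (rule image_closure_subset[OF continuous_on_th]) (auto intro: closure_subset[THEN subsetD])
qed

text \<open>Fibres of \<open>th\<close> are orbits, so the choice of a preimage is harmless;
  continuity holds because \<open>th\<close> is a closed map.\<close>

lemma disc_algebra_descends: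
  assumes f: "f \<in> disc_algebra \<Omega>" and inv: "\<And>A z. A \<in> G \<Longrightarrow> z \<in> closure \<Omega> \<Longrightarrow> f (A *v z) = f z"
  obtains h where "h \<in> disc_algebra (th ` \<Omega>)" "\<And>z. z \<in> closure \<Omega> \<Longrightarrow> h (th z) = f z"
proof -
  have cf: "continuous_on (closure \<Omega>) f" and hf: "holo_on f \<Omega>" using f by (auto simp: disc_algebra_def)
  obtain g where g: "holo_on g (th ` \<Omega>)" "\<And>z. z \<in> \<Omega> \<Longrightarrow> g (th z) = f z"
    by (rule holo_descends[OF hf]) (use inv closure_subset in blast)+
  define h where "h y = f (SOME z. z \<in> closure \<Omega> \<and> th z = y)" for y
  have h: "h (th z) = f z" if z: "z \<in> closure \<Omega>" for z
  proof -
    define u where "u = (SOME u. u \<in> closure \<Omega> \<and> th u = th z)"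
    have u: "u \<in> closure \<Omega> \<and> th u = th z" unfolding u_def by (rule someI[of _ z]) (simp add: z)
    then obtain A where "A \<in> G" "A *v z = u" using th_eq_imp_orbit by metis
    then show ?thesis using inv[of A z] z by (simp add: h_def u_def[symmetric])
  qed
  have "continuous_on (th ` closure \<Omega>) h"
    unfolding continuous_on_closed_vimage[OF closed_th_image[OF closed_closure]]
  proof (intro allI impI)
    fix C :: "complex set" assume "closed C"
    have "h -` C \<inter> th ` closure \<Omega> = th ` (f -` C \<inter> closure \<Omega>)" using h by auto
    moreover have "closed (f -` C \<inter> closure \<Omega>)"
      using cf \<open>closed C\<close> continuous_on_closed_vimage[OF closed_closure, of \<Omega> f] by blast
    ultimately show "closed (h -` C \<inter> th ` closure \<Omega>)" using closed_th_image by simp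
  qed
  moreover have "holo_on h (th ` \<Omega>)"
    by (subst holo_on_cong[where H = g]) (use g h closure_subset[of \<Omega>] in auto)
  ultimately have "h \<in> disc_algebra (th ` \<Omega>)" by (simp add: disc_algebra_def closure_th)
  then show ?thesis using h by (rule that)
qed

text \<open>The preimage \<open>T\<close> of a boundary on the quotient has to be a boundary for
  \<open>\<Omega>\<close>. If \<open>f\<close> were larger at \<open>u\<close> than on
  \<open>T\<close>, the symmetric combination, normalised by \<open>f u\<close>, would descend to a
  function with value 1 at \<open>th u\<close> and arbitrarily small on \<open>B\<close>. The
  inclusion lets \<open>mu\<close> be pushed forward to the Shilov boundary of the quotient.\<close>

theorem th_shilov:
  assumes z: "z \<in> shilov \<Omega>"
  shows "th z \<in> shilov (th ` \<Omega>)"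
  unfolding shilov_alt
proof (intro allI impI)
  fix B assume B: "boundary_for (th ` \<Omega>) B"
  define T where "T = closure \<Omega> \<inter> th -` B"
  have clT: "closed T" unfolding T_def
    using B by (intro continuous_closed_preimage continuous_on_th) (auto simp: boundary_for_def)
  have compT: "compact T" using compact_Int_closed[OF compact_closure_dom clT] by (simp add: T_def Int_absorb1 Int_assoc[symmetric])
  \<comment> \<open>Nonemptiness is needed for the maximum over \<open>T\<close>; the zero function
    already forces a point into \<open>B\<close>.\<close>
  have neT: "T \<noteq> {}"
  proof -
    have "(\<lambda>_. 0) \<in> disc_algebra (th ` \<Omega>)" by (simp add: disc_algebra_def holo_on_const)
    moreover have "th 0 \<in> closure (th ` \<Omega>)" by (rule subsetD[OF closure_subset imageI[OF zero_dom]])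
    ultimately have "\<exists>b\<in>B. cmod 0 \<le> cmod (0::complex)" by (rule boundary_forD[OF B])
    then obtain b where "b \<in> B" by blast
    moreover have "B \<subseteq> th ` closure \<Omega>" using B by (simp add: boundary_for_def closure_th)
    ultimately show ?thesis unfolding T_def by blast
  qed
  have GT: "A *v x \<in> T" if "A \<in> G" "x \<in> T" for A x
    using that G_closure th_invariant by (auto simp: T_def)
  have "boundary_for \<Omega> T"
    unfolding boundary_for_def
  proof (intro conjI ballI clT)
    fix f u assume f: "f \<in> disc_algebra \<Omega>" and u: "u \<in> closure \<Omega>"
    have cf: "continuous_on (closure \<Omega>) f" using f by (simp add: disc_algebra_def)
    have "continuous_on T (\<lambda>x. cmod (f x))"
      by (intro continuous_on_norm continuous_on_subset[OF cf]) (simp add: T_def)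
    then obtain b where b: "b \<in> T" "\<And>x. x \<in> T \<Longrightarrow> cmod (f x) \<le> cmod (f b)"
      using continuous_attains_sup[OF compT neT] by blast
    have "cmod (f u) \<le> cmod (f b)"
    proof (rule ccontr)
      assume "\<not> cmod (f u) \<le> cmod (f b)"
      then have less: "cmod (f b) < cmod (f u)" by simp
      then have nz: "f u \<noteq> 0" by auto
      define q where "q = cmod (f b) / cmod (f u)"
      have q: "0 \<le> q" "q < 1" using less nz by (auto simp: q_def)
      have main: "1 \<le> (1 + q ^ m) ^ card G - 1" for m
      proof -
        define s where "s x = 1 - (\<Prod>A\<in>G. 1 - (f (A *v x) / f u) ^ m)" for x
        have fA: "(\<lambda>x. f (A *v x)) \<in> disc_algebra \<Omega>" if "A \<in> G" for A
          using lin_aut_G[OF that] disc_algebra_compose[OF _ f] by blast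
        have s1: "continuous_on (closure \<Omega>) s" unfolding s_def using fA nz
          by (intro continuous_on_diff continuous_on_const continuous_on_prod continuous_on_power continuous_on_divide)
            (auto simp: disc_algebra_def)
        have "holo_on (\<lambda>x. 1 - (\<Prod>A\<in>G. 1 - ((1 / f u) * f (A *v x)) ^ m)) \<Omega>" using fA
          by (intro holo_on_diff holo_on_const holo_on_prod holo_on_power holo_on_cmult) (auto simp: disc_algebra_def)
        then have s2: "holo_on s \<Omega>" by (simp add: s_def[abs_def])
        have sD: "s \<in> disc_algebra \<Omega>" using s1 s2 by (simp add: disc_algebra_def)
        have inv: "s (A *v x) = s x" if "A \<in> G" for A x
          unfolding s_def matrix_vector_mul_assoc
          using prod.reindex_bij_betw[OF bij_G_mult[OF that], of "\<lambda>B. 1 - (f (B *v x) / f u) ^ m"] by simp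
        obtain h where h: "h \<in> disc_algebra (th ` \<Omega>)" "\<And>x. x \<in> closure \<Omega> \<Longrightarrow> h (th x) = s x"
          by (rule disc_algebra_descends[OF sD]) (use inv in blast)+
        have "th u \<in> closure (th ` \<Omega>)" using u by (simp add: closure_th)
        from boundary_forD[OF B h(1) this] obtain y where y: "y \<in> B" "cmod (h (th u)) \<le> cmod (h y)" by blast
        then obtain x where x: "x \<in> closure \<Omega>" "y = th x" using B by (auto simp: boundary_for_def closure_th)
        have xT: "x \<in> T" using x y by (simp add: T_def)
        have "s u = 1" unfolding s_def using G_finite G_one nz by (auto simp: prod_zero_iff intro!: bexI[of _ "mat 1"])
        then have "1 \<le> cmod (s x)" using y h(2) u x by simp
        also have "\<dots> \<le> (1 + q ^ m) ^ card G - 1"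
          unfolding s_def
          by (rule norm_one_minus_prod_le) (use b(2) GT xT in \<open>auto simp: norm_divide q_def intro!: divide_right_mono\<close>)
        finally show ?thesis .
      qed
      have "(\<lambda>m. (1 + q ^ m) ^ card G - 1) \<longlonglongrightarrow> (1 + 0) ^ card G - 1"
        using q by (intro tendsto_intros LIMSEQ_power_zero) auto
      then have "1 \<le> (1 + 0) ^ card G - (1::real)"
        by (rule LIMSEQ_le_const) (use main in blast)
      then show False by simp
    qed
    then show "\<exists>b\<in>T. cmod (f u) \<le> cmod (f b)" using b(1) by blast
  qed (auto simp: T_def)
  then have "z \<in> T" using z by (simp add: shilov_alt)
  then show "th z \<in> B" by (simp add: T_def)
qed

end

section \<open>The invariant measure on the Shilov boundary\<close>

locale hardy_domain = circled_domain \<Omega> for \<Omega> :: "(complex^'n) set" +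
  fixes mu :: "(complex^'n) measure"
  assumes isotropy: "isotropy_measure \<Omega> mu"
begin

abbreviation "S0 \<equiv> shilov \<Omega>"

sublocale mu: prob_space mu
  using isotropy by (simp add: isotropy_measure_def)

lemma sets_mu: "sets mu = sets (restrict_space borel S0)"
  using isotropy by (simp add: isotropy_measure_def)

lemma space_mu: "space mu = S0"
  using sets_eq_imp_space_eq[OF sets_mu] by (simp add: space_restrict_space)

lemma measurable_mu_iff: "f \<in> measurable mu N \<longleftrightarrow> f \<in> measurable (restrict_space borel S0) N"
  by (simp add: measurable_cong_sets[OF sets_mu refl])

lemma borel_measurable_mu: "f \<in> measurable borel N \<Longrightarrow> f \<in> measurable mu N"
  unfolding measurable_mu_iff by (rule measurable_restrict_space1)

lemma continuous_measurable_mu: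
  fixes f :: "complex^'n \<Rightarrow> 'b::topological_space"
  shows "continuous_on S0 f \<Longrightarrow> f \<in> borel_measurable mu"
  unfolding measurable_mu_iff by (rule borel_measurable_continuous_on_restrict)

lemma poly_fun_measurable_mu: "poly_fun f \<Longrightarrow> f \<in> borel_measurable mu"
  by (rule continuous_measurable_mu[OF poly_fun_continuous_on])

lemma lin_aut_measurable:
  assumes "lin_aut A B"
  shows "(\<lambda>z. A *v z) \<in> measurable mu mu"
proof -
  have "(\<lambda>z. A *v z) \<in> measurable mu (restrict_space borel S0)"
    by (rule measurable_restrict_space2)
      (auto simp: space_mu continuous_measurable_mu[OF continuous_on_matrix] shilov_lin_aut[OF assms])
  then show ?thesis by (simp add: measurable_cong_sets[OF refl sets_mu])
qed

lemma distr_lin_aut: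
  assumes "lin_aut A B"
  shows "distr mu mu (\<lambda>z. A *v z) = mu"
  using isotropy lin_aut_holo_aut[OF assms] continuous_on_matrix[of "closure \<Omega>" A]
  unfolding isotropy_measure_def by (simp add: matrix_vector_mult_0_right)

lemma measurable_circ: "cmod c = 1 \<Longrightarrow> (\<lambda>z. c *s z) \<in> measurable mu mu"
  using lin_aut_measurable[OF lin_aut_mat, of c] by (simp add: mat_smult)

lemma distr_circ: "cmod c = 1 \<Longrightarrow> distr mu mu (\<lambda>z. c *s z) = mu"
  using distr_lin_aut[OF lin_aut_mat, of c] by (simp add: mat_smult)

lemma integral_circ:
  fixes f :: "complex^'n \<Rightarrow> 'b::{banach,second_countable_topology}"
  assumes "f \<in> borel_measurable mu" "cmod c = 1"
  shows "(LINT z|mu. f (c *s z)) = (LINT z|mu. f z)"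
  using integral_distr[OF measurable_circ[OF assms(2)] assms(1)] by (simp add: distr_circ[OF assms(2)])

lemma nn_integral_circ:
  assumes "f \<in> borel_measurable mu" "cmod c = 1"
  shows "(\<integral>\<^sup>+ z. f (c *s z) \<partial>mu) = (\<integral>\<^sup>+ z. f z \<partial>mu)"
  using nn_integral_distr[OF measurable_circ[OF assms(2)], of f] assms(1) by (simp add: distr_circ[OF assms(2)])

end

section \<open>Hardy spaces and radial limits\<close>

context hardy_domain
begin

text \<open>The weight of a function under the circle action, on the boundary only. Integers are
  used since products with conjugates have differences of weights.\<close>

definition circ_hom :: "int \<Rightarrow> (complex^'n \<Rightarrow> complex) \<Rightarrow> bool" where
  "circ_hom k f \<longleftrightarrow> (\<forall>t. \<forall>z\<in>S0. f (cis t *s z) = cis (of_int k * t) * f z)"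

text \<open>Rotation by the angle \<open>pi / k\<close> changes the sign of \<open>f\<close> and
  preserves the measure.\<close>

lemma circ_hom_integral_zero:
  assumes f: "f \<in> borel_measurable mu" "circ_hom k f" "k \<noteq> 0"
  shows "(LINT z|mu. f z) = 0"
proof -
  define c where "c = cis (pi / of_int k)"
  have "(LINT z|mu. f (c *s z)) = (LINT z|mu. - f z)"
    by (rule Bochner_Integration.integral_cong)
      (use f in \<open>auto simp: circ_hom_def c_def space_mu\<close>)
  moreover have "(LINT z|mu. f (c *s z)) = (LINT z|mu. f z)"
    by (rule integral_circ[OF f(1)]) (simp add: c_def)
  ultimately show ?thesis by simp
qed

lemma circ_hom_mult_cnj: "circ_hom m f \<Longrightarrow> circ_hom n g \<Longrightarrow> circ_hom (m - n) (\<lambda>z. f z * cnj (g z))"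
proof -
  assume f: "circ_hom m f" and g: "circ_hom n g"
  have "cis (of_int (m - n) * t) = cis (of_int m * t) * cnj (cis (of_int n * t))" for t
    by (simp add: cis_cnj cis_mult left_diff_distrib)
  then show ?thesis using f g by (simp add: circ_hom_def mult_ac)
qed

lemma circ_hom_orthogonal:
  assumes "f \<in> L2 mu" "g \<in> L2 mu" "circ_hom k f" "circ_hom l g" "k \<noteq> l"
  shows "L2_inner mu f g = 0"
  unfolding L2_inner_def
  by (rule circ_hom_integral_zero[OF _ circ_hom_mult_cnj[OF assms(3,4)]])
    (intro borel_measurable_times borel_measurable_cnj L2_measurable assms, use assms in simp)

lemma circ_hom_cmult: "circ_hom n f \<Longrightarrow> circ_hom n (\<lambda>z. c * f z)"
  by (simp add: circ_hom_def mult_ac)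

context
  fixes q :: "nat \<Rightarrow> complex^'n \<Rightarrow> complex" and b :: "nat \<Rightarrow> real" and f :: "complex^'n \<Rightarrow> complex"
  assumes meas: "\<And>n. q n \<in> borel_measurable mu" and hom: "\<And>n. circ_hom (int n) (q n)"
    and bound: "\<And>n z. z \<in> S0 \<Longrightarrow> cmod (q n z) \<le> b n" and b: "summable b"
    and f: "\<And>z. z \<in> S0 \<Longrightarrow> (\<lambda>n. q n z) sums f z"
begin

lemma series_partial_bound: "z \<in> S0 \<Longrightarrow> cmod (\<Sum>n<N. q n z) \<le> suminf b"
proof -
  assume z: "z \<in> S0"
  have "cmod (\<Sum>n<N. q n z) \<le> (\<Sum>n<N. b n)" by (rule sum_norm_le) (rule bound[OF z])
  also have "\<dots> \<le> suminf b"
    by (rule sum_le_suminf[OF b]) (use order_trans[OF norm_ge_zero bound[OF z]] in auto)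
  finally show ?thesis .
qed

lemma series_measurable: "f \<in> borel_measurable mu"
  by (rule borel_measurable_LIMSEQ_metric[where f = "\<lambda>N z. \<Sum>n<N. q n z"])
    (use meas f in \<open>auto simp: sums_def space_mu\<close>)

lemma series_limit: "z \<in> S0 \<Longrightarrow> (\<lambda>N. \<Sum>n<N. q n z) \<longlonglongrightarrow> f z"
  using f by (simp add: sums_def)

lemma series_bound: "z \<in> S0 \<Longrightarrow> cmod (f z) \<le> suminf b"
  by (rule LIMSEQ_le_const2[OF tendsto_norm[OF series_limit]]) (use series_partial_bound in auto)

lemma series_L2: "f \<in> L2 mu"
  by (rule mu.L2_bounded[OF series_measurable, of "suminf b"]) (use series_bound space_mu in auto)

lemma series_term_L2: "q n \<in> L2 mu"
  by (rule mu.L2_bounded[OF meas, of _ "b n"]) (use bound space_mu in auto)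

text \<open>Parseval: the terms have different weights and are therefore orthogonal, and the sum of
  the bounds \<open>b\<close> dominates the partial sums.\<close>

lemma series_sqn: "(\<lambda>n. sqn mu (q n)) sums sqn mu f"
proof -
  have "L2_inner mu (q m) (q n) = 0" if "m \<noteq> n" for m n
    by (rule circ_hom_orthogonal[OF series_term_L2 series_term_L2 hom hom]) (use that in simp)
  then have "sqn mu (\<lambda>z. \<Sum>n<N. q n z) = (\<Sum>n<N. sqn mu (q n))" for N
    by (intro sqn_sum_orthogonal series_term_L2)
  moreover have "(\<lambda>N. sqn mu (\<lambda>z. \<Sum>n<N. q n z)) \<longlonglongrightarrow> sqn mu f"
    unfolding sqn_def
  proof (rule integral_dominated_convergence[where w = "\<lambda>z. (suminf b)\<^sup>2"])
    show "AE z in mu. (\<lambda>N. (cmod (\<Sum>n<N. q n z))\<^sup>2) \<longlonglongrightarrow> (cmod (f z))\<^sup>2"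
      using series_limit by (intro AE_I2 tendsto_intros) (auto simp: space_mu)
    show "AE z in mu. norm ((cmod (\<Sum>n<N. q n z))\<^sup>2) \<le> (suminf b)\<^sup>2" for N
      using series_partial_bound by (intro AE_I2) (auto simp: space_mu intro!: power_mono)
    show "(\<lambda>z. (cmod (\<Sum>n<N. q n z))\<^sup>2) \<in> borel_measurable mu" for N
      using meas by (intro borel_measurable_power borel_measurable_norm borel_measurable_sum) auto
  qed (use series_measurable in auto)
  ultimately show ?thesis by (simp add: sums_def)
qed

end

lemma hcomp_circ_hom: "holo_on F \<Omega> \<Longrightarrow> circ_hom (int n) (hcomp F n)"
  by (simp add: circ_hom_def hcomp_scale Complex.DeMoivre)

lemma hcomp_measurable: "holo_on F \<Omega> \<Longrightarrow> hcomp F n \<in> borel_measurable mu"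
  by (rule poly_fun_measurable_mu[OF poly_fun_hcomp])

lemma S0_closure: "z \<in> S0 \<Longrightarrow> z \<in> closure \<Omega>"
  using shilov_subset by blast

lemma hcomp_series_bound:
  assumes F: "holo_on F \<Omega>" and s: "0 \<le> s" "s < 1" and c: "\<And>n. cmod (c n) \<le> s ^ n"
  shows "\<exists>b. summable b \<and> (\<forall>n. \<forall>z\<in>S0. cmod (c n * hcomp F n z) \<le> b n)"
proof -
  define \<rho> where "\<rho> = (1 + s) / 2"
  have \<rho>: "0 < \<rho>" "\<rho> < 1" "s < \<rho>" using s by (auto simp: \<rho>_def)
  obtain M where M: "\<And>n z. z \<in> closure \<Omega> \<Longrightarrow> cmod (hcomp F n z) \<le> M / \<rho> ^ n"
    using hcomp_bound_closure[OF F \<rho>(1,2)] by blast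
  have "cmod (c n * hcomp F n z) \<le> M * (s / \<rho>) ^ n" if "z \<in> S0" for n z
  proof -
    have "cmod (c n * hcomp F n z) \<le> s ^ n * (M / \<rho> ^ n)"
      unfolding norm_mult using M[OF S0_closure[OF that]] c s by (intro mult_mono) auto
    then show ?thesis by (simp add: power_divide mult.commute)
  qed
  moreover have "summable (\<lambda>n. M * (s / \<rho>) ^ n)" using s \<rho> by (intro summable_mult summable_geometric) simp
  ultimately show ?thesis by blast
qed

lemma slice_sums:
  assumes "holo_on F \<Omega>" "z \<in> S0" "0 \<le> r" "r < 1"
  shows "(\<lambda>n. of_real r ^ n * hcomp F n z) sums F (r *\<^sub>R z)"
proof -
  have "of_real r *s z = r *\<^sub>R z" by (simp add: vec_eq_iff, simp add: scaleR_conv_of_real)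
  then show ?thesis using hcomp_sums[OF assms(1) S0_closure[OF assms(2)], of "of_real r"] assms by (simp add: mult.commute)
qed

lemma dilate_measurable: 
  assumes "holo_on F \<Omega>" "0 \<le> r" "r < 1"
  shows "(\<lambda>z. F (r *\<^sub>R z)) \<in> borel_measurable mu"
proof (rule continuous_measurable_mu)
  show "continuous_on S0 (\<lambda>z. F (r *\<^sub>R z))"
    by (rule continuous_on_compose2[OF holo_on_continuous_on[OF assms(1)]])
      (use assms scaleR_closure S0_closure in \<open>auto intro!: continuous_intros\<close>)
qed

lemma scaled_hcomp_series:
  assumes F: "holo_on F \<Omega>" and s: "0 \<le> s" "s < 1" "\<And>n. cmod (c n) \<le> s ^ n"
    and g: "\<And>z. z \<in> S0 \<Longrightarrow> (\<lambda>n. c n * hcomp F n z) sums g z"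
  shows "g \<in> L2 mu" "(\<lambda>n. (cmod (c n))\<^sup>2 * sqn mu (hcomp F n)) sums sqn mu g"
proof -
  obtain b where b: "summable b" "\<And>n z. z \<in> S0 \<Longrightarrow> cmod (c n * hcomp F n z) \<le> b n"
    using hcomp_series_bound[OF F s] by blast
  have m: "(\<lambda>z. c n * hcomp F n z) \<in> borel_measurable mu" for n using hcomp_measurable[OF F] by simp
  note h = m circ_hom_cmult[OF hcomp_circ_hom[OF F]] b(2) b(1) g
  show "g \<in> L2 mu"
    by (rule series_L2[of "\<lambda>n z. c n * hcomp F n z", OF h])
  show "(\<lambda>n. (cmod (c n))\<^sup>2 * sqn mu (hcomp F n)) sums sqn mu g"
    unfolding sqn_scale[symmetric] by (rule series_sqn[of "\<lambda>n z. c n * hcomp F n z", OF h])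
qed

lemma
  assumes F: "holo_on F \<Omega>" and r: "0 \<le> r" "r < 1"
  shows dilate_L2: "(\<lambda>z. F (r *\<^sub>R z)) \<in> L2 mu"
    and dilate_sqn: "(\<lambda>n. r ^ (2 * n) * sqn mu (hcomp F n)) sums sqn mu (\<lambda>z. F (r *\<^sub>R z))"
proof -
  have c: "cmod (of_real r ^ n) \<le> r ^ n" for n using r by (simp add: norm_power)
  note h = scaled_hcomp_series[OF F r c slice_sums[OF F _ r]]
  show "(\<lambda>z. F (r *\<^sub>R z)) \<in> L2 mu" by (rule h(1))
  have "(cmod (of_real r ^ n))\<^sup>2 = r ^ (2 * n)" for n
    using r by (simp add: norm_power power_mult[symmetric] mult.commute)
  then show "(\<lambda>n. r ^ (2 * n) * sqn mu (hcomp F n)) sums sqn mu (\<lambda>z. F (r *\<^sub>R z))"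
    using h(2) by simp
qed

text \<open>Parseval on each dilate gives the squared norms of the components with factors
  \<open>r ^ (2 * n)\<close>. For \<open>r\<close> tending to 1 the supremum over radii becomes the
  sum over components.\<close>

lemma hardy_sq_le_iff:
  assumes F: "holo_on F \<Omega>" and K: "0 \<le> K"
  shows "hardy_sq mu F \<le> ennreal K \<longleftrightarrow> (\<forall>r\<in>{0<..<1}. sqn mu (\<lambda>z. F (r *\<^sub>R z)) \<le> K)"
    and "hardy_sq mu F \<le> ennreal K \<longleftrightarrow> (\<forall>N. (\<Sum>n<N. sqn mu (hcomp F n)) \<le> K)"
proof -
  have nn: "(\<integral>\<^sup>+ z. ennreal ((cmod (F (r *\<^sub>R z)))\<^sup>2) \<partial>mu) = ennreal (sqn mu (\<lambda>z. F (r *\<^sub>R z)))"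
    if "r \<in> {0<..<1}" for r
    unfolding sqn_def using L2_integrable_sq[OF dilate_L2[OF F, of r]] that
    by (intro nn_integral_eq_integral) auto
  show 1: "hardy_sq mu F \<le> ennreal K \<longleftrightarrow> (\<forall>r\<in>{0<..<1}. sqn mu (\<lambda>z. F (r *\<^sub>R z)) \<le> K)"
    unfolding hardy_sq_def SUP_le_iff by (intro ball_cong refl) (simp add: nn K)
  show "hardy_sq mu F \<le> ennreal K \<longleftrightarrow> (\<forall>N. (\<Sum>n<N. sqn mu (hcomp F n)) \<le> K)"
    unfolding 1
  proof (intro iffI allI ballI)
    fix N assume le: "\<forall>r\<in>{0<..<1}. sqn mu (\<lambda>z. F (r *\<^sub>R z)) \<le> K"
    have part: "(\<Sum>n<N. r ^ (2 * n) * sqn mu (hcomp F n)) \<le> K" if r: "r \<in> {0<..<1}" for r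
    proof -
      have "(\<Sum>n<N. r ^ (2 * n) * sqn mu (hcomp F n)) \<le> suminf (\<lambda>n. r ^ (2 * n) * sqn mu (hcomp F n))"
        using dilate_sqn[OF F, of r] r by (intro sum_le_suminf) (auto simp: sums_iff sqn_nonneg)
      also have "\<dots> = sqn mu (\<lambda>z. F (r *\<^sub>R z))" using dilate_sqn[OF F, of r] r by (auto simp: sums_iff)
      finally show ?thesis using le r by fastforce
    qed
    have "((\<lambda>r. \<Sum>n<N. r ^ (2 * n) * sqn mu (hcomp F n)) \<longlongrightarrow> (\<Sum>n<N. 1 ^ (2 * n) * sqn mu (hcomp F n))) (at_left 1)"
      by (intro tendsto_intros)
    then have "(\<Sum>n<N. 1 ^ (2 * n) * sqn mu (hcomp F n)) \<le> K"
    proof (rule tendsto_upperbound)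
      show "\<forall>\<^sub>F r in at_left 1. (\<Sum>n<N. r ^ (2 * n) * sqn mu (hcomp F n)) \<le> K"
        using eventually_at_left_real[of 0 "1::real"] by (auto elim!: eventually_mono intro!: part)
    qed simp
    then show "(\<Sum>n<N. sqn mu (hcomp F n)) \<le> K" by simp
  next
    fix r :: real assume le: "\<forall>N. (\<Sum>n<N. sqn mu (hcomp F n)) \<le> K" and r: "r \<in> {0<..<1}"
    have s: "(\<lambda>n. r ^ (2 * n) * sqn mu (hcomp F n)) sums sqn mu (\<lambda>z. F (r *\<^sub>R z))"
      using dilate_sqn[OF F, of r] r by auto
    have "(\<Sum>n<N. r ^ (2 * n) * sqn mu (hcomp F n)) \<le> K" for N
    proof -
      have "(\<Sum>n<N. r ^ (2 * n) * sqn mu (hcomp F n)) \<le> (\<Sum>n<N. 1 * sqn mu (hcomp F n))"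
        using r by (intro sum_mono mult_right_mono sqn_nonneg power_le_one) auto
      then show ?thesis using le[rule_format, of N] by simp
    qed
    then show "sqn mu (\<lambda>z. F (r *\<^sub>R z)) \<le> K"
      using s unfolding sums_def by (blast intro: LIMSEQ_le_const2)
  qed
qed

lemma
  assumes "F \<in> hardy_space \<Omega> mu"
  shows hardy_holo: "holo_on F \<Omega>" and hardy_sums: "(\<lambda>n. sqn mu (hcomp F n)) sums (hardy_nrm mu F)\<^sup>2"
proof -
  show F: "holo_on F \<Omega>" using assms by (simp add: hardy_space_def)
  define K where "K = enn2real (hardy_sq mu F)"
  have K: "hardy_sq mu F = ennreal K" "0 \<le> K" using assms by (simp_all add: hardy_space_def K_def less_top)
  have le: "(\<Sum>n<N. sqn mu (hcomp F n)) \<le> K" for N using hardy_sq_le_iff(2)[OF F K(2)] K(1) by simp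
  have s: "summable (\<lambda>n. sqn mu (hcomp F n))"
    by (rule summableI_nonneg_bounded[of _ K]) (auto simp: sqn_nonneg le)
  have "suminf (\<lambda>n. sqn mu (hcomp F n)) \<le> K" by (rule suminf_le_const[OF s le])
  moreover have "hardy_sq mu F \<le> ennreal (suminf (\<lambda>n. sqn mu (hcomp F n)))"
    using s by (subst hardy_sq_le_iff(2)[OF F]) (auto intro!: sum_le_suminf suminf_nonneg simp: sqn_nonneg)
  then have "K \<le> suminf (\<lambda>n. sqn mu (hcomp F n))"
    using K s by (simp add: ennreal_le_iff suminf_nonneg sqn_nonneg)
  ultimately have "suminf (\<lambda>n. sqn mu (hcomp F n)) = K" by simp
  moreover have "(hardy_nrm mu F)\<^sup>2 = K" using K by (simp add: hardy_nrm_def K_def)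
  ultimately show "(\<lambda>n. sqn mu (hcomp F n)) sums (hardy_nrm mu F)\<^sup>2" using s by (simp add: sums_iff)
qed

lemma hardy_spaceI:
  assumes F: "holo_on F \<Omega>" and K: "\<And>r. 0 < r \<Longrightarrow> r < 1 \<Longrightarrow> sqn mu (\<lambda>z. F (r *\<^sub>R z)) \<le> K"
  shows "F \<in> hardy_space \<Omega> mu"
proof -
  have "0 \<le> K" using order_trans[OF sqn_nonneg K, of "1/2"] by simp
  then have "hardy_sq mu F \<le> ennreal K" using K by (subst hardy_sq_le_iff(1)[OF F]) auto
  then show ?thesis using F ennreal_less_top[of K]
    unfolding hardy_space_def by (auto intro: order.strict_trans1 simp del: ennreal_less_top)
qed

lemma hardy_dilate_le:
  assumes "F \<in> hardy_space \<Omega> mu" "0 < r" "r < 1"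
  shows "sqn mu (\<lambda>z. F (r *\<^sub>R z)) \<le> (hardy_nrm mu F)\<^sup>2"
proof (rule sums_le[OF _ dilate_sqn[OF hardy_holo[OF assms(1)]] hardy_sums[OF assms(1)]])
  show "r ^ (2 * n) * sqn mu (hcomp F n) \<le> sqn mu (hcomp F n)" for n
    using mult_right_mono[OF power_le_one[of r "2 * n"] sqn_nonneg] assms by simp
qed (use assms in auto)

end

section \<open>The Cauchy criterion and measurability of radial limits\<close>

definition radius :: "nat \<Rightarrow> real" where "radius n = 1 - 1 / real (n + 2)"

lemma radius: "0 < radius n" "radius n < 1" "0 \<le> radius n"
  by (simp_all add: radius_def)

lemma radius_mono: "m \<le> n \<Longrightarrow> radius m \<le> radius n"
  by (simp add: radius_def frac_le)

lemma radius_tendsto: "radius \<longlonglongrightarrow> 1"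
proof -
  have "(\<lambda>n. 1 - 1 / real (n + 2)) \<longlonglongrightarrow> 1 - 0"
    by (intro tendsto_diff tendsto_const LIMSEQ_ignore_initial_segment[OF lim_1_over_n])
  then show ?thesis by (simp add: radius_def[abs_def])
qed

lemma radius_at_left: "filterlim radius (at_left 1) sequentially"
  by (rule tendsto_imp_filterlim_at_left[OF radius_tendsto]) (simp add: radius)

lemma radius_ex: "c < 1 \<Longrightarrow> \<exists>m. c < radius m"
  using order_tendstoD(1)[OF radius_tendsto] eventually_happens'[OF sequentially_bot] by blast

lemma convergent_iff_cauchy:
  fixes f :: "'a \<Rightarrow> complex"
  assumes "F \<noteq> bot"
  shows "(\<exists>l. (f \<longlongrightarrow> l) F) \<longleftrightarrow>
    (\<forall>e>0. \<exists>P. eventually P F \<and> (\<forall>x y. P x \<and> P y \<longrightarrow> dist (f x) (f y) < e))"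
  unfolding cauchy_filter_metric_filtermap[symmetric] filterlim_def
  using complete_UNIV[where 'a = complex] assms nhds_imp_cauchy_filter[of "filtermap f F"]
  unfolding complete_uniform by (auto simp: filtermap_bot_iff)

lemma eventually_at_left_radius:
  "eventually P (at_left 1) \<longleftrightarrow> (\<exists>m. \<forall>r\<in>{radius m<..<1}. P r)"
  unfolding eventually_at_left_field
proof
  assume "\<exists>b<1. \<forall>y>b. y < 1 \<longrightarrow> P y"
  then obtain b where b: "b < 1" "\<And>y. b < y \<Longrightarrow> y < 1 \<Longrightarrow> P y" by blast
  obtain m where "b < radius m" using radius_ex[OF b(1)] by blast
  then show "\<exists>m. \<forall>r\<in>{radius m<..<1}. P r" using b(2) by (intro exI[of _ m]) auto
next
  assume "\<exists>m. \<forall>r\<in>{radius m<..<1}. P r"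
  then obtain m where "\<forall>r\<in>{radius m<..<1}. P r" ..
  then show "\<exists>b<1. \<forall>y>b. y < 1 \<longrightarrow> P y" using radius(2)[of m] by auto
qed

text \<open>The Cauchy criterion with countable quantifiers over tolerances and starting radii, in
  preparation for measurability.\<close>

lemma at_left_convergent_iff:
  fixes f :: "real \<Rightarrow> complex"
  shows "(\<exists>l. (f \<longlongrightarrow> l) (at_left 1)) \<longleftrightarrow>
    (\<forall>k::nat. \<exists>m. \<forall>r\<in>{radius m<..<1}. \<forall>r'\<in>{radius m<..<1}. cmod (f r - f r') \<le> 1 / real (k + 1))"
  unfolding convergent_iff_cauchy[OF trivial_limit_at_left_real]
proof (intro iffI allI impI)
  fix k :: nat
  assume "\<forall>e>0. \<exists>P. eventually P (at_left 1) \<and> (\<forall>r r'. P r \<and> P r' \<longrightarrow> dist (f r) (f r') < e)"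
  then obtain P where P: "eventually P (at_left 1)" "\<And>r r'. P r \<Longrightarrow> P r' \<Longrightarrow> dist (f r) (f r') < 1 / real (k + 1)"
    by (metis of_nat_0_less_iff zero_less_divide_1_iff zero_less_Suc Suc_eq_plus1)
  then show "\<exists>m. \<forall>r\<in>{radius m<..<1}. \<forall>r'\<in>{radius m<..<1}. cmod (f r - f r') \<le> 1 / real (k + 1)"
    unfolding eventually_at_left_radius dist_norm by (blast intro: less_imp_le)
next
  fix e :: real
  assume R: "\<forall>k::nat. \<exists>m. \<forall>r\<in>{radius m<..<1}. \<forall>r'\<in>{radius m<..<1}. cmod (f r - f r') \<le> 1 / real (k + 1)" and "0 < e"
  then obtain k where k: "1 / real (k + 1) < e" using nat_approx_posE by (metis Suc_eq_plus1)
  obtain m where m: "\<forall>r\<in>{radius m<..<1}. \<forall>r'\<in>{radius m<..<1}. cmod (f r - f r') \<le> 1 / real (k + 1)"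
    using R by blast
  show "\<exists>P. eventually P (at_left 1) \<and> (\<forall>r r'. P r \<and> P r' \<longrightarrow> dist (f r) (f r') < e)"
    unfolding eventually_at_left_radius dist_norm
    by (intro exI[of _ "\<lambda>r. r \<in> {radius m<..<1}"] conjI exI[of _ m] ballI allI impI; (elim conjE)?)
      (use m in \<open>auto intro!: order.strict_trans1[OF _ k]\<close>)
qed

text \<open>Continuity lets rational radii stand for all radii, which removes the last uncountable
  quantifiers from the criterion.\<close>

lemma rational_bound_extends:
  fixes f :: "real \<Rightarrow> complex"
  assumes f: "continuous_on {0<..<1} f" and a: "0 < a"
    and b: "\<And>q q'. q \<in> \<rat> \<Longrightarrow> q' \<in> \<rat> \<Longrightarrow> q \<in> {a<..<1} \<Longrightarrow> q' \<in> {a<..<1} \<Longrightarrow> cmod (f q - f q') \<le> e"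
    and r: "r \<in> {a<..<1}" "r' \<in> {a<..<1}"
  shows "cmod (f r - f r') \<le> e"
proof -
  have cf: "continuous_on {a<..<1} f" by (rule continuous_on_subset[OF f]) (use a in auto)
  have ext: "cmod (f r - c) \<le> e" if r: "r \<in> {a<..<1}" and c: "\<And>q. q \<in> \<rat> \<Longrightarrow> q \<in> {a<..<1} \<Longrightarrow> cmod (f q - c) \<le> e" for r c
  proof (rule ccontr)
    assume "\<not> cmod (f r - c) \<le> e"
    moreover have "continuous_on {a<..<1} (\<lambda>r. cmod (f r - c))" by (intro continuous_intros cf)
    then have "open ((\<lambda>r. cmod (f r - c)) -` {e<..} \<inter> {a<..<1})"
      using continuous_on_open_vimage[OF open_greaterThanLessThan] open_greaterThan by blast
    ultimately have "\<exists>d>0. ball r d \<subseteq> (\<lambda>r. cmod (f r - c)) -` {e<..} \<inter> {a<..<1}"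
      using r unfolding open_contains_ball by (elim ballE[of _ _ r]) auto
    then obtain d where d: "0 < d" "ball r d \<subseteq> (\<lambda>r. cmod (f r - c)) -` {e<..} \<inter> {a<..<1}" by blast
    obtain q where q: "q \<in> \<rat>" "r < q" "q < r + d" using Rats_dense_in_real[of r "r + d"] d(1) by auto
    then have "q \<in> ball r d" by (auto simp: dist_real_def)
    then have "q \<in> (\<lambda>r. cmod (f r - c)) -` {e<..} \<inter> {a<..<1}" using d(2) by (rule rev_subsetD)
    then show False using c[OF q(1)] by simp
  qed
  show ?thesis
  proof (rule ext[OF r(1)])
    fix q :: real assume q: "q \<in> \<rat>" "q \<in> {a<..<1}"
    have "cmod (f r' - f q) \<le> e" by (rule ext[OF r(2)]) (use b q in auto)
    then show "cmod (f q - f r') \<le> e" by (simp add: norm_minus_commute)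
  qed
qed

text \<open>The points where the limit exists form a measurable set \<open>C\<close> by the
  countable criterion, and there the limit may be taken along \<open>radius\<close>.\<close>

lemma Lim_at_left_measurable:
  fixes F :: "real \<Rightarrow> 'a \<Rightarrow> complex"
  assumes meas: "\<And>r. 0 < r \<Longrightarrow> r < 1 \<Longrightarrow> F r \<in> borel_measurable M"
    and cont: "\<And>x. x \<in> space M \<Longrightarrow> continuous_on {0<..<1} (\<lambda>r. F r x)"
  shows "(\<lambda>x. Lim (at_left 1) (\<lambda>r. F r x)) \<in> borel_measurable M"
proof -
  define I where "I m q \<longleftrightarrow> real_of_rat q \<in> {radius m<..<1}" for m q
  define C where "C = {x\<in>space M. \<forall>k::nat. \<exists>m. \<forall>q q'. I m q \<and> I m q' \<longrightarrow>
      cmod (F (real_of_rat q) x - F (real_of_rat q') x) \<le> 1 / real (k + 1)}"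
  have meas': "F (real_of_rat q) \<in> borel_measurable M" if "I m q" for m q
  proof -
    have "0 < real_of_rat q" "real_of_rat q < 1"
      using that radius(1)[of m] unfolding I_def greaterThanLessThan_iff by linarith+
    then show ?thesis by (rule meas)
  qed
  have C: "C \<in> sets M"
    unfolding C_def
  proof (intro sets.sets_Collect_countable_All sets.sets_Collect_countable_Ex)
    fix k m q q'
    show "{x\<in>space M. I m q \<and> I m q' \<longrightarrow> cmod (F (real_of_rat q) x - F (real_of_rat q') x) \<le> 1 / real (k + 1)} \<in> sets M"
    proof (cases "I m q \<and> I m q'")
      case True
      then have [measurable]: "F (real_of_rat q) \<in> borel_measurable M" "F (real_of_rat q') \<in> borel_measurable M"
        using meas' by auto
      show ?thesis by measurable
    next
      case False
      then have "{x\<in>space M. I m q \<and> I m q' \<longrightarrow> cmod (F (real_of_rat q) x - F (real_of_rat q') x) \<le> 1 / real (k + 1)} = space M" by auto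
      then show ?thesis by simp
    qed
  qed
  have conv: "(\<exists>l. ((\<lambda>r. F r x) \<longlongrightarrow> l) (at_left 1)) \<longleftrightarrow> x \<in> C" if x: "x \<in> space M" for x
  proof -
    have "(\<forall>r\<in>{radius m<..<1}. \<forall>r'\<in>{radius m<..<1}. cmod (F r x - F r' x) \<le> e) \<longleftrightarrow>
        (\<forall>q q'. I m q \<and> I m q' \<longrightarrow> cmod (F (real_of_rat q) x - F (real_of_rat q') x) \<le> e)" for m e
    proof (intro iffI ballI)
      fix r r' assume *: "\<forall>q q'. I m q \<and> I m q' \<longrightarrow> cmod (F (real_of_rat q) x - F (real_of_rat q') x) \<le> e"
        and r: "r \<in> {radius m<..<1}" "r' \<in> {radius m<..<1}"
      show "cmod (F r x - F r' x) \<le> e"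
        by (rule rational_bound_extends[OF cont[OF x] radius(1)[of m] _ r])
          (use * in \<open>auto simp: I_def elim!: Rats_cases\<close>)
    qed (auto simp: I_def)
    then show ?thesis unfolding at_left_convergent_iff C_def using x by simp
  qed
  \<comment> \<open>Where no limit exists \<open>Lim\<close> is the fixed default value
    \<open>THE l. False\<close>, so it is constant off \<open>C\<close>.\<close>
  have m1: "(\<lambda>x. if x \<in> C then lim (\<lambda>n. F (radius n) x) else (THE l. False)) \<in> borel_measurable M"
    using C by (intro measurable_If_set borel_measurable_lim_metric meas radius measurable_const) auto
  have eq: "Lim (at_left 1) (\<lambda>r. F r x) = (if x \<in> C then lim (\<lambda>n. F (radius n) x) else (THE l. False))"
    if x: "x \<in> space M" for x
  proof (cases "x \<in> C")
    case True
    then obtain l where l: "((\<lambda>r. F r x) \<longlongrightarrow> l) (at_left 1)" using conv[OF x] by blast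
    have "lim (\<lambda>n. F (radius n) x) = l"
      by (rule limI[OF filterlim_compose[OF l radius_at_left]])
    then show ?thesis using tendsto_Lim[OF _ l] True by simp
  next
    case False
    then have "\<And>l. \<not> ((\<lambda>r. F r x) \<longlongrightarrow> l) (at_left 1)" using conv[OF x] by blast
    then show ?thesis using False by (simp add: t2_space_class.Lim_def)
  qed
  show ?thesis by (rule measurable_cong[OF eq, THEN iffD2, OF _ m1])
qed

section \<open>The maximal inequality on the Shilov boundary\<close>

context hardy_domain
begin

lemma measurable_orbit: "(\<lambda>(z, s). cis (2 * pi * s) *s z) \<in> measurable (mu \<Otimes>\<^sub>M lborel) mu"
proof -
  have 1: "(\<lambda>p. (fst p, snd p)) \<in> measurable (mu \<Otimes>\<^sub>M lborel) (borel \<Otimes>\<^sub>M (borel :: real measure))"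
    by (intro measurable_Pair measurable_compose[OF measurable_fst borel_measurable_mu]
        measurable_compose[OF measurable_snd]) auto
  have 2: "(\<lambda>p::(complex^'n) \<times> real. cis (2 * pi * snd p) *s fst p) \<in> borel_measurable borel"
    unfolding vector_scalar_mult_def cis_conv_exp
    by (intro borel_measurable_continuous_onI continuous_on_vec_lambda continuous_intros)
  have "(\<lambda>p. cis (2 * pi * snd p) *s fst p) \<in> measurable (mu \<Otimes>\<^sub>M lborel) borel"
    using measurable_compose[OF 1, of "\<lambda>p. cis (2 * pi * snd p) *s fst p" borel] 2 by (simp add: borel_prod)
  then have "(\<lambda>p. cis (2 * pi * snd p) *s fst p) \<in> measurable (mu \<Otimes>\<^sub>M lborel) (restrict_space borel S0)"
    by (intro measurable_restrict_space2) (auto simp: space_pair_measure space_mu shilov_circ)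
  then show ?thesis by (simp add: measurable_cong_sets[OF refl sets_mu] case_prod_beta')
qed

text \<open>Fubini and rotation invariance. Estimates on single circles therefore integrate to
  estimates for \<open>mu\<close>.\<close>

lemma nn_integral_orbit:
  assumes g: "g \<in> borel_measurable mu"
  shows "(\<integral>\<^sup>+z. (\<integral>\<^sup>+s\<in>{0..1}. g (cis (2 * pi * s) *s z) \<partial>lborel) \<partial>mu) = (\<integral>\<^sup>+z. g z \<partial>mu)"
proof -
  interpret pair_sigma_finite mu lborel ..
  have m: "(\<lambda>(z, s). g (cis (2 * pi * s) *s z)) \<in> borel_measurable (mu \<Otimes>\<^sub>M lborel)"
    using measurable_compose[OF measurable_orbit g] by (simp add: case_prod_beta')
  have m2: "(\<lambda>(z, s). g (cis (2 * pi * s) *s z) * indicator {0..1} s) \<in> borel_measurable (mu \<Otimes>\<^sub>M lborel)"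
    using m by (simp add: case_prod_beta')
  have "(\<integral>\<^sup>+z. (\<integral>\<^sup>+s. g (cis (2 * pi * s) *s z) * indicator {0..1} s \<partial>lborel) \<partial>mu)
      = (\<integral>\<^sup>+s. (\<integral>\<^sup>+z. g (cis (2 * pi * s) *s z) * indicator {0..1} s \<partial>mu) \<partial>lborel)"
    by (rule Fubini'[OF m2, symmetric])
  also have "\<dots> = (\<integral>\<^sup>+s. (\<integral>\<^sup>+z. g z \<partial>mu) * indicator {0..1::real} s \<partial>lborel)"
  proof (rule nn_integral_cong)
    fix s :: real
    have "(\<lambda>z. g (cis (2 * pi * s) *s z)) \<in> borel_measurable mu"
      by (rule measurable_compose[OF measurable_circ g]) simp
    then show "(\<integral>\<^sup>+z. g (cis (2 * pi * s) *s z) * indicator {0..1} s \<partial>mu) = (\<integral>\<^sup>+z. g z \<partial>mu) * indicator {0..1} s"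
      by (simp add: nn_integral_multc nn_integral_circ[OF g])
  qed
  also have "\<dots> = (\<integral>\<^sup>+z. g z \<partial>mu)" by (simp add: nn_integral_cmult_indicator)
  finally show ?thesis .
qed

lemma smult_scaleR: "c *s (R *\<^sub>R (z::complex^'n)) = (c * of_real R) *s z"
  by (simp add: vec_eq_iff, simp add: scaleR_conv_of_real)

text \<open>A union over possibly uncountably many radii, measurable because each member is
  relatively open.\<close>

lemma open_exceed:
  assumes H: "holo_on H \<Omega>" and I: "I \<subseteq> {0..<1}"
  shows "{z\<in>S0. \<exists>r\<in>I. l < cmod (H (r *\<^sub>R z))} \<in> sets mu"
proof -
  have "\<exists>A. open A \<and> A \<inter> S0 = (\<lambda>z. cmod (H (r *\<^sub>R z))) -` {l<..} \<inter> S0" if r: "r \<in> I" for r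
  proof -
    have r': "0 \<le> r" "r < 1" using r I by auto
    have "continuous_on S0 (\<lambda>z. H (r *\<^sub>R z))"
      by (rule continuous_on_compose2[OF holo_on_continuous_on[OF H]])
        (use r' scaleR_closure S0_closure in \<open>auto intro!: continuous_intros\<close>)
    then have "continuous_on S0 (\<lambda>z. cmod (H (r *\<^sub>R z)))" by (rule continuous_on_norm)
    then show ?thesis using open_greaterThan unfolding continuous_on_open_invariant by blast
  qed
  then have "\<forall>r\<in>I. \<exists>A. open A \<and> A \<inter> S0 = (\<lambda>z. cmod (H (r *\<^sub>R z))) -` {l<..} \<inter> S0" by blast
  then obtain A where A: "\<forall>r\<in>I. open (A r) \<and> A r \<inter> S0 = (\<lambda>z. cmod (H (r *\<^sub>R z))) -` {l<..} \<inter> S0"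
    unfolding bchoice_iff by blast
  have "{z\<in>S0. \<exists>r\<in>I. l < cmod (H (r *\<^sub>R z))} = S0 \<inter> (\<Union>r\<in>I. A r)"
  proof (intro equalityI subsetI)
    fix z assume "z \<in> {z\<in>S0. \<exists>r\<in>I. l < cmod (H (r *\<^sub>R z))}"
    then obtain r where r: "z \<in> S0" "r \<in> I" "l < cmod (H (r *\<^sub>R z))" by blast
    then have "z \<in> A r \<inter> S0" using bspec[OF A r(2)] by simp
    then show "z \<in> S0 \<inter> (\<Union>r\<in>I. A r)" using r by blast
  next
    fix z assume "z \<in> S0 \<inter> (\<Union>r\<in>I. A r)"
    then obtain r where r: "z \<in> S0" "r \<in> I" "z \<in> A r \<inter> S0" by blast
    then have "l < cmod (H (r *\<^sub>R z))" using bspec[OF A r(2)] by simp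
    then show "z \<in> {z\<in>S0. \<exists>r\<in>I. l < cmod (H (r *\<^sub>R z))}" using r by blast
  qed
  moreover have "open (\<Union>r\<in>I. A r)" using A by blast
  ultimately show ?thesis unfolding sets_mu sets_restrict_space by auto
qed

text \<open>Integrate \<open>radial_weak_type\<close> over the circles through the points
  \<open>R z\<close>. With \<open>R < 1\<close> each slice is holomorphic on the disc of radius
  \<open>1 / R > 1\<close>.\<close>

lemma weak_type_dilate:
  assumes H: "holo_on H \<Omega>" and R: "0 < R" "R < 1" and l: "0 < l"
  shows "emeasure mu {z\<in>S0. \<exists>r\<in>{0<..<R}. 32 * l < cmod (H (r *\<^sub>R z))}
    \<le> ennreal (10 / l) * (\<integral>\<^sup>+z. ennreal (cmod (H (R *\<^sub>R z))) \<partial>mu)"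
proof -
  define E where "E = {z\<in>S0. \<exists>r\<in>{0<..<R}. 32 * l < cmod (H (r *\<^sub>R z))}"
  have E: "E \<in> sets mu" unfolding E_def by (rule open_exceed[OF H]) (use R in auto)
  define g where "g z = ennreal (cmod (H (R *\<^sub>R z)))" for z
  have g: "g \<in> borel_measurable mu"
    unfolding g_def using dilate_measurable[OF H, of R] R by simp
  have slice: "(\<integral>\<^sup>+s\<in>{0..1}. indicator E (cis (2 * pi * s) *s z) \<partial>lborel)
      \<le> ennreal (10 / l) * (\<integral>\<^sup>+s\<in>{0..1}. g (cis (2 * pi * s) *s z) \<partial>lborel)" if z: "z \<in> S0" for z
  proof -
    define f where "f w = H (w *s (R *\<^sub>R z))" for w
    have fz: "f (of_real r * cis (2 * pi * s)) = H ((r * R) *\<^sub>R (cis (2 * pi * s) *s z))" for r s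
      unfolding f_def smult_scaleR
      by (rule arg_cong[of _ _ H]) (simp add: vec_eq_iff, simp add: scaleR_conv_of_real)
    have hol: "f holomorphic_on ball 0 (1 / R)"
      unfolding f_def
    proof -
      have "0 + w *s (R *\<^sub>R z) \<in> \<Omega>" if "w \<in> ball 0 (1 / R)" for w
      proof -
        have "cmod (w * of_real R) < 1" using that R by (simp add: norm_mult pos_less_divide_eq)
        then show ?thesis unfolding smult_scaleR add_0 by (rule scale_closure[OF S0_closure[OF z]])
      qed
      from holo_on_line[OF H open_dom open_ball[of 0 "1 / R"] this]
      show "(\<lambda>w. H (w *s (R *\<^sub>R z))) holomorphic_on ball 0 (1 / R)" by simp
    qed
    have set: "{s\<in>{0..1}. \<exists>r\<in>{0<..<1}. 32 * l < cmod (f (of_real r * cis (2 * pi * s)))}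
        = {s\<in>{0..1}. cis (2 * pi * s) *s z \<in> E}"
    proof (intro Collect_cong conj_cong refl)
      fix s :: real
      have "(\<exists>r\<in>{0<..<R}. 32 * l < cmod (H (r *\<^sub>R (cis (2 * pi * s) *s z)))) \<longleftrightarrow>
          (\<exists>r\<in>{0<..<1}. 32 * l < cmod (H ((r * R) *\<^sub>R (cis (2 * pi * s) *s z))))"
      proof (intro iffI; elim bexE)
        fix r assume "r \<in> {0<..<R}" "32 * l < cmod (H (r *\<^sub>R (cis (2 * pi * s) *s z)))"
        then show "\<exists>r\<in>{0<..<1}. 32 * l < cmod (H ((r * R) *\<^sub>R (cis (2 * pi * s) *s z)))"
          using R by (intro bexI[of _ "r / R"]) auto
      next
        fix r assume "r \<in> {0<..<1::real}" "32 * l < cmod (H ((r * R) *\<^sub>R (cis (2 * pi * s) *s z)))"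
        then show "\<exists>r\<in>{0<..<R}. 32 * l < cmod (H (r *\<^sub>R (cis (2 * pi * s) *s z)))"
          using R by (intro bexI[of _ "r * R"]) auto
      qed
      then show "(\<exists>r\<in>{0<..<1}. 32 * l < cmod (f (of_real r * cis (2 * pi * s)))) \<longleftrightarrow> cis (2 * pi * s) *s z \<in> E"
        unfolding fz E_def using shilov_circ[OF z, of "cis (2 * pi * s)"] by simp
    qed
    have m: "(\<lambda>s. cis (2 * pi * s) *s z) \<in> measurable lborel mu"
      using measurable_compose[OF measurable_Pair1'[of z mu lborel] measurable_orbit] z by (simp add: space_mu)
    have ms: "{s\<in>{0..1}. cis (2 * pi * s) *s z \<in> E} \<in> sets lborel"
    proof -
      have "(\<lambda>s. cis (2 * pi * s) *s z) -` E \<inter> space lborel \<in> sets lborel" by (rule measurable_sets[OF m E])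
      then have "{0..1} \<inter> ((\<lambda>s. cis (2 * pi * s) *s z) -` E \<inter> space lborel) \<in> sets lborel" by (intro sets.Int) auto
      also have "{0..1} \<inter> ((\<lambda>s. cis (2 * pi * s) *s z) -` E \<inter> space lborel) = {s\<in>{0..1}. cis (2 * pi * s) *s z \<in> E}" by auto
      finally show ?thesis .
    qed
    have "(\<integral>\<^sup>+s\<in>{0..1}. indicator E (cis (2 * pi * s) *s z) \<partial>lborel)
        = (\<integral>\<^sup>+s. indicator {s\<in>{0..1}. cis (2 * pi * s) *s z \<in> E} s \<partial>lborel)"
      by (rule nn_integral_cong) (auto simp: indicator_def)
    also have "\<dots> = emeasure lborel {s\<in>{0..1}. cis (2 * pi * s) *s z \<in> E}"
      by (rule nn_integral_indicator[OF ms])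
    also have "\<dots> \<le> ennreal (10 / l) * (\<integral>\<^sup>+s\<in>{0..1}. g (cis (2 * pi * s) *s z) \<partial>lborel)"
    proof -
      have gs: "g (cis (2 * pi * s) *s z) = ennreal (cmod (f (cis (2 * pi * s))))" for s
        using fz[of 1] by (simp add: g_def)
      show ?thesis unfolding set[symmetric] gs by (rule radial_weak_type[OF hol _ l]) (use R in simp)
    qed
    finally show ?thesis .
  qed
  have "emeasure mu E = (\<integral>\<^sup>+z. indicator E z \<partial>mu)" using E by simp
  also have "\<dots> = (\<integral>\<^sup>+z. (\<integral>\<^sup>+s\<in>{0..1}. indicator E (cis (2 * pi * s) *s z) \<partial>lborel) \<partial>mu)"
    by (rule nn_integral_orbit[symmetric]) (use E in simp)
  also have "\<dots> \<le> (\<integral>\<^sup>+z. ennreal (10 / l) * (\<integral>\<^sup>+s\<in>{0..1}. g (cis (2 * pi * s) *s z) \<partial>lborel) \<partial>mu)"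
    by (rule nn_integral_mono) (use slice in \<open>simp add: space_mu\<close>)
  also have "\<dots> = ennreal (10 / l) * (\<integral>\<^sup>+z. (\<integral>\<^sup>+s\<in>{0..1}. g (cis (2 * pi * s) *s z) \<partial>lborel) \<partial>mu)"
  proof (rule nn_integral_cmult)
    have "(\<lambda>(z, s). g (cis (2 * pi * s) *s z) * indicator {0..1} s) \<in> borel_measurable (mu \<Otimes>\<^sub>M lborel)"
      using measurable_compose[OF measurable_orbit g] by (simp add: case_prod_beta')
    then show "(\<lambda>z. \<integral>\<^sup>+s\<in>{0..1}. g (cis (2 * pi * s) *s z) \<partial>lborel) \<in> borel_measurable mu"
      by (rule lborel.borel_measurable_nn_integral)
  qed
  also have "\<dots> = ennreal (10 / l) * (\<integral>\<^sup>+z. g z \<partial>mu)" by (simp only: nn_integral_orbit[OF g])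
  finally show ?thesis unfolding E_def g_def .
qed

text \<open>The exceptional sets for radii below \<open>radius n\<close> increase to the full one,
  and the L1 norm of a dilate is at most its L2 norm, which is bounded by \<open>sqrt B\<close>
  uniformly.\<close>

lemma maximal_weak_type:
  assumes H: "holo_on H \<Omega>" and l: "0 < l" and B: "\<And>R. 0 < R \<Longrightarrow> R < 1 \<Longrightarrow> sqn mu (\<lambda>z. H (R *\<^sub>R z)) \<le> B"
  shows "emeasure mu {z\<in>S0. \<exists>r\<in>{0<..<1}. 32 * l < cmod (H (r *\<^sub>R z))} \<le> ennreal (10 / l * sqrt B)"
proof -
  define E where "E n = {z\<in>S0. \<exists>r\<in>{0<..<radius n}. 32 * l < cmod (H (r *\<^sub>R z))}" for n
  have le: "emeasure mu (E n) \<le> ennreal (10 / l * sqrt B)" for n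
  proof -
    have L2: "(\<lambda>z. H (radius n *\<^sub>R z)) \<in> L2 mu" by (rule dilate_L2[OF H radius(3) radius(2)])
    have "(LINT z|mu. cmod (H (radius n *\<^sub>R z)))\<^sup>2 \<le> B"
      by (rule order_trans[OF mu.integral_sq_le_sqn[OF L2] B[OF radius(1,2)]])
    then have "(LINT z|mu. cmod (H (radius n *\<^sub>R z))) \<le> sqrt B" by (rule real_le_rsqrt)
    moreover have "(\<integral>\<^sup>+z. ennreal (cmod (H (radius n *\<^sub>R z))) \<partial>mu) = ennreal (LINT z|mu. cmod (H (radius n *\<^sub>R z)))"
      using mu.L2_integrable[OF L2] by (intro nn_integral_eq_integral) auto
    moreover have "emeasure mu (E n) \<le> ennreal (10 / l) * (\<integral>\<^sup>+z. ennreal (cmod (H (radius n *\<^sub>R z))) \<partial>mu)"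
      unfolding E_def by (rule weak_type_dilate[OF H radius(1,2) l])
    ultimately have "emeasure mu (E n) \<le> ennreal (10 / l) * ennreal (sqrt B)"
      by (metis (no_types, lifting) ennreal_leI mult_left_mono order_trans zero_le)
    then show ?thesis using l by (simp add: ennreal_mult'[symmetric])
  qed
  have "{z\<in>S0. \<exists>r\<in>{0<..<1}. 32 * l < cmod (H (r *\<^sub>R z))} = (\<Union>n. E n)"
  proof (intro equalityI subsetI)
    fix z assume "z \<in> {z\<in>S0. \<exists>r\<in>{0<..<1}. 32 * l < cmod (H (r *\<^sub>R z))}"
    then obtain r where r: "z \<in> S0" "0 < r" "r < 1" "32 * l < cmod (H (r *\<^sub>R z))" by auto
    obtain n where "r < radius n" using radius_ex[OF r(3)] by blast
    then have "z \<in> E n" using r by (auto simp: E_def)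
    then show "z \<in> (\<Union>n. E n)" by blast
  next
    fix z assume "z \<in> (\<Union>n. E n)"
    then obtain n r where "z \<in> S0" "0 < r" "r < radius n" "32 * l < cmod (H (r *\<^sub>R z))" by (auto simp: E_def)
    moreover have "radius n < 1" by (rule radius)
    ultimately show "z \<in> {z\<in>S0. \<exists>r\<in>{0<..<1}. 32 * l < cmod (H (r *\<^sub>R z))}" by fastforce
  qed
  moreover have "emeasure mu (\<Union>n. E n) = (SUP n. emeasure mu (E n))"
  proof (rule SUP_emeasure_incseq[symmetric])
    show "range E \<subseteq> sets mu"
    proof (intro image_subsetI)
      fix n
      show "E n \<in> sets mu" unfolding E_def by (rule open_exceed[OF H]) (use radius(2)[of n] in auto)
    qed
    have "E m \<subseteq> E n" if "m \<le> n" for m n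
      unfolding E_def using radius_mono[OF that] by (intro Collect_mono) (auto intro: order.strict_trans2)
    then show "incseq E" unfolding incseq_def by blast
  qed
  moreover have "(SUP n. emeasure mu (E n)) \<le> ennreal (10 / l * sqrt B)" by (rule SUP_least) (rule le)
  ultimately show ?thesis by simp
qed

end

section \<open>Existence of radial limits and the boundary isometry\<close>

lemma smult_of_real: "of_real r *s z = r *\<^sub>R (z::complex^'n)"
  by (simp add: vec_eq_iff, simp add: scaleR_conv_of_real)

context hardy_domain
begin

definition hpart :: "(complex^'n \<Rightarrow> complex) \<Rightarrow> nat \<Rightarrow> complex^'n \<Rightarrow> complex" where
  "hpart F N z = (\<Sum>n<N. hcomp F n z)"

text \<open>By \<open>hardy_sums\<close> this is the sum of the squared norms of the components of
  degree at least \<open>N\<close>, written as a difference to avoid an infinite sum.\<close>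

definition tail_sq :: "(complex^'n \<Rightarrow> complex) \<Rightarrow> nat \<Rightarrow> real" where
  "tail_sq F N = (hardy_nrm mu F)\<^sup>2 - (\<Sum>n<N. sqn mu (hcomp F n))"

lemma holo_bounded_hardy:
  assumes F: "holo_on F \<Omega>" and B: "\<And>z. z \<in> \<Omega> \<Longrightarrow> cmod (F z) \<le> B"
  shows "F \<in> hardy_space \<Omega> mu"
proof (rule hardy_spaceI[OF F])
  fix r :: real assume r: "0 < r" "r < 1"
  have "sqn mu (\<lambda>z. F (r *\<^sub>R z)) \<le> (LINT z|mu. B\<^sup>2)"
    unfolding sqn_def using r B scaleR_closure S0_closure
    by (intro integral_mono L2_integrable_sq dilate_L2[OF F] power_mono) (auto simp: space_mu)
  then show "sqn mu (\<lambda>z. F (r *\<^sub>R z)) \<le> B\<^sup>2" by (simp add: mu.prob_space)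
qed

lemma radial_tendsto_continuous:
  fixes f :: "complex^'n \<Rightarrow> complex"
  assumes "isCont f z"
  shows "((\<lambda>r. f (r *\<^sub>R z)) \<longlongrightarrow> f z) (at_left 1)"
proof -
  have "((\<lambda>r. r *\<^sub>R z) \<longlongrightarrow> 1 *\<^sub>R z) (at_left 1)" by (intro tendsto_intros)
  then show ?thesis using isCont_tendsto_compose[OF assms, of "\<lambda>r. r *\<^sub>R z"] by simp
qed

lemma poly_fun_isCont: "poly_fun f \<Longrightarrow> isCont f z"
  using poly_fun_continuous_on[of f UNIV] by (simp add: continuous_on_eq_continuous_at)

lemma poly_fun_hardy:
  assumes f: "poly_fun f"
  shows "f \<in> hardy_space \<Omega> mu" and "radial_limit f z = f z"
proof -
  obtain B where B: "\<forall>z\<in>closure \<Omega>. cmod (f z) \<le> B"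
    using continuous_on_compact_bound[OF compact_closure_dom poly_fun_continuous_on[OF f]] by blast
  show "f \<in> hardy_space \<Omega> mu"
    by (rule holo_bounded_hardy[OF poly_fun_holo_on[OF f], of B]) (use B closure_subset in blast)
  show "radial_limit f z = f z"
    unfolding radial_limit_def by (intro tendsto_Lim radial_tendsto_continuous poly_fun_isCont f) simp
qed

lemma poly_fun_L2:
  assumes "poly_fun f"
  shows "f \<in> L2 mu"
proof -
  obtain B where "\<forall>z\<in>closure \<Omega>. cmod (f z) \<le> B"
    using continuous_on_compact_bound[OF compact_closure_dom poly_fun_continuous_on[OF assms]] by blast
  then show ?thesis
    by (intro mu.L2_bounded[of _ B] poly_fun_measurable_mu assms) (auto simp: space_mu S0_closure)
qed

context
  fixes F assumes F: "F \<in> hardy_space \<Omega> mu"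
begin

lemma hpart_poly: "poly_fun (hpart F N)"
  unfolding hpart_def[abs_def] by (intro poly_fun_sum poly_fun_hcomp hardy_holo[OF F])

lemma tail_tendsto: "tail_sq F \<longlonglongrightarrow> 0"
  using tendsto_diff[OF tendsto_const[of "(hardy_nrm mu F)\<^sup>2"] hardy_sums[OF F, unfolded sums_def]]
  by (simp add: tail_sq_def[abs_def])

text \<open>The scaled series with the coefficients below \<open>N\<close> set to 0, so that its
  norm is dominated by the tail.\<close>

lemma truncated_dilate:
  assumes r: "0 \<le> r" "r < 1"
  shows "(\<lambda>z. F (r *\<^sub>R z) - hpart F N (r *\<^sub>R z)) \<in> L2 mu"
    "sqn mu (\<lambda>z. F (r *\<^sub>R z) - hpart F N (r *\<^sub>R z)) \<le> tail_sq F N"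
proof -
  note hol = hardy_holo[OF F]
  define c where "c n = (if n < N then 0 else of_real r ^ n :: complex)" for n
  have c: "cmod (c n) \<le> r ^ n" for n using r by (simp add: c_def norm_power)
  have s: "(\<lambda>n. c n * hcomp F n z) sums (F (r *\<^sub>R z) - hpart F N (r *\<^sub>R z))" if z: "z \<in> S0" for z
  proof -
    have "(\<lambda>n. if n \<in> {..<N} then of_real r ^ n * hcomp F n z else 0) sums (\<Sum>n<N. of_real r ^ n * hcomp F n z)"
      by (rule sums_If_finite_set) simp
    from sums_diff[OF slice_sums[OF hol z r] this] show ?thesis
      by (simp add: hpart_def c_def hcomp_scale[OF hol] if_distrib[of "\<lambda>x. x * _"] if_distrib[of "\<lambda>x. _ - x"]
          flip: smult_of_real cong: if_cong)
  qed
  note h = scaled_hcomp_series[OF hol r c s]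
  show "(\<lambda>z. F (r *\<^sub>R z) - hpart F N (r *\<^sub>R z)) \<in> L2 mu" by (rule h(1))
  have fin: "(\<lambda>n. if n \<in> {..<N} then sqn mu (hcomp F n) else 0) sums (\<Sum>n<N. sqn mu (hcomp F n))"
    by (rule sums_If_finite_set) simp
  show "sqn mu (\<lambda>z. F (r *\<^sub>R z) - hpart F N (r *\<^sub>R z)) \<le> tail_sq F N"
    unfolding tail_sq_def
  proof (rule sums_le[OF _ h(2) sums_diff[OF hardy_sums[OF F] fin]])
    have "(r ^ n)\<^sup>2 * sqn mu (hcomp F n) \<le> 1 * sqn mu (hcomp F n)" for n
      using r by (intro mult_right_mono power_le_one sqn_nonneg) auto
    then show "(cmod (c n))\<^sup>2 * sqn mu (hcomp F n) \<le> sqn mu (hcomp F n) - (if n \<in> {..<N} then sqn mu (hcomp F n) else 0)" for n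
      using r by (simp add: c_def norm_power)
  qed
qed

text \<open>The points that are bad for every \<open>N\<close> lie in each exceptional set of the
  maximal inequality, whose measure is at most a constant times
  \<open>sqrt (tail_sq F N)\<close>.\<close>

lemma oscillation_null:
  assumes l: "0 < l"
  shows "AE z in mu. \<exists>N. \<forall>r\<in>{0<..<1}. cmod (F (r *\<^sub>R z) - hpart F N (r *\<^sub>R z)) \<le> 32 * l"
proof -
  define E where "E N = {z\<in>S0. \<exists>r\<in>{0<..<1}. 32 * l < cmod (F (r *\<^sub>R z) - hpart F N (r *\<^sub>R z))}" for N
  have hol: "holo_on (\<lambda>z. F z - hpart F N z) \<Omega>" for N
    by (intro holo_on_diff poly_fun_holo_on hpart_poly hardy_holo[OF F])
  have E: "E N \<in> sets mu" for N
    unfolding E_def by (rule open_exceed[OF hol]) auto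
  define Z where "Z = (\<Inter>N. E N)"
  have Z: "Z \<in> sets mu" unfolding Z_def using E by auto
  have "emeasure mu (E N) \<le> ennreal (10 / l * sqrt (tail_sq F N))" for N
    unfolding E_def by (rule maximal_weak_type[OF hol l]) (simp add: truncated_dilate(2))
  then have "emeasure mu Z \<le> ennreal (10 / l * sqrt (tail_sq F N))" for N
    using emeasure_mono[OF _ E, of Z N] by (auto simp: Z_def intro: order_trans)
  moreover have "(\<lambda>N. ennreal (10 / l * sqrt (tail_sq F N))) \<longlonglongrightarrow> ennreal (10 / l * sqrt 0)"
    by (intro tendsto_intros tail_tendsto)
  ultimately have "emeasure mu Z \<le> ennreal (10 / l * sqrt 0)" by (intro LIMSEQ_le_const) auto
  then have "AE z in mu. z \<notin> Z" using Z by (intro AE_not_in) (simp add: null_sets_def)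
  then show ?thesis
  proof (rule AE_mp[OF _ AE_I2], intro impI)
    fix z assume z: "z \<in> space mu" "z \<notin> Z"
    then obtain N where "z \<notin> E N" by (auto simp: Z_def)
    then show "\<exists>N. \<forall>r\<in>{0<..<1}. cmod (F (r *\<^sub>R z) - hpart F N (r *\<^sub>R z)) \<le> 32 * l"
      using z unfolding E_def space_mu by (intro exI[of _ N]) (auto simp: not_less)
  qed
qed

text \<open>Off a null set \<open>F\<close> stays within any given tolerance of some polynomial
  \<open>hpart F N\<close> along the whole radius, and polynomials are continuous; so the radial
  values are Cauchy.\<close>

lemma radial_limit_AE: "AE z in mu. ((\<lambda>r. F (r *\<^sub>R z)) \<longlongrightarrow> radial_limit F z) (at_left 1)"
proof -
  \<comment> \<open>With this choice \<open>32 * l k\<close> is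
    \<open>1 / (4 * real (k + 1))\<close>: comparing two radial values costs four such
    errors.\<close>
  define l where "l k = 1 / (128 * real (k + 1))" for k :: nat
  have l: "0 < l k" for k by (simp add: l_def)
  have "AE z in mu. \<forall>k. \<exists>N. \<forall>r\<in>{0<..<1}. cmod (F (r *\<^sub>R z) - hpart F N (r *\<^sub>R z)) \<le> 32 * l k"
    unfolding AE_all_countable using oscillation_null[OF l] by blast
  then show ?thesis
  proof (rule AE_mp[OF _ AE_I2], intro impI)
    fix z assume osc: "\<forall>k. \<exists>N. \<forall>r\<in>{0<..<1}. cmod (F (r *\<^sub>R z) - hpart F N (r *\<^sub>R z)) \<le> 32 * l k"
    have "\<exists>L. ((\<lambda>r. F (r *\<^sub>R z)) \<longlongrightarrow> L) (at_left 1)"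
      unfolding convergent_iff_cauchy[OF trivial_limit_at_left_real]
    proof (intro allI impI)
      fix e :: real assume "0 < e"
      then obtain k where k: "1 / real (k + 1) < e" using nat_approx_posE by (metis Suc_eq_plus1)
      define d where "d = 1 / (4 * real (k + 1))"
      have d: "0 < d" "4 * d < e" "32 * l k = d" using k by (simp_all add: d_def l_def field_simps)
      obtain N where N: "\<And>r. r \<in> {0<..<1} \<Longrightarrow> cmod (F (r *\<^sub>R z) - hpart F N (r *\<^sub>R z)) \<le> d"
        using osc d(3) by metis
      define Q where "Q r \<longleftrightarrow> r \<in> {0<..<1} \<and> dist (hpart F N (r *\<^sub>R z)) (hpart F N z) < d" for r
      have "eventually Q (at_left 1)"
        unfolding Q_def using tendstoD[OF radial_tendsto_continuous[OF poly_fun_isCont[OF hpart_poly]] d(1)]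
        by (intro eventually_conj eventually_at_left_real) auto
      moreover have "dist (F (r *\<^sub>R z)) (F (r' *\<^sub>R z)) < e" if "Q r" "Q r'" for r r'
      proof -
        have "cmod (F (r *\<^sub>R z) - hpart F N z) < 2 * d" if "Q r" for r
          using that N[of r] norm_triangle_ineq[of "F (r *\<^sub>R z) - hpart F N (r *\<^sub>R z)" "hpart F N (r *\<^sub>R z) - hpart F N z"]
          by (auto simp: Q_def dist_norm)
        from this[OF that(1)] this[OF that(2)] d(2) show ?thesis
          using dist_triangle2[of "F (r *\<^sub>R z)" "F (r' *\<^sub>R z)" "hpart F N z"] by (simp add: dist_norm)
      qed
      ultimately show "\<exists>P. eventually P (at_left 1) \<and> (\<forall>r r'. P r \<and> P r' \<longrightarrow> dist (F (r *\<^sub>R z)) (F (r' *\<^sub>R z)) < e)"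
        by blast
    qed
    then obtain L where L: "((\<lambda>r. F (r *\<^sub>R z)) \<longlongrightarrow> L) (at_left 1)" ..
    then show "((\<lambda>r. F (r *\<^sub>R z)) \<longlongrightarrow> radial_limit F z) (at_left 1)"
      unfolding radial_limit_def using tendsto_Lim[OF _ L] by simp
  qed
qed

lemma radial_limit_measurable: "radial_limit F \<in> borel_measurable mu"
  unfolding radial_limit_def[abs_def]
proof (rule Lim_at_left_measurable)
  show "(\<lambda>z. F (r *\<^sub>R z)) \<in> borel_measurable mu" if "0 < r" "r < 1" for r
    using dilate_measurable[OF hardy_holo[OF F], of r] that by simp
  fix z assume "z \<in> space mu"
  then have z: "z \<in> S0" by (simp add: space_mu)
  show "continuous_on {0<..<1} (\<lambda>r. F (r *\<^sub>R z))"
    by (rule continuous_on_compose2[OF holo_on_continuous_on[OF hardy_holo[OF F]]])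
      (use scaleR_closure[OF S0_closure[OF z]] in \<open>auto intro!: continuous_intros\<close>)
qed

text \<open>Fatou along the radii \<open>radius n\<close>, where \<open>truncated_dilate\<close>
  bounds the norms by the tail.\<close>

lemma hpart_approximation:
  shows "(\<lambda>z. radial_limit F z - hpart F N z) \<in> L2 mu"
    and "sqn mu (\<lambda>z. radial_limit F z - hpart F N z) \<le> tail_sq F N"
proof -
  define D where "D z = radial_limit F z - hpart F N z" for z
  define d where "d n z = F (radius n *\<^sub>R z) - hpart F N (radius n *\<^sub>R z)" for n z
  have Dm: "D \<in> borel_measurable mu"
    unfolding D_def using poly_fun_measurable_mu[OF hpart_poly] radial_limit_measurable by measurable
  have d: "d n \<in> L2 mu" "sqn mu (d n) \<le> tail_sq F N" for n
    unfolding d_def by (rule truncated_dilate[OF radius(3,2)])+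
  have "AE z in mu. (\<lambda>n. d n z) \<longlonglongrightarrow> D z"
    using radial_limit_AE
  proof eventually_elim
    case (elim z)
    show ?case unfolding d_def D_def
      by (intro tendsto_intros filterlim_compose[OF elim radius_at_left]
          filterlim_compose[OF radial_tendsto_continuous[OF poly_fun_isCont[OF hpart_poly]] radius_at_left])
  qed
  note L2_limit[OF d(1) Dm this always_eventually[OF allI[OF d(2)]]]
  then show "(\<lambda>z. radial_limit F z - hpart F N z) \<in> L2 mu" "sqn mu (\<lambda>z. radial_limit F z - hpart F N z) \<le> tail_sq F N"
    by (simp_all add: D_def[abs_def])
qed

lemma radial_limit_L2: "radial_limit F \<in> L2 mu"
  using L2_add[OF hpart_approximation(1) poly_fun_L2[OF hpart_poly], of 0 0] by simp

lemma hpart_tendsto: "(\<lambda>N. sqn mu (\<lambda>z. hpart F N z - radial_limit F z)) \<longlonglongrightarrow> 0"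
proof (rule tendsto_sandwich[OF _ _ tendsto_const tail_tendsto])
  show "\<forall>\<^sub>F N in sequentially. sqn mu (\<lambda>z. hpart F N z - radial_limit F z) \<le> tail_sq F N"
    using hpart_approximation(2) by (simp add: sqn_diff_commute[of mu "hpart F _"])
qed (simp add: sqn_nonneg)

lemma hcomp_L2: "hcomp F n \<in> L2 mu"
  by (intro poly_fun_L2 poly_fun_hcomp hardy_holo[OF F])

lemma hcomp_orthogonal: "u \<in> L2 mu \<Longrightarrow> circ_hom k u \<Longrightarrow> int n \<noteq> k \<Longrightarrow> L2_inner mu (hcomp F n) u = 0"
  by (rule circ_hom_orthogonal[OF hcomp_L2 _ hcomp_circ_hom[OF hardy_holo[OF F]]])

text \<open>The partial sums converge in L2 to the boundary function, and orthogonality of the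
  components evaluates their norms. So passage to the boundary is isometric.\<close>

lemma radial_limit_sqn: "sqn mu (radial_limit F) = (hardy_nrm mu F)\<^sup>2"
proof -
  have "(\<lambda>N. sqn mu (hpart F N)) \<longlonglongrightarrow> sqn mu (radial_limit F)"
    by (rule sqn_tendsto[OF poly_fun_L2[OF hpart_poly] radial_limit_L2 hpart_tendsto])
  moreover have "sqn mu (hpart F N) = (\<Sum>n<N. sqn mu (hcomp F n))" for N
    unfolding hpart_def[abs_def]
    by (intro sqn_sum_orthogonal hcomp_L2 hcomp_orthogonal[OF _ hcomp_circ_hom[OF hardy_holo[OF F]]]) auto
  ultimately show ?thesis using hardy_sums[OF F] LIMSEQ_unique by (simp add: sums_def)
qed

lemma radial_limit_pairing_sums:
  assumes u: "u \<in> L2 mu"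
  shows "(\<lambda>n. L2_inner mu (hcomp F n) u) sums L2_inner mu (radial_limit F) u"
proof -
  have "(\<lambda>N. L2_inner mu (hpart F N) u) \<longlonglongrightarrow> L2_inner mu (radial_limit F) u"
    unfolding L2_inner_def
    by (rule tendsto_integral_mult[OF poly_fun_L2[OF hpart_poly] radial_limit_L2 L2_cnj[OF u] hpart_tendsto])
  moreover have "L2_inner mu (hpart F N) u = (\<Sum>n<N. L2_inner mu (hcomp F n) u)" for N
    unfolding hpart_def[abs_def] by (intro L2_inner_sum_left hcomp_L2 u)
  ultimately show ?thesis by (simp add: sums_def)
qed

text \<open>All other components are orthogonal to a function of weight \<open>k\<close>. This is
  how single components of a boundary function are reached.\<close>

lemma radial_limit_pairing:
  assumes u: "u \<in> L2 mu" "circ_hom (int k) u"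
  shows "L2_inner mu (radial_limit F) u = L2_inner mu (hcomp F k) u"
proof (rule sums_unique2[OF radial_limit_pairing_sums[OF u(1)]])
  have "(\<lambda>n. if n = k then L2_inner mu (hcomp F k) u else 0) sums L2_inner mu (hcomp F k) u"
    by (rule sums_single)
  moreover have "(if n = k then L2_inner mu (hcomp F k) u else 0) = L2_inner mu (hcomp F n) u" for n
    using hcomp_orthogonal[OF u, of n] by auto
  ultimately show "(\<lambda>n. L2_inner mu (hcomp F n) u) sums L2_inner mu (hcomp F k) u" by simp
qed

end

end

section \<open>Hardy spaces on the quotient\<close>

text \<open>The normalisation divides by the norm of \<open>jac P\<close>. The final proof derives
  \<open>nrm_jac\<close> from \<open>psi_nonzero\<close> through
  \<open>qmeasure_degenerate\<close>.\<close>

locale hardy_quotient = quotient_domain G P \<Omega> + hardy_domain \<Omega> mu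
  for G :: "(complex^'n^'n) set" and P :: "'n \<Rightarrow> 'n cpoly" and \<Omega> :: "(complex^'n) set"
    and mu :: "(complex^'n) measure" +
  assumes nrm_jac: "hardy_nrm mu (jac P) \<noteq> 0"
begin

abbreviation "J \<equiv> jac P"
abbreviation "c \<equiv> hardy_nrm mu J"
abbreviation "q \<equiv> qmeasure \<Omega> P mu"
abbreviation "Sh \<equiv> shilov (th ` \<Omega>)"

lemma sqn_jac: "sqn mu J = c\<^sup>2"
proof -
  have "radial_limit J = J" by (rule ext) (rule poly_fun_hardy(2)[OF poly_fun_jac])
  then show ?thesis using radial_limit_sqn[OF poly_fun_hardy(1)[OF poly_fun_jac[of P]]] by simp
qed

lemma jac_measurable: "J \<in> borel_measurable mu"
  by (rule poly_fun_measurable_mu) simp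

lemma jac_L2: "J \<in> L2 mu"
  by (rule poly_fun_L2) simp

lemma space_q: "space q = Sh"
  by (simp add: qmeasure_def space_restrict_space)

lemma sets_q: "sets q = sets (restrict_space borel Sh)"
  by (simp add: qmeasure_def)

lemma measurable_q_iff: "f \<in> measurable q N \<longleftrightarrow> f \<in> measurable (restrict_space borel Sh) N"
  by (simp add: measurable_cong_sets[OF sets_q refl])

lemma th_measurable': "th \<in> measurable mu (restrict_space borel Sh)"
  by (rule measurable_restrict_space2) (auto simp: space_mu th_shilov continuous_measurable_mu[OF continuous_on_th])

lemma th_measurable: "th \<in> measurable mu q"
  using th_measurable' by (simp add: measurable_cong_sets[OF refl sets_q])

lemma pull_measurable: "f \<in> borel_measurable q \<Longrightarrow> pull P f \<in> borel_measurable mu"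
  unfolding pull_def by (intro borel_measurable_times jac_measurable measurable_compose[OF th_measurable])

lemma weight_measurable: "(\<lambda>z. (cmod (J z))\<^sup>2 / c\<^sup>2) \<in> borel_measurable mu"
  using jac_measurable by measurable

lemma th_measurable_density: "th \<in> measurable (density mu g) (restrict_space borel Sh)"
  using th_measurable' by (simp add: measurable_cong_sets[of "density mu g" mu])

lemma integral_q:
  fixes f :: "complex^'n \<Rightarrow> 'b::{banach,second_countable_topology}"
  assumes f: "f \<in> borel_measurable q"
  shows "(LINT y|q. f y) = (LINT z|mu. ((cmod (J z))\<^sup>2 / c\<^sup>2) *\<^sub>R f (th z))"
    and "integrable q f \<longleftrightarrow> integrable mu (\<lambda>z. ((cmod (J z))\<^sup>2 / c\<^sup>2) *\<^sub>R f (th z))"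
proof -
  have f': "f \<in> borel_measurable (restrict_space borel Sh)" using f by (simp add: measurable_q_iff)
  have fth: "(\<lambda>z. f (th z)) \<in> borel_measurable mu" by (rule measurable_compose[OF th_measurable f])
  show "(LINT y|q. f y) = (LINT z|mu. ((cmod (J z))\<^sup>2 / c\<^sup>2) *\<^sub>R f (th z))"
    unfolding qmeasure_def integral_distr[OF th_measurable_density f']
    by (rule integral_density[OF fth weight_measurable]) simp
  show "integrable q f \<longleftrightarrow> integrable mu (\<lambda>z. ((cmod (J z))\<^sup>2 / c\<^sup>2) *\<^sub>R f (th z))"
    unfolding qmeasure_def integrable_distr_eq[OF th_measurable_density f']
    by (rule integrable_density[OF fth weight_measurable]) simp
qed

lemma weight_mult: "((cmod (J z))\<^sup>2 / c\<^sup>2) *\<^sub>R (f (th z) * cnj (g (th z))) = pull P f z * cnj (pull P g z) / of_real (c\<^sup>2)"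
proof -
  have "((cmod (J z))\<^sup>2 / c\<^sup>2) *\<^sub>R (f (th z) * cnj (g (th z))) = of_real ((cmod (J z))\<^sup>2) * (f (th z) * cnj (g (th z))) / of_real (c\<^sup>2)"
    by (simp add: scaleR_conv_of_real)
  then show ?thesis unfolding complex_norm_square by (simp add: pull_def mult_ac)
qed

lemma weight_norm: "((cmod (J z))\<^sup>2 / c\<^sup>2) *\<^sub>R (cmod (f (th z)))\<^sup>2 = (cmod (pull P f z))\<^sup>2 / c\<^sup>2"
  by (simp add: pull_def norm_mult power_mult_distrib)

lemma L2_inner_q:
  assumes "f \<in> borel_measurable q" "g \<in> borel_measurable q"
  shows "L2_inner q f g = (LINT z|mu. pull P f z * cnj (pull P g z)) / of_real (c\<^sup>2)"
proof -
  have "(\<lambda>y. f y * cnj (g y)) \<in> borel_measurable q"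
    using assms by (intro borel_measurable_times borel_measurable_cnj)
  then show ?thesis unfolding L2_inner_def using integral_q(1)[of "\<lambda>y. f y * cnj (g y)"] by (simp add: weight_mult)
qed

lemma sqn_q: "f \<in> borel_measurable q \<Longrightarrow> sqn q f = sqn mu (pull P f) / c\<^sup>2"
  unfolding sqn_def using integral_q(1)[of "\<lambda>y. (cmod (f y))\<^sup>2"] by (simp only: weight_norm) simp

lemma L2_q_iff: "f \<in> L2 q \<longleftrightarrow> f \<in> borel_measurable q \<and> pull P f \<in> L2 mu"
proof (cases "f \<in> borel_measurable q")
  case True
  have "integrable q (\<lambda>y. (cmod (f y))\<^sup>2) \<longleftrightarrow> integrable mu (\<lambda>z. (cmod (pull P f z))\<^sup>2 / c\<^sup>2)"
    using integral_q(2)[of "\<lambda>y. (cmod (f y))\<^sup>2"] True by (simp only: weight_norm) simp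
  also have "\<dots> \<longleftrightarrow> integrable mu (\<lambda>z. (cmod (pull P f z))\<^sup>2)" using nrm_jac by (simp add: divide_inverse)
  finally show ?thesis using True pull_measurable by (simp add: L2_def)
qed (simp add: L2_def)

text \<open>The density of \<open>q\<close> vanishes with \<open>J\<close>, so nothing has to be
  checked at the zeros of the Jacobian, where radial limits upstairs say nothing about the
  quotient.\<close>

lemma AE_q_I:
  assumes "{y\<in>Sh. R y} \<in> sets q" "AE z in mu. J z \<noteq> 0 \<longrightarrow> R (th z)"
  shows "AE y in q. R y"
proof -
  have "AE z in density mu (\<lambda>z. ennreal ((cmod (J z))\<^sup>2 / c\<^sup>2)). R (th z)"
    using weight_measurable assms(2) nrm_jac by (subst AE_density) (auto elim: eventually_mono)
  then show ?thesis unfolding qmeasure_def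
    by (subst AE_distr_iff[OF th_measurable_density]) (use assms(1) in \<open>auto simp: space_restrict_space sets_q\<close>)
qed

lemma prob_space_q: "prob_space q"
proof -
  have "integrable mu (\<lambda>z. (cmod (J z))\<^sup>2 / c\<^sup>2)" using L2_integrable_sq[OF jac_L2] by simp
  moreover have "(LINT z|mu. (cmod (J z))\<^sup>2 / c\<^sup>2) = 1" using sqn_jac nrm_jac by (simp add: sqn_def)
  ultimately have "(\<integral>\<^sup>+z. ennreal ((cmod (J z))\<^sup>2 / c\<^sup>2) \<partial>mu) = 1"
    by (subst nn_integral_eq_integral) auto
  then have "prob_space (density mu (\<lambda>z. ennreal ((cmod (J z))\<^sup>2 / c\<^sup>2)))"
    using weight_measurable by (intro prob_spaceI) (simp add: emeasure_density)
  then show ?thesis unfolding qmeasure_def by (rule prob_space.prob_space_distr[OF _ th_measurable_density])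
qed

sublocale q: prob_space q by (rule prob_space_q)

lemma pull_add: "pull P (\<lambda>y. f y + a * g y) = (\<lambda>z. pull P f z + a * pull P g z)"
  by (auto simp: pull_def algebra_simps)

lemma Sh_closure: "y \<in> Sh \<Longrightarrow> \<exists>z\<in>closure \<Omega>. y = th z"
  using shilov_subset[of "th ` \<Omega>"] by (auto simp: closure_th)

lemma dil_Sh_dom: "y \<in> Sh \<Longrightarrow> 0 \<le> r \<Longrightarrow> r < 1 \<Longrightarrow> dil (of_real r) y \<in> th ` \<Omega>"
proof -
  assume y: "y \<in> Sh" and r: "0 \<le> r" "r < 1"
  obtain z where z: "z \<in> closure \<Omega>" "y = th z" using Sh_closure[OF y] by blast
  have "of_real r *s z \<in> \<Omega>" using r by (intro scale_closure[OF z(1)]) simp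
  then show ?thesis unfolding z(2) th_scale[symmetric] by blast
qed

lemma continuous_dil: "continuous_on X (\<lambda>r. dil (of_real r) y)" "continuous_on Y (dil a)"
  unfolding dil_def[abs_def] by (intro continuous_on_vec_lambda continuous_intros)+

lemma qradial_limit_alt: "qradial_limit P f y = Lim (at_left 1) (\<lambda>r. f (dil (of_real r) y))"
  by (simp add: qradial_limit_def dil_def wt_def)

lemma qradial_limit_measurable:
  assumes f: "holo_on f (th ` \<Omega>)"
  shows "qradial_limit P f \<in> borel_measurable q"
  unfolding qradial_limit_alt[abs_def]
proof (rule Lim_at_left_measurable)
  show "(\<lambda>y. f (dil (of_real r) y)) \<in> borel_measurable q" if "0 < r" "r < 1" for r
    unfolding measurable_q_iff
    by (intro borel_measurable_continuous_on_restrict continuous_on_compose2[OF holo_on_continuous_on[OF f]] continuous_dil)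
      (use dil_Sh_dom that in auto)
  show "continuous_on {0<..<1} (\<lambda>r. f (dil (of_real r) y))" if "y \<in> space q" for y
    by (intro continuous_on_compose2[OF holo_on_continuous_on[OF f]] continuous_dil)
      (use dil_Sh_dom that in \<open>auto simp: space_q\<close>)
qed

lemma poly_fun_th: "poly_fun R \<Longrightarrow> poly_fun (\<lambda>z. R (th z))"
  by (rule poly_fun_compose) (auto intro: poly_fun_poly_map)

lemma poly_fun_pull: "poly_fun R \<Longrightarrow> poly_fun (pull P R)"
  unfolding pull_def by (intro poly_fun_mult poly_fun_th) simp_all

abbreviation "qH \<equiv> qhardy_space \<Omega> P mu"
abbreviation "bv \<equiv> qradial_limit P"

lemma qH_holo: "f \<in> qH \<Longrightarrow> holo_on f (th ` \<Omega>)" and qH_pull: "f \<in> qH \<Longrightarrow> pull P f \<in> hardy_space \<Omega> mu"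
  by (simp_all add: qhardy_space_def)

lemma pull_dilate: "pull P f (r *\<^sub>R z) = of_real r ^ jdeg * J z * f (dil (of_real r) (th z))" if "r \<noteq> 0"
  using that jac_scale[of "of_real r" z] by (simp add: pull_def th_scale[symmetric] smult_of_real)

text \<open>By homogeneity \<open>pull P f\<close> at \<open>r z\<close> is
  \<open>r ^ jdeg * J z\<close> times \<open>f\<close> at the dilated point, so a radial limit
  upstairs yields one downstairs wherever \<open>J z \<noteq> 0\<close>. At zeros of
  \<open>J\<close> both sides of the second claim are 0.\<close>

lemma qradial_limit_tendsto:
  assumes f: "f \<in> qH"
  shows "AE z in mu. J z \<noteq> 0 \<longrightarrow> ((\<lambda>r. f (dil (of_real r) (th z))) \<longlongrightarrow> bv f (th z)) (at_left 1)"
    and "AE z in mu. radial_limit (pull P f) z = pull P (bv f) z"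
proof -
  have *: "AE z in mu. (J z \<noteq> 0 \<longrightarrow> ((\<lambda>r. f (dil (of_real r) (th z))) \<longlongrightarrow> bv f (th z)) (at_left 1))
      \<and> radial_limit (pull P f) z = pull P (bv f) z"
    using radial_limit_AE[OF qH_pull[OF f]]
  proof eventually_elim
    case (elim z)
    have ev: "\<forall>\<^sub>F r in at_left (1::real). 0 < r \<and> r < 1"
      using eventually_at_left_real[of 0 "1::real"] by (auto elim: eventually_mono)
    show ?case
    proof (cases "J z = 0")
      case True
      have "((\<lambda>r. pull P f (r *\<^sub>R z)) \<longlongrightarrow> 0) (at_left 1)"
        by (rule tendsto_eventually, rule eventually_mono[OF ev]) (simp add: pull_dilate True)
      then have "radial_limit (pull P f) z = 0"
        using tendsto_unique[OF _ elim] by simp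
      then show ?thesis using True by (simp add: pull_def)
    next
      case False
      have "((\<lambda>r. pull P f (r *\<^sub>R z) / (of_real r ^ jdeg * J z)) \<longlongrightarrow> radial_limit (pull P f) z / (of_real 1 ^ jdeg * J z)) (at_left 1)"
        using False by (intro tendsto_intros elim) auto
      then have "((\<lambda>r. pull P f (r *\<^sub>R z) / (of_real r ^ jdeg * J z)) \<longlongrightarrow> radial_limit (pull P f) z / J z) (at_left 1)" by simp
      then have "((\<lambda>r. f (dil (of_real r) (th z))) \<longlongrightarrow> radial_limit (pull P f) z / J z) (at_left 1)"
        by (rule Lim_transform_eventually) (rule eventually_mono[OF ev], simp add: pull_dilate False)
      moreover from this have "bv f (th z) = radial_limit (pull P f) z / J z"
        unfolding qradial_limit_alt by (intro tendsto_Lim) simp_all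
      ultimately show ?thesis using False by (simp add: pull_def)
    qed
  qed
  show "AE z in mu. J z \<noteq> 0 \<longrightarrow> ((\<lambda>r. f (dil (of_real r) (th z))) \<longlongrightarrow> bv f (th z)) (at_left 1)"
    using * by eventually_elim blast
  show "AE z in mu. radial_limit (pull P f) z = pull P (bv f) z"
    using * by eventually_elim blast
qed

lemma L2_cong_AE:
  assumes f: "f \<in> L2 M" and g: "g \<in> borel_measurable M" and eq: "AE x in M. f x = g x"
  shows "g \<in> L2 M"
proof -
  have "integrable M (\<lambda>x. (cmod (g x))\<^sup>2) \<longleftrightarrow> integrable M (\<lambda>x. (cmod (f x))\<^sup>2)"
    by (rule integrable_cong_AE) (use g L2_measurable[OF f] eq in \<open>auto elim: eventually_mono\<close>)
  then show ?thesis using g f by (simp add: L2_def)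
qed

lemma sqn_cong_AE:
  assumes "f \<in> borel_measurable M" "g \<in> borel_measurable M" "AE x in M. f x = g x"
  shows "sqn M f = sqn M g"
  unfolding sqn_def by (rule integral_cong_AE) (use assms in \<open>auto elim: eventually_mono\<close>)

lemma bv_L2:
  assumes f: "f \<in> qH"
  shows "bv f \<in> L2 q" and "sqn q (bv f) = (qhardy_nrm P mu f)\<^sup>2" and "bv f \<in> qhardy_boundary \<Omega> P mu"
proof -
  have m: "bv f \<in> borel_measurable q" by (rule qradial_limit_measurable[OF qH_holo[OF f]])
  have pL2: "pull P (bv f) \<in> L2 mu"
    by (rule L2_cong_AE[OF radial_limit_L2[OF qH_pull[OF f]] pull_measurable[OF m] qradial_limit_tendsto(2)[OF f]])
  then show L: "bv f \<in> L2 q" using m by (simp add: L2_q_iff)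
  have "sqn mu (pull P (bv f)) = sqn mu (radial_limit (pull P f))"
    by (rule sqn_cong_AE[symmetric, OF radial_limit_measurable[OF qH_pull[OF f]] pull_measurable[OF m] qradial_limit_tendsto(2)[OF f]])
  then show "sqn q (bv f) = (qhardy_nrm P mu f)\<^sup>2"
    by (simp add: sqn_q[OF m] radial_limit_sqn[OF qH_pull[OF f]] qhardy_nrm_def power_divide)
  have "AE z in mu. pull P (bv f) z = radial_limit (pull P f) z"
    using qradial_limit_tendsto(2)[OF f] by eventually_elim simp
  then show "bv f \<in> qhardy_boundary \<Omega> P mu"
    using L pL2 qH_pull[OF f] by (auto simp: qhardy_boundary_def hardy_boundary_def)
qed

lemma hardy_space_combine:
  assumes "F \<in> hardy_space \<Omega> mu" "H \<in> hardy_space \<Omega> mu"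
  shows "(\<lambda>z. F z + a * H z) \<in> hardy_space \<Omega> mu"
    and "AE z in mu. radial_limit (\<lambda>z. F z + a * H z) z = radial_limit F z + a * radial_limit H z"
proof -
  have hol: "holo_on (\<lambda>z. F z + a * H z) \<Omega>"
    by (intro holo_on_add holo_on_cmult hardy_holo assms)
  show "(\<lambda>z. F z + a * H z) \<in> hardy_space \<Omega> mu"
  proof (rule hardy_spaceI[OF hol])
    fix r :: real assume r: "0 < r" "r < 1"
    have "sqn mu (\<lambda>z. F (r *\<^sub>R z) + a * H (r *\<^sub>R z)) \<le> 2 * sqn mu (\<lambda>z. F (r *\<^sub>R z)) + 2 * sqn mu (\<lambda>z. a * H (r *\<^sub>R z))"
      using r by (intro sqn_add_le L2_scale dilate_L2 hardy_holo assms) auto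
    also have "\<dots> \<le> 2 * (hardy_nrm mu F)\<^sup>2 + 2 * ((cmod a)\<^sup>2 * (hardy_nrm mu H)\<^sup>2)"
      unfolding sqn_scale by (intro add_mono mult_left_mono hardy_dilate_le assms r) auto
    finally show "sqn mu (\<lambda>z. F (r *\<^sub>R z) + a * H (r *\<^sub>R z)) \<le> 2 * (hardy_nrm mu F)\<^sup>2 + 2 * ((cmod a)\<^sup>2 * (hardy_nrm mu H)\<^sup>2)" .
  qed
  show "AE z in mu. radial_limit (\<lambda>z. F z + a * H z) z = radial_limit F z + a * radial_limit H z"
    using radial_limit_AE[OF assms(1)] radial_limit_AE[OF assms(2)]
  proof eventually_elim
    case (elim z)
    have "((\<lambda>r. F (r *\<^sub>R z) + a * H (r *\<^sub>R z)) \<longlongrightarrow> radial_limit F z + a * radial_limit H z) (at_left 1)"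
      by (intro tendsto_intros elim)
    from tendsto_Lim[OF _ this] show ?case by (simp add: radial_limit_def)
  qed
qed

lemma qH_combine:
  assumes f: "f \<in> qH" and g: "g \<in> qH"
  shows "(\<lambda>y. f y + a * g y) \<in> qH" and "AE y in q. bv (\<lambda>y. f y + a * g y) y = bv f y + a * bv g y"
proof -
  have hol: "holo_on (\<lambda>y. f y + a * g y) (th ` \<Omega>)"
    by (intro holo_on_add holo_on_cmult qH_holo f g)
  show "(\<lambda>y. f y + a * g y) \<in> qH"
    using hol hardy_space_combine(1)[OF qH_pull[OF f] qH_pull[OF g]] by (simp add: qhardy_space_def pull_add)
  have meas: "(\<lambda>y. bv (\<lambda>y. f y + a * g y) y - (bv f y + a * bv g y)) \<in> borel_measurable q"
    using qradial_limit_measurable[OF hol] qradial_limit_measurable[OF qH_holo[OF f]] qradial_limit_measurable[OF qH_holo[OF g]]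
    by measurable
  show "AE y in q. bv (\<lambda>y. f y + a * g y) y = bv f y + a * bv g y"
  proof (rule AE_q_I)
    have "{y\<in>space q. bv (\<lambda>y. f y + a * g y) y - (bv f y + a * bv g y) = 0} \<in> sets q"
      using meas by measurable
    then show "{y\<in>Sh. bv (\<lambda>y. f y + a * g y) y = bv f y + a * bv g y} \<in> sets q" by (simp add: space_q)
    show "AE z in mu. J z \<noteq> 0 \<longrightarrow> bv (\<lambda>y. f y + a * g y) (th z) = bv f (th z) + a * bv g (th z)"
      using qradial_limit_tendsto(1)[OF f] qradial_limit_tendsto(1)[OF g]
    proof eventually_elim
      case (elim z)
      show ?case
      proof
        assume "J z \<noteq> 0"
        then have "((\<lambda>r. f (dil (of_real r) (th z)) + a * g (dil (of_real r) (th z))) \<longlongrightarrow> bv f (th z) + a * bv g (th z)) (at_left 1)"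
          using elim by (intro tendsto_intros) auto
        from tendsto_Lim[OF _ this] show "bv (\<lambda>y. f y + a * g y) (th z) = bv f (th z) + a * bv g (th z)"
          by (simp add: qradial_limit_alt[of "\<lambda>y. f y + a * g y"])
      qed
    qed
  qed
qed

lemma qH_poly: "poly_fun R \<Longrightarrow> R \<in> qH"
  using poly_fun_hardy(1)[OF poly_fun_pull] poly_fun_holo_on by (simp add: qhardy_space_def)

lemma dil_one: "dil 1 y = y"
  by (simp add: dil_def)

lemma bv_poly:
  assumes R: "poly_fun R"
  shows "bv R y = R y"
proof -
  have "isCont (\<lambda>r. dil (of_real r) y) (1::real)"
    using continuous_dil(1)[of UNIV y] by (simp add: continuous_on_eq_continuous_at)
  from isCont_o2[OF this poly_fun_isCont[OF R]]
  have "((\<lambda>r. R (dil (of_real r) y)) \<longlongrightarrow> R (dil (of_real 1) y)) (at_left 1)"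
    unfolding isCont_def by (rule filterlim_mono[OF _ order_refl at_le]) simp
  then show ?thesis unfolding qradial_limit_alt by (intro tendsto_Lim) (simp_all add: dil_one)
qed

lemma qH_one: "(\<lambda>_. 1) \<in> qH" by (rule qH_poly) simp

text \<open>The polarisation sum is evaluated with \<open>sqn_add_scale\<close>, using that
  \<open>bv\<close> preserves norms and is additive almost everywhere.\<close>

lemma qhardy_inner_bv:
  assumes f: "f \<in> qH" and g: "g \<in> qH"
  shows "qhardy_inner P mu f g = L2_inner q (bv f) (bv g)"
proof -
  note Lf = bv_L2(1)[OF f] and Lg = bv_L2(1)[OF g]
  define A where "A = L2_inner q (bv f) (bv g)"
  have n: "(qhardy_nrm P mu (\<lambda>x. f x + a * g x))\<^sup>2 = sqn q (bv f) + 2 * Re (cnj a * A) + (cmod a)\<^sup>2 * sqn q (bv g)" for a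
    using sqn_cong_AE[OF L2_measurable[OF bv_L2(1)[OF qH_combine(1)[OF f g]]] L2_measurable[OF L2_add[OF Lf L2_scale[OF Lg]]] qH_combine(2)[OF f g]]
    by (simp only: A_def bv_L2(2)[OF qH_combine(1)[OF f g], symmetric] sqn_add_scale[OF Lf Lg])
  have "(\<Sum>k<4. \<i> ^ k * of_real ((qhardy_nrm P mu (\<lambda>x. f x + \<i> ^ k * g x))\<^sup>2)) = 4 * A"
    unfolding n by (simp add: numeral_eq_Suc complex_eq_iff algebra_simps)
  then show ?thesis by (simp add: qhardy_inner_def A_def)
qed

end

section \<open>Skew components and weighted homogeneous polynomials\<close>

context reflection_invariants
begin

text \<open>The quotient \<open>T\<close> by the Jacobian is invariant and homogeneous of degree
  \<open>k - jdeg\<close>. For negative degree it must vanish, as letting the scaling factor tend to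
  0 shows; otherwise it descends to the quotient.\<close>

lemma skew_homogeneous:
  assumes f: "poly_fun f" "skew f" and hom: "\<And>c z. f (c *s z) = c ^ k * f z"
  shows "k < jdeg \<Longrightarrow> f z = 0"
    and "jdeg \<le> k \<Longrightarrow> \<exists>Q. poly_fun Q \<and> (\<forall>z. f z = jac P z * Q (th z)) \<and> (\<forall>c y. Q (dil c y) = c ^ (k - jdeg) * Q y)"
proof -
  have "\<exists>T. poly_fun T \<and> (\<forall>z. f z = jac P z * T z)"
    by (rule skew_divisible[OF f], intro exI conjI allI)
  then obtain T where T: "poly_fun T" "\<And>z. f z = jac P z * T z" by blast
  obtain z0 where z0: "jac P z0 \<noteq> 0" using jac_nontrivial by blast
  have inv: "T (A *v z) = T z" if A: "A \<in> G" for A z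
  proof (rule poly_fun_cancel[OF poly_fun_compose_matrix[OF T(1)] T(1) poly_fun_jac z0])
    fix z assume "jac P z \<noteq> 0"
    moreover have "f (A *v z) * det A = f z" using f(2) A by (simp add: skew_def)
    moreover have "f (A *v z) * det A = (jac P (A *v z) * det A) * T (A *v z)" by (simp add: T(2))
    ultimately have "jac P z * T (A *v z) = jac P z * T z" unfolding jac_skew[OF A] by (simp add: T(2))
    with \<open>jac P z \<noteq> 0\<close> show "T (A *v z) = T z" by simp
  qed
  have sc: "c ^ jdeg * T (c *s z) = c ^ k * T z" if c: "c \<noteq> 0" for c z
  proof (rule poly_fun_cancel[OF _ _ poly_fun_jac z0])
    show "poly_fun (\<lambda>z. c ^ jdeg * T (c *s z))" "poly_fun (\<lambda>z. c ^ k * T z)"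
      using T(1) by (auto intro!: poly_fun_mult poly_fun_compose[OF T(1)])
    fix z assume "jac P z \<noteq> 0"
    then show "c ^ jdeg * T (c *s z) = c ^ k * T z"
      using hom[of c z] jac_scale[OF c, of z] by (simp add: T(2) mult_ac)
  qed
  \<comment> \<open>\<open>jac_scale\<close> excludes the scaling factor 0, which is reached by
    continuity along \<open>\<epsilon> n\<close>.\<close>
  define \<epsilon> where "\<epsilon> n = (1 / of_nat (Suc n) :: complex)" for n
  have \<epsilon>: "\<epsilon> n \<noteq> 0" "\<epsilon> \<longlonglongrightarrow> 0" for n
    unfolding \<epsilon>_def using LIMSEQ_Suc[OF lim_1_over_n[where 'a = complex]] by (auto simp del: of_nat_Suc)
  have T0: "(\<lambda>n. T (\<epsilon> n *s z)) \<longlonglongrightarrow> T 0" for z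
  proof -
    have "(\<lambda>n. \<epsilon> n *s z) \<longlonglongrightarrow> 0 *s z"
      unfolding vector_scalar_mult_def by (intro tendsto_vec_lambda tendsto_intros \<epsilon>(2))
    then have "(\<lambda>n. \<epsilon> n *s z) \<longlonglongrightarrow> 0" by simp
    then show ?thesis using poly_fun_continuous_on[OF T(1), of UNIV] continuous_on_tendsto_compose[of UNIV T] by fastforce
  qed
  {
    assume k: "k < jdeg"
    have "T z = 0"
    proof -
      have eq: "T z = \<epsilon> n ^ (jdeg - k) * T (\<epsilon> n *s z)" for n
      proof -
        have "\<epsilon> n ^ k * T z = \<epsilon> n ^ k * (\<epsilon> n ^ (jdeg - k) * T (\<epsilon> n *s z))"
          using sc[OF \<epsilon>(1), of n z] k by (simp add: mult.assoc[symmetric] power_add[symmetric])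
        then show ?thesis using \<epsilon>(1) by simp
      qed
      have "(\<lambda>n. \<epsilon> n ^ (jdeg - k) * T (\<epsilon> n *s z)) \<longlonglongrightarrow> 0 ^ (jdeg - k) * T 0"
        by (intro tendsto_intros \<epsilon>(2) T0)
      then have "(\<lambda>n. T z) \<longlonglongrightarrow> 0" unfolding eq[symmetric] using k by (simp add: zero_power)
      then show ?thesis by (simp add: LIMSEQ_const_iff)
    qed
    then show "f z = 0" by (simp add: T(2))
  }
  assume k: "jdeg \<le> k"
  have sc2: "T (c *s z) = c ^ (k - jdeg) * T z" if "c \<noteq> 0" for c z
  proof -
    have "c ^ jdeg * T (c *s z) = c ^ jdeg * (c ^ (k - jdeg) * T z)"
      using sc[OF that, of z] k by (simp add: mult.assoc[symmetric] power_add[symmetric])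
    then show ?thesis using that by simp
  qed
  have sc0: "T (c *s z) = c ^ (k - jdeg) * T z" for c z
  proof (cases "c = 0")
    case True
    have "(\<lambda>n. \<epsilon> n ^ (k - jdeg) * T z) \<longlonglongrightarrow> 0 ^ (k - jdeg) * T z" by (intro tendsto_intros \<epsilon>(2))
    then have "(\<lambda>n. T (\<epsilon> n *s z)) \<longlonglongrightarrow> 0 ^ (k - jdeg) * T z" unfolding sc2[OF \<epsilon>(1)] .
    then have "T 0 = 0 ^ (k - jdeg) * T z" using T0[of z] LIMSEQ_unique by blast
    then show ?thesis using True by simp
  qed (rule sc2)
  have "\<exists>Q. \<forall>z. T z = cpoly_eval Q (th z)"
    by (rule invariant_poly_fun[where f = T, OF T(1) inv], assumption, intro exI allI)
  then obtain Q where Q: "\<And>z. T z = cpoly_eval Q (th z)" by blast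
  have "cpoly_eval Q (dil c y) = c ^ (k - jdeg) * cpoly_eval Q y" for c y
  proof -
    obtain z where "y = th z" using surj_th by (metis UNIV_I imageE)
    then show ?thesis using sc0[of c z] by (simp add: th_scale[symmetric] Q[symmetric])
  qed
  then show "\<exists>Q. poly_fun Q \<and> (\<forall>z. f z = jac P z * Q (th z)) \<and> (\<forall>c y. Q (dil c y) = c ^ (k - jdeg) * Q y)"
    by (intro exI[of _ "cpoly_eval Q"]) (simp add: T(2) Q)
qed

end

context hardy_domain
begin

lemma L2_inner_lin_aut:
  assumes "f \<in> borel_measurable mu" "g \<in> borel_measurable mu" "lin_aut A B"
  shows "L2_inner mu (\<lambda>z. f (A *v z)) (\<lambda>z. g (A *v z)) = L2_inner mu f g"
  unfolding L2_inner_def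
  using integral_distr[OF lin_aut_measurable[OF assms(3)] borel_measurable_times[OF assms(1) borel_measurable_cnj[OF assms(2)]]]
  by (simp add: distr_lin_aut[OF assms(3)])

end

context hardy_quotient
begin

lemma pull_skew: "A \<in> G \<Longrightarrow> pull P h (A *v z) * det A = pull P h z"
  using jac_skew[of A z] by (simp add: pull_def th_invariant mult_ac)

abbreviation "qhb \<equiv> qhardy_boundary \<Omega> P mu"

lemma qhb_L2: "h \<in> qhb \<Longrightarrow> h \<in> L2 q"
  by (simp add: qhardy_boundary_def)

definition hom_poly :: "nat \<Rightarrow> (complex^'n \<Rightarrow> complex) \<Rightarrow> bool" where
  "hom_poly n Q \<longleftrightarrow> poly_fun Q \<and> (\<forall>t y. Q (dil t y) = t ^ n * Q y)"

context
  fixes h F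
  assumes h: "h \<in> qhb" and F: "F \<in> hardy_space \<Omega> mu" and hF: "AE z in mu. pull P h z = radial_limit F z"
begin

lemma pull_h_L2: "pull P h \<in> L2 mu"
  using qhb_L2[OF h] L2_q_iff by blast

lemma pull_radial_limit: "u \<in> L2 mu \<Longrightarrow> L2_inner mu (pull P h) u = L2_inner mu (radial_limit F) u"
  by (rule L2_inner_cong_AE) (use hF radial_limit_measurable[OF F] L2_measurable[OF pull_h_L2] L2_measurable in auto)

lemma pull_pairing: "u \<in> L2 mu \<Longrightarrow> circ_hom (int k) u \<Longrightarrow> L2_inner mu (pull P h) u = L2_inner mu (hcomp F k) u"
  by (simp add: pull_radial_limit radial_limit_pairing[OF F])

text \<open>The projection of a component onto the skew polynomials. Skewness is given for
  \<open>pull P h\<close> on the boundary and has to be transferred to the components of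
  \<open>F\<close>.\<close>

definition skewed :: "nat \<Rightarrow> complex^'n \<Rightarrow> complex" where
  "skewed k z = (\<Sum>A\<in>G. det A * hcomp F k (A *v z)) / of_nat (card G)"

lemma card_G: "of_nat (card G) \<noteq> (0::complex)"
  using G_finite G_one by (auto simp: card_eq_0_iff)

lemma skewed_poly: "poly_fun (skewed k)"
proof -
  have "poly_fun (\<lambda>z. hcomp F k (A *v z))" for A
    by (rule poly_fun_compose_matrix[OF poly_fun_hcomp[OF hardy_holo[OF F]]])
  then have "poly_fun (\<lambda>z. \<Sum>A\<in>G. det A * hcomp F k (A *v z))"
    by (intro poly_fun_sum poly_fun_mult) simp_all
  then show ?thesis unfolding skewed_def[abs_def] by (rule poly_fun_divide)
qed

lemma skewed_skew: "skew (skewed k)"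
  unfolding skew_def
proof (intro ballI allI)
  fix B z assume B: "B \<in> G"
  have "(\<Sum>A\<in>G. det A * hcomp F k (A *v (B *v z))) * det B = (\<Sum>A\<in>G. det (A ** B) * hcomp F k ((A ** B) *v z))"
    unfolding sum_distrib_right by (rule sum.cong) (simp_all add: matrix_vector_mul_assoc det_mul mult_ac)
  also have "\<dots> = (\<Sum>A\<in>G. det A * hcomp F k (A *v z))"
    by (rule sum_G[OF B, of "\<lambda>A. det A * hcomp F k (A *v z)"])
  finally show "skewed k (B *v z) * det B = skewed k z" by (simp add: skewed_def)
qed

lemma skewed_scale: "skewed k (a *s z) = a ^ k * skewed k z"
  by (simp add: skewed_def matrix_smult hcomp_scale[OF hardy_holo[OF F]] sum_distrib_left mult_ac)

text \<open>Pairing with the difference \<open>u\<close> extracts degree \<open>k\<close> from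
  \<open>pull P h\<close>, which is skew, and \<open>mu\<close> is invariant under \<open>G\<close>.
  Hence \<open>hcomp F k\<close> and its skew projection have the same pairing with
  \<open>u\<close>, so \<open>u\<close> has norm 0.\<close>

lemma hcomp_skewed: "AE z in mu. hcomp F k z = skewed k z"
proof -
  define u where "u z = hcomp F k z - skewed k z" for z
  have uP: "poly_fun u" unfolding u_def
    by (intro poly_fun_diff skewed_poly poly_fun_hcomp hardy_holo[OF F])
  have uL: "u \<in> L2 mu" by (rule poly_fun_L2[OF uP])
  have us: "u (a *s z) = a ^ k * u z" for a z
    by (simp add: u_def skewed_scale hcomp_scale[OF hardy_holo[OF F]] right_diff_distrib)
  have uh: "circ_hom (int k) (\<lambda>z. u (B *v z))" for B
    by (simp add: circ_hom_def matrix_smult us Complex.DeMoivre)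
  have Fk: "poly_fun (hcomp F k)" by (rule poly_fun_hcomp[OF hardy_holo[OF F]])
  have part: "det A * L2_inner mu (\<lambda>z. hcomp F k (A *v z)) u = L2_inner mu (pull P h) u" if A: "A \<in> G" for A
  proof -
    obtain B where B: "lin_aut A B" using lin_aut_G[OF A] by blast
    have uB: "(\<lambda>z. u (B *v z)) \<in> L2 mu" by (intro poly_fun_L2 poly_fun_compose_matrix uP)
    have "L2_inner mu (\<lambda>z. f (A *v z)) u = L2_inner mu f (\<lambda>z. u (B *v z))" if "f \<in> L2 mu" for f
      using L2_inner_lin_aut[OF L2_measurable[OF that] L2_measurable[OF uB] B] by (simp add: lin_aut_inverse[OF B])
    from this[OF poly_fun_L2[OF Fk]] this[OF pull_h_L2] pull_pairing[OF uB uh]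
    have "det A * L2_inner mu (\<lambda>z. hcomp F k (A *v z)) u = L2_inner mu (\<lambda>z. det A * pull P h (A *v z)) u"
      by (simp add: L2_inner_scale_left)
    then show ?thesis by (simp add: mult.commute[of "det A"] pull_skew[OF A])
  qed
  have "L2_inner mu (skewed k) u = (1 / of_nat (card G)) * (\<Sum>A\<in>G. L2_inner mu (\<lambda>z. det A * hcomp F k (A *v z)) u)"
    using L2_inner_scale_left[of mu "1 / of_nat (card G)" "\<lambda>z. \<Sum>A\<in>G. det A * hcomp F k (A *v z)" u]
      L2_inner_sum_left[of G "\<lambda>A z. det A * hcomp F k (A *v z)", OF L2_scale[OF poly_fun_L2[OF poly_fun_compose_matrix[OF Fk]]] uL]
    by (simp add: skewed_def[abs_def])
  also have "\<dots> = L2_inner mu (hcomp F k) u"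
    using pull_pairing[OF uL, of k] uh[of "mat 1"] card_G by (simp add: L2_inner_scale_left part)
  finally have eq: "L2_inner mu (hcomp F k) u = L2_inner mu (skewed k) u" ..
  have "L2_inner mu u u = L2_inner mu (\<lambda>z. hcomp F k z + (- 1) * skewed k z) u" by (simp add: u_def[abs_def])
  also have "\<dots> = L2_inner mu (hcomp F k) u + L2_inner mu (\<lambda>z. (- 1) * skewed k z) u"
    by (rule L2_inner_add_left) (intro L2_scale poly_fun_L2 Fk skewed_poly uL)+
  also have "\<dots> = 0" unfolding L2_inner_scale_left by (simp add: eq)
  finally have "sqn mu u = 0" using L2_inner_self[OF uL] by simp
  from sqn_eq_0_AE[OF uL this] show ?thesis by eventually_elim (simp add: u_def)
qed

lemma hcomp_low: "k < jdeg \<Longrightarrow> AE z in mu. hcomp F k z = 0"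
  using hcomp_skewed[of k] by eventually_elim (simp add: skew_homogeneous(1)[OF skewed_poly skewed_skew skewed_scale])

lemma hcomp_high: "\<exists>Q. hom_poly n Q \<and> (AE z in mu. hcomp F (jdeg + n) z = pull P Q z)"
proof -
  obtain Q where Q: "poly_fun Q" "\<forall>z. skewed (jdeg + n) z = J z * Q (th z)" "\<forall>a y. Q (dil a y) = a ^ n * Q y"
    using skew_homogeneous(2)[OF skewed_poly skewed_skew skewed_scale, of "jdeg + n"] by auto
  have "AE z in mu. hcomp F (jdeg + n) z = pull P Q z"
    using hcomp_skewed[of "jdeg + n"] by eventually_elim (simp add: pull_def Q(2))
  then show ?thesis using Q by (auto simp: hom_poly_def)
qed

end

lemma poly_qhb: "poly_fun R \<Longrightarrow> R \<in> qhb"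
  using bv_L2(3)[OF qH_poly, of R] bv_poly[of R] by (metis ext)

lemma poly_L2_q: "poly_fun R \<Longrightarrow> R \<in> L2 q"
  by (rule qhb_L2[OF poly_qhb])

lemma hom_poly_L2: "hom_poly n Q \<Longrightarrow> Q \<in> L2 q"
  by (simp add: hom_poly_def poly_L2_q)

lemma L2_inner_q_pull:
  assumes "f \<in> L2 q" "g \<in> L2 q"
  shows "L2_inner q f g = L2_inner mu (pull P f) (pull P g) / of_real (c\<^sup>2)"
  using L2_inner_q[OF L2_measurable[OF assms(1)] L2_measurable[OF assms(2)]] by (simp add: L2_inner_def)

lemma hom_poly_orthogonal:
  assumes "hom_poly m f" "hom_poly n g" "m \<noteq> n"
  shows "L2_inner q f g = 0"
proof -
  have "pull P f (t *s z) = t ^ (jdeg + k) * pull P f z" if "hom_poly k f" "t \<noteq> 0" for f k t z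
    using that by (simp add: pull_def hom_poly_def th_scale jac_scale power_add mult_ac)
  then have "circ_hom (int (jdeg + k)) (pull P f)" if "hom_poly k f" for f k
    using that by (simp add: circ_hom_def Complex.DeMoivre)
  then have "L2_inner mu (pull P f) (pull P g) = 0"
    using assms L2_q_iff hom_poly_L2 by (intro circ_hom_orthogonal[of _ _ "int (jdeg + m)" "int (jdeg + n)"]) auto
  then show ?thesis by (simp add: L2_inner_q_pull[OF hom_poly_L2[OF assms(1)] hom_poly_L2[OF assms(2)]])
qed

lemma qhb_pull:
  assumes "h \<in> qhb"
  shows "\<exists>F. F \<in> hardy_space \<Omega> mu \<and> (AE z in mu. pull P h z = radial_limit F z)"
  using assms by (auto simp: qhardy_boundary_def hardy_boundary_def)

text \<open>Components of degree below \<open>jdeg\<close> vanish, those of degree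
  \<open>jdeg + n\<close> are pulled back from weighted degree \<open>n\<close>. Convergence of the
  pairings with L2 functions is all that the orthogonality arguments below call for.\<close>

theorem boundary_expansion:
  assumes h: "h \<in> qhb"
  shows "\<exists>Q. (\<forall>n. hom_poly n (Q n)) \<and> (\<forall>v\<in>L2 q. (\<lambda>n. L2_inner q (Q n) v) sums L2_inner q h v)"
proof -
  obtain F where F: "F \<in> hardy_space \<Omega> mu" "AE z in mu. pull P h z = radial_limit F z" using qhb_pull[OF h] by blast
  have "\<forall>n. \<exists>Q. hom_poly n Q \<and> (AE z in mu. hcomp F (jdeg + n) z = pull P Q z)"
    using hcomp_high[OF h F] by blast
  then obtain Q where Q: "\<forall>n. hom_poly n (Q n) \<and> (AE z in mu. hcomp F (jdeg + n) z = pull P (Q n) z)" unfolding choice_iff by blast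
  have "(\<lambda>n. L2_inner q (Q n) v) sums L2_inner q h v" if v: "v \<in> L2 q" for v
  proof -
    have pv: "pull P v \<in> L2 mu" using v L2_q_iff by blast
    have Fm: "hcomp F k \<in> borel_measurable mu" for k by (rule L2_measurable[OF hcomp_L2[OF F(1)]])
    have low: "(\<Sum>k<jdeg. L2_inner mu (hcomp F k) (pull P v)) = 0"
      by (intro sum.neutral ballI L2_inner_zero_AE hcomp_low[OF h F] Fm L2_measurable[OF pv]) simp
    have "L2_inner mu (hcomp F (n + jdeg)) (pull P v) = L2_inner mu (pull P (Q n)) (pull P v)" for n
      by (rule L2_inner_cong_AE)
        (use Q Fm L2_measurable[OF pv] poly_fun_measurable_mu[OF poly_fun_pull] in \<open>auto simp: hom_poly_def add.commute\<close>)
    with sums_split_initial_segment[OF radial_limit_pairing_sums[OF F(1) pv], of jdeg]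
    have "(\<lambda>n. L2_inner mu (pull P (Q n)) (pull P v)) sums L2_inner mu (pull P h) (pull P v)"
      by (simp add: low pull_radial_limit[OF h F pv])
    then have "(\<lambda>n. L2_inner mu (pull P (Q n)) (pull P v) / of_real (c\<^sup>2)) sums (L2_inner mu (pull P h) (pull P v) / of_real (c\<^sup>2))"
      by (rule sums_divide)
    moreover have "L2_inner q (Q n) v = L2_inner mu (pull P (Q n)) (pull P v) / of_real (c\<^sup>2)" for n
      using Q by (intro L2_inner_q_pull hom_poly_L2[of n] v) blast
    ultimately show ?thesis by (simp add: L2_inner_q_pull[OF qhb_L2[OF h] v])
  qed
  then show ?thesis using Q by blast
qed

section \<open>Multiplication by bounded holomorphic functions\<close>

lemma hcomp_mult:
  assumes "holo_on F \<Omega>" "holo_on H \<Omega>"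
  shows "hcomp (\<lambda>z. F z * H z) n z = (\<Sum>i\<le>n. hcomp F i z * hcomp H (n - i) z)"
proof -
  have S: "open {w. w *s z \<in> \<Omega>}"
    unfolding vector_scalar_mult_def
    by (intro open_vimage[OF open_dom, unfolded vimage_def] continuous_intros continuous_on_vec_lambda)
  have hol: "(\<lambda>w. F (w *s z)) holomorphic_on {w. w *s z \<in> \<Omega>}" "(\<lambda>w. H (w *s z)) holomorphic_on {w. w *s z \<in> \<Omega>}"
    using holo_on_line[OF assms(1) open_dom S, of 0 z] holo_on_line[OF assms(2) open_dom S, of 0 z] by auto
  have "hcomp (\<lambda>z. F z * H z) n z = (\<Sum>i = 0..n. of_nat (n choose i) * (deriv ^^ i) (\<lambda>w. F (w *s z)) 0 * (deriv ^^ (n - i)) (\<lambda>w. H (w *s z)) 0) / fact n"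
    unfolding hcomp_def by (subst higher_deriv_mult[OF hol S]) (simp_all add: zero_dom)
  also have "\<dots> = (\<Sum>i\<le>n. hcomp F i z * hcomp H (n - i) z)"
    unfolding sum_divide_distrib atMost_atLeast0
    by (rule sum.cong) (auto simp: hcomp_def binomial_fact field_simps)
  finally show ?thesis .
qed

lemma hcomp_0: "hcomp F 0 z = F 0"
  by (simp add: hcomp_def)

lemma pull_one: "pull P (\<lambda>_. 1) = J"
  by (simp add: pull_def)

text \<open>Integration against \<open>q\<close> is pairing with \<open>J\<close> upstairs and
  extracts degree \<open>jdeg\<close>, below which \<open>F\<close> has no components. In that
  degree the product retains only the constant term of \<open>\<phi>\<close>.\<close>

theorem bounded_mult_integral:
  assumes \<phi>: "holo_on \<phi> (th ` \<Omega>)" "\<And>y. y \<in> th ` \<Omega> \<Longrightarrow> cmod (\<phi> y) \<le> B" and qH: "\<phi> \<in> qH" and h: "h \<in> qhb"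
  shows "(LINT y|q. bv \<phi> y * h y) = \<phi> 0 * (LINT y|q. h y)"
proof -
  obtain F where F: "F \<in> hardy_space \<Omega> mu" "AE z in mu. pull P h z = radial_limit F z" using qhb_pull[OF h] by blast
  define K where "K z = \<phi> (th z) * F z" for z
  have \<phi>th: "holo_on (\<lambda>z. \<phi> (th z)) \<Omega>" by (rule holo_on_compose_poly[OF \<phi>(1)]) (rule poly_fun_poly_map)
  have Khol: "holo_on K \<Omega>" unfolding K_def by (intro holo_on_mult \<phi>th hardy_holo[OF F(1)])
  have B: "0 \<le> B" using order_trans[OF norm_ge_zero \<phi>(2)] zero_dom by blast
  have Kle: "cmod (K z) \<le> cmod (of_real B * F z)" if "z \<in> \<Omega>" for z
    unfolding K_def norm_mult using mult_right_mono[OF \<phi>(2), of "th z" "cmod (F z)"] that B by simp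
  have KH: "K \<in> hardy_space \<Omega> mu"
  proof (rule hardy_spaceI[OF Khol])
    fix r :: real assume r: "0 < r" "r < 1"
    have "sqn mu (\<lambda>z. K (r *\<^sub>R z)) \<le> sqn mu (\<lambda>z. of_real B * F (r *\<^sub>R z))"
      unfolding sqn_def using r
      by (intro integral_mono L2_integrable_sq L2_scale dilate_L2 Khol hardy_holo[OF F(1)] power_mono Kle)
        (auto simp: space_mu intro!: scaleR_closure S0_closure)
    also have "\<dots> \<le> (cmod (of_real B))\<^sup>2 * (hardy_nrm mu F)\<^sup>2"
      unfolding sqn_scale by (intro mult_left_mono hardy_dilate_le[OF F(1) r]) simp
    finally show "sqn mu (\<lambda>z. K (r *\<^sub>R z)) \<le> (cmod (of_real B))\<^sup>2 * (hardy_nrm mu F)\<^sup>2" .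
  qed
  have bm: "bv \<phi> \<in> borel_measurable q" by (rule qradial_limit_measurable[OF \<phi>(1)])
  have hm: "h \<in> borel_measurable q" by (rule L2_measurable[OF qhb_L2[OF h]])
  have lim: "AE z in mu. radial_limit K z = pull P (\<lambda>y. bv \<phi> y * h y) z"
    using radial_limit_AE[OF F(1)] F(2) qradial_limit_tendsto(1)[OF qH]
  proof (rule AE_mp[OF AE_conjI[OF AE_conjI] AE_I2], intro impI, elim conjE)
    fix z assume z: "z \<in> space mu" and Fz: "((\<lambda>r. F (r *\<^sub>R z)) \<longlongrightarrow> radial_limit F z) (at_left 1)"
      and hz: "pull P h z = radial_limit F z"
      and pz: "J z \<noteq> 0 \<longrightarrow> ((\<lambda>r. \<phi> (dil (of_real r) (th z))) \<longlongrightarrow> bv \<phi> (th z)) (at_left 1)"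
    have thr: "th (r *\<^sub>R z) = dil (of_real r) (th z)" for r by (simp add: th_scale[symmetric] smult_of_real)
    have "((\<lambda>r. K (r *\<^sub>R z)) \<longlongrightarrow> pull P (\<lambda>y. bv \<phi> y * h y) z) (at_left 1)"
    proof (cases "J z = 0")
      \<comment> \<open>Here no limit of \<open>\<phi>\<close> is available, but \<open>F\<close>
        tends to 0 and \<open>\<phi>\<close> is bounded.\<close>
      case True
      then have "radial_limit F z = 0" using hz by (simp add: pull_def)
      then have F0: "((\<lambda>r. cmod (of_real B * F (r *\<^sub>R z))) \<longlongrightarrow> 0) (at_left 1)"
        using tendsto_norm_zero[OF tendsto_mult_right_zero[of "\<lambda>r. F (r *\<^sub>R z)" _ "of_real B"]] Fz by simp
      have "((\<lambda>r. K (r *\<^sub>R z)) \<longlongrightarrow> 0) (at_left 1)"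
      proof (rule Lim_null_comparison[OF _ F0])
        show "\<forall>\<^sub>F r in at_left 1. norm (K (r *\<^sub>R z)) \<le> cmod (of_real B * F (r *\<^sub>R z))"
          using eventually_at_left_real[of 0 "1::real"] z
          by (auto simp: space_mu elim!: eventually_mono intro!: Kle scaleR_closure S0_closure)
      qed
      then show ?thesis using True by (simp add: pull_def)
    next
      case False
      then have "((\<lambda>r. \<phi> (dil (of_real r) (th z))) \<longlongrightarrow> bv \<phi> (th z)) (at_left 1)" using pz by blast
      from tendsto_mult[OF this Fz] show ?thesis by (simp add: K_def thr hz[symmetric] pull_def mult_ac)
    qed
    then show "radial_limit K z = pull P (\<lambda>y. bv \<phi> y * h y) z"
      unfolding radial_limit_def by (intro tendsto_Lim) simp_all
  qed
  have Jhom: "circ_hom (int jdeg) J"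
    by (simp add: circ_hom_def jac_scale Complex.DeMoivre)
  have one: "(\<lambda>_. 1) \<in> borel_measurable q" by simp
  have val: "(LINT y|q. f y) = L2_inner mu (pull P f) J / of_real (c\<^sup>2)" if "f \<in> borel_measurable q" for f
    using L2_inner_q[OF that one] by (simp only: L2_inner_def pull_one complex_cnj_one mult_1_right)
  have "L2_inner mu (pull P (\<lambda>y. bv \<phi> y * h y)) J = L2_inner mu (radial_limit K) J"
    by (rule L2_inner_cong_AE)
      (use lim in \<open>auto intro!: pull_measurable jac_measurable borel_measurable_times bm hm radial_limit_measurable[OF KH]\<close>)
  then have lhs: "(LINT y|q. bv \<phi> y * h y) = L2_inner mu (hcomp K jdeg) J / of_real (c\<^sup>2)"
    by (simp only: val[OF borel_measurable_times[OF bm hm]] radial_limit_pairing[OF KH jac_L2 Jhom])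
  have rhs: "(LINT y|q. h y) = L2_inner mu (hcomp F jdeg) J / of_real (c\<^sup>2)"
    by (simp add: val[OF hm] pull_pairing[OF h F jac_L2 Jhom])
  have "AE z in mu. \<forall>k<jdeg. hcomp F k z = 0"
    unfolding AE_all_countable using hcomp_low[OF h F] by (metis (mono_tags, lifting) AE_I2 eventually_mono)
  then have "AE z in mu. hcomp K jdeg z = \<phi> 0 * hcomp F jdeg z"
  proof eventually_elim
    case (elim z)
    have "hcomp K jdeg z = (\<Sum>i\<le>jdeg. hcomp (\<lambda>z. \<phi> (th z)) i z * hcomp F (jdeg - i) z)"
      unfolding K_def[abs_def] by (rule hcomp_mult[OF \<phi>th hardy_holo[OF F(1)]])
    also have "\<dots> = (\<Sum>i\<le>jdeg. if i = 0 then \<phi> 0 * hcomp F jdeg z else 0)"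
      by (rule sum.cong) (use elim in \<open>auto simp: hcomp_0 th_zero\<close>)
    finally show ?case by simp
  qed
  then have "L2_inner mu (hcomp K jdeg) J = L2_inner mu (\<lambda>z. \<phi> 0 * hcomp F jdeg z) J"
    using hcomp_measurable[OF Khol] hcomp_measurable[OF hardy_holo[OF F(1)]] jac_measurable
    by (intro L2_inner_cong_AE) auto
  then show ?thesis using lhs rhs by (simp add: L2_inner_scale_left)
qed

lemma schur_qH:
  assumes \<phi>: "holo_on \<phi> (th ` \<Omega>)" "\<And>y. y \<in> th ` \<Omega> \<Longrightarrow> cmod (\<phi> y) \<le> B"
  shows "\<phi> \<in> qH"
proof -
  obtain C where C: "\<forall>z\<in>closure \<Omega>. cmod (J z) \<le> C"
    using continuous_on_compact_bound[OF compact_closure_dom poly_fun_continuous_on[OF poly_fun_jac]] by blast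
  have hol: "holo_on (pull P \<phi>) \<Omega>"
    unfolding pull_def
    by (intro holo_on_mult holo_on_compose_poly[OF \<phi>(1)] poly_fun_poly_map poly_fun_holo_on poly_fun_jac)
  have "pull P \<phi> \<in> hardy_space \<Omega> mu"
  proof (rule holo_bounded_hardy[OF hol])
    fix z assume z: "z \<in> \<Omega>"
    then have "cmod (J z) \<le> C" using C closure_subset by blast
    then show "cmod (pull P \<phi> z) \<le> C * B"
      unfolding pull_def norm_mult using \<phi>(2)[of "th z"] z order_trans[OF norm_ge_zero] by (intro mult_mono) auto
  qed
  then show ?thesis using \<phi>(1) by (simp add: qhardy_space_def)
qed

lemma bv_bounded:
  assumes f: "f \<in> qH" and B: "\<And>y. y \<in> th ` \<Omega> \<Longrightarrow> cmod (f y) \<le> B"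
  shows "AE y in q. cmod (bv f y) \<le> B"
proof (rule AE_q_I)
  have "{y\<in>space q. cmod (bv f y) \<le> B} \<in> sets q"
    using qradial_limit_measurable[OF qH_holo[OF f]] by measurable
  then show "{y\<in>Sh. cmod (bv f y) \<le> B} \<in> sets q" by (simp add: space_q)
  show "AE z in mu. J z \<noteq> 0 \<longrightarrow> cmod (bv f (th z)) \<le> B"
    using qradial_limit_tendsto(1)[OF f]
  proof (rule AE_mp[OF _ AE_I2], intro impI)
    fix z assume z: "z \<in> space mu" and l: "J z \<noteq> 0 \<longrightarrow> ((\<lambda>r. f (dil (of_real r) (th z))) \<longlongrightarrow> bv f (th z)) (at_left 1)" and "J z \<noteq> 0"
    then have "((\<lambda>r. cmod (f (dil (of_real r) (th z)))) \<longlongrightarrow> cmod (bv f (th z))) (at_left 1)"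
      by (intro tendsto_norm) blast
    then show "cmod (bv f (th z)) \<le> B"
    proof (rule tendsto_upperbound)
      show "\<forall>\<^sub>F r in at_left 1. cmod (f (dil (of_real r) (th z))) \<le> B"
        using eventually_at_left_real[of 0 "1::real"] z th_shilov
        by (auto simp: space_mu elim!: eventually_mono intro!: B dil_Sh_dom)
    qed simp
  qed
qed

lemma poly_bounded:
  assumes R: "poly_fun R"
  shows "\<exists>B. \<forall>y\<in>th ` closure \<Omega>. cmod (R y) \<le> B"
  by (rule continuous_on_compact_bound[OF compact_continuous_image[OF continuous_on_th compact_closure_dom] poly_fun_continuous_on[OF R]])

lemma poly_mult_integral:
  assumes R: "poly_fun R" and h: "h \<in> qhb"
  shows "(LINT y|q. R y * h y) = R 0 * (LINT y|q. h y)"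
proof -
  obtain B where "\<forall>y\<in>th ` closure \<Omega>. cmod (R y) \<le> B" using poly_bounded[OF R] ..
  then show ?thesis
    using bounded_mult_integral[OF poly_fun_holo_on[OF R] _ qH_poly[OF R] h, of B] closure_subset[of \<Omega>]
    by (auto simp: bv_poly[OF R])
qed

end

section \<open>Extension of annihilating functions\<close>

lemma power_series_coeff_bound:
  assumes sums: "\<And>t. cmod t < 1 \<Longrightarrow> (\<lambda>n. a n * t ^ n) sums g t" and B: "\<And>t. cmod t < 1 \<Longrightarrow> cmod (g t) \<le> B"
    and r: "0 < r" "r < 1"
  shows "cmod (a n) \<le> B / r ^ n"
proof -
  have hol: "g holomorphic_on ball 0 1"
    by (rule power_series_holomorphic[of 0 1 a]) (use sums in simp)
  have "g has_fps_expansion Abs_fps a"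
  proof -
    have "conv_radius a \<ge> norm (1 / 2 :: complex)"
      by (rule conv_radius_geI) (use sums[of "1 / 2"] in \<open>simp add: sums_iff\<close>)
    moreover have "eventually (\<lambda>z. z \<in> ball 0 1) (nhds (0::complex))" by (rule eventually_nhds_in_open) auto
    ultimately show ?thesis
      using sums unfolding has_fps_expansion_def eval_fps_def fps_conv_radius_def
      by (auto simp: sums_iff elim!: eventually_mono intro: less_le_trans[of 0 "ereal (1 / 2)"])
  qed
  from fps_nth_fps_expansion[OF this] have a: "a n = (deriv ^^ n) g 0 / fact n" by simp
  have sub: "cball 0 r \<subseteq> ball (0::complex) 1" using r by auto
  have "cmod ((deriv ^^ n) g 0) \<le> fact n * B / r ^ n"
  proof (rule Cauchy_inequality)
    show "g holomorphic_on ball 0 r" by (rule holomorphic_on_subset[OF hol]) (use r in auto)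
    show "continuous_on (cball 0 r) g"
      by (rule continuous_on_subset[OF holomorphic_on_imp_continuous_on[OF hol] sub])
  qed (use r B in auto)
  then show ?thesis by (simp add: a norm_divide field_simps)
qed

lemma conj_setI: "f \<in> E \<Longrightarrow> (\<lambda>x. cnj (f x)) \<in> conj_set E"
  by (auto simp: conj_set_def)

definition lin_closed :: "('a \<Rightarrow> complex) set \<Rightarrow> bool" where
  "lin_closed E \<longleftrightarrow> (\<lambda>x. 0) \<in> E \<and> (\<forall>f\<in>E. \<forall>g\<in>E. \<forall>a. (\<lambda>x. f x + a * g x) \<in> E)"

lemma lin_closedD: "lin_closed E \<Longrightarrow> f \<in> E \<Longrightarrow> g \<in> E \<Longrightarrow> (\<lambda>x. f x + a * g x) \<in> E"
  and lin_closed_zero: "lin_closed E \<Longrightarrow> (\<lambda>x. 0) \<in> E"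
  by (auto simp: lin_closed_def)

lemma lin_closed_L2: "lin_closed (L2 M)"
  by (simp add: lin_closed_def L2_zero L2_add L2_scale)

lemma sum_setI: "f \<in> E \<Longrightarrow> g \<in> F \<Longrightarrow> (\<lambda>x. f x + g x) \<in> sum_set E F"
  unfolding sum_set_def by (intro CollectI exI conjI) (rule refl)

lemma lin_closed_sum_set:
  assumes E: "lin_closed E" and F: "lin_closed F"
  shows "lin_closed (sum_set E F)"
  unfolding lin_closed_def
proof (intro conjI ballI allI)
  have "(\<lambda>x. 0 + 0) \<in> sum_set E F"
    by (rule sum_setI[OF lin_closed_zero[OF E] lin_closed_zero[OF F]])
  then show "(\<lambda>x. 0) \<in> sum_set E F" by simp
  fix f g a assume "f \<in> sum_set E F" "g \<in> sum_set E F"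
  then obtain f1 f2 g1 g2 where fg: "f1 \<in> E" "g1 \<in> E" "f2 \<in> F" "g2 \<in> F"
    "f = (\<lambda>x. f1 x + f2 x)" "g = (\<lambda>x. g1 x + g2 x)" by (auto simp: sum_set_def)
  have "(\<lambda>x. (f1 x + a * g1 x) + (f2 x + a * g2 x)) \<in> sum_set E F"
    by (rule sum_setI[OF lin_closedD[OF E fg(1,2)] lin_closedD[OF F fg(3,4)]])
  then show "(\<lambda>x. f x + a * g x) \<in> sum_set E F" by (simp add: fg algebra_simps)
qed

lemma lin_closed_ominus:
  assumes E: "lin_closed E" and EL: "E \<subseteq> L2 M" and FL: "F \<subseteq> L2 M"
  shows "lin_closed (ominus M E F)"
  unfolding lin_closed_def ominus_def
proof (intro conjI ballI allI)
  show "(\<lambda>x. 0) \<in> {f\<in>E. \<forall>g\<in>F. L2_inner M f g = 0}"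
    using lin_closed_zero[OF E] by (simp add: L2_inner_def)
  fix f g a assume fg: "f \<in> {f\<in>E. \<forall>g\<in>F. L2_inner M f g = 0}" "g \<in> {f\<in>E. \<forall>g\<in>F. L2_inner M f g = 0}"
  have "L2_inner M (\<lambda>x. f x + a * g x) h = 0" if h: "h \<in> F" for h
  proof -
    have "L2_inner M (\<lambda>x. f x + a * g x) h = L2_inner M f h + L2_inner M (\<lambda>x. a * g x) h"
      using fg EL FL h by (intro L2_inner_add_left L2_scale) auto
    then show ?thesis using fg h by (simp add: L2_inner_scale_left)
  qed
  then show "(\<lambda>x. f x + a * g x) \<in> {f\<in>E. \<forall>g\<in>F. L2_inner M f g = 0}"
    using lin_closedD[OF E] fg by simp
qed

lemma lin_closed_conj_set:
  assumes E: "lin_closed E"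
  shows "lin_closed (conj_set E)"
  unfolding lin_closed_def conj_set_def
proof (intro conjI ballI allI)
  show "(\<lambda>x. 0) \<in> (\<lambda>f x. cnj (f x)) ` E"
    by (rule image_eqI[OF _ lin_closed_zero[OF E]]) simp
  fix f g a assume "f \<in> (\<lambda>f x. cnj (f x)) ` E" "g \<in> (\<lambda>f x. cnj (f x)) ` E"
  then obtain f' g' where fg: "f' \<in> E" "g' \<in> E" "f = (\<lambda>x. cnj (f' x))" "g = (\<lambda>x. cnj (g' x))" by blast
  show "(\<lambda>x. f x + a * g x) \<in> (\<lambda>f x. cnj (f x)) ` E"
    by (rule image_eqI[OF _ lin_closedD[OF E fg(1,2), of "cnj a"]]) (simp add: fg)
qed

lemma conj_set_L2: "E \<subseteq> L2 M \<Longrightarrow> conj_set E \<subseteq> L2 M"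
  by (auto simp: conj_set_def intro!: L2_cnj)

lemma sum_set_L2: "E \<subseteq> L2 M \<Longrightarrow> F \<subseteq> L2 M \<Longrightarrow> sum_set E F \<subseteq> L2 M"
  by (auto simp: sum_set_def intro!: L2_add)

lemma sum_set_left: "f \<in> E \<Longrightarrow> lin_closed F \<Longrightarrow> f \<in> sum_set E F"
  using lin_closed_zero[of F] unfolding sum_set_def by (intro CollectI exI[of _ f] exI[of _ "\<lambda>x. 0"]) auto

lemma sum_set_right: "f \<in> F \<Longrightarrow> lin_closed E \<Longrightarrow> f \<in> sum_set E F"
  using lin_closed_zero[of E] unfolding sum_set_def by (intro CollectI exI[of _ "\<lambda>x. 0"] exI[of _ f]) auto

section \<open>Weighted homogeneous projections and the mixed space\<close>

context hardy_quotient
begin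

definition wdeg :: "('n \<Rightarrow>\<^sub>0 nat) \<Rightarrow> nat" where
  "wdeg a = (\<Sum>i\<in>UNIV. wt i * Poly_Mapping.lookup a i)"

lemma monom_fun_dil: "monom_fun a (dil t y) = t ^ wdeg a * monom_fun a y"
  by (simp add: monom_fun_def dil_def wdeg_def power_mult_distrib prod.distrib power_sum power_mult)

text \<open>Positive weights bound every exponent by the weighted degree.\<close>

lemma finite_wdeg: "finite {a. wdeg a = n}"
proof (rule finite_imageD)
  have "Poly_Mapping.lookup a i \<le> wdeg a" for a i
  proof -
    have "Poly_Mapping.lookup a i \<le> wt i * Poly_Mapping.lookup a i" using wt_pos[of i] by simp
    also have "\<dots> \<le> wdeg a" unfolding wdeg_def by (rule member_le_sum) auto
    finally show ?thesis .
  qed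
  then have "Poly_Mapping.lookup ` {a. wdeg a = n} \<subseteq> (UNIV :: 'n set) \<rightarrow>\<^sub>E {..n}" by (auto simp: PiE_def)
  then show "finite (Poly_Mapping.lookup ` {a. wdeg a = n})"
    by (rule finite_subset) (intro finite_PiE, auto)
  show "inj_on Poly_Mapping.lookup {a. wdeg a = n}" by (rule inj_onI, rule poly_mapping_eqI) (simp only:)
qed

text \<open>For fixed \<open>y\<close> the value at \<open>dil t y\<close> is a polynomial in
  \<open>t\<close>; comparing the coefficients of \<open>t ^ n\<close> discards the monomials of
  other weighted degree.\<close>

lemma hom_poly_monomials:
  assumes Q: "poly_fun Q" and hom: "\<And>t y. Q (dil t y) = t ^ n * Q y"
  shows "\<exists>b. \<forall>y. Q y = (\<Sum>a\<in>{a. wdeg a = n}. b a * monom_fun a y)"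
proof -
  obtain p where p: "Q = cpoly_eval p" using Q by (auto simp: poly_fun_def)
  define K where "K = Poly_Mapping.keys p"
  have ev: "Q y = (\<Sum>a\<in>K. Poly_Mapping.lookup p a * monom_fun a y)" for y
    unfolding p K_def by (rule cpoly_eval_superset) auto
  have "Q y = (\<Sum>a\<in>{a. wdeg a = n}. Poly_Mapping.lookup p a * monom_fun a y)" for y
  proof -
    define r where "r = (\<Sum>a\<in>K. Polynomial.monom (Poly_Mapping.lookup p a * monom_fun a y) (wdeg a))"
    have "poly r t = poly (Polynomial.monom (Q y) n) t" for t
    proof -
      have "poly r t = Q (dil t y)"
        unfolding ev by (simp add: r_def poly_sum poly_monom monom_fun_dil mult_ac)
      then show ?thesis by (simp add: hom poly_monom)
    qed
    then have "r = Polynomial.monom (Q y) n" by (simp add: poly_eq_poly_eq_iff[symmetric] fun_eq_iff)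
    then have "Q y = poly.coeff r n" by simp
    also have "\<dots> = (\<Sum>a\<in>K. if wdeg a = n then Poly_Mapping.lookup p a * monom_fun a y else 0)"
      by (simp add: r_def coeff_sum)
    also have "\<dots> = (\<Sum>a\<in>K \<inter> {a. wdeg a = n}. Poly_Mapping.lookup p a * monom_fun a y)"
      by (subst sum.inter_restrict) (simp_all add: K_def)
    also have "\<dots> = (\<Sum>a\<in>{a. wdeg a = n}. Poly_Mapping.lookup p a * monom_fun a y)"
      by (rule sum.mono_neutral_left[OF finite_wdeg]) (auto simp: K_def in_keys_iff)
    finally show ?thesis .
  qed
  then show ?thesis by blast
qed

text \<open>The finitely many monomials of weighted degree \<open>n\<close> span the homogeneous
  polynomials, so \<open>L2_finite_projection\<close> applies.\<close>

lemma hom_projection: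
  assumes v: "v \<in> L2 q"
  shows "\<exists>R. hom_poly n R \<and> (\<forall>Q. hom_poly n Q \<longrightarrow> L2_inner q (\<lambda>y. v y - R y) Q = 0)"
proof -
  define I where "I = {a. wdeg a = n}"
  have mp: "poly_fun (monom_fun a)" for a :: "'n \<Rightarrow>\<^sub>0 nat"
    using poly_fun_monom[of 1 a] by simp
  have mL: "monom_fun a \<in> L2 q" for a by (rule poly_L2_q[OF mp])
  obtain b where b: "\<forall>a\<in>I. L2_inner q (\<lambda>y. v y - (\<Sum>j\<in>I. b j * monom_fun j y)) (monom_fun a) = 0"
    using L2_finite_projection[of I monom_fun q v] finite_wdeg mL v unfolding I_def by blast
  define R where "R y = (\<Sum>j\<in>I. b j * monom_fun j y)" for y
  have Rp: "poly_fun R" unfolding R_def by (intro poly_fun_sum poly_fun_mult mp) simp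
  have "R (dil t y) = t ^ n * R y" for t y
    unfolding R_def sum_distrib_left by (rule sum.cong) (auto simp: monom_fun_dil I_def)
  then have R: "hom_poly n R" using Rp by (simp add: hom_poly_def)
  have dL: "(\<lambda>y. v y - R y) \<in> L2 q" by (rule L2_diff[OF v poly_L2_q[OF Rp]])
  have "L2_inner q (\<lambda>y. v y - R y) Q = 0" if "hom_poly n Q" for Q
  proof -
    have "\<exists>d. \<forall>y. Q y = (\<Sum>a\<in>{a. wdeg a = n}. d a * monom_fun a y)"
      by (rule hom_poly_monomials) (use that in \<open>auto simp: hom_poly_def\<close>)
    then obtain d where d: "\<And>y. Q y = (\<Sum>a\<in>I. d a * monom_fun a y)" unfolding I_def by blast
    have "L2_inner q (\<lambda>y. v y - R y) Q = L2_inner q (\<lambda>y. v y - R y) (\<lambda>y. \<Sum>a\<in>I. d a * monom_fun a y)"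
      by (simp only: d[symmetric])
    also have "\<dots> = (\<Sum>a\<in>I. L2_inner q (\<lambda>y. v y - R y) (\<lambda>y. d a * monom_fun a y))"
      by (rule L2_inner_sum_right[OF L2_scale[OF mL] dL])
    also have "\<dots> = 0"
      unfolding L2_inner_scale_right by (rule sum.neutral) (use b in \<open>simp add: R_def\<close>)
    finally show ?thesis .
  qed
  then show ?thesis using R by blast
qed

lemma lin_closed_qhb: "lin_closed qhb"
  unfolding lin_closed_def
proof (intro conjI ballI allI)
  show "(\<lambda>x. 0) \<in> qhb" by (rule poly_qhb) simp
  fix f g a assume f: "f \<in> qhb" and g: "g \<in> qhb"
  obtain F where F: "F \<in> hardy_space \<Omega> mu" "AE z in mu. pull P f z = radial_limit F z" using qhb_pull[OF f] by blast
  obtain H where H: "H \<in> hardy_space \<Omega> mu" "AE z in mu. pull P g z = radial_limit H z" using qhb_pull[OF g] by blast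
  have L: "(\<lambda>x. f x + a * g x) \<in> L2 q" by (intro L2_add L2_scale qhb_L2 f g)
  have "AE z in mu. pull P (\<lambda>x. f x + a * g x) z = radial_limit (\<lambda>z. F z + a * H z) z"
    using F(2) H(2) hardy_space_combine(2)[OF F(1) H(1), of a] by eventually_elim (simp add: pull_add)
  then show "(\<lambda>x. f x + a * g x) \<in> qhb"
    using L L2_q_iff[of "\<lambda>x. f x + a * g x"] hardy_space_combine(1)[OF F(1) H(1), of a]
    unfolding qhardy_boundary_def hardy_boundary_def by blast
qed

lemma qhb_subset: "qhb \<subseteq> L2 q"
  using qhb_L2 by blast

abbreviation "qhb0 \<equiv> qhardy_boundary0 \<Omega> P mu"

abbreviation "mixed \<equiv> mixed_space \<Omega> P mu"

lemma qhb0_alt: "qhb0 = ominus q qhb {\<lambda>_. 1}"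
  by (simp add: qhardy_boundary0_def ominus_def)

lemma lin_closed_qhb0: "lin_closed qhb0"
  unfolding qhb0_alt by (rule lin_closed_ominus[OF lin_closed_qhb qhb_subset]) (auto intro: poly_L2_q)

lemma lin_closed_mixed: "lin_closed mixed"
  unfolding mixed_space_def
  by (rule lin_closed_ominus[OF lin_closed_L2 subset_refl]) (intro sum_set_L2 conj_set_L2 qhb_subset)

lemma mixed_subset: "mixed \<subseteq> L2 q" and qhb0_subset: "qhb0 \<subseteq> L2 q"
  using qhb_subset by (auto simp: mixed_space_def ominus_def qhardy_boundary0_def)

text \<open>By \<open>boundary_expansion\<close> orthogonality to polynomials already implies
  orthogonality to all of \<open>qhb\<close>; the two conditions treat \<open>qhb\<close> and its
  conjugates.\<close>

lemma mixed_spaceI: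
  assumes r: "r \<in> L2 q" and orth: "\<And>R. poly_fun R \<Longrightarrow> L2_inner q r R = 0" "\<And>R. poly_fun R \<Longrightarrow> (LINT y|q. r y * R y) = 0"
  shows "r \<in> mixed"
proof -
  have zero: "L2_inner q h v = 0" if h: "h \<in> qhb" and v: "v \<in> L2 q" "\<And>R. poly_fun R \<Longrightarrow> L2_inner q R v = 0" for h v
  proof -
    obtain Q where Q: "\<forall>n. hom_poly n (Q n)" "\<forall>v\<in>L2 q. (\<lambda>n. L2_inner q (Q n) v) sums L2_inner q h v"
      using boundary_expansion[OF h] by blast
    have "L2_inner q (Q n) v = 0" for n using Q(1) v(2) by (simp add: hom_poly_def)
    with bspec[OF Q(2) v(1)] show ?thesis by (simp add: sums_unique2[OF _ sums_zero])
  qed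
  have c: "L2_inner q R r = 0" "L2_inner q R (\<lambda>y. cnj (r y)) = 0" if "poly_fun R" for R
    using orth[OF that] by (simp_all add: L2_inner_commute[of q R r]) (simp add: L2_inner_def mult.commute)
  have "L2_inner q r (\<lambda>x. h1 x + cnj (h2 x)) = 0" if h: "h1 \<in> qhb" "h2 \<in> qhb" for h1 h2
  proof -
    have "L2_inner q r h1 = 0" using zero[OF h(1) r c(1)] by (simp add: L2_inner_commute[of q r h1])
    moreover have "L2_inner q r (\<lambda>x. cnj (h2 x)) = 0"
      using zero[OF h(2) L2_cnj[OF r] c(2)] by (simp add: L2_inner_def mult.commute)
    ultimately show ?thesis
      using L2_inner_add_right[OF qhb_L2[OF h(1)] L2_cnj[OF qhb_L2[OF h(2)]] r] by simp
  qed
  then show ?thesis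
    using r by (auto simp: mixed_space_def ominus_def sum_set_def conj_set_def)
qed

section \<open>The Schur function attached to an annihilating function\<close>

context
  fixes S
  assumes kernel: "reproducing_kernel (th ` \<Omega>) qH (qhardy_inner P mu) S"
begin

lemma ker_qH: "y \<in> th ` \<Omega> \<Longrightarrow> (\<lambda>x. S x y) \<in> qH"
  using kernel unfolding reproducing_kernel_def by blast

lemma reproducing: "y \<in> th ` \<Omega> \<Longrightarrow> f \<in> qH \<Longrightarrow> L2_inner q (bv f) (bv (\<lambda>x. S x y)) = f y"
  using kernel unfolding reproducing_kernel_def by (simp only: qhardy_inner_bv[OF _ ker_qH, symmetric])

context
  fixes \<phi> :: "complex^'n \<Rightarrow> complex"
  assumes meas: "\<phi> \<in> borel_measurable q" and bounded: "\<And>y. cmod (\<phi> y) \<le> 1"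
    and ann_mixed: "\<And>m. m \<in> mixed \<Longrightarrow> (LINT y|q. \<phi> y * m y) = 0"
    and ann_qhb0: "\<And>h. h \<in> qhb0 \<Longrightarrow> (LINT y|q. \<phi> y * h y) = 0"
begin

lemma phi_L2: "\<phi> \<in> L2 q"
  by (rule q.L2_bounded[OF meas bounded])

text \<open>\<open>R - R 0\<close> belongs to \<open>qhb0\<close> because integration of polynomials
  is evaluation at 0, and \<open>\<phi>\<close> annihilates \<open>qhb0\<close>.\<close>

lemma phi_poly_integral:
  assumes R: "poly_fun R"
  shows "(LINT y|q. \<phi> y * R y) = R 0 * (LINT y|q. \<phi> y)"
proof -
  have p: "poly_fun (\<lambda>y. R y - R 0)" using R by (intro poly_fun_diff) simp_all
  have one: "(\<lambda>_. 1) \<in> qhb" by (rule poly_qhb) simp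
  have "(LINT y|q. R y - R 0) = 0"
    using poly_mult_integral[OF p one] by simp
  then have "(\<lambda>y. R y - R 0) \<in> qhb0"
    using poly_qhb[OF p] by (simp add: qhardy_boundary0_def L2_inner_def)
  from ann_qhb0[OF this] have "(LINT y|q. \<phi> y * R y - R 0 * \<phi> y) = 0" by (simp add: algebra_simps)
  then show ?thesis
    using L2_mult_integrable[OF phi_L2 poly_L2_q[OF R]] q.L2_integrable[OF phi_L2] by simp
qed

text \<open>The component of \<open>\<phi>\<close> orthogonal to the polynomials has a conjugate in the mixed space, which \<open>\<phi>\<close>
  annihilates.\<close>

lemma polynomial_limit:
  obtains u where "\<forall>n. poly_fun (u n)" "(\<lambda>n. sqn q (\<lambda>y. u n y - \<phi> y)) \<longlonglongrightarrow> 0"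
proof -
  note fin = q.finite_measure_axioms
  obtain u r where u': "\<forall>n. u n \<in> {R. poly_fun R}" and r: "r \<in> L2 q" "(\<lambda>n. sqn q (\<lambda>x. (\<phi> x - u n x) - r x)) \<longlonglongrightarrow> 0"
    and orth: "\<forall>h\<in>{R. poly_fun R}. L2_inner q h r = 0" "L2_inner q \<phi> r = of_real (sqn q r)"
      "sqn q r = 0 \<longrightarrow> (\<lambda>n. sqn q (\<lambda>x. u n x - \<phi> x)) \<longlonglongrightarrow> 0"
  proof (rule L2_orthogonal_part[OF fin phi_L2, of "{R. poly_fun R}"])
    show "{R. poly_fun R} \<subseteq> L2 q" by (auto intro: poly_L2_q)
    fix h k :: "complex^'n \<Rightarrow> complex" and c assume "h \<in> {R. poly_fun R}" "k \<in> {R. poly_fun R}"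
    then show "(\<lambda>x. h x + c * k x) \<in> {R. poly_fun R}" by (simp add: poly_fun_add poly_fun_mult)
  qed (simp, blast)
  have u: "poly_fun (u n)" for n using u' by simp
  have one: "(\<lambda>_. 1) \<in> qhb" by (rule poly_qhb) simp
  have r0: "(LINT y|q. r y) = 0"
    using orth(1)[rule_format, of "\<lambda>_. 1"] L2_inner_commute[of q "\<lambda>_. 1" r] by (simp add: L2_inner_def)
  have dL: "(\<lambda>x. \<phi> x - u n x) \<in> L2 q" for n by (intro L2_diff phi_L2 poly_L2_q u)
  \<comment> \<open>\<open>\<phi>\<close> and the approximating polynomials both satisfy the
    identity of \<open>phi_poly_integral\<close>; it passes to the limit \<open>r\<close>, whose
    integral is 0.\<close>
  have rR: "(LINT y|q. r y * R y) = 0" if R: "poly_fun R" for R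
  proof -
    have lim: "(\<lambda>n. LINT y|q. (\<phi> y - u n y) * R y) \<longlonglongrightarrow> (LINT y|q. r y * R y)" if "poly_fun R" for R
      by (rule tendsto_integral_mult[OF dL r(1) poly_L2_q[OF that] r(2)])
    have "(LINT y|q. (\<phi> y - u n y) * R y) = R 0 * (LINT y|q. (\<phi> y - u n y) * 1)" for n
      using phi_poly_integral[OF R] poly_mult_integral[OF u poly_qhb[OF R], of n]
        poly_mult_integral[OF R one] poly_mult_integral[OF u one, of n]
        L2_mult_integrable[OF phi_L2 poly_L2_q[OF R]] L2_mult_integrable[OF poly_L2_q[OF u] poly_L2_q[OF R], of n]
        q.L2_integrable[OF phi_L2] q.L2_integrable[OF poly_L2_q[OF u], of n]
      by (simp add: left_diff_distrib right_diff_distrib)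
    then have "(\<lambda>n. LINT y|q. (\<phi> y - u n y) * R y) \<longlonglongrightarrow> R 0 * (LINT y|q. r y * 1)"
      by (simp only: tendsto_mult_left[OF lim] poly_fun_const)
    from LIMSEQ_unique[OF lim[OF R] this] show ?thesis by (simp add: r0)
  qed
  have "(\<lambda>y. cnj (r y)) \<in> mixed"
  proof (rule mixed_spaceI[OF L2_cnj[OF r(1)]])
    fix R :: "complex^'n \<Rightarrow> complex" assume R: "poly_fun R"
    have "L2_inner q (\<lambda>y. cnj (r y)) R = cnj (LINT y|q. r y * R y)"
      by (simp add: L2_inner_def flip: Bochner_Integration.integral_cnj)
    then show "L2_inner q (\<lambda>y. cnj (r y)) R = 0" by (simp add: rR[OF R])
    show "(LINT y|q. cnj (r y) * R y) = 0" using orth(1) R by (simp add: L2_inner_def mult.commute)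
  qed
  from ann_mixed[OF this] have "sqn q r = 0" using orth(2) by (simp add: L2_inner_def)
  then show ?thesis using u orth(3) by (intro that[of u]) auto
qed

text \<open>The value at \<open>x\<close> of the projection of \<open>\<phi>\<close> to the Hardy
  space, expressed through the reproducing kernel.\<close>

definition extension :: "complex^'n \<Rightarrow> complex" where
  "extension x = L2_inner q \<phi> (bv (\<lambda>y. S y x))"

text \<open>One factor \<open>\<phi>\<close> is approximated by polynomials \<open>u n\<close>,
  which are absorbed into \<open>Q\<close>; hence the claim for arbitrary \<open>Q\<close>. For
  \<open>Q = 1\<close> it says that powers of \<open>\<phi>\<close> pair to powers of
  \<open>extension x\<close>.\<close>

lemma power_pairing:
  assumes x: "x \<in> th ` \<Omega>"
  shows "poly_fun Q \<Longrightarrow> L2_inner q (\<lambda>y. \<phi> y ^ j * Q y) (bv (\<lambda>y. S y x)) = extension x ^ j * Q x"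
proof (induction j arbitrary: Q)
  case 0
  have "bv Q = Q" by (rule ext) (rule bv_poly[OF 0])
  then show ?case using reproducing[OF x qH_poly[OF 0]] by simp
next
  case (Suc j)
  define k where "k = bv (\<lambda>y. S y x)"
  have k: "k \<in> L2 q" unfolding k_def by (rule bv_L2(1)[OF ker_qH[OF x]])
  obtain u where u': "\<forall>n. poly_fun (u n)" and lim: "(\<lambda>n. sqn q (\<lambda>y. u n y - \<phi> y)) \<longlonglongrightarrow> 0"
    by (rule polynomial_limit)
  have u: "poly_fun (u n)" for n using u' by simp
  obtain B where B: "\<forall>y\<in>th ` closure \<Omega>. cmod (Q y) \<le> B" using poly_bounded[OF Suc.prems] ..
  have gL: "(\<lambda>y. (\<phi> y ^ j * Q y) * cnj (k y)) \<in> L2 q"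
  proof (rule L2_mult_bounded[OF L2_cnj[OF k], where B = B])
    show "(\<lambda>y. \<phi> y ^ j * Q y) \<in> borel_measurable q"
      by (intro borel_measurable_times borel_measurable_power meas L2_measurable[OF poly_L2_q[OF Suc.prems]])
    fix y assume "y \<in> space q"
    then have "cmod (Q y) \<le> B" using B Sh_closure by (auto simp: space_q)
    then have "cmod (\<phi> y) ^ j * cmod (Q y) \<le> 1 * B"
      by (intro mult_mono power_le_one bounded) auto
    then show "cmod (\<phi> y ^ j * Q y) \<le> B" by (simp add: norm_mult norm_power)
  qed
  note L = tendsto_integral_mult[OF poly_L2_q[OF u] phi_L2 _ lim]
  have "(\<lambda>n. LINT y|q. u n y * ((\<phi> y ^ j * Q y) * cnj (k y))) \<longlonglongrightarrow> (LINT y|q. \<phi> y * ((\<phi> y ^ j * Q y) * cnj (k y)))"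
    by (rule L[OF gL])
  moreover have "(LINT y|q. u n y * ((\<phi> y ^ j * Q y) * cnj (k y))) = extension x ^ j * Q x * u n x" for n
    using Suc.IH[OF poly_fun_mult[OF Suc.prems u], of n] by (simp add: L2_inner_def k_def mult_ac)
  moreover have "(\<lambda>n. u n x) \<longlonglongrightarrow> extension x"
  proof -
    have "bv (u n) = u n" for n by (rule ext) (rule bv_poly[OF u])
    then have "L2_inner q (u n) k = u n x" for n using reproducing[OF x qH_poly[OF u], of n] by (simp add: k_def)
    then show ?thesis using L[OF L2_cnj[OF k]] by (simp add: extension_def L2_inner_def k_def)
  qed
  then have "(\<lambda>n. extension x ^ j * Q x * u n x) \<longlonglongrightarrow> extension x ^ j * Q x * extension x" by (rule tendsto_mult_left)
  ultimately show ?case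
    using LIMSEQ_unique by (fastforce simp: L2_inner_def k_def mult_ac)
qed

text \<open>The powers of \<open>\<phi>\<close> have norm at most one, so the powers of the extension are bounded by the norm of the
  kernel function.\<close>

lemma extension_bound:
  assumes x: "x \<in> th ` \<Omega>"
  shows "cmod (extension x) \<le> 1"
proof (rule ccontr)
  assume "\<not> cmod (extension x) \<le> 1"
  then have gt: "1 < (cmod (extension x))\<^sup>2" by simp
  define k where "k = bv (\<lambda>y. S y x)"
  have k: "k \<in> L2 q" unfolding k_def by (rule bv_L2(1)[OF ker_qH[OF x]])
  have "((cmod (extension x))\<^sup>2) ^ j \<le> sqn q k" for j
  proof -
    have p: "(\<lambda>y. \<phi> y ^ j) \<in> borel_measurable q" "\<And>y. cmod (\<phi> y ^ j) \<le> 1"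
      using meas bounded by (auto simp: norm_power power_le_one)
    have "((cmod (extension x))\<^sup>2) ^ j = (cmod (L2_inner q (\<lambda>y. \<phi> y ^ j) k))\<^sup>2"
      using power_pairing[OF x, of "\<lambda>_. 1" j] by (simp add: k_def norm_power power_mult[symmetric] mult.commute)
    also have "\<dots> \<le> sqn q (\<lambda>y. \<phi> y ^ j) * sqn q k" by (rule cmod_L2_inner_sq_le[OF q.L2_bounded[OF p] k])
    also have "\<dots> \<le> 1 * sqn q k" by (intro mult_right_mono q.sqn_le_1[OF p] sqn_nonneg)
    finally show ?thesis by simp
  qed
  moreover obtain j where "sqn q k < ((cmod (extension x))\<^sup>2) ^ j" using real_arch_pow[OF gt] by blast
  ultimately show False using not_less by blast
qed

text \<open>The kernel function is expanded instead of \<open>\<phi>\<close>, since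
  \<open>\<phi>\<close> is not known to lie in \<open>qhb\<close>. Its term of degree
  \<open>n\<close> sees only the projection \<open>R n\<close> of \<open>\<phi>\<close>, and the
  kernel evaluates \<open>R n\<close> at \<open>x\<close>.\<close>

lemma extension_expansion:
  obtains R where "\<forall>n. hom_poly n (R n)" "\<forall>x\<in>th ` \<Omega>. (\<lambda>n. R n x) sums extension x"
proof -
  have "\<forall>n. \<exists>R. hom_poly n R \<and> (\<forall>Q. hom_poly n Q \<longrightarrow> L2_inner q (\<lambda>y. \<phi> y - R y) Q = 0)"
    using hom_projection[OF phi_L2] by blast
  then obtain R where R': "\<forall>n. hom_poly n (R n) \<and> (\<forall>Q. hom_poly n Q \<longrightarrow> L2_inner q (\<lambda>y. \<phi> y - R n y) Q = 0)"
    unfolding choice_iff by blast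
  then have R: "hom_poly n (R n)" for n by blast
  have pair: "L2_inner q \<phi> Q = L2_inner q (R n) Q" if Q: "hom_poly n Q" for n Q
  proof -
    have "L2_inner q (\<lambda>y. (\<phi> y - R n y) + R n y) Q = L2_inner q (\<lambda>y. \<phi> y - R n y) Q + L2_inner q (R n) Q"
      by (intro L2_inner_add_left L2_diff phi_L2 hom_poly_L2[OF R] hom_poly_L2[OF Q])
    then show ?thesis using R' Q by simp
  qed
  have "(\<lambda>n. R n x) sums extension x" if x: "x \<in> th ` \<Omega>" for x
  proof -
    define k where "k = bv (\<lambda>y. S y x)"
    have k: "k \<in> qhb" unfolding k_def by (rule bv_L2(3)[OF ker_qH[OF x]])
    obtain Q where Q: "\<forall>n. hom_poly n (Q n)" and sums: "\<forall>v\<in>L2 q. (\<lambda>n. L2_inner q (Q n) v) sums L2_inner q k v"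
      using boundary_expansion[OF k] by blast
    have "L2_inner q (Q n) \<phi> = cnj (R n x)" for n
    proof -
      have "(\<lambda>m. if m = n then L2_inner q (Q n) (R n) else 0) sums L2_inner q (Q n) (R n)"
        by (rule sums_single)
      moreover have "(if m = n then L2_inner q (Q n) (R n) else 0) = L2_inner q (Q m) (R n)" for m
        using hom_poly_orthogonal[OF Q[rule_format, of m] R[of n]] by auto
      ultimately have "(\<lambda>m. L2_inner q (Q m) (R n)) sums L2_inner q (Q n) (R n)" by simp
      note sums_unique2[OF bspec[OF sums hom_poly_L2[OF R]] this]
      moreover have "bv (R n) = R n" using R by (intro ext bv_poly) (simp add: hom_poly_def)
      then have "L2_inner q (R n) k = R n x"
        using reproducing[OF x qH_poly, of "R n"] R[of n] by (simp add: k_def hom_poly_def)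
      ultimately show ?thesis
        using pair[OF Q[rule_format, of n]] L2_inner_commute[of q "Q n" \<phi>] L2_inner_commute[of q "Q n" "R n"] L2_inner_commute[of q k "R n"]
        by simp
    qed
    then have "(\<lambda>n. cnj (R n x)) sums cnj (extension x)"
      using sums phi_L2 L2_inner_commute[of q k \<phi>] by (auto simp: extension_def k_def)
    then show ?thesis by (simp add: sums_cnj)
  qed
  then show ?thesis using R by (intro that[of R]) auto
qed

text \<open>Cauchy's estimate on the disc \<open>t \<mapsto> dil t (th z)\<close>, where the
  extension is bounded by 1, bounds \<open>R n\<close> as \<open>weighted_series\<close>
  requires.\<close>

lemma extension_holo: "holo_on extension (th ` \<Omega>)"
proof -
  obtain R where R': "\<forall>n. hom_poly n (R n)" and sums: "\<forall>x\<in>th ` \<Omega>. (\<lambda>n. R n x) sums extension x"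
    by (rule extension_expansion)
  have R: "poly_fun (R n)" "R n (dil t y) = t ^ n * R n y" for n t y using R' by (auto simp: hom_poly_def)
  have "holo_on (\<lambda>y. suminf (\<lambda>n. R n y)) (th ` \<Omega>)"
  proof (rule weighted_series[OF R(1)])
    show "R n (th (t *s z)) = t ^ n * R n (th z)" for n t z by (simp add: th_scale R(2))
    fix r :: real assume r: "0 < r" "r < 1"
    have "cmod (R n (th z)) \<le> 1 / r ^ n" if z: "z \<in> \<Omega>" for n z
    proof (rule power_series_coeff_bound[OF _ _ r])
      fix t :: complex assume "cmod t < 1"
      then have d: "dil t (th z) \<in> th ` \<Omega>"
        using z closure_subset[of \<Omega>] scale_closure[of z t] by (auto simp flip: th_scale)
      then show "(\<lambda>n. R n (th z) * t ^ n) sums extension (dil t (th z))"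
        using bspec[OF sums d] by (simp add: R(2) mult.commute)
      show "cmod (extension (dil t (th z))) \<le> 1" by (rule extension_bound[OF d])
    qed
    then show "\<exists>M. \<forall>n. \<forall>z\<in>\<Omega>. cmod (R n (th z)) \<le> M / r ^ n" by blast
  qed
  then show ?thesis
    by (rule iffD1[OF holo_on_cong, rotated]) (use sums in \<open>auto simp: sums_iff\<close>)
qed

end

end

end

section \<open>Interpolation\<close>

lemma L2_nrm_sq: "(L2_nrm M f)\<^sup>2 = sqn M f"
  unfolding L2_nrm_def sqn_def[symmetric] by (simp add: sqn_nonneg)

context hardy_quotient
begin

lemma sqn_ker_zero:
  assumes "f \<in> qH" "sqn q (bv f) = 0" "g \<in> qH"
  shows "L2_inner q (bv g) (bv f) = 0"
  using cmod_L2_inner_sq_le[OF bv_L2(1)[OF assms(3)] bv_L2(1)[OF assms(1)]] by (simp add: assms(2))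

lemma interpolating_poly:
  assumes "inj_on \<zeta> {..<p::nat}" "i < p"
  shows "\<exists>L. poly_fun L \<and> (\<forall>j<p. L (\<zeta> j) = (if j = i then 1 else 0))"
proof -
  define E where "E = \<zeta> ` ({..<p} - {i})"
  have E: "finite E" "\<zeta> i \<notin> E" using assms by (auto simp: E_def inj_on_def)
  obtain b where b: "poly_fun b" "b (\<zeta> i) = 1"
    "\<And>c. c \<in> E \<Longrightarrow> vanishes 1 c b"
    by (rule poly_fun_bump[OF E, where s = 1]) blast
  have "b (\<zeta> j) = 0" if "j < p" "j \<noteq> i" for j
    using b(3)[of "\<zeta> j"] that by (auto simp: E_def)
  then show ?thesis using b(1,2) by (intro exI[of _ b]) auto
qed

context
  fixes S and p :: nat and \<zeta> :: "nat \<Rightarrow> complex^'n"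
  assumes kernel: "reproducing_kernel (th ` \<Omega>) qH (qhardy_inner P mu) S"
    and points_dom: "\<forall>i<p. \<zeta> i \<in> th ` \<Omega>" and inj: "inj_on \<zeta> {..<p}"
begin

lemma points: "i < p \<Longrightarrow> \<zeta> i \<in> th ` \<Omega>"
  using points_dom by blast

definition comb :: "(nat \<Rightarrow> complex) \<Rightarrow> complex^'n \<Rightarrow> complex" where
  "comb a = (\<lambda>x. \<Sum>i<p. a i * S x (\<zeta> i))"

abbreviation "KS \<equiv> kernel_span S p \<zeta>"

abbreviation "KB \<equiv> boundary_values \<Omega> P mu KS"

definition kb :: "nat \<Rightarrow> complex^'n \<Rightarrow> complex" where
  "kb i = bv (\<lambda>x. S x (\<zeta> i))"

lemma kernel_span_comb: "k \<in> KS \<longleftrightarrow> (\<exists>a. k = comb a)"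
  by (auto simp: kernel_span_def comb_def)

lemma kb_L2: "i < p \<Longrightarrow> kb i \<in> L2 q"
  unfolding kb_def by (rule bv_L2(1)[OF ker_qH[OF kernel points]])

lemma kb_eval: "i < p \<Longrightarrow> f \<in> qH \<Longrightarrow> L2_inner q (bv f) (kb i) = f (\<zeta> i)"
  unfolding kb_def by (rule reproducing[OF kernel points])

text \<open>Additivity of \<open>bv\<close> holds almost everywhere, because \<open>Lim\<close>
  takes a default value where a limit fails to exist; the finite sum is therefore built by
  induction.\<close>

lemma comb_bv: "comb a \<in> qH \<and> (AE y in q. bv (comb a) y = (\<Sum>i<p. a i * kb i y))"
proof -
  have "(\<lambda>x. \<Sum>i<m. a i * S x (\<zeta> i)) \<in> qH \<and> (AE y in q. bv (\<lambda>x. \<Sum>i<m. a i * S x (\<zeta> i)) y = (\<Sum>i<m. a i * kb i y))"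
    if "m \<le> p" for m
    using that
  proof (induction m)
    case 0
    have z: "poly_fun (\<lambda>_::complex^'n. 0)" by simp
    show ?case using qH_poly[OF z] bv_poly[OF z] by simp
  next
    case (Suc m)
    then have IH: "(\<lambda>x. \<Sum>i<m. a i * S x (\<zeta> i)) \<in> qH" "AE y in q. bv (\<lambda>x. \<Sum>i<m. a i * S x (\<zeta> i)) y = (\<Sum>i<m. a i * kb i y)" by auto
    have k: "(\<lambda>x. S x (\<zeta> m)) \<in> qH" using Suc.prems by (intro ker_qH[OF kernel] points) simp
    have 1: "(\<lambda>x. \<Sum>i<Suc m. a i * S x (\<zeta> i)) \<in> qH" using qH_combine(1)[OF IH(1) k, of "a m"] by simp
    have 2: "AE y in q. bv (\<lambda>x. \<Sum>i<Suc m. a i * S x (\<zeta> i)) y = (\<Sum>i<Suc m. a i * kb i y)"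
      using qH_combine(2)[OF IH(1) k, of "a m"] IH(2) by eventually_elim (simp add: kb_def)
    show ?case using 1 2 by blast
  qed
  then show ?thesis by (simp add: comb_def)
qed

lemma comb_qH: "comb a \<in> qH" using comb_bv by blast

lemma comb_L2: "bv (comb a) \<in> L2 q" by (rule bv_L2(1)[OF comb_qH])

lemma inner_comb:
  assumes g: "g \<in> L2 q"
  shows "L2_inner q g (bv (comb a)) = (\<Sum>i<p. cnj (a i) * L2_inner q g (kb i))"
proof -
  have sL: "(\<lambda>y. \<Sum>i<p. a i * kb i y) \<in> L2 q" by (rule L2_sum) (auto intro!: L2_scale kb_L2)
  have "L2_inner q g (bv (comb a)) = L2_inner q g (\<lambda>y. \<Sum>i<p. a i * kb i y)"
    by (rule L2_inner_cong_AE[OF L2_measurable[OF g] L2_measurable[OF g] L2_measurable[OF comb_L2] L2_measurable[OF sL]])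
      (use comb_bv in auto)
  also have "\<dots> = (\<Sum>i<p. L2_inner q g (\<lambda>y. a i * kb i y))"
    by (rule L2_inner_sum_right) (auto intro!: L2_scale kb_L2 g)
  finally show ?thesis by (simp add: L2_inner_scale_right)
qed

lemma inner_comb_eval: "f \<in> qH \<Longrightarrow> L2_inner q (bv f) (bv (comb a)) = (\<Sum>i<p. cnj (a i) * f (\<zeta> i))"
  unfolding inner_comb[OF bv_L2(1)] by (rule sum.cong) (simp_all add: kb_eval)

text \<open>A combination vanishing at all nodes is orthogonal to itself, hence to every element of
  the Hardy space; pairing with an interpolating polynomial isolates the coefficient
  \<open>a i\<close>.\<close>

lemma comb_independent:
  assumes zero: "\<And>i. i < p \<Longrightarrow> comb a (\<zeta> i) = 0" and i: "i < p"
  shows "a i = 0"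
proof -
  have "of_real (sqn q (bv (comb a))) = (\<Sum>i<p. cnj (a i) * comb a (\<zeta> i))"
    using inner_comb_eval[OF comb_qH, of a a] by (simp add: L2_inner_self[OF comb_L2])
  then have "sqn q (bv (comb a)) = 0" using zero by simp
  obtain L where L: "poly_fun L" "\<forall>j<p. L (\<zeta> j) = (if j = i then 1 else 0)"
    using interpolating_poly[OF inj i] by blast
  have "0 = (\<Sum>j<p. cnj (a j) * L (\<zeta> j))"
    using sqn_ker_zero[OF comb_qH \<open>sqn q (bv (comb a)) = 0\<close> qH_poly[OF L(1)]] inner_comb_eval[OF qH_poly[OF L(1)], of a] by simp
  also have "\<dots> = (\<Sum>j<p. if j = i then cnj (a i) else 0)" by (rule sum.cong) (use L(2) in auto)
  also have "\<dots> = cnj (a i)" using i by simp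
  finally show ?thesis by simp
qed

lemma inner_qH:
  "f \<in> qH \<Longrightarrow> i < p \<Longrightarrow> qhardy_inner P mu f (\<lambda>x. S x (\<zeta> i)) = f (\<zeta> i)"
  using kernel points unfolding reproducing_kernel_def by blast

lemma ker_in_span: "i < p \<Longrightarrow> (\<lambda>x. S x (\<zeta> i)) \<in> KS"
proof -
  assume i: "i < p"
  have "comb (\<lambda>j. if j = i then 1 else 0) = (\<lambda>x. S x (\<zeta> i))"
  proof
    fix x
    have "comb (\<lambda>j. if j = i then 1 else 0) x = (\<Sum>j<p. if j = i then S x (\<zeta> i) else 0)"
      unfolding comb_def by (rule sum.cong) auto
    then show "comb (\<lambda>j. if j = i then 1 else 0) x = S x (\<zeta> i)" using i by simp
  qed
  then show ?thesis unfolding kernel_span_comb by metis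
qed

text \<open>Orthogonality to the kernel at \<open>\<zeta> i\<close> means agreement of values there,
  so projection onto the span is interpolation at the nodes. Uniqueness, needed for the definite
  description, comes from \<open>comb_independent\<close>.\<close>

lemma orth_proj_spec:
  assumes f: "f \<in> qH"
  shows "orth_proj KS (qhardy_inner P mu) f \<in> KS
    \<and> (\<forall>i<p. orth_proj KS (qhardy_inner P mu) f (\<zeta> i) = f (\<zeta> i))"
proof -
  let ?Q = "KS" and ?ip = "qhardy_inner P mu"
  have fL: "bv f \<in> L2 q" by (rule bv_L2(1)[OF f])
  have "\<exists>b. \<forall>i\<in>{..<p}. L2_inner q (\<lambda>x. bv f x - (\<Sum>j\<in>{..<p}. b j * kb j x)) (kb i) = 0"
    by (rule L2_finite_projection) (auto intro: kb_L2 fL)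
  then obtain b where b: "\<And>i. i < p \<Longrightarrow> L2_inner q (\<lambda>x. bv f x - (\<Sum>j<p. b j * kb j x)) (kb i) = 0" by blast
  have df: "(\<lambda>x. f x - k x) \<in> qH" "AE y in q. bv (\<lambda>x. f x - k x) y = bv f y - bv k y" if "k \<in> qH" for k
    using qH_combine[OF f that, of "-1"] by simp_all
  have val: "comb b (\<zeta> i) = f (\<zeta> i)" if i: "i < p" for i
  proof -
    have sL: "(\<lambda>y. \<Sum>i<p. b i * kb i y) \<in> L2 q" by (rule L2_sum) (auto intro!: L2_scale kb_L2)
    have "f (\<zeta> i) - comb b (\<zeta> i) = L2_inner q (bv (\<lambda>x. f x - comb b x)) (kb i)"
      by (rule kb_eval[OF i df(1)[OF comb_qH], symmetric])
    also have "\<dots> = L2_inner q (\<lambda>x. bv f x - (\<Sum>j<p. b j * kb j x)) (kb i)"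
    proof (rule L2_inner_cong_AE[OF L2_measurable[OF bv_L2(1)[OF df(1)[OF comb_qH]]] L2_measurable[OF L2_diff[OF fL sL]] L2_measurable[OF kb_L2[OF i]] L2_measurable[OF kb_L2[OF i]]])
      show "AE x in q. bv (\<lambda>x. f x - comb b x) x = bv f x - (\<Sum>j<p. b j * kb j x)"
        using df(2)[OF comb_qH, of b] comb_bv[of b, THEN conjunct2] by eventually_elim simp
    qed simp
    finally show ?thesis using b[OF i] by simp
  qed
  have ipQ: "?ip (\<lambda>x. f x - comb b' x) (comb a) = (\<Sum>i<p. cnj (a i) * (f (\<zeta> i) - comb b' (\<zeta> i)))" for a b'
    unfolding qhardy_inner_bv[OF df(1)[OF comb_qH] comb_qH] by (rule inner_comb_eval[OF df(1)[OF comb_qH]])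
  have "orth_proj ?Q ?ip f = comb b"
    unfolding orth_proj_def
  proof (rule the_equality)
    show "comb b \<in> ?Q \<and> (\<forall>g\<in>?Q. ?ip (\<lambda>x. f x - comb b x) g = 0)"
    proof (intro conjI ballI)
      show "comb b \<in> ?Q" unfolding kernel_span_comb by blast
      fix g assume "g \<in> ?Q"
      then obtain a where g: "g = comb a" unfolding kernel_span_comb by blast
      show "?ip (\<lambda>x. f x - comb b x) g = 0" unfolding g ipQ by (rule sum.neutral) (simp add: val)
    qed
    fix k assume k: "k \<in> ?Q \<and> (\<forall>g\<in>?Q. ?ip (\<lambda>x. f x - k x) g = 0)"
    then obtain d where d: "k = comb d" unfolding kernel_span_comb by blast
    have kv: "comb d (\<zeta> i) = f (\<zeta> i)" if i: "i < p" for i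
    proof -
      have "?ip (\<lambda>x. f x - comb d x) (\<lambda>x. S x (\<zeta> i)) = 0" using k ker_in_span[OF i] unfolding d by blast
      then show ?thesis using inner_qH[OF df(1)[OF comb_qH] i] by simp
    qed
    have lin: "comb (\<lambda>i. d i - b i) x = comb d x - comb b x" for x
      by (simp add: comb_def left_diff_distrib sum_subtractf)
    have "d i - b i = 0" if "i < p" for i
      by (rule comb_independent[of "\<lambda>i. d i - b i", OF _ that]) (simp add: lin kv val)
    then have "comb d = comb b" unfolding comb_def by (intro ext sum.cong) auto
    then show "k = comb b" using d by simp
  qed
  then show ?thesis using val unfolding kernel_span_comb by auto
qed

lemma lin_closed_bv: "lin_closed (KB)"
  unfolding lin_closed_def
proof (intro conjI ballI allI)
  have "AE y in q. 0 = bv (comb (\<lambda>_. 0)) y" using comb_bv[of "\<lambda>_. 0", THEN conjunct2] by eventually_elim simp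
  then show "(\<lambda>x. 0) \<in> KB"
    unfolding boundary_values_def by (intro CollectI conjI bexI[of _ "comb (\<lambda>_. 0)"]) (auto simp: L2_zero kernel_span_comb)
  fix f g t assume f: "f \<in> KB" and g: "g \<in> KB"
  obtain a where a: "f \<in> L2 q" "AE x in q. f x = bv (comb a) x" using f by (auto simp: boundary_values_def kernel_span_comb)
  obtain b where b: "g \<in> L2 q" "AE x in q. g x = bv (comb b) x" using g by (auto simp: boundary_values_def kernel_span_comb)
  have "AE x in q. f x + t * g x = bv (comb (\<lambda>i. a i + t * b i)) x"
    using a(2) b(2) comb_bv[of a, THEN conjunct2] comb_bv[of b, THEN conjunct2] comb_bv[of "\<lambda>i. a i + t * b i", THEN conjunct2]
    by eventually_elim (simp add: sum_distrib_left sum.distrib[symmetric] algebra_simps)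
  then show "(\<lambda>x. f x + t * g x) \<in> KB"
    unfolding boundary_values_def
    by (intro CollectI conjI bexI[of _ "comb (\<lambda>i. a i + t * b i)"] L2_add L2_scale a b) (auto simp: kernel_span_comb)
qed

context
  fixes w :: "nat \<Rightarrow> complex" and \<psi> :: "complex^'n \<Rightarrow> complex"
  assumes psi_span: "\<psi> \<in> KS" and psi_vals: "\<forall>i<p. \<psi> (\<zeta> i) = w i"
    and psi_nz: "sqn q (bv \<psi>) \<noteq> 0"
begin

lemma psi_val: "i < p \<Longrightarrow> \<psi> (\<zeta> i) = w i"
  using psi_vals by blast

abbreviation "D \<equiv> sqn q (bv \<psi>)"

abbreviation "MT \<equiv> M_tilde \<Omega> P mu KS \<psi>"

definition A0 :: "(complex^'n \<Rightarrow> complex) set" where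
  "A0 = ominus q (conj_set (KB)) {\<lambda>x. a * cnj (bv \<psi> x) | a. True}"

abbreviation "g0 \<equiv> (\<lambda>x. cnj (bv \<psi> x) / of_real D)"

lemma psi_qH: "\<psi> \<in> qH" using psi_span comb_qH unfolding kernel_span_comb by blast

lemma psi_L2: "bv \<psi> \<in> L2 q" by (rule bv_L2(1)[OF psi_qH])

lemma M_tilde_alt: "MT = sum_set (sum_set A0 mixed) qhb0"
  by (simp add: M_tilde_def A0_def)

lemma A0_sub: "A0 \<subseteq> L2 q"
proof -
  have "KB \<subseteq> L2 q" by (auto simp: boundary_values_def)
  then show ?thesis unfolding A0_def ominus_def using conj_set_L2 by blast
qed

lemma lin_A0: "lin_closed A0"
  unfolding A0_def
proof (rule lin_closed_ominus[OF lin_closed_conj_set[OF lin_closed_bv] conj_set_L2])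
  show "KB \<subseteq> L2 q" by (auto simp: boundary_values_def)
  show "{\<lambda>x. a * cnj (bv \<psi> x) |a. True} \<subseteq> L2 q" using L2_scale[OF L2_cnj[OF psi_L2]] by auto
qed

lemma M_tilde_L2: "MT \<subseteq> L2 q"
  unfolding M_tilde_alt by (intro sum_set_L2 A0_sub mixed_subset qhb0_subset)

lemma lin_M_tilde: "lin_closed MT"
  unfolding M_tilde_alt by (intro lin_closed_sum_set lin_A0 lin_closed_mixed lin_closed_qhb0)

lemma g0_L2: "g0 \<in> L2 q"
  using L2_scale[OF L2_cnj[OF psi_L2], of "1 / of_real D"] by simp

lemma inner_psi: "L2_inner q (bv \<psi>) (bv (comb a)) = (\<Sum>i<p. cnj (a i) * w i)"
  unfolding inner_comb_eval[OF psi_qH] by (rule sum.cong) (simp_all add: psi_val)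

lemma integral_g0:
  assumes "f \<in> L2 q"
  shows "(LINT y|q. f y * g0 y) = L2_inner q f (bv \<psi>) / of_real D"
  unfolding L2_inner_def by simp

text \<open>The hypothesis on \<open>f\<close> says that its pairings with the span are those of
  \<open>\<psi>\<close>. An element of \<open>A0\<close> is orthogonal to the conjugate of
  \<open>\<psi>\<close>, so integration against \<open>\<psi>\<close> kills it, and then so does
  integration against \<open>f\<close>.\<close>

lemma integral_A0:
  assumes a: "a \<in> A0" and f: "f \<in> L2 q" "\<And>k. L2_inner q f (bv (comb k)) = (\<Sum>i<p. cnj (k i) * w i)"
  shows "(LINT y|q. f y * a y) = 0"
proof -
  obtain a' where a': "a = (\<lambda>x. cnj (a' x))" "a' \<in> KB"
    using a by (auto simp: A0_def ominus_def conj_set_def)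
  obtain k where k: "a' \<in> L2 q" "AE x in q. a' x = bv (comb k) x" using a'(2) by (auto simp: boundary_values_def kernel_span_comb)
  have rep: "(LINT y|q. h y * a y) = L2_inner q h (bv (comb k))" if "h \<in> L2 q" for h
  proof -
    have "(LINT y|q. h y * a y) = L2_inner q h a'" by (simp add: a'(1) L2_inner_def)
    also have "\<dots> = L2_inner q h (bv (comb k))"
      by (rule L2_inner_cong_AE) (use that k comb_L2 L2_measurable in auto)
    finally show ?thesis .
  qed
  have "L2_inner q a (\<lambda>x. 1 * cnj (bv \<psi> x)) = 0"
    using a unfolding A0_def ominus_def by blast
  then have "(LINT y|q. bv \<psi> y * a y) = 0" by (simp add: L2_inner_def mult.commute)
  then have "(\<Sum>i<p. cnj (k i) * w i) = 0" using rep[OF psi_L2] inner_psi by simp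
  then show ?thesis using rep[OF f(1)] f(2) by simp
qed

lemma integral_g0_value:
  assumes f: "f \<in> L2 q" "\<And>k. L2_inner q f (bv (comb k)) = (\<Sum>i<p. cnj (k i) * w i)"
  shows "(LINT y|q. f y * g0 y) = 1"
proof -
  obtain k where k: "\<psi> = comb k" using psi_span unfolding kernel_span_comb by blast
  have "L2_inner q f (bv (comb k)) = L2_inner q (bv \<psi>) (bv (comb k))" by (simp only: f(2) inner_psi)
  then have "L2_inner q f (bv \<psi>) = L2_inner q (bv \<psi>) (bv \<psi>)" unfolding k[symmetric] .
  then show ?thesis using integral_g0[OF f(1)] L2_inner_self[OF psi_L2] psi_nz by simp
qed

text \<open>The boundary function \<open>f\<close> kills each summand for its own reason:
  \<open>A0\<close> by interpolation, \<open>mixed\<close> because it is orthogonal to conjugates of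
  \<open>qhb\<close>, and \<open>qhb0\<close> by \<open>bounded_mult_integral\<close>.\<close>

theorem schur_imp_distance:
  assumes \<phi>: "\<phi> \<in> schur_class (th ` \<Omega>)" "\<And>i. i < p \<Longrightarrow> \<phi> (\<zeta> i) = w i"
    and h: "h \<in> MT"
  shows "1 \<le> (LINT y|q. cmod (g0 y - h y))"
proof -
  have hol: "holo_on \<phi> (th ` \<Omega>)" and le: "\<And>y. y \<in> th ` \<Omega> \<Longrightarrow> cmod (\<phi> y) \<le> 1" using \<phi>(1) by (auto simp: schur_class_def)
  have pH: "\<phi> \<in> qH" by (rule schur_qH[OF hol le])
  define f where "f = bv \<phi>"
  have fL: "f \<in> L2 q" and fb: "f \<in> qhb" unfolding f_def by (rule bv_L2[OF pH])+
  have f1: "AE y in q. cmod (f y) \<le> 1" unfolding f_def by (rule bv_bounded[OF pH le])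
  have fk: "L2_inner q f (bv (comb k)) = (\<Sum>i<p. cnj (k i) * w i)" for k
    unfolding f_def inner_comb_eval[OF pH] by (rule sum.cong) (simp_all add: \<phi>(2))
  obtain h1 h0 where h10: "h1 \<in> sum_set A0 mixed" "h0 \<in> qhb0" "h = (\<lambda>x. h1 x + h0 x)"
    using h unfolding M_tilde_alt by (auto simp: sum_set_def)
  obtain a m where am: "a \<in> A0" "m \<in> mixed" "h1 = (\<lambda>x. a x + m x)"
    using h10(1) by (auto simp: sum_set_def)
  have L: "a \<in> L2 q" "m \<in> L2 q" "h0 \<in> L2 q" using am h10 A0_sub mixed_subset qhb0_subset by auto
  have hL: "h \<in> L2 q" using h M_tilde_L2 by blast
  have ia: "(LINT y|q. f y * a y) = 0" by (rule integral_A0[OF am(1) fL fk])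
  have im: "(LINT y|q. f y * m y) = 0"
  proof -
    have "(\<lambda>x. 0 + cnj (f x)) \<in> sum_set qhb (conj_set qhb)"
      by (rule sum_setI[OF lin_closed_zero[OF lin_closed_qhb] conj_setI[OF fb]])
    then have "L2_inner q m (\<lambda>x. 0 + cnj (f x)) = 0" using am(2) unfolding mixed_space_def ominus_def by blast
    then show ?thesis by (simp add: L2_inner_def mult.commute)
  qed
  have i0: "(LINT y|q. f y * h0 y) = 0"
  proof -
    have "h0 \<in> qhb" "(LINT y|q. h0 y) = 0" using h10(2) by (auto simp: qhardy_boundary0_def L2_inner_def)
    then show ?thesis unfolding f_def using bounded_mult_integral[OF hol le pH] by simp
  qed
  have int: "integrable q (\<lambda>y. f y * u y)" if "u \<in> L2 q" for u by (rule L2_mult_integrable[OF fL that])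
  have "(LINT y|q. f y * h y) = (LINT y|q. f y * a y + f y * m y + f y * h0 y)"
    by (simp add: h10(3) am(3) algebra_simps)
  also have "\<dots> = 0" using int[OF L(1)] int[OF L(2)] int[OF L(3)] by (simp add: ia im i0)
  finally have ih: "(LINT y|q. f y * h y) = 0" .
  have "(LINT y|q. f y * (g0 y - h y)) = (LINT y|q. f y * g0 y) - (LINT y|q. f y * h y)"
    unfolding right_diff_distrib by (rule Bochner_Integration.integral_diff[OF int[OF g0_L2] int[OF hL]])
  also have "\<dots> = 1" using integral_g0_value[OF fL fk] ih by simp
  finally have one: "(LINT y|q. f y * (g0 y - h y)) = 1" .
  have dL: "(\<lambda>y. g0 y - h y) \<in> L2 q" by (rule L2_diff[OF g0_L2 hL])
  have "1 \<le> (LINT y|q. cmod (f y * (g0 y - h y)))"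
    using integral_norm_bound[of q "\<lambda>y. f y * (g0 y - h y)"] unfolding one by simp
  also have "\<dots> \<le> (LINT y|q. cmod (g0 y - h y))"
  proof (rule integral_mono_AE)
    show "AE y in q. cmod (f y * (g0 y - h y)) \<le> cmod (g0 y - h y)"
      using f1 by eventually_elim (simp add: norm_mult mult_left_le_one_le)
  qed (use int[OF dL] q.L2_integrable[OF dL] in auto)
  finally show ?thesis .
qed

theorem distance_imp_schur:
  assumes dist: "\<And>h. h \<in> MT \<Longrightarrow> 1 \<le> (LINT y|q. cmod (g0 y - h y))"
  shows "\<exists>\<phi>\<in>schur_class (th ` \<Omega>). \<forall>i<p. \<phi> (\<zeta> i) = w i"
proof -
  let ?N = "MT"
  have "\<exists>f. f \<in> borel_measurable q \<and> (\<forall>x. cmod (f x) \<le> 1) \<and> (\<forall>h\<in>?N. (LINT y|q. f y * h y) = 0) \<and> (LINT y|q. f y * g0 y) = 1"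
    by (rule annihilator_of_distance[OF prob_space_q g0_L2 M_tilde_L2 lin_closed_zero[OF lin_M_tilde] lin_closedD[OF lin_M_tilde] dist])
      blast+
  then obtain \<phi> where meas: "\<phi> \<in> borel_measurable q" and bounded: "\<And>x. cmod (\<phi> x) \<le> 1"
    and ann: "\<And>h. h \<in> ?N \<Longrightarrow> (LINT y|q. \<phi> y * h y) = 0" and one: "(LINT y|q. \<phi> y * g0 y) = 1" by blast
  have lin: "lin_closed (sum_set A0 mixed)" by (intro lin_closed_sum_set lin_A0 lin_closed_mixed)
  have ann_m: "(LINT y|q. \<phi> y * m y) = 0" if "m \<in> mixed" for m
    by (rule ann, unfold M_tilde_alt, rule sum_set_left[OF sum_set_right[OF that lin_A0] lin_closed_qhb0])
  have ann_0: "(LINT y|q. \<phi> y * h y) = 0" if "h \<in> qhb0" for h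
    by (rule ann, unfold M_tilde_alt, rule sum_set_right[OF that lin])
  have ann_A: "(LINT y|q. \<phi> y * a y) = 0" if "a \<in> A0" for a
    by (rule ann, unfold M_tilde_alt, rule sum_set_left[OF sum_set_left[OF that lin_closed_mixed] lin_closed_qhb0])
  define F where "F = extension S \<phi>"
  have Fschur: "F \<in> schur_class (th ` \<Omega>)"
    unfolding schur_class_def F_def
    using extension_holo[OF kernel meas bounded ann_m ann_0] extension_bound[OF kernel meas bounded ann_m ann_0] by blast
  have phiL: "\<phi> \<in> L2 q" by (rule q.L2_bounded[OF meas bounded])
  have "F (\<zeta> i) = w i" if i: "i < p" for i
  proof -
    have Fk: "F (\<zeta> i) = L2_inner q \<phi> (kb i)"
      unfolding F_def kb_def by (rule extension_def[OF kernel meas bounded ann_m ann_0])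
    \<comment> \<open>\<open>u\<close> is the boundary kernel \<open>kb i\<close> minus its
      component along \<open>\<psi>\<close>, so \<open>cnj u\<close> lies in \<open>A0\<close>.
      Annihilating it, together with the value 1 on \<open>g0\<close>, forces the pairing of
      \<open>\<phi>\<close> with \<open>kb i\<close> to be \<open>w i\<close>.\<close>
    define t where "t = cnj (w i) / of_real D"
    define u where "u x = kb i x + (- t) * bv \<psi> x" for x
    obtain k where k: "(\<lambda>x. S x (\<zeta> i)) = comb k" using ker_in_span[OF i] unfolding kernel_span_comb by blast
    have kin: "kb i \<in> KB"
      unfolding boundary_values_def using kb_L2[OF i] ker_in_span[OF i] by (auto simp: kb_def)
    have pin: "bv \<psi> \<in> KB"
      unfolding boundary_values_def using psi_L2 psi_span by auto
    have uin: "u \<in> KB"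
      unfolding u_def by (rule lin_closedD[OF lin_closed_bv kin pin])
    have pk: "L2_inner q (bv \<psi>) (kb i) = w i" using kb_eval[OF i psi_qH] psi_val[OF i] by simp
    have pu: "L2_inner q (bv \<psi>) u = 0"
      unfolding u_def
      by (subst L2_inner_add_right[OF kb_L2[OF i] L2_scale[OF psi_L2] psi_L2])
        (simp only: L2_inner_scale_right pk L2_inner_self[OF psi_L2], simp add: t_def psi_nz)
    have "(\<lambda>x. cnj (u x)) \<in> A0"
      unfolding A0_def ominus_def
    proof (intro CollectI conjI ballI conj_setI[OF uin])
      fix h assume "h \<in> {\<lambda>x. a * cnj (bv \<psi> x) |a. True}"
      then obtain a where h: "h = (\<lambda>x. a * cnj (bv \<psi> x))" by blast
      have "L2_inner q (\<lambda>x. cnj (u x)) (\<lambda>x. cnj (bv \<psi> x)) = L2_inner q (bv \<psi>) u"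
        by (simp add: L2_inner_def mult.commute)
      then show "L2_inner q (\<lambda>x. cnj (u x)) h = 0" unfolding h L2_inner_scale_right pu by simp
    qed
    then have "L2_inner q \<phi> u = 0" using ann_A by (simp add: L2_inner_def)
    moreover have "L2_inner q \<phi> u = L2_inner q \<phi> (kb i) + cnj (- t) * L2_inner q \<phi> (bv \<psi>)"
      unfolding u_def
      by (subst L2_inner_add_right[OF kb_L2[OF i] L2_scale[OF psi_L2] phiL]) (simp only: L2_inner_scale_right)
    moreover have "L2_inner q \<phi> (bv \<psi>) = of_real D"
      using integral_g0[OF phiL] one psi_nz by (simp add: field_simps)
    ultimately show ?thesis using psi_nz by (simp add: Fk t_def)
  qed
  then show ?thesis using Fschur by blast
qed

theorem schur_iff_distance:
  "(\<exists>\<phi>\<in>schur_class (th ` \<Omega>). \<forall>i<p. \<phi> (\<zeta> i) = w i) \<longleftrightarrow>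
    L1_dist q g0 (MT) \<ge> 1"
proof
  assume "\<exists>\<phi>\<in>schur_class (th ` \<Omega>). \<forall>i<p. \<phi> (\<zeta> i) = w i"
  then obtain \<phi> where \<phi>: "\<phi> \<in> schur_class (th ` \<Omega>)" "\<And>i. i < p \<Longrightarrow> \<phi> (\<zeta> i) = w i" by blast
  show "L1_dist q g0 (MT) \<ge> 1"
    unfolding L1_dist_def
    by (rule cINF_greatest) (use lin_closed_zero[OF lin_M_tilde] schur_imp_distance[OF \<phi>] in blast)+
next
  assume d: "L1_dist q g0 (MT) \<ge> 1"
  show "\<exists>\<phi>\<in>schur_class (th ` \<Omega>). \<forall>i<p. \<phi> (\<zeta> i) = w i"
  proof (rule distance_imp_schur)
    fix h assume h: "h \<in> MT"
    have "bdd_below ((\<lambda>h. LINT y|q. cmod (g0 y - h y)) ` MT)"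
      by (rule bdd_belowI[of _ 0]) (auto simp: Bochner_Integration.integral_nonneg)
    from order_trans[OF d[unfolded L1_dist_def] cINF_lower[OF this h]]
    show "1 \<le> (LINT y|q. cmod (g0 y - h y))" .
  qed
qed

end

end

end

text \<open>Division by zero makes the density of \<open>qmeasure\<close> identically 0, and under
  the zero measure every norm is 0.\<close>

lemma qmeasure_degenerate:
  assumes "hardy_nrm mu (jac P) = 0"
  shows "L2_nrm (qmeasure \<Omega> P mu) f = 0"
proof -
  have "emeasure (qmeasure \<Omega> P mu) A = 0" for A
    unfolding qmeasure_def distr_def by (simp add: assms emeasure_measure_of_conv null_measure_eq_density[symmetric])
  then have "AE x in qmeasure \<Omega> P mu. (cmod (f x))\<^sup>2 = 0"
    by (intro AE_I[of _ _ "space (qmeasure \<Omega> P mu)"]) auto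
  then show ?thesis unfolding L2_nrm_def by (simp add: integral_eq_zero_AE)
qed

theorem theorem4p2:
  fixes \<Omega> :: "(complex^'n) set"
    and G :: "(complex^'n^'n) set"
    and P :: "'n \<Rightarrow> 'n cpoly"
    and mu :: "(complex^'n) measure"
    and S :: "complex^'n \<Rightarrow> complex^'n \<Rightarrow> complex"
    and p :: nat
    and \<zeta> :: "nat \<Rightarrow> complex^'n"
    and w :: "nat \<Rightarrow> complex"
    and X Xadj :: "(complex^'n \<Rightarrow> complex) \<Rightarrow> (complex^'n \<Rightarrow> complex)"
    and Q :: "(complex^'n \<Rightarrow> complex) set"
    and \<psi> :: "complex^'n \<Rightarrow> complex"
  assumes domain: "standard_bsd \<Omega>"
    and group: "finite_reflection_group G"
    and invariant: "\<forall>A\<in>G. (*v) A ` \<Omega> = \<Omega>"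
    and basic: "basic_invariants G P"
    and measure: "isotropy_measure \<Omega> mu"
    and kernel: "reproducing_kernel (poly_map P ` \<Omega>) (qhardy_space \<Omega> P mu) (qhardy_inner P mu) S"
    and points: "\<forall>i<p. \<zeta> i \<in> poly_map P ` \<Omega>" "inj_on \<zeta> {..<p}"
    and targets: "\<forall>i<p. w i \<in> ball 0 1"
    and Q_def: "Q = kernel_span S p \<zeta>"
    and X: "X \<in> bounded_ops Q (qhardy_nrm P mu)"
    and Xadj: "Xadj \<in> bounded_ops Q (qhardy_nrm P mu)" "adjoint_on Q (qhardy_inner P mu) X Xadj"
    and X_kernel: "\<forall>i<p. Xadj (\<lambda>x. S x (\<zeta> i)) = (\<lambda>x. cnj (w i) * S x (\<zeta> i))"
    and psi_def: "\<psi> = X (orth_proj Q (qhardy_inner P mu) (\<lambda>_. 1))"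
    and psi_nonzero: "L2_nrm (qmeasure \<Omega> P mu) (qradial_limit P \<psi>) \<noteq> 0"
  shows "(\<exists>\<phi>\<in>schur_class (poly_map P ` \<Omega>). \<forall>i<p. \<phi> (\<zeta> i) = w i) \<longleftrightarrow>
    L1_dist (qmeasure \<Omega> P mu)
      (\<lambda>x. cnj (qradial_limit P \<psi> x) /
           of_real ((L2_nrm (qmeasure \<Omega> P mu) (qradial_limit P \<psi>))\<^sup>2))
      (M_tilde \<Omega> P mu Q \<psi>) \<ge> 1"
proof -
  have "hardy_nrm mu (jac P) \<noteq> 0" using psi_nonzero qmeasure_degenerate by blast
  note k = kernel points
  from \<open>hardy_nrm mu (jac P) \<noteq> 0\<close> interpret hardy_quotient G P \<Omega> mu
    using domain group invariant basic measure by unfold_locales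
  \<comment> \<open>By \<open>orth_proj_spec\<close> the projection of the constant 1 has the value
    1 at every node.\<close>
  define u where "u = orth_proj Q (qhardy_inner P mu) (\<lambda>_. 1)"
  have u: "u \<in> Q" "\<And>i. i < p \<Longrightarrow> u (\<zeta> i) = 1"
    using orth_proj_spec[OF k qH_one] unfolding u_def Q_def by auto
  have psiQ: "\<psi> \<in> Q" using X u(1) unfolding psi_def u_def[symmetric] by (simp add: bounded_ops_def)
  have QqH: "f \<in> qhardy_space \<Omega> P mu" if "f \<in> Q" for f
    using that comb_qH[OF k] unfolding Q_def kernel_span_comb[OF k] by blast
  \<comment> \<open>The adjoint maps the kernel at \<open>\<zeta> i\<close> to
    \<open>cnj (w i)\<close> times itself, so the value of \<open>X u\<close> there is
    \<open>w i * u (\<zeta> i) = w i\<close>.\<close>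
  have val: "\<forall>i<p. \<psi> (\<zeta> i) = w i"
  proof (intro allI impI)
    fix i assume i: "i < p"
    have kQ: "(\<lambda>x. S x (\<zeta> i)) \<in> Q" unfolding Q_def by (rule ker_in_span[OF k i])
    have "\<psi> (\<zeta> i) = qhardy_inner P mu \<psi> (\<lambda>x. S x (\<zeta> i))" by (rule inner_qH[OF k QqH[OF psiQ] i, symmetric])
    also have "\<dots> = qhardy_inner P mu u (\<lambda>x. cnj (w i) * S x (\<zeta> i))"
      using Xadj(2) u(1) kQ X_kernel i unfolding adjoint_on_def psi_def u_def[symmetric] by simp
    also have "\<dots> = w i"
    proof -
      have eq: "(\<lambda>x. cnj (w i) * S x (\<zeta> i)) = comb S p \<zeta> (\<lambda>j. if j = i then cnj (w i) else 0)"
      proof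
        fix x
        have "comb S p \<zeta> (\<lambda>j. if j = i then cnj (w i) else 0) x = (\<Sum>j<p. if j = i then cnj (w i) * S x (\<zeta> i) else 0)"
          unfolding comb_def[OF k] by (rule sum.cong) auto
        then show "cnj (w i) * S x (\<zeta> i) = comb S p \<zeta> (\<lambda>j. if j = i then cnj (w i) else 0) x" using i by simp
      qed
      have "qhardy_inner P mu u (comb S p \<zeta> (\<lambda>j. if j = i then cnj (w i) else 0)) = (\<Sum>j<p. cnj (if j = i then cnj (w i) else 0) * u (\<zeta> j))"
        unfolding qhardy_inner_bv[OF QqH[OF u(1)] comb_qH[OF k]] by (rule inner_comb_eval[OF k QqH[OF u(1)]])
      also have "\<dots> = (\<Sum>j<p. if j = i then w i else 0)" by (rule sum.cong) (auto simp: u(2))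
      finally show ?thesis unfolding eq using i by simp
    qed
    finally show "\<psi> (\<zeta> i) = w i" .
  qed
  have nz: "sqn (qmeasure \<Omega> P mu) (qradial_limit P \<psi>) \<noteq> 0" using psi_nonzero unfolding L2_nrm_sq[symmetric] by simp
  show ?thesis
    unfolding L2_nrm_sq Q_def by (rule schur_iff_distance[OF k psiQ[unfolded Q_def] val nz])
qed

end
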